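(* Let $A$ be an artin algebra with $\operatorname{id}A=1$ and let $I$ be a basic injective $A$-module such that $\mathsf{add}\,I$ consists of all injective $A$-modules with projective dimension at most one. Then the following conditions are equivalent for each $n\ge0$. (1) $A$ is an almost $n$-Auslander--Gorenstein algebra. (2) There exists a unique basic $1$-tilting $A$-module in $\mathsf{Fac}_1(I)\cap\mathsf{Sub}^n(I)$ which is a $0$-cotilting $A$-module.
   Context: Throughout, $A$ is a basic, non-semisimple artin algebra with Matlis duality $\mathrm{D}$; $\mathsf{mod}\,A$ is the category of finitely generated right $A$-modules and "module" means object of $\mathsf{mod}\,A$; $\operatorname{pd}$, $\operatorname{id}$ denote projective and injective dimension, and $\operatorname{id}A$ is the injective dimension of $A$ as a right module. $\mathsf{add}\,Q$ is the full subcategory of direct summands of finite direct sums of $Q$. A module is basic if it is a direct sum of pairwise non-isomorphic indecomposables; uniqueness is up to isomorphism. For a module $Q$ and $m\ge 1$, $\mathsf{Sub}^{m}(Q)$ is the full subcategory of modules $X$ for which there is an exact sequence $0\to X\to Q^0\to\cdots\to Q^{m-1}$ with all $Q^i\in\mathsf{add}\,Q$; $\mathsf{Fac}_{m}(Q)$ is the full subcategory of modules $Y$ for which there is an exact sequence $Q_{m-1}\to\cdots\to Q_0\to Y\to 0$ with all $Q_i\in\mathsf{add}\,Q$. Put $\mathsf{Sub}^0(Q)=\mathsf{mod}\,A$. For an injective module $I$, $I\text{-}\operatorname{domdim}X\ge m$ means $X\in\mathsf{Sub}^m(I)$. With $I$ as in the claim, $A$ is an almost $n$-Auslander--Gorenstein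 algebra if $\operatorname{id}A\le n+1\le I\text{-}\operatorname{domdim}A$. A module $T$ is tilting if $\operatorname{pd}T<\infty$, $\operatorname{Ext}_A^i(T,T)=0$ for all $i\ge1$, and there is an exact sequence $0\to A\to T^0\to\cdots\to T^r\to 0$ for some $r\ge 0$ with all $T^i\in\mathsf{add}\,T$; it is $d$-tilting if moreover $\operatorname{pd}T=d$. A module $C$ is cotilting if $\operatorname{id}C<\infty$, $\operatorname{Ext}_A^i(C,C)=0$ for all $i\ge1$, and there is an exact sequence $0\to C_r\to\cdots\to C_0\to\mathrm{D}A\to0$ for some $r\ge 0$ with all $C_i\in\mathsf{add}\,C$; it is $d$-cotilting if moreover $\operatorname{id}C=d$. *)

theory Defs
  imports "HOL-Algebra.QuotRing" "HOL-Algebra.Module" "HOL-Algebra.Elementary_Groups"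
    "HOL-Library.Extended_Nat"
begin

section \<open>Right modules over a ring\<close>

text \<open>
  Right modules are carried by the records of type \<^typ>\<open>('a, 'm) module\<close>; the term
  \<open>a \<odot>\<^bsub>M\<^esub> x\<close> is read as the right action \<open>x \<cdot> a\<close>. As in the
  library, the fields \<open>mult\<close> and \<open>one\<close> of a module record carry no meaning.
\<close>

locale right_module = A?: ring A + M?: abelian_group M
  for A :: "('a, 'c) ring_scheme" (structure) and M :: "('a, 'm, 'd) module_scheme" (structure) +
  assumes act_closed:
      "\<lbrakk> a \<in> carrier A; x \<in> carrier M \<rbrakk> \<Longrightarrow> a \<odot>\<^bsub>M\<^esub> x \<in> carrier M"
    and act_add_ring:
      "\<lbrakk> a \<in> carrier A; b \<in> carrier A; x \<in> carrier M \<rbrakk> \<Longrightarrow>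
       (a \<oplus> b) \<odot>\<^bsub>M\<^esub> x = a \<odot>\<^bsub>M\<^esub> x \<oplus>\<^bsub>M\<^esub> b \<odot>\<^bsub>M\<^esub> x"
    and act_add_module:
      "\<lbrakk> a \<in> carrier A; x \<in> carrier M; y \<in> carrier M \<rbrakk> \<Longrightarrow>
       a \<odot>\<^bsub>M\<^esub> (x \<oplus>\<^bsub>M\<^esub> y) = a \<odot>\<^bsub>M\<^esub> x \<oplus>\<^bsub>M\<^esub> a \<odot>\<^bsub>M\<^esub> y"
    and act_mult:
      "\<lbrakk> a \<in> carrier A; b \<in> carrier A; x \<in> carrier M \<rbrakk> \<Longrightarrow>
       (a \<otimes> b) \<odot>\<^bsub>M\<^esub> x = b \<odot>\<^bsub>M\<^esub> (a \<odot>\<^bsub>M\<^esub> x)"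
    and act_one: "x \<in> carrier M \<Longrightarrow> \<one> \<odot>\<^bsub>M\<^esub> x = x"

text \<open>The objects of \<open>mod A\<close>: finitely generated right \<open>A\<close>-modules.\<close>

definition fg_module :: "'a ring \<Rightarrow> ('a, 'm) module \<Rightarrow> bool" where
  "fg_module A M \<longleftrightarrow> right_module A M \<and>
     (\<exists>S. finite S \<and> S \<subseteq> carrier M \<and>
        (\<forall>x \<in> carrier M. \<exists>c \<in> S \<rightarrow> carrier A. x = (\<Oplus>\<^bsub>M\<^esub>s\<in>S. c s \<odot>\<^bsub>M\<^esub> s)))"

text \<open>
  Up to isomorphism a finitely generated right \<open>A\<close>-module is a quotient \<open>A\<^sup>k / K\<close>; its
  elements are cosets, that is, sets of functions from \<open>{..<k}\<close> to \<open>A\<close>. So every object of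
  \<open>mod A\<close> has an isomorphic copy on the following type, over which all quantifications over
  objects of \<open>mod A\<close> range. Single modules, such as \<open>A\<close> and \<open>D A\<close>, may live on other types.
\<close>

type_synonym 'a fgmod = "('a, (nat \<Rightarrow> 'a) set) module"

definition regular :: "'a ring \<Rightarrow> ('a, 'a) module" where
  "regular A = \<lparr>carrier = carrier A, mult = mult A, one = \<one>\<^bsub>A\<^esub>,
     zero = \<zero>\<^bsub>A\<^esub>, add = add A, smult = (\<lambda>a x. x \<otimes>\<^bsub>A\<^esub> a)\<rparr>"

definition rmod_hom :: "'a ring \<Rightarrow> ('a, 'm) module \<Rightarrow> ('a, 'n) module \<Rightarrow> ('m \<Rightarrow> 'n) set" where
  "rmod_hom A M N = {f \<in> carrier M \<rightarrow> carrier N.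
     (\<forall>x \<in> carrier M. \<forall>y \<in> carrier M. f (x \<oplus>\<^bsub>M\<^esub> y) = f x \<oplus>\<^bsub>N\<^esub> f y) \<and>
     (\<forall>a \<in> carrier A. \<forall>x \<in> carrier M. f (a \<odot>\<^bsub>M\<^esub> x) = a \<odot>\<^bsub>N\<^esub> f x)}"

definition rmod_iso :: "'a ring \<Rightarrow> ('a, 'm) module \<Rightarrow> ('a, 'n) module \<Rightarrow> bool" where
  "rmod_iso A M N \<longleftrightarrow> (\<exists>f \<in> rmod_hom A M N. bij_betw f (carrier M) (carrier N))"

definition zero_module :: "('a, 'm) module \<Rightarrow> bool" where
  "zero_module M \<longleftrightarrow> carrier M = {\<zero>\<^bsub>M\<^esub>}"

definition direct_sum2 :: "('a, 'm) module \<Rightarrow> ('a, 'n) module \<Rightarrow> ('a, 'm \<times> 'n) module" where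
  "direct_sum2 M N = \<lparr>carrier = carrier M \<times> carrier N, mult = undefined, one = undefined,
     zero = (\<zero>\<^bsub>M\<^esub>, \<zero>\<^bsub>N\<^esub>),
     add = (\<lambda>u v. (fst u \<oplus>\<^bsub>M\<^esub> fst v, snd u \<oplus>\<^bsub>N\<^esub> snd v)),
     smult = (\<lambda>a u. (a \<odot>\<^bsub>M\<^esub> fst u, a \<odot>\<^bsub>N\<^esub> snd u))\<rparr>"

definition direct_sum :: "nat \<Rightarrow> (nat \<Rightarrow> ('a, 'm) module) \<Rightarrow> ('a, nat \<Rightarrow> 'm) module" where
  "direct_sum k N = \<lparr>carrier = (\<Pi>\<^sub>E i\<in>{..<k}. carrier (N i)), mult = undefined, one = undefined,
     zero = (\<lambda>i\<in>{..<k}. \<zero>\<^bsub>N i\<^esub>),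
     add = (\<lambda>u v. \<lambda>i\<in>{..<k}. u i \<oplus>\<^bsub>N i\<^esub> v i),
     smult = (\<lambda>a u. \<lambda>i\<in>{..<k}. a \<odot>\<^bsub>N i\<^esub> u i)\<rparr>"

definition simple_module :: "'a ring \<Rightarrow> ('a, 'm) module \<Rightarrow> bool" where
  "simple_module A M \<longleftrightarrow> fg_module A M \<and> \<not> zero_module M \<and>
     (\<forall>N. submodule N A M \<longrightarrow> N = {\<zero>\<^bsub>M\<^esub>} \<or> N = carrier M)"

definition semisimple_module :: "'a ring \<Rightarrow> ('a, 'm) module \<Rightarrow> bool" where
  "semisimple_module A M \<longleftrightarrow>
     (\<exists>k (S :: nat \<Rightarrow> 'a fgmod). (\<forall>i<k. simple_module A (S i)) \<and> rmod_iso A M (direct_sum k S))"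

definition indecomposable_module :: "'a ring \<Rightarrow> ('a, 'm) module \<Rightarrow> bool" where
  "indecomposable_module A M \<longleftrightarrow> fg_module A M \<and> \<not> zero_module M \<and>
     (\<forall>(X :: 'a fgmod) (Y :: 'a fgmod). fg_module A X \<and> fg_module A Y \<and>
        rmod_iso A M (direct_sum2 X Y) \<longrightarrow> zero_module X \<or> zero_module Y)"

definition basic_module :: "'a ring \<Rightarrow> ('a, 'm) module \<Rightarrow> bool" where
  "basic_module A M \<longleftrightarrow> fg_module A M \<and>
     (\<exists>k (N :: nat \<Rightarrow> 'a fgmod).
        (\<forall>i<k. indecomposable_module A (N i)) \<and>
        (\<forall>i<k. \<forall>j<k. i \<noteq> j \<longrightarrow> \<not> rmod_iso A (N i) (N j)) \<and>
        rmod_iso A M (direct_sum k N))"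

definition in_add :: "'a ring \<Rightarrow> 'a fgmod \<Rightarrow> ('a, 'm) module \<Rightarrow> bool" where
  "in_add A Q X \<longleftrightarrow> fg_module A X \<and>
     (\<exists>k (Y :: 'a fgmod). fg_module A Y \<and>
        rmod_iso A (direct_sum2 X Y) (direct_sum k (\<lambda>_. Q)))"


section \<open>Exact sequences\<close>

text \<open>
  \<open>0 \<rightarrow> X \<rightarrow> Q\<^sup>0 \<rightarrow> \<dots> \<rightarrow> Q\<^sup>r \<rightarrow> 0\<close> with all \<open>Q\<^sup>i\<close> satisfying \<open>P\<close>; the augmentation is
  \<open>e\<close>, and \<open>d i\<close> maps \<open>Q\<^sup>i\<close> to \<open>Q\<^sup>i\<^sup>+\<^sup>1\<close>.
\<close>

definition finite_coresolution ::
  "'a ring \<Rightarrow> ('a fgmod \<Rightarrow> bool) \<Rightarrow> nat \<Rightarrow> ('a, 'm) module \<Rightarrow> bool" where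
  "finite_coresolution A P r X \<longleftrightarrow>
     (\<exists>(Q :: nat \<Rightarrow> 'a fgmod) e d.
        let K = (\<lambda>i. if i < r then a_kernel (Q i) (Q (Suc i)) (d i) else carrier (Q i)) in
        (\<forall>i\<le>r. fg_module A (Q i) \<and> P (Q i)) \<and>
        e \<in> rmod_hom A X (Q 0) \<and> (\<forall>i<r. d i \<in> rmod_hom A (Q i) (Q (Suc i))) \<and>
        inj_on e (carrier X) \<and>
        e ` carrier X = K 0 \<and>
        (\<forall>i<r. d i ` carrier (Q i) = K (Suc i)))"

text \<open>
  \<open>0 \<rightarrow> Q\<^sub>r \<rightarrow> \<dots> \<rightarrow> Q\<^sub>0 \<rightarrow> Y \<rightarrow> 0\<close> with all \<open>Q\<^sub>i\<close> satisfying \<open>P\<close>; here \<open>d i\<close> maps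
  \<open>Q\<^sub>i\<^sub>+\<^sub>1\<close> to \<open>Q\<^sub>i\<close>.
\<close>

definition finite_resolution ::
  "'a ring \<Rightarrow> ('a fgmod \<Rightarrow> bool) \<Rightarrow> nat \<Rightarrow> ('a, 'm) module \<Rightarrow> bool" where
  "finite_resolution A P r Y \<longleftrightarrow>
     (\<exists>(Q :: nat \<Rightarrow> 'a fgmod) e d.
        let B = (\<lambda>i. if i < r then d i ` carrier (Q (Suc i)) else {\<zero>\<^bsub>Q i\<^esub>}) in
        (\<forall>i\<le>r. fg_module A (Q i) \<and> P (Q i)) \<and>
        e \<in> rmod_hom A (Q 0) Y \<and> (\<forall>i<r. d i \<in> rmod_hom A (Q (Suc i)) (Q i)) \<and>
        e ` carrier (Q 0) = carrier Y \<and>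
        a_kernel (Q 0) Y e = B 0 \<and>
        (\<forall>i<r. a_kernel (Q (Suc i)) (Q i) (d i) = B (Suc i)))"

text \<open>
  \<open>Sub\<^sup>m(Q)\<close>: exact sequences \<open>0 \<rightarrow> X \<rightarrow> Q\<^sup>0 \<rightarrow> \<dots> \<rightarrow> Q\<^sup>m\<^sup>-\<^sup>1\<close>, without a
  condition at the last term; for \<open>m = 0\<close> all of \<open>mod A\<close>.
\<close>

definition Sub :: "'a ring \<Rightarrow> nat \<Rightarrow> 'a fgmod \<Rightarrow> ('a, 'm) module \<Rightarrow> bool" where
  "Sub A m Q X \<longleftrightarrow> fg_module A X \<and>
     (m = 0 \<or> (\<exists>(J :: nat \<Rightarrow> 'a fgmod) e d.
        (\<forall>i<m. in_add A Q (J i)) \<and>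
        e \<in> rmod_hom A X (J 0) \<and> (\<forall>i. Suc i < m \<longrightarrow> d i \<in> rmod_hom A (J i) (J (Suc i))) \<and>
        inj_on e (carrier X) \<and>
        (1 < m \<longrightarrow> e ` carrier X = a_kernel (J 0) (J 1) (d 0)) \<and>
        (\<forall>i. Suc (Suc i) < m \<longrightarrow>
           d i ` carrier (J i) = a_kernel (J (Suc i)) (J (Suc (Suc i))) (d (Suc i)))))"

text \<open>
  \<open>Fac\<^sub>m(Q)\<close>, for \<open>m \<ge> 1\<close>: exact sequences \<open>Q\<^sub>m\<^sub>-\<^sub>1 \<rightarrow> \<dots> \<rightarrow> Q\<^sub>0 \<rightarrow> Y \<rightarrow> 0\<close>.
\<close>

definition Fac :: "'a ring \<Rightarrow> nat \<Rightarrow> 'a fgmod \<Rightarrow> ('a, 'm) module \<Rightarrow> bool" where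
  "Fac A m Q Y \<longleftrightarrow> fg_module A Y \<and>
     (\<exists>(P :: nat \<Rightarrow> 'a fgmod) e d.
        (\<forall>i<m. in_add A Q (P i)) \<and>
        e \<in> rmod_hom A (P 0) Y \<and> (\<forall>i. Suc i < m \<longrightarrow> d i \<in> rmod_hom A (P (Suc i)) (P i)) \<and>
        e ` carrier (P 0) = carrier Y \<and>
        (1 < m \<longrightarrow> a_kernel (P 0) Y e = d 0 ` carrier (P 1)) \<and>
        (\<forall>i. Suc (Suc i) < m \<longrightarrow>
           a_kernel (P (Suc i)) (P i) (d i) = d (Suc i) ` carrier (P (Suc (Suc i)))))"


section \<open>Homological dimensions and Ext\<close>

definition projective_module :: "'a ring \<Rightarrow> ('a, 'm) module \<Rightarrow> bool" where
  "projective_module A P \<longleftrightarrow> fg_module A P \<and>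
     (\<forall>(X :: 'a fgmod) (Y :: 'a fgmod) g f. fg_module A X \<and> fg_module A Y \<and>
        g \<in> rmod_hom A X Y \<and> g ` carrier X = carrier Y \<and> f \<in> rmod_hom A P Y \<longrightarrow>
        (\<exists>h \<in> rmod_hom A P X. \<forall>p \<in> carrier P. g (h p) = f p))"

definition injective_module :: "'a ring \<Rightarrow> ('a, 'm) module \<Rightarrow> bool" where
  "injective_module A J \<longleftrightarrow> fg_module A J \<and>
     (\<forall>(X :: 'a fgmod) (Y :: 'a fgmod) g f. fg_module A X \<and> fg_module A Y \<and>
        g \<in> rmod_hom A X Y \<and> inj_on g (carrier X) \<and> f \<in> rmod_hom A X J \<longrightarrow>
        (\<exists>h \<in> rmod_hom A Y J. \<forall>x \<in> carrier X. h (g x) = f x))"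

text \<open>Both dimensions are \<open>\<infinity>\<close> if there is no finite (co)resolution.\<close>

definition proj_dim :: "'a ring \<Rightarrow> ('a, 'm) module \<Rightarrow> enat" where
  "proj_dim A X = Inf {enat r | r. finite_resolution A (projective_module A) r X}"

definition inj_dim :: "'a ring \<Rightarrow> ('a, 'm) module \<Rightarrow> enat" where
  "inj_dim A X = Inf {enat r | r. finite_coresolution A (injective_module A) r X}"

text \<open>Projective resolutions \<open>\<dots> \<rightarrow> P\<^sub>1 \<rightarrow> P\<^sub>0 \<rightarrow> X \<rightarrow> 0\<close> in \<open>mod A\<close>.\<close>

definition proj_resolution ::
  "'a ring \<Rightarrow> ('a, 'm) module \<Rightarrow> (nat \<Rightarrow> 'a fgmod) \<Rightarrow> ((nat \<Rightarrow> 'a) set \<Rightarrow> 'm) \<Rightarrow>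
   (nat \<Rightarrow> (nat \<Rightarrow> 'a) set \<Rightarrow> (nat \<Rightarrow> 'a) set) \<Rightarrow> bool" where
  "proj_resolution A X P e d \<longleftrightarrow>
     (\<forall>i. projective_module A (P i)) \<and>
     e \<in> rmod_hom A (P 0) X \<and> (\<forall>i. d i \<in> rmod_hom A (P (Suc i)) (P i)) \<and>
     e ` carrier (P 0) = carrier X \<and>
     a_kernel (P 0) X e = d 0 ` carrier (P 1) \<and>
     (\<forall>i. a_kernel (P (Suc i)) (P i) (d i) = d (Suc i) ` carrier (P (Suc (Suc i))))"

text \<open>The abelian group \<open>Hom\<^sub>A(X, Y)\<close>, its elements being represented by extensional functions.\<close>

definition Hom_group :: "'a ring \<Rightarrow> ('a, 'm) module \<Rightarrow> ('a, 'n) module \<Rightarrow> ('m \<Rightarrow> 'n) monoid" where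
  "Hom_group A X Y = \<lparr>carrier = rmod_hom A X Y \<inter> extensional (carrier X),
     mult = (\<lambda>f g. \<lambda>x\<in>carrier X. f x \<oplus>\<^bsub>Y\<^esub> g x),
     one = (\<lambda>x\<in>carrier X. \<zero>\<^bsub>Y\<^esub>)\<rparr>"

definition cocycles ::
  "'a ring \<Rightarrow> (nat \<Rightarrow> 'a fgmod) \<Rightarrow> (nat \<Rightarrow> (nat \<Rightarrow> 'a) set \<Rightarrow> (nat \<Rightarrow> 'a) set) \<Rightarrow>
   nat \<Rightarrow> ('a, 'n) module \<Rightarrow> ((nat \<Rightarrow> 'a) set \<Rightarrow> 'n) set" where
  "cocycles A P d i Y =
     {f \<in> carrier (Hom_group A (P i) Y). \<forall>x \<in> carrier (P (Suc i)). f (d i x) = \<zero>\<^bsub>Y\<^esub>}"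

definition coboundaries ::
  "'a ring \<Rightarrow> (nat \<Rightarrow> 'a fgmod) \<Rightarrow> (nat \<Rightarrow> (nat \<Rightarrow> 'a) set \<Rightarrow> (nat \<Rightarrow> 'a) set) \<Rightarrow>
   nat \<Rightarrow> ('a, 'n) module \<Rightarrow> ((nat \<Rightarrow> 'a) set \<Rightarrow> 'n) set" where
  "coboundaries A P d i Y =
     (case i of
        0 \<Rightarrow> {one (Hom_group A (P 0) Y)}
      | Suc j \<Rightarrow> {\<lambda>x\<in>carrier (P (Suc j)). g (d j x) | g. g \<in> carrier (Hom_group A (P j) Y)})"

text \<open>
  \<open>Ext\<^sup>i\<^sub>A(X, Y)\<close> is the \<open>i\<close>-th cohomology group of \<open>Hom\<^sub>A(P, Y)\<close> for a projective
  resolution \<open>P\<close> of \<open>X\<close>; up to isomorphism the choice of \<open>P\<close> does not matter.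
\<close>

definition Ext ::
  "'a ring \<Rightarrow> nat \<Rightarrow> ('a, 'm) module \<Rightarrow> ('a, 'n) module \<Rightarrow> ((nat \<Rightarrow> 'a) set \<Rightarrow> 'n) set monoid" where
  "Ext A i X Y =
     (case (SOME (P, e, d). proj_resolution A X P e d) of (P, e, d) \<Rightarrow>
        (Hom_group A (P i) Y\<lparr>carrier := cocycles A P d i Y\<rparr>) Mod coboundaries A P d i Y)"


section \<open>Artin algebras and Matlis duality\<close>

definition artinian_ring :: "'r ring \<Rightarrow> bool" where
  "artinian_ring R \<longleftrightarrow> cring R \<and>
     (\<forall>J :: nat \<Rightarrow> 'r set. (\<forall>i. ideal (J i) R \<and> J (Suc i) \<subseteq> J i) \<longrightarrow>
        (\<exists>m. \<forall>i\<ge>m. J i = J m))"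

text \<open>\<open>A\<close> as a module over \<open>R\<close> along a ring homomorphism \<open>\<phi>\<close> with central image.\<close>

definition scalar_module :: "'a ring \<Rightarrow> ('r \<Rightarrow> 'a) \<Rightarrow> ('r, 'a) module" where
  "scalar_module A \<phi> = \<lparr>carrier = carrier A, mult = mult A, one = \<one>\<^bsub>A\<^esub>,
     zero = \<zero>\<^bsub>A\<^esub>, add = add A, smult = (\<lambda>r x. \<phi> r \<otimes>\<^bsub>A\<^esub> x)\<rparr>"

definition artin_algebra :: "'r ring \<Rightarrow> ('r \<Rightarrow> 'a) \<Rightarrow> 'a ring \<Rightarrow> bool" where
  "artin_algebra R \<phi> A \<longleftrightarrow> artinian_ring R \<and> ring A \<and> \<phi> \<in> ring_hom R A \<and>
     (\<forall>r \<in> carrier R. \<forall>x \<in> carrier A. \<phi> r \<otimes>\<^bsub>A\<^esub> x = x \<otimes>\<^bsub>A\<^esub> \<phi> r) \<and>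
     fg_module R (scalar_module A \<phi>)"

text \<open>The Jacobson radical of a commutative ring.\<close>

definition jacobson_radical :: "'r ring \<Rightarrow> 'r set" where
  "jacobson_radical R = carrier R \<inter> \<Inter>{J. maximalideal J R}"

text \<open>\<open>R / J\<close> as an \<open>R\<close>-module, for an ideal \<open>J\<close>.\<close>

definition quotient_module :: "'r ring \<Rightarrow> 'r set \<Rightarrow> ('r, 'r set) module" where
  "quotient_module R J = ring.extend (R Quot J)
     \<lparr>smult = (\<lambda>r X. X \<otimes>\<^bsub>R Quot J\<^esub> (J +>\<^bsub>R\<^esub> r))\<rparr>"

definition injective_envelope :: "'a ring \<Rightarrow> ('a, 'm) module \<Rightarrow> ('a, 'n) module \<Rightarrow> bool" where
  "injective_envelope A S E \<longleftrightarrow> injective_module A E \<and>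
     (\<exists>f \<in> rmod_hom A S E. inj_on f (carrier S) \<and>
        (\<forall>N. submodule N A E \<and> N \<inter> f ` carrier S = {\<zero>\<^bsub>E\<^esub>} \<longrightarrow> N = {\<zero>\<^bsub>E\<^esub>}))"

text \<open>
  The Matlis duality of an artin \<open>R\<close>-algebra is \<open>D = Hom\<^sub>R(-, E)\<close>, where \<open>E\<close> is the
  injective envelope of \<open>R / rad R\<close>. The right module \<open>D A\<close> is the dual of the left
  regular module: \<open>(f \<cdot> a)(x) = f (a x)\<close>.
\<close>

definition matlis_module :: "'r ring \<Rightarrow> ('r, 'e) module \<Rightarrow> bool" where
  "matlis_module R E \<longleftrightarrow> injective_envelope R (quotient_module R (jacobson_radical R)) E"

definition dual_regular ::
  "'r ring \<Rightarrow> ('r \<Rightarrow> 'a) \<Rightarrow> ('r, 'e) module \<Rightarrow> 'a ring \<Rightarrow> ('a, 'a \<Rightarrow> 'e) module" where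
  "dual_regular R \<phi> E A = \<lparr>carrier = rmod_hom R (scalar_module A \<phi>) E \<inter> extensional (carrier A),
     mult = undefined, one = undefined,
     zero = (\<lambda>x\<in>carrier A. \<zero>\<^bsub>E\<^esub>),
     add = (\<lambda>f g. \<lambda>x\<in>carrier A. f x \<oplus>\<^bsub>E\<^esub> g x),
     smult = (\<lambda>a f. \<lambda>x\<in>carrier A. f (a \<otimes>\<^bsub>A\<^esub> x))\<rparr>"


section \<open>Tilting modules and almost Auslander--Gorenstein algebras\<close>

definition tilting :: "'a ring \<Rightarrow> 'a fgmod \<Rightarrow> bool" where
  "tilting A T \<longleftrightarrow> fg_module A T \<and> proj_dim A T < \<infinity> \<and>
     (\<forall>i\<ge>1. trivial_group (Ext A i T T)) \<and>
     (\<exists>r. finite_coresolution A (in_add A T) r (regular A))"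

definition d_tilting :: "'a ring \<Rightarrow> nat \<Rightarrow> 'a fgmod \<Rightarrow> bool" where
  "d_tilting A d T \<longleftrightarrow> tilting A T \<and> proj_dim A T = enat d"

definition cotilting ::
  "'r ring \<Rightarrow> ('r \<Rightarrow> 'a) \<Rightarrow> ('r, 'e) module \<Rightarrow> 'a ring \<Rightarrow> 'a fgmod \<Rightarrow> bool" where
  "cotilting R \<phi> E A C \<longleftrightarrow> fg_module A C \<and> inj_dim A C < \<infinity> \<and>
     (\<forall>i\<ge>1. trivial_group (Ext A i C C)) \<and>
     (\<exists>r. finite_resolution A (in_add A C) r (dual_regular R \<phi> E A))"

definition d_cotilting ::
  "'r ring \<Rightarrow> ('r \<Rightarrow> 'a) \<Rightarrow> ('r, 'e) module \<Rightarrow> 'a ring \<Rightarrow> nat \<Rightarrow> 'a fgmod \<Rightarrow> bool" where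
  "d_cotilting R \<phi> E A d C \<longleftrightarrow> cotilting R \<phi> E A C \<and> inj_dim A C = enat d"

text \<open>\<open>id A \<le> n + 1 \<le> I-domdim A\<close>, where \<open>I-domdim X \<ge> m\<close> means \<open>X \<in> Sub\<^sup>m(I)\<close>.\<close>

definition almost_Auslander_Gorenstein :: "'a ring \<Rightarrow> 'a fgmod \<Rightarrow> nat \<Rightarrow> bool" where
  "almost_Auslander_Gorenstein A I n \<longleftrightarrow>
     inj_dim A (regular A) \<le> enat (n + 1) \<and> Sub A (n + 1) I (regular A)"

end

theory Submission
  imports Defs
begin

text \<open>
  Condition (1) says no more than that \<open>A\<close> embeds into a module \<open>Q\<close> of \<open>add I\<close>. As \<open>id A = 1\<close>, the
  cokernel of such an embedding is injective, and since \<open>pd Q \<le> 1\<close> it has projective dimension at most one.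
  So \<open>0 \<rightarrow> A \<rightarrow> Q \<rightarrow> Q / A \<rightarrow> 0\<close> lies in \<open>add I\<close> apart from \<open>A\<close>, and \<open>I\<close> is tilting; its
  projective dimension is not zero, as otherwise the sequence would split and \<open>A\<close> would be injective.
  Conversely, a \<open>1\<close>-tilting module that is \<open>0\<close>-cotilting is injective with projective dimension one, so it
  belongs to \<open>add I\<close>, and its coresolution of \<open>A\<close> starts with such an embedding.

  It remains to see that a basic module \<open>T\<close> of \<open>add I\<close> with a sequence
  \<open>0 \<rightarrow> A \<rightarrow> T\<^sup>0 \<rightarrow> C \<rightarrow> 0\<close>, \<open>T\<^sup>0, C \<in> add T\<close>, has every indecomposable injective module as a
  summand: this gives the \<open>add I\<close>-resolution of \<open>D A\<close> and the uniqueness. The number of summands of \<open>T\<close> is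
  at least the number of indecomposable projectives, as in the Grothendieck group of projectives, and this
  is at least the number of indecomposable injectives, which inject into the projectives by way of
  their simple socles.
\<close>

section \<open>Homomorphisms, submodules and quotients\<close>

text \<open>The exponent \<open>n\<close> is absorbed by zero padding: an exact sequence with terms
  in \<open>add I\<close> and surjective last map extends by zero modules to any length.
  Self-orthogonality is automatic, since Ext into an injective module vanishes. The weight lies in
  the count. The Grothendieck group is never built: an integral relation between classes is read as
  two direct sums, positive and negative part, and equality of classes is turned into an isomorphism
  by Schanuel's lemma and cancellation. This is why Fitting's lemma and cancellation of finitely
  generated summands are developed so early. Finite length is the only chain condition in use. For
  \<open>A\<close> it is inherited from the base ring \<open>R\<close>, where it has to be extracted
  from the descending chain condition on ideals alone. A recurring obstacle is one of types: the
  definitions quantify over \<open>'a fgmod\<close>, while submodules of sums, free modules and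
  \<open>D A\<close> live elsewhere. Copies on \<open>'a fgmod\<close> bridge the gap, so each basic
  notion is first freed from that type.\<close>

lemmas (in abelian_group) abelian_group_simprules
  [algebra abelian_group "zero G" "add G" "a_inv G" "a_minus G"] =
  a_closed zero_closed a_inv_closed minus_closed a_assoc l_zero l_neg a_comm minus_eq
  r_zero r_neg r_neg2 r_neg1 minus_add minus_minus a_lcomm

lemma (in abelian_group) diff_zero_iff:
  "x \<in> carrier G \<Longrightarrow> y \<in> carrier G \<Longrightarrow> x \<ominus> y = \<zero> \<longleftrightarrow> x = y"
  by (metis a_inv_closed add.inv_inv minus_equality minus_eq r_neg a_comm)

context right_module
begin

lemma act_zero [simp]:
  assumes "a \<in> carrier A" shows "a \<odot>\<^bsub>M\<^esub> \<zero>\<^bsub>M\<^esub> = \<zero>\<^bsub>M\<^esub>"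
  using act_add_module[of a "\<zero>\<^bsub>M\<^esub>" "\<zero>\<^bsub>M\<^esub>"] act_closed[of a "\<zero>\<^bsub>M\<^esub>"] assms
  by (metis M.add.r_cancel_one M.l_zero M.zero_closed)

lemma zero_act [simp]:
  assumes "x \<in> carrier M" shows "\<zero> \<odot>\<^bsub>M\<^esub> x = \<zero>\<^bsub>M\<^esub>"
  using act_add_ring[of "\<zero>" "\<zero>" x] act_closed[of "\<zero>" x] assms
  by (metis M.add.r_cancel_one A.l_zero A.zero_closed)

lemma neg_act:
  assumes "a \<in> carrier A" "x \<in> carrier M"
  shows "(\<ominus> a) \<odot>\<^bsub>M\<^esub> x = \<ominus>\<^bsub>M\<^esub> (a \<odot>\<^bsub>M\<^esub> x)"
  using act_add_ring[of "\<ominus> a" a x] assms act_closed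
  by (metis A.a_inv_closed A.l_neg M.minus_equality zero_act)

lemma act_neg:
  assumes "a \<in> carrier A" "x \<in> carrier M"
  shows "a \<odot>\<^bsub>M\<^esub> (\<ominus>\<^bsub>M\<^esub> x) = \<ominus>\<^bsub>M\<^esub> (a \<odot>\<^bsub>M\<^esub> x)"
  using act_add_module[of a "\<ominus>\<^bsub>M\<^esub> x" x] assms act_closed
  by (metis M.a_inv_closed M.l_neg M.minus_equality act_zero)

lemma act_minus:
  assumes "a \<in> carrier A" "x \<in> carrier M" "y \<in> carrier M"
  shows "a \<odot>\<^bsub>M\<^esub> (x \<ominus>\<^bsub>M\<^esub> y) = a \<odot>\<^bsub>M\<^esub> x \<ominus>\<^bsub>M\<^esub> a \<odot>\<^bsub>M\<^esub> y"
  using assms by (simp add: M.minus_eq act_add_module act_neg)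

end

lemma right_moduleI:
  fixes A (structure) and M (structure)
  assumes "ring A"
    and "\<And>x y. x \<in> carrier M \<Longrightarrow> y \<in> carrier M \<Longrightarrow> x \<oplus>\<^bsub>M\<^esub> y \<in> carrier M"
    and "\<zero>\<^bsub>M\<^esub> \<in> carrier M"
    and "\<And>x y z. x \<in> carrier M \<Longrightarrow> y \<in> carrier M \<Longrightarrow> z \<in> carrier M \<Longrightarrow>
      x \<oplus>\<^bsub>M\<^esub> y \<oplus>\<^bsub>M\<^esub> z = x \<oplus>\<^bsub>M\<^esub> (y \<oplus>\<^bsub>M\<^esub> z)"
    and "\<And>x y. x \<in> carrier M \<Longrightarrow> y \<in> carrier M \<Longrightarrow> x \<oplus>\<^bsub>M\<^esub> y = y \<oplus>\<^bsub>M\<^esub> x"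
    and "\<And>x. x \<in> carrier M \<Longrightarrow> \<zero>\<^bsub>M\<^esub> \<oplus>\<^bsub>M\<^esub> x = x"
    and "\<And>x. x \<in> carrier M \<Longrightarrow> \<exists>y \<in> carrier M. y \<oplus>\<^bsub>M\<^esub> x = \<zero>\<^bsub>M\<^esub>"
    and "\<And>a x. a \<in> carrier A \<Longrightarrow> x \<in> carrier M \<Longrightarrow> a \<odot>\<^bsub>M\<^esub> x \<in> carrier M"
    and "\<And>a b x. a \<in> carrier A \<Longrightarrow> b \<in> carrier A \<Longrightarrow> x \<in> carrier M \<Longrightarrow>
       (a \<oplus>\<^bsub>A\<^esub> b) \<odot>\<^bsub>M\<^esub> x = a \<odot>\<^bsub>M\<^esub> x \<oplus>\<^bsub>M\<^esub> b \<odot>\<^bsub>M\<^esub> x"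
    and "\<And>a x y. a \<in> carrier A \<Longrightarrow> x \<in> carrier M \<Longrightarrow> y \<in> carrier M \<Longrightarrow>
       a \<odot>\<^bsub>M\<^esub> (x \<oplus>\<^bsub>M\<^esub> y) = a \<odot>\<^bsub>M\<^esub> x \<oplus>\<^bsub>M\<^esub> a \<odot>\<^bsub>M\<^esub> y"
    and "\<And>a b x. a \<in> carrier A \<Longrightarrow> b \<in> carrier A \<Longrightarrow> x \<in> carrier M \<Longrightarrow>
       (a \<otimes>\<^bsub>A\<^esub> b) \<odot>\<^bsub>M\<^esub> x = b \<odot>\<^bsub>M\<^esub> (a \<odot>\<^bsub>M\<^esub> x)"
    and "\<And>x. x \<in> carrier M \<Longrightarrow> \<one>\<^bsub>A\<^esub> \<odot>\<^bsub>M\<^esub> x = x"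
  shows "right_module A M"
proof -
  have "abelian_group M" by (rule abelian_groupI) (use assms in auto)
  then show ?thesis
    unfolding right_module_def right_module_axioms_def using assms by auto
qed

text \<open>Negatives come from the action of \<open>\<ominus> \<one>\<close>, so that closure under
  sums and scalars already yields an additive subgroup.\<close>

lemma submoduleI':
  assumes M: "right_module A M" and N: "N \<subseteq> carrier M" "\<zero>\<^bsub>M\<^esub> \<in> N"
    "\<And>x y. x \<in> N \<Longrightarrow> y \<in> N \<Longrightarrow> x \<oplus>\<^bsub>M\<^esub> y \<in> N"
    "\<And>a x. a \<in> carrier A \<Longrightarrow> x \<in> N \<Longrightarrow> a \<odot>\<^bsub>M\<^esub> x \<in> N"
  shows "submodule N A M"
proof -
  interpret right_module A M by fact
  have inv: "\<ominus>\<^bsub>M\<^esub> x \<in> N" if "x \<in> N" for x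
    using N(4)[of "\<ominus>\<^bsub>A\<^esub> \<one>\<^bsub>A\<^esub>" x] neg_act[of "\<one>\<^bsub>A\<^esub>" x] act_one[of x] that N(1) by auto
  show ?thesis
    unfolding submodule_def submodule_axioms_def subgroup_def
    using N inv by (auto simp: a_inv_def)
qed

lemma submoduleD:
  assumes "submodule N A M"
  shows "N \<subseteq> carrier M" "\<zero>\<^bsub>M\<^esub> \<in> N"
    "\<And>x y. x \<in> N \<Longrightarrow> y \<in> N \<Longrightarrow> x \<oplus>\<^bsub>M\<^esub> y \<in> N"
    "\<And>a x. a \<in> carrier A \<Longrightarrow> x \<in> N \<Longrightarrow> a \<odot>\<^bsub>M\<^esub> x \<in> N"
    "\<And>x. x \<in> N \<Longrightarrow> \<ominus>\<^bsub>M\<^esub> x \<in> N"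
    "\<And>x y. x \<in> N \<Longrightarrow> y \<in> N \<Longrightarrow> x \<ominus>\<^bsub>M\<^esub> y \<in> N"
  using assms unfolding submodule_def submodule_axioms_def subgroup_def
  by (auto simp: a_inv_def a_minus_def)

lemma submodule_carrier: "right_module A M \<Longrightarrow> submodule (carrier M) A M"
proof -
  assume "right_module A M"
  then interpret right_module A M .
  show ?thesis by (rule submoduleI') (auto intro: act_closed right_module_axioms)
qed

lemma submodule_zero: "right_module A M \<Longrightarrow> submodule {\<zero>\<^bsub>M\<^esub>} A M"
proof -
  assume "right_module A M"
  then interpret right_module A M .
  show ?thesis by (rule submoduleI') (auto intro: right_module_axioms)
qed

lemma submodule_Int: "right_module A M \<Longrightarrow> submodule N A M \<Longrightarrow> submodule K A M \<Longrightarrow> submodule (N \<inter> K) A M"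
  by (rule submoduleI') (auto dest: submoduleD)

definition submodule_sum :: "('a, 'm) module \<Rightarrow> 'm set \<Rightarrow> 'm set \<Rightarrow> 'm set" where
  "submodule_sum M K L = {x \<oplus>\<^bsub>M\<^esub> y | x y. x \<in> K \<and> y \<in> L}"

lemma submodule_sum:
  assumes M: "right_module A M" and K: "submodule K A M" and L: "submodule L A M"
  shows "submodule (submodule_sum M K L) A M" "K \<subseteq> submodule_sum M K L" "L \<subseteq> submodule_sum M K L"
proof -
  interpret right_module A M by fact
  note KD = submoduleD[OF K] and LD = submoduleD[OF L]
  show "K \<subseteq> submodule_sum M K L"
    unfolding submodule_sum_def
  proof safe
    fix x assume "x \<in> K"
    then show "\<exists>u v. x = u \<oplus>\<^bsub>M\<^esub> v \<and> u \<in> K \<and> v \<in> L"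
      using KD LD by (intro exI[of _ "\<zero>\<^bsub>M\<^esub>"] exI[of _ x]) auto
  qed
  show "L \<subseteq> submodule_sum M K L"
    unfolding submodule_sum_def
  proof safe
    fix x assume "x \<in> L"
    then show "\<exists>u v. x = u \<oplus>\<^bsub>M\<^esub> v \<and> u \<in> K \<and> v \<in> L"
      using KD LD by (intro exI[of _ "\<zero>\<^bsub>M\<^esub>"] exI[of _ x]) auto
  qed
  show "submodule (submodule_sum M K L) A M"
  proof (rule submoduleI'[OF M])
    show "submodule_sum M K L \<subseteq> carrier M"
      using KD(1) LD(1) by (auto simp: submodule_sum_def)
    show "\<zero>\<^bsub>M\<^esub> \<in> submodule_sum M K L"
      using \<open>K \<subseteq> submodule_sum M K L\<close> KD(2) by auto
    fix x y assume "x \<in> submodule_sum M K L" "y \<in> submodule_sum M K L"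
    then obtain k l k' l' where *: "x = k \<oplus>\<^bsub>M\<^esub> l" "y = k' \<oplus>\<^bsub>M\<^esub> l'" "k \<in> K" "k' \<in> K" "l \<in> L" "l' \<in> L"
      by (auto simp: submodule_sum_def)
    then have "k \<in> carrier M" "k' \<in> carrier M" "l \<in> carrier M" "l' \<in> carrier M"
      using KD(1) LD(1) by auto
    then have "x \<oplus>\<^bsub>M\<^esub> y = (k \<oplus>\<^bsub>M\<^esub> k') \<oplus>\<^bsub>M\<^esub> (l \<oplus>\<^bsub>M\<^esub> l')" unfolding * by algebra
    then show "x \<oplus>\<^bsub>M\<^esub> y \<in> submodule_sum M K L"
      unfolding submodule_sum_def using * KD(3) LD(3) by blast
  next
    fix a x assume a: "a \<in> carrier A" and "x \<in> submodule_sum M K L"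
    then obtain k l where *: "x = k \<oplus>\<^bsub>M\<^esub> l" "k \<in> K" "l \<in> L"
      by (auto simp: submodule_sum_def)
    then have "k \<in> carrier M" "l \<in> carrier M" using KD(1) LD(1) by auto
    then have "a \<odot>\<^bsub>M\<^esub> x = a \<odot>\<^bsub>M\<^esub> k \<oplus>\<^bsub>M\<^esub> a \<odot>\<^bsub>M\<^esub> l" using * a act_add_module by auto
    then show "a \<odot>\<^bsub>M\<^esub> x \<in> submodule_sum M K L"
      unfolding submodule_sum_def using * KD(4) LD(4) a by blast
  qed
qed

section \<open>Homomorphisms, kernels and images\<close>

lemma rmod_homI:
  assumes "\<And>x. x \<in> carrier M \<Longrightarrow> f x \<in> carrier N"
    and "\<And>x y. x \<in> carrier M \<Longrightarrow> y \<in> carrier M \<Longrightarrow> f (x \<oplus>\<^bsub>M\<^esub> y) = f x \<oplus>\<^bsub>N\<^esub> f y"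
    and "\<And>a x. a \<in> carrier A \<Longrightarrow> x \<in> carrier M \<Longrightarrow> f (a \<odot>\<^bsub>M\<^esub> x) = a \<odot>\<^bsub>N\<^esub> f x"
  shows "f \<in> rmod_hom A M N"
  using assms by (auto simp: rmod_hom_def)

lemma rmod_homD:
  assumes "f \<in> rmod_hom A M N"
  shows "x \<in> carrier M \<Longrightarrow> f x \<in> carrier N"
    and "x \<in> carrier M \<Longrightarrow> y \<in> carrier M \<Longrightarrow> f (x \<oplus>\<^bsub>M\<^esub> y) = f x \<oplus>\<^bsub>N\<^esub> f y"
    and "a \<in> carrier A \<Longrightarrow> x \<in> carrier M \<Longrightarrow> f (a \<odot>\<^bsub>M\<^esub> x) = a \<odot>\<^bsub>N\<^esub> f x"
  using assms by (auto simp: rmod_hom_def)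

text \<open>Homomorphisms are functions on a whole type of which only the values on the carrier
  count. This lets \<open>restrict\<close> be inserted wherever extensional representatives are
  required.\<close>

lemma rmod_hom_cong:
  assumes "f \<in> rmod_hom A M N" "right_module A M" "\<And>x. x \<in> carrier M \<Longrightarrow> g x = f x"
  shows "g \<in> rmod_hom A M N"
proof -
  interpret right_module A M by fact
  show ?thesis using assms(1,3) act_closed by (auto simp: rmod_hom_def)
qed

text \<open>\<open>rmod_hom\<close> asks for additivity and linearity only; zero, negatives and the
  submodule properties of kernel and image need both module structures, which the locale puts next
  to the map.\<close>

locale module_hom =
  M: right_module A M + N: right_module A N
  for A :: "'a ring" and M :: "('a, 'm) module" and N :: "('a, 'n) module" +
  fixes f
  assumes hom: "f \<in> rmod_hom A M N"
begin

lemmas closed = rmod_homD(1)[OF hom]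
  and add = rmod_homD(2)[OF hom]
  and act = rmod_homD(3)[OF hom]

lemma zero: "f \<zero>\<^bsub>M\<^esub> = \<zero>\<^bsub>N\<^esub>"
  using add[of "\<zero>\<^bsub>M\<^esub>" "\<zero>\<^bsub>M\<^esub>"] closed[of "\<zero>\<^bsub>M\<^esub>"]
  by (metis M.M.l_zero M.M.zero_closed N.M.add.r_cancel_one)

lemma neg: "x \<in> carrier M \<Longrightarrow> f (\<ominus>\<^bsub>M\<^esub> x) = \<ominus>\<^bsub>N\<^esub> f x"
  using add[of "\<ominus>\<^bsub>M\<^esub> x" x] closed zero
  by (intro N.M.minus_equality[symmetric]) (auto simp: M.M.l_neg)

lemma minus: "x \<in> carrier M \<Longrightarrow> y \<in> carrier M \<Longrightarrow> f (x \<ominus>\<^bsub>M\<^esub> y) = f x \<ominus>\<^bsub>N\<^esub> f y"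
  unfolding a_minus_def using add[of x "\<ominus>\<^bsub>M\<^esub> y"] neg[of y] by auto

lemma inj_iff: "inj_on f (carrier M) \<longleftrightarrow> (\<forall>x \<in> carrier M. f x = \<zero>\<^bsub>N\<^esub> \<longrightarrow> x = \<zero>\<^bsub>M\<^esub>)"
proof
  assume *: "\<forall>x \<in> carrier M. f x = \<zero>\<^bsub>N\<^esub> \<longrightarrow> x = \<zero>\<^bsub>M\<^esub>"
  show "inj_on f (carrier M)"
  proof (rule inj_onI)
    fix x y assume "x \<in> carrier M" "y \<in> carrier M" "f x = f y"
    then show "x = y"
      using *[rule_format, of "x \<ominus>\<^bsub>M\<^esub> y"] minus[of x y] closed M.M.diff_zero_iff N.M.diff_zero_iff
      by (metis M.M.minus_closed)
  qed
next
  assume "inj_on f (carrier M)"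
  then show "\<forall>x \<in> carrier M. f x = \<zero>\<^bsub>N\<^esub> \<longrightarrow> x = \<zero>\<^bsub>M\<^esub>"
    using zero M.M.zero_closed by (metis inj_onD)
qed

lemma eq_iff: "x \<in> carrier M \<Longrightarrow> y \<in> carrier M \<Longrightarrow> f x = f y \<longleftrightarrow> x \<ominus>\<^bsub>M\<^esub> y \<in> a_kernel M N f"
  using minus[of x y] closed by (auto simp: a_kernel_def' N.M.diff_zero_iff)

lemma submodule_image: "submodule K A M \<Longrightarrow> submodule (f ` K) A N"
proof (rule submoduleI'[OF N.right_module_axioms])
  assume K: "submodule K A M"
  note KD = submoduleD[OF K]
  show "f ` K \<subseteq> carrier N" using KD(1) closed by auto
  show "\<zero>\<^bsub>N\<^esub> \<in> f ` K" using KD(2) zero by (metis imageI)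
  fix x y assume "x \<in> f ` K" "y \<in> f ` K"
  then obtain u v where *: "u \<in> K" "v \<in> K" "x = f u" "y = f v" by auto
  then show "x \<oplus>\<^bsub>N\<^esub> y \<in> f ` K" using add[of u v] KD by (metis imageI subsetD)
next
  assume K: "submodule K A M"
  fix a x assume "a \<in> carrier A" "x \<in> f ` K"
  then obtain u where "u \<in> K" "x = f u" "a \<in> carrier A" by auto
  then show "a \<odot>\<^bsub>N\<^esub> x \<in> f ` K"
    using act[of a u] submoduleD(1)[OF K] submoduleD(4)[OF K, of a u]
    by (metis (no_types, lifting) imageI subsetD)
qed

lemma submodule_preimage: "submodule K A N \<Longrightarrow> submodule {x \<in> carrier M. f x \<in> K} A M"
  by (rule submoduleI'[OF M.right_module_axioms])
    (auto simp: zero add act M.act_closed dest: submoduleD)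

lemma submodule_kernel: "submodule (a_kernel M N f) A M"
  using submodule_preimage[OF submodule_zero[OF N.right_module_axioms]]
  by (simp add: a_kernel_def')

lemma submodule_range: "submodule (f ` carrier M) A N"
  by (rule submodule_image) (rule submodule_carrier[OF M.right_module_axioms])

end

lemma module_homI: "right_module A M \<Longrightarrow> right_module A N \<Longrightarrow> f \<in> rmod_hom A M N \<Longrightarrow> module_hom A M N f"
  by (auto intro: module_hom.intro module_hom_axioms.intro)

lemma rmod_hom_id: "(\<lambda>x. x) \<in> rmod_hom A M M"
  by (auto simp: rmod_hom_def)

lemma rmod_hom_comp:
  "f \<in> rmod_hom A M N \<Longrightarrow> g \<in> rmod_hom A N L \<Longrightarrow> (\<lambda>x. g (f x)) \<in> rmod_hom A M L"
  by (auto simp: rmod_hom_def Pi_iff)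

lemma rmod_hom_zero:
  assumes "right_module A N" shows "(\<lambda>x. \<zero>\<^bsub>N\<^esub>) \<in> rmod_hom A M N"
proof -
  interpret right_module A N by fact
  show ?thesis by (auto simp: rmod_hom_def)
qed

lemma rmod_hom_add:
  assumes "right_module A N" "f \<in> rmod_hom A M N" "g \<in> rmod_hom A M N"
  shows "(\<lambda>x. f x \<oplus>\<^bsub>N\<^esub> g x) \<in> rmod_hom A M N"
proof -
  interpret right_module A N by fact
  note f = rmod_homD[OF assms(2)] and g = rmod_homD[OF assms(3)]
  show ?thesis
  proof (rule rmod_homI)
    fix x y assume "x \<in> carrier M" "y \<in> carrier M"
    with f(1)[of x] f(1)[of y] g(1)[of x] g(1)[of y] f(2)[of x y] g(2)[of x y]
    show "f (x \<oplus>\<^bsub>M\<^esub> y) \<oplus>\<^bsub>N\<^esub> g (x \<oplus>\<^bsub>M\<^esub> y) = (f x \<oplus>\<^bsub>N\<^esub> g x) \<oplus>\<^bsub>N\<^esub> (f y \<oplus>\<^bsub>N\<^esub> g y)"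
      by (simp add: M.a_ac)
  qed (auto simp: f g act_add_module)
qed

lemma rmod_hom_neg:
  assumes "right_module A N" "f \<in> rmod_hom A M N"
  shows "(\<lambda>x. \<ominus>\<^bsub>N\<^esub> f x) \<in> rmod_hom A M N"
proof -
  interpret right_module A N by fact
  note f = rmod_homD[OF assms(2)]
  show ?thesis by (rule rmod_homI) (auto simp: f act_neg M.minus_add)
qed

lemma rmod_hom_minus:
  assumes "right_module A N" "f \<in> rmod_hom A M N" "g \<in> rmod_hom A M N"
  shows "(\<lambda>x. f x \<ominus>\<^bsub>N\<^esub> g x) \<in> rmod_hom A M N"
  unfolding a_minus_def by (intro rmod_hom_add rmod_hom_neg assms)

lemma rmod_hom_into_sub:
  "f \<in> rmod_hom A M N \<Longrightarrow> f ` carrier M \<subseteq> K \<Longrightarrow> f \<in> rmod_hom A M (N\<lparr>carrier := K\<rparr>)"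
  by (auto simp: rmod_hom_def)

lemma rmod_hom_inclusion: "K \<subseteq> carrier M \<Longrightarrow> (\<lambda>x. x) \<in> rmod_hom A (M\<lparr>carrier := K\<rparr>) M"
  by (auto simp: rmod_hom_def)

lemma rmod_hom_restrict:
  "f \<in> rmod_hom A M N \<Longrightarrow> K \<subseteq> carrier M \<Longrightarrow> f \<in> rmod_hom A (M\<lparr>carrier := K\<rparr>) N"
  by (auto simp: rmod_hom_def subset_iff)

lemma right_module_sub:
  assumes M: "right_module A M" and K: "submodule K A M"
  shows "right_module A (M\<lparr>carrier := K\<rparr>)"
proof -
  interpret right_module A M by fact
  note KD = submoduleD[OF K] and s = subsetD[OF submoduleD(1)[OF K]]
  show ?thesis
  proof (rule right_moduleI)
    fix x assume "x \<in> carrier (M\<lparr>carrier := K\<rparr>)"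
    then show "\<exists>y\<in>carrier (M\<lparr>carrier := K\<rparr>). y \<oplus>\<^bsub>M\<lparr>carrier := K\<rparr>\<^esub> x = \<zero>\<^bsub>M\<lparr>carrier := K\<rparr>\<^esub>"
      using KD s by (auto intro!: bexI[of _ "\<ominus>\<^bsub>M\<^esub> x"] simp: M.l_neg)
  qed (use A.ring_axioms KD s in \<open>auto simp: M.a_assoc act_add_ring act_add_module act_mult act_one
        intro: M.a_comm\<close>)
qed

lemma submodule_sub_iff:
  assumes M: "right_module A M" and K: "submodule K A M"
  shows "submodule N A (M\<lparr>carrier := K\<rparr>) \<longleftrightarrow> submodule N A M \<and> N \<subseteq> K"
proof -
  have "submodule N A M" if "submodule N A (M\<lparr>carrier := K\<rparr>)"
    by (rule submoduleI'[OF M]) (use submoduleD[OF that] submoduleD[OF K] in auto)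
  moreover have "submodule N A (M\<lparr>carrier := K\<rparr>)" if "submodule N A M" "N \<subseteq> K"
    by (rule submoduleI'[OF right_module_sub[OF M K]]) (use submoduleD[OF that(1)] that in auto)
  ultimately show ?thesis using submoduleD(1)[of N A "M\<lparr>carrier := K\<rparr>"] by auto
qed

subsection \<open>Isomorphisms\<close>

lemma rmod_isoI:
  "f \<in> rmod_hom A M N \<Longrightarrow> inj_on f (carrier M) \<Longrightarrow> f ` carrier M = carrier N \<Longrightarrow> rmod_iso A M N"
  by (auto simp: rmod_iso_def bij_betw_def)

lemma rmod_iso_refl: "rmod_iso A M M"
  using rmod_hom_id by (fastforce simp: rmod_iso_def intro: bij_betwI)

lemma rmod_hom_inverse:
  assumes "right_module A M" "f \<in> rmod_hom A M N" "bij_betw f (carrier M) (carrier N)"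
  shows "inv_into (carrier M) f \<in> rmod_hom A N M"
proof -
  interpret right_module A M by fact
  let ?g = "inv_into (carrier M) f"
  note f = rmod_homD[OF assms(2)]
  have g: "?g y \<in> carrier M" "f (?g y) = y" if "y \<in> carrier N" for y
    using that assms(3) by (auto simp: bij_betw_inv_into_right inv_into_into bij_betw_def)
  have e: "?g (f x) = x" if "x \<in> carrier M" for x
    using that assms(3) by (auto simp: bij_betw_inv_into_left)
  show ?thesis
  proof (rule rmod_homI)
    fix x y assume xy: "x \<in> carrier N" "y \<in> carrier N"
    then have "x \<oplus>\<^bsub>N\<^esub> y = f (?g x \<oplus>\<^bsub>M\<^esub> ?g y)" using f(2) g by auto
    then show "?g (x \<oplus>\<^bsub>N\<^esub> y) = ?g x \<oplus>\<^bsub>M\<^esub> ?g y" using e g xy by auto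
  next
    fix a x assume ax: "a \<in> carrier A" "x \<in> carrier N"
    then have "a \<odot>\<^bsub>N\<^esub> x = f (a \<odot>\<^bsub>M\<^esub> ?g x)" using f(3) g by auto
    then show "?g (a \<odot>\<^bsub>N\<^esub> x) = a \<odot>\<^bsub>M\<^esub> ?g x" using e g ax act_closed by auto
  qed (use g in auto)
qed

lemma rmod_isoE:
  assumes "right_module A M" "rmod_iso A M N"
  obtains f g where "f \<in> rmod_hom A M N" "g \<in> rmod_hom A N M"
    "\<And>x. x \<in> carrier M \<Longrightarrow> g (f x) = x" "\<And>y. y \<in> carrier N \<Longrightarrow> f (g y) = y"
proof -
  from assms(2) obtain f where f: "f \<in> rmod_hom A M N" "bij_betw f (carrier M) (carrier N)"
    by (auto simp: rmod_iso_def)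
  show ?thesis
    by (rule that[OF f(1) rmod_hom_inverse[OF assms(1) f]])
      (use f(2) in \<open>auto simp: bij_betw_inv_into_left bij_betw_inv_into_right\<close>)
qed

lemma rmod_isoI':
  assumes "f \<in> rmod_hom A M N" "g \<in> rmod_hom A N M"
    "\<And>x. x \<in> carrier M \<Longrightarrow> g (f x) = x" "\<And>y. y \<in> carrier N \<Longrightarrow> f (g y) = y"
  shows "rmod_iso A M N"
  unfolding rmod_iso_def
  using assms rmod_homD(1)[OF assms(1)] rmod_homD(1)[OF assms(2)]
  by (intro bexI[OF _ assms(1)] bij_betwI[of _ _ _ g]) auto

lemma rmod_iso_sym: "right_module A M \<Longrightarrow> rmod_iso A M N \<Longrightarrow> rmod_iso A N M"
  by (erule (1) rmod_isoE) (auto intro: rmod_isoI')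

lemma rmod_iso_trans: "rmod_iso A M N \<Longrightarrow> rmod_iso A N L \<Longrightarrow> rmod_iso A M L"
proof -
  assume "rmod_iso A M N" "rmod_iso A N L"
  then obtain f g where f: "f \<in> rmod_hom A M N" "bij_betw f (carrier M) (carrier N)"
    and g: "g \<in> rmod_hom A N L" "bij_betw g (carrier N) (carrier L)"
    by (auto simp: rmod_iso_def)
  show "rmod_iso A M L"
    unfolding rmod_iso_def
    using rmod_hom_comp[OF f(1) g(1)] bij_betw_trans[OF f(2) g(2)] by (auto simp: comp_def)
qed

text \<open>Every law is checked on preimages. Nothing is known of \<open>N\<close> beforehand, not
  even that its field \<open>zero\<close> is neutral, so the value of that field is asked for
  separately. Only surjectivity is assumed, which makes the lemma serve copies and quotients
  alike.\<close>

lemma right_module_iso: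
  assumes M: "right_module A M" and N: "\<zero>\<^bsub>N\<^esub> = f \<zero>\<^bsub>M\<^esub>" and f: "f \<in> rmod_hom A M N" "f ` carrier M = carrier N"
  shows "right_module A N"
proof -
  interpret right_module A M by fact
  note h = rmod_homD[OF f(1)]
  have ex: "\<exists>x \<in> carrier M. y = f x" if "y \<in> carrier N" for y using f(2) that by auto
  show ?thesis
  proof (rule right_moduleI)
    show "ring A" by (rule A.ring_axioms)
    show "\<zero>\<^bsub>N\<^esub> \<in> carrier N" using N h by auto
    fix x y z assume "x \<in> carrier N" "y \<in> carrier N" "z \<in> carrier N"
    then obtain u v w where [simp]: "u \<in> carrier M" "v \<in> carrier M" "w \<in> carrier M"
      and *: "x = f u" "y = f v" "z = f w" using ex by metis
    show "x \<oplus>\<^bsub>N\<^esub> y \<in> carrier N" using h(1)[of "u \<oplus>\<^bsub>M\<^esub> v"] by (simp add: * h(2)[symmetric])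
    show "x \<oplus>\<^bsub>N\<^esub> y \<oplus>\<^bsub>N\<^esub> z = x \<oplus>\<^bsub>N\<^esub> (y \<oplus>\<^bsub>N\<^esub> z)"
      using M.a_assoc[of u v w] by (simp add: * h(2)[symmetric])
    show "x \<oplus>\<^bsub>N\<^esub> y = y \<oplus>\<^bsub>N\<^esub> x"
      using M.a_comm[of u v] by (simp add: * h(2)[symmetric])
    show "\<zero>\<^bsub>N\<^esub> \<oplus>\<^bsub>N\<^esub> x = x" by (simp add: * N h(2)[symmetric])
    show "\<exists>y \<in> carrier N. y \<oplus>\<^bsub>N\<^esub> x = \<zero>\<^bsub>N\<^esub>"
      by (intro bexI[of _ "f (\<ominus>\<^bsub>M\<^esub> u)"]) (simp_all add: * N h(2)[symmetric] M.l_neg, simp add: h)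
    show "\<one>\<^bsub>A\<^esub> \<odot>\<^bsub>N\<^esub> x = x" by (simp add: * h(3)[symmetric] act_one)
    fix a b assume ab: "a \<in> carrier A" "b \<in> carrier A"
    show "a \<odot>\<^bsub>N\<^esub> x \<in> carrier N" 
      using ab h(1)[of "a \<odot>\<^bsub>M\<^esub> u"] act_closed[of a u] by (simp add: * h(3)[symmetric])
    show "(a \<oplus>\<^bsub>A\<^esub> b) \<odot>\<^bsub>N\<^esub> x = a \<odot>\<^bsub>N\<^esub> x \<oplus>\<^bsub>N\<^esub> b \<odot>\<^bsub>N\<^esub> x"
      using ab by (simp add: * h(2,3)[symmetric] act_closed act_add_ring)
    show "a \<odot>\<^bsub>N\<^esub> (x \<oplus>\<^bsub>N\<^esub> y) = a \<odot>\<^bsub>N\<^esub> x \<oplus>\<^bsub>N\<^esub> a \<odot>\<^bsub>N\<^esub> y"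
      using ab by (simp add: * h(2,3)[symmetric] act_closed act_add_module)
    show "(a \<otimes>\<^bsub>A\<^esub> b) \<odot>\<^bsub>N\<^esub> x = b \<odot>\<^bsub>N\<^esub> (a \<odot>\<^bsub>N\<^esub> x)"
      using ab by (simp add: * h(3)[symmetric] act_closed act_mult)
  qed
qed

section \<open>Copies on other types, and quotient modules\<close>

definition transport :: "('m \<Rightarrow> 'n) \<Rightarrow> ('a, 'm) module \<Rightarrow> ('a, 'n) module" where
  "transport c M = (let b = inv_into (carrier M) c in
     \<lparr>carrier = c ` carrier M, mult = undefined, one = undefined, zero = c \<zero>\<^bsub>M\<^esub>,
      add = (\<lambda>u v. c (b u \<oplus>\<^bsub>M\<^esub> b v)), smult = (\<lambda>a u. c (a \<odot>\<^bsub>M\<^esub> b u))\<rparr>)"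

text \<open>The target type contributes only room: as \<open>c\<close> is injective on the carrier,
  each image can be decoded, and the operations are carried out on the decoded elements.\<close>

lemma transport:
  assumes M: "right_module A M" and c: "inj_on c (carrier M)"
  shows "right_module A (transport c M)" "rmod_iso A M (transport c M)"
proof -
  have h: "c \<in> rmod_hom A M (transport c M)"
    using c by (auto intro!: rmod_homI simp: transport_def Let_def)
  show "right_module A (transport c M)"
    by (rule right_module_iso[OF M _ h]) (auto simp: transport_def Let_def)
  show "rmod_iso A M (transport c M)"
    by (rule rmod_isoI[OF h c]) (auto simp: transport_def Let_def)
qed

text \<open>Quotients live on the type of the module itself: every coset is replaced by a representative.\<close>

definition coset_rep :: "('a, 'm) module \<Rightarrow> 'm set \<Rightarrow> 'm \<Rightarrow> 'm" where
  "coset_rep M K x = (SOME y. y \<in> carrier M \<and> x \<ominus>\<^bsub>M\<^esub> y \<in> K)"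

definition rep_quotient :: "('a, 'm) module \<Rightarrow> 'm set \<Rightarrow> ('a, 'm) module" where
  "rep_quotient M K = \<lparr>carrier = coset_rep M K ` carrier M, mult = undefined, one = undefined,
     zero = coset_rep M K \<zero>\<^bsub>M\<^esub>, add = (\<lambda>u v. coset_rep M K (u \<oplus>\<^bsub>M\<^esub> v)),
     smult = (\<lambda>a u. coset_rep M K (a \<odot>\<^bsub>M\<^esub> u))\<rparr>"

lemma rep_quotient:
  assumes M: "right_module A M" and K: "submodule K A M"
  shows "right_module A (rep_quotient M K)"
    and "coset_rep M K \<in> rmod_hom A M (rep_quotient M K)"
    and "coset_rep M K ` carrier M = carrier (rep_quotient M K)"
    and "a_kernel M (rep_quotient M K) (coset_rep M K) = K"
proof -
  interpret right_module A M by fact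
  note KD = submoduleD[OF K] and KM = subsetD[OF submoduleD(1)[OF K]]
  let ?r = "coset_rep M K"
  have r: "?r x \<in> carrier M \<and> x \<ominus>\<^bsub>M\<^esub> ?r x \<in> K" if "x \<in> carrier M" for x
    unfolding coset_rep_def
    by (rule someI[of _ x]) (use that KD(2) in \<open>auto simp: M.minus_eq M.r_neg\<close>)
  \<comment> \<open>Congruent elements satisfy the same predicate under the \<open>SOME\<close> of
    \<open>coset_rep\<close>, hence receive the same representative.\<close>
  have eq: "?r x = ?r y" if xy: "x \<in> carrier M" "y \<in> carrier M" "x \<ominus>\<^bsub>M\<^esub> y \<in> K" for x y
  proof -
    have "x \<ominus>\<^bsub>M\<^esub> z \<in> K \<longleftrightarrow> y \<ominus>\<^bsub>M\<^esub> z \<in> K" if "z \<in> carrier M" for z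
    proof
      have "y \<ominus>\<^bsub>M\<^esub> z = (x \<ominus>\<^bsub>M\<^esub> z) \<ominus>\<^bsub>M\<^esub> (x \<ominus>\<^bsub>M\<^esub> y)"
        using xy(1,2) that by algebra
      then show "x \<ominus>\<^bsub>M\<^esub> z \<in> K \<Longrightarrow> y \<ominus>\<^bsub>M\<^esub> z \<in> K" using KD(6) xy by auto
      have "x \<ominus>\<^bsub>M\<^esub> z = (y \<ominus>\<^bsub>M\<^esub> z) \<oplus>\<^bsub>M\<^esub> (x \<ominus>\<^bsub>M\<^esub> y)"
        using xy(1,2) that by algebra
      then show "y \<ominus>\<^bsub>M\<^esub> z \<in> K \<Longrightarrow> x \<ominus>\<^bsub>M\<^esub> z \<in> K" using KD(3) xy by auto
    qed
    then show ?thesis unfolding coset_rep_def by metis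
  qed
  have sw: "?r x \<ominus>\<^bsub>M\<^esub> x \<in> K" if "x \<in> carrier M" for x
  proof -
    have "?r x \<ominus>\<^bsub>M\<^esub> x = \<ominus>\<^bsub>M\<^esub> (x \<ominus>\<^bsub>M\<^esub> ?r x)" using r[OF that, THEN conjunct1] that by algebra
    then show ?thesis using KD(5) r[OF that] by auto
  qed
  show h: "?r \<in> rmod_hom A M (rep_quotient M K)"
  proof (rule rmod_homI)
    fix x y assume xy: "x \<in> carrier M" "y \<in> carrier M"
    have rr: "?r x \<in> carrier M" "?r y \<in> carrier M" using r xy by auto
    have "(x \<oplus>\<^bsub>M\<^esub> y) \<ominus>\<^bsub>M\<^esub> (?r x \<oplus>\<^bsub>M\<^esub> ?r y) = (x \<ominus>\<^bsub>M\<^esub> ?r x) \<oplus>\<^bsub>M\<^esub> (y \<ominus>\<^bsub>M\<^esub> ?r y)"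
      using rr xy by algebra
    then have "(x \<oplus>\<^bsub>M\<^esub> y) \<ominus>\<^bsub>M\<^esub> (?r x \<oplus>\<^bsub>M\<^esub> ?r y) \<in> K" using r xy KD(3) by auto
    then show "?r (x \<oplus>\<^bsub>M\<^esub> y) = ?r x \<oplus>\<^bsub>rep_quotient M K\<^esub> ?r y"
      using eq xy r by (simp add: rep_quotient_def)
  next
    fix a x assume ax: "a \<in> carrier A" "x \<in> carrier M"
    have "a \<odot>\<^bsub>M\<^esub> x \<ominus>\<^bsub>M\<^esub> a \<odot>\<^bsub>M\<^esub> ?r x = a \<odot>\<^bsub>M\<^esub> (x \<ominus>\<^bsub>M\<^esub> ?r x)"
      using r ax act_minus by auto
    then have "a \<odot>\<^bsub>M\<^esub> x \<ominus>\<^bsub>M\<^esub> a \<odot>\<^bsub>M\<^esub> ?r x \<in> K" using r ax KD(4) by auto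
    then show "?r (a \<odot>\<^bsub>M\<^esub> x) = a \<odot>\<^bsub>rep_quotient M K\<^esub> ?r x"
      using eq ax r act_closed by (simp add: rep_quotient_def)
  qed (auto simp: rep_quotient_def)
  show im: "?r ` carrier M = carrier (rep_quotient M K)" by (simp add: rep_quotient_def)
  show "right_module A (rep_quotient M K)"
    by (rule right_module_iso[OF M _ h im]) (simp add: rep_quotient_def)
  show "a_kernel M (rep_quotient M K) ?r = K"
  proof -
    have "?r x = ?r \<zero>\<^bsub>M\<^esub> \<longleftrightarrow> x \<in> K" if x: "x \<in> carrier M" for x
    proof
      assume e: "?r x = ?r \<zero>\<^bsub>M\<^esub>"
      have c: "?r x \<in> carrier M" using r x by auto
      have "x = (x \<ominus>\<^bsub>M\<^esub> ?r x) \<oplus>\<^bsub>M\<^esub> (?r x \<ominus>\<^bsub>M\<^esub> \<zero>\<^bsub>M\<^esub>)" using x c by algebra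
      then show "x \<in> K" using r[OF x] sw[of "\<zero>\<^bsub>M\<^esub>"] KD(3) e by (metis M.zero_closed)
    next
      assume "x \<in> K"
      then have "x \<ominus>\<^bsub>M\<^esub> \<zero>\<^bsub>M\<^esub> \<in> K" using KD by auto
      then show "?r x = ?r \<zero>\<^bsub>M\<^esub>" using eq x by auto
    qed
    then show ?thesis using KM by (auto simp: a_kernel_def' rep_quotient_def)
  qed
qed

text \<open>The universal property of a cokernel. The preimage chosen by \<open>inv_into\<close>
  does not matter, as two preimages differ by an element that \<open>g\<close>, hence also
  \<open>k\<close>, sends to zero.\<close>

lemma factor_through_surj:
  assumes mods: "right_module A M" "right_module A C" "right_module A Z"
    and g: "g \<in> rmod_hom A M C" "g ` carrier M = carrier C"
    and k: "k \<in> rmod_hom A M Z" "\<And>x. x \<in> carrier M \<Longrightarrow> g x = \<zero>\<^bsub>C\<^esub> \<Longrightarrow> k x = \<zero>\<^bsub>Z\<^esub>"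
  obtains h where "h \<in> rmod_hom A C Z" "\<And>x. x \<in> carrier M \<Longrightarrow> h (g x) = k x"
proof -
  interpret g: module_hom A M C g by (rule module_homI) fact+
  interpret k: module_hom A M Z k by (rule module_homI) fact+
  define h where "h y = k (inv_into (carrier M) g y)" for y
  have e: "h (g x) = k x" if x: "x \<in> carrier M" for x
  proof -
    have *: "inv_into (carrier M) g (g x) \<in> carrier M" "g (inv_into (carrier M) g (g x)) = g x"
      using x by (auto intro: inv_into_into f_inv_into_f)
    then show ?thesis unfolding h_def
      using k(2)[of "inv_into (carrier M) g (g x) \<ominus>\<^bsub>M\<^esub> x"] x g.minus[OF *(1) x] k.minus[OF *(1) x]
      by (metis g.M.M.minus_closed g.N.M.diff_zero_iff g.closed k.N.M.diff_zero_iff k.closed)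
  qed
  have "h \<in> rmod_hom A C Z"
  proof (rule rmod_homI)
    fix x y assume "x \<in> carrier C" "y \<in> carrier C"
    then obtain u v where *: "u \<in> carrier M" "v \<in> carrier M" "x = g u" "y = g v"
      using g(2) by (metis imageE)
    then show "h (x \<oplus>\<^bsub>C\<^esub> y) = h x \<oplus>\<^bsub>Z\<^esub> h y"
      using e g.add[of u v] k.add[of u v] by (metis g.M.M.a_closed)
  next
    fix a x assume "a \<in> carrier A" "x \<in> carrier C"
    then obtain u where *: "u \<in> carrier M" "x = g u" "a \<in> carrier A" using g(2) by (metis imageE)
    then show "h (a \<odot>\<^bsub>C\<^esub> x) = a \<odot>\<^bsub>Z\<^esub> h x"
      using e g.act[of a u] k.act[of a u] by (metis g.M.act_closed)
  next
    fix x assume "x \<in> carrier C"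
    then obtain u where "u \<in> carrier M" "x = g u" using g(2) by (metis imageE)
    then show "h x \<in> carrier Z" using e k.closed by auto
  qed
  then show ?thesis using that e by blast
qed

text \<open>The universal property of a kernel: \<open>f\<close> is undone on its image, and
  linearity of the result is checked after applying the injective map \<open>f\<close>.\<close>

lemma factor_through_inj:
  assumes mods: "right_module A X" "right_module A M" "right_module A Z"
    and f: "f \<in> rmod_hom A X M" "inj_on f (carrier X)"
    and k: "k \<in> rmod_hom A Z M" "k ` carrier Z \<subseteq> f ` carrier X"
  obtains h where "h \<in> rmod_hom A Z X" "\<And>z. z \<in> carrier Z \<Longrightarrow> f (h z) = k z"
proof -
  interpret f: module_hom A X M f by (rule module_homI) fact+
  interpret k: module_hom A Z M k by (rule module_homI) fact+
  define h where "h z = inv_into (carrier X) f (k z)" for z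
  have h: "h z \<in> carrier X" "f (h z) = k z" if "z \<in> carrier Z" for z
    unfolding h_def by (rule inv_into_into f_inv_into_f, use k(2) that in blast)+
  have "h \<in> rmod_hom A Z X"
  proof (rule rmod_homI)
    fix x y assume "x \<in> carrier Z" "y \<in> carrier Z"
    then show "h (x \<oplus>\<^bsub>Z\<^esub> y) = h x \<oplus>\<^bsub>X\<^esub> h y"
      using h f.add[of "h x" "h y"] k.add[of x y] by (intro inj_onD[OF f(2)]) auto
  next
    fix a x assume "a \<in> carrier A" "x \<in> carrier Z"
    then show "h (a \<odot>\<^bsub>Z\<^esub> x) = a \<odot>\<^bsub>X\<^esub> h x"
      using h f.act[of a "h x"] k.act[of a x]
      by (intro inj_onD[OF f(2)]) (auto simp: k.M.act_closed f.M.act_closed)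
  qed (use h in auto)
  then show ?thesis using that h by blast
qed

section \<open>Direct sums\<close>

lemma direct_sum2_simps [simp]:
  "carrier (direct_sum2 M N) = carrier M \<times> carrier N"
  "\<zero>\<^bsub>direct_sum2 M N\<^esub> = (\<zero>\<^bsub>M\<^esub>, \<zero>\<^bsub>N\<^esub>)"
  "u \<oplus>\<^bsub>direct_sum2 M N\<^esub> v = (fst u \<oplus>\<^bsub>M\<^esub> fst v, snd u \<oplus>\<^bsub>N\<^esub> snd v)"
  "a \<odot>\<^bsub>direct_sum2 M N\<^esub> u = (a \<odot>\<^bsub>M\<^esub> fst u, a \<odot>\<^bsub>N\<^esub> snd u)"
  by (simp_all add: direct_sum2_def)

lemma direct_sum_simps [simp]:
  "carrier (direct_sum k N) = (\<Pi>\<^sub>E i\<in>{..<k}. carrier (N i))"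
  "\<zero>\<^bsub>direct_sum k N\<^esub> = (\<lambda>i\<in>{..<k}. \<zero>\<^bsub>N i\<^esub>)"
  "u \<oplus>\<^bsub>direct_sum k N\<^esub> v = (\<lambda>i\<in>{..<k}. u i \<oplus>\<^bsub>N i\<^esub> v i)"
  "a \<odot>\<^bsub>direct_sum k N\<^esub> u = (\<lambda>i\<in>{..<k}. a \<odot>\<^bsub>N i\<^esub> u i)"
  by (simp_all add: direct_sum_def)

lemma right_module_direct_sum2:
  assumes "right_module A M" "right_module A N"
  shows "right_module A (direct_sum2 M N)"
proof -
  interpret M: right_module A M by fact
  interpret N: right_module A N by fact
  show ?thesis
  proof (rule right_moduleI)
    fix x assume "x \<in> carrier (direct_sum2 M N)"
    then show "\<exists>y\<in>carrier (direct_sum2 M N). y \<oplus>\<^bsub>direct_sum2 M N\<^esub> x = \<zero>\<^bsub>direct_sum2 M N\<^esub>"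
      by (intro bexI[of _ "(\<ominus>\<^bsub>M\<^esub> fst x, \<ominus>\<^bsub>N\<^esub> snd x)"]) (auto simp: M.M.l_neg N.M.l_neg)
  qed (auto simp: M.A.ring_axioms M.M.a_ac N.M.a_ac M.act_closed N.act_closed
        M.act_add_ring N.act_add_ring M.act_add_module N.act_add_module M.act_mult N.act_mult
        M.act_one N.act_one)
qed

lemma right_module_direct_sum:
  assumes "ring A" "\<And>i. i < k \<Longrightarrow> right_module A (N i)"
  shows "right_module A (direct_sum k N)"
proof -
  have N: "abelian_group (N i)" "right_module_axioms A (N i)" if "i < k" for i
    using assms(2)[OF that] by (auto simp: right_module_def)
  have g: "abelian_monoid (N i)" if "i < k" for i
    using N(1)[OF that] by (simp add: abelian_group_def)
  \<comment> \<open>Elements of the sum are \<open>undefined\<close> outside \<open>{..<k}\<close>,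
    so agreement on the index set is equality of functions.\<close>
  have ext: "(\<lambda>i\<in>{..<k}. v i) = u" if "u \<in> carrier (direct_sum k N)" "\<And>i. i < k \<Longrightarrow> v i = u i" for u v
  proof
    fix i show "(\<lambda>i\<in>{..<k}. v i) i = u i"
      using that(2)[of i] PiE_arb[of u "{..<k}" "\<lambda>i. carrier (N i)" i] that(1) by auto
  qed
  show ?thesis
  proof (rule right_moduleI)
    show "ring A" by fact
    fix x assume x: "x \<in> carrier (direct_sum k N)"
    show "\<exists>y\<in>carrier (direct_sum k N). y \<oplus>\<^bsub>direct_sum k N\<^esub> x = \<zero>\<^bsub>direct_sum k N\<^esub>"
      by (rule bexI[of _ "\<lambda>i\<in>{..<k}. \<ominus>\<^bsub>N i\<^esub> x i"])
        (use x in \<open>auto simp: abelian_group.l_neg[OF N(1)] abelian_group.a_inv_closed[OF N(1)] PiE_iff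
          intro!: restrict_ext\<close>)
    show "\<zero>\<^bsub>direct_sum k N\<^esub> \<oplus>\<^bsub>direct_sum k N\<^esub> x = x"
      unfolding direct_sum_simps by (rule ext[OF x]) (use x in \<open>auto simp: abelian_monoid.l_zero[OF g] PiE_iff\<close>)
    show "\<one>\<^bsub>A\<^esub> \<odot>\<^bsub>direct_sum k N\<^esub> x = x"
      unfolding direct_sum_simps
      by (rule ext[OF x]) (use x right_module.act_one[OF assms(2)] in \<open>auto simp: PiE_iff\<close>)
  qed (use assms(2) in \<open>auto simp: PiE_iff abelian_monoid.a_closed[OF g] abelian_monoid.zero_closed[OF g]
        abelian_monoid.a_ac[OF g] right_module.act_closed[OF assms(2)]
        right_module.act_add_ring[OF assms(2)] right_module.act_add_module[OF assms(2)]
        right_module.act_mult[OF assms(2)] intro!: restrict_ext\<close>)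
qed

lemma rmod_hom_fst: "fst \<in> rmod_hom A (direct_sum2 M N) M"
  and rmod_hom_snd: "snd \<in> rmod_hom A (direct_sum2 M N) N"
  by (auto intro!: rmod_homI)

lemma rmod_hom_pair:
  "f \<in> rmod_hom A L M \<Longrightarrow> g \<in> rmod_hom A L N \<Longrightarrow> (\<lambda>x. (f x, g x)) \<in> rmod_hom A L (direct_sum2 M N)"
  by (auto simp: rmod_hom_def)

lemma rmod_hom_copair:
  assumes "right_module A L" "f \<in> rmod_hom A M L" "g \<in> rmod_hom A N L"
  shows "(\<lambda>x. f (fst x) \<oplus>\<^bsub>L\<^esub> g (snd x)) \<in> rmod_hom A (direct_sum2 M N) L"
  by (intro rmod_hom_add[OF assms(1)] rmod_hom_comp[OF rmod_hom_fst assms(2)]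
      rmod_hom_comp[OF rmod_hom_snd assms(3)])

lemma rmod_hom_inl: "right_module A N \<Longrightarrow> (\<lambda>x. (x, \<zero>\<^bsub>N\<^esub>)) \<in> rmod_hom A M (direct_sum2 M N)"
  and rmod_hom_inr: "right_module A M \<Longrightarrow> (\<lambda>y. (\<zero>\<^bsub>M\<^esub>, y)) \<in> rmod_hom A N (direct_sum2 M N)"
  by (intro rmod_hom_pair rmod_hom_id rmod_hom_zero; assumption)+

lemma direct_sum2_cong:
  assumes "right_module A M" "right_module A N" "rmod_iso A M M'" "rmod_iso A N N'"
  shows "rmod_iso A (direct_sum2 M N) (direct_sum2 M' N')"
proof -
  obtain f f' where f: "f \<in> rmod_hom A M M'" "f' \<in> rmod_hom A M' M"
    "\<And>x. x \<in> carrier M \<Longrightarrow> f' (f x) = x" "\<And>y. y \<in> carrier M' \<Longrightarrow> f (f' y) = y"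
    by (rule rmod_isoE[OF assms(1,3)]) blast
  obtain g g' where g: "g \<in> rmod_hom A N N'" "g' \<in> rmod_hom A N' N"
    "\<And>x. x \<in> carrier N \<Longrightarrow> g' (g x) = x" "\<And>y. y \<in> carrier N' \<Longrightarrow> g (g' y) = y"
    by (rule rmod_isoE[OF assms(2,4)]) blast
  show ?thesis
    by (rule rmod_isoI'[of "\<lambda>x. (f (fst x), g (snd x))" _ _ _ "\<lambda>x. (f' (fst x), g' (snd x))"])
      (auto simp: f(3,4) g(3,4) intro!: rmod_hom_pair rmod_hom_comp[OF rmod_hom_fst f(1)] rmod_hom_comp[OF rmod_hom_snd g(1)]
        rmod_hom_comp[OF rmod_hom_fst f(2)] rmod_hom_comp[OF rmod_hom_snd g(2)])
qed

lemma direct_sum2_commute: "rmod_iso A (direct_sum2 M N) (direct_sum2 N M)"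
  by (rule rmod_isoI'[of "\<lambda>x. (snd x, fst x)" _ _ _ "\<lambda>x. (snd x, fst x)"])
    (auto intro!: rmod_homI)

lemma direct_sum2_assoc:
  "rmod_iso A (direct_sum2 (direct_sum2 M N) L) (direct_sum2 M (direct_sum2 N L))"
  by (rule rmod_isoI'[of "\<lambda>x. (fst (fst x), snd (fst x), snd x)" _ _ _ "\<lambda>x. ((fst x, fst (snd x)), snd (snd x))"])
    (auto intro!: rmod_homI)

lemma direct_sum2_zero:
  assumes "right_module A M" "right_module A Z" "zero_module Z"
  shows "rmod_iso A (direct_sum2 M Z) M"
  by (rule rmod_isoI'[of fst _ _ _ "\<lambda>x. (x, \<zero>\<^bsub>Z\<^esub>)"])
    (use assms rmod_hom_fst rmod_hom_inl[OF assms(2)] in \<open>auto simp: zero_module_def\<close>)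

lemma zero_module_direct_sum_0: "zero_module (direct_sum 0 N)"
  by (simp add: zero_module_def restrict_def)

text \<open>Dropping the last coordinate has to reset it to \<open>undefined\<close>, hence
  \<open>restrict\<close>; the way back is a function update. All inductions over
  \<open>direct_sum\<close> pass through this isomorphism.\<close>

lemma direct_sum_Suc: "rmod_iso A (direct_sum (Suc k) N) (direct_sum2 (direct_sum k N) (N k))"
proof (rule rmod_isoI'[of "\<lambda>u. (restrict u {..<k}, u k)" _ _ _ "\<lambda>x. (fst x)(k := snd x)"])
  show "(\<lambda>u. (restrict u {..<k}, u k)) \<in> rmod_hom A (direct_sum (Suc k) N) (direct_sum2 (direct_sum k N) (N k))"
    by (rule rmod_homI) (auto simp: PiE_iff intro!: restrict_ext)
  have lt: "i < k" if "i < Suc k" "i \<noteq> k" for i using that by simp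
  show "(\<lambda>x. (fst x)(k := snd x)) \<in> rmod_hom A (direct_sum2 (direct_sum k N) (N k)) (direct_sum (Suc k) N)"
  proof (rule rmod_homI)
    fix x assume x: "x \<in> carrier (direct_sum2 (direct_sum k N) (N k))"
    then show "(fst x)(k := snd x) \<in> carrier (direct_sum (Suc k) N)"
      using PiE_fun_upd[of "snd x" "\<lambda>i. carrier (N i)" k "fst x" "{..<k}"]
      by (simp only: direct_sum2_simps direct_sum_simps mem_Times_iff lessThan_Suc)
    fix y assume y: "y \<in> carrier (direct_sum2 (direct_sum k N) (N k))"
    show "(fst (x \<oplus>\<^bsub>direct_sum2 (direct_sum k N) (N k)\<^esub> y))(k := snd (x \<oplus>\<^bsub>direct_sum2 (direct_sum k N) (N k)\<^esub> y)) =
        (fst x)(k := snd x) \<oplus>\<^bsub>direct_sum (Suc k) N\<^esub> (fst y)(k := snd y)"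
      by (rule ext) (auto dest: lt)
  next
    fix a x assume "a \<in> carrier A" "x \<in> carrier (direct_sum2 (direct_sum k N) (N k))"
    show "(fst (a \<odot>\<^bsub>direct_sum2 (direct_sum k N) (N k)\<^esub> x))(k := snd (a \<odot>\<^bsub>direct_sum2 (direct_sum k N) (N k)\<^esub> x)) =
        a \<odot>\<^bsub>direct_sum (Suc k) N\<^esub> (fst x)(k := snd x)"
      by (rule ext) (auto dest: lt)
  qed
  show "(fst (restrict u {..<k}, u k))(k := snd (restrict u {..<k}, u k)) = u"
    if "u \<in> carrier (direct_sum (Suc k) N)" for u
  proof -
    have "u i = undefined" if "\<not> i < Suc k" for i
      using PiE_arb[of u "{..<Suc k}" "\<lambda>i. carrier (N i)" i] \<open>u \<in> _\<close> that by simp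
    then show ?thesis by (simp add: fun_eq_iff restrict_def)
  qed
  show "(restrict ((fst x)(k := snd x)) {..<k}, ((fst x)(k := snd x)) k) = x"
    if "x \<in> carrier (direct_sum2 (direct_sum k N) (N k))" for x
  proof -
    have "fst x i = undefined" if "\<not> i < k" for i
      using PiE_arb[of "fst x" "{..<k}" "\<lambda>i. carrier (N i)" i] \<open>x \<in> _\<close> that by (simp add: mem_Times_iff)
    then show ?thesis by (simp add: prod_eq_iff fun_eq_iff restrict_def)
  qed
qed

lemma zero_module_iso: "rmod_iso A M N \<Longrightarrow> right_module A M \<Longrightarrow> right_module A N \<Longrightarrow> zero_module M \<Longrightarrow> zero_module N"
proof -
  assume M: "right_module A M" and N: "right_module A N" and "rmod_iso A M N" "zero_module M"
  then obtain f where f: "f \<in> rmod_hom A M N" "bij_betw f (carrier M) (carrier N)" by (auto simp: rmod_iso_def)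
  interpret module_hom A M N f by (rule module_homI) fact+
  show ?thesis using f(2) \<open>zero_module M\<close> zero by (auto simp: zero_module_def bij_betw_def)
qed

lemma zero_modules_iso:
  assumes "right_module A M" "right_module A N" "zero_module M" "zero_module N"
  shows "rmod_iso A M N"
  using assms rmod_hom_zero[OF assms(2), of M]
  by (intro rmod_isoI[of "\<lambda>x. \<zero>\<^bsub>N\<^esub>"]) (auto simp: zero_module_def)

section \<open>Finite length and finite generation\<close>

text \<open>A module has finite length iff its submodules admit a strictly monotone rank function;
  since the rank is bounded by that of the whole module, this covers both chain conditions.\<close>

definition fin_length :: "'a ring \<Rightarrow> ('a, 'm) module \<Rightarrow> bool" where
  "fin_length A M \<longleftrightarrow> (\<exists>r :: 'm set \<Rightarrow> nat. \<forall>N N'. submodule N A M \<and> submodule N' A M \<and> N \<subset> N' \<longrightarrow> r N < r N')"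

lemma fin_lengthI:
  "(\<And>N N'. submodule N A M \<Longrightarrow> submodule N' A M \<Longrightarrow> N \<subset> N' \<Longrightarrow> r N < (r N' :: nat)) \<Longrightarrow> fin_length A M"
  unfolding fin_length_def by (intro exI[of _ r]) auto

lemma fin_lengthE:
  assumes "fin_length A M"
  obtains r :: "'m set \<Rightarrow> nat" where
    "\<And>N N'. submodule N A M \<Longrightarrow> submodule N' A M \<Longrightarrow> N \<subset> N' \<Longrightarrow> r N < r N'"
    "\<And>N N'. submodule N A M \<Longrightarrow> submodule N' A M \<Longrightarrow> N \<subseteq> N' \<Longrightarrow> r N \<le> r N'"
proof -
  from assms obtain r :: "'m set \<Rightarrow> nat" where
    r: "\<And>N N'. submodule N A M \<Longrightarrow> submodule N' A M \<Longrightarrow> N \<subset> N' \<Longrightarrow> r N < r N'"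
    unfolding fin_length_def by blast
  have "r N \<le> r N'" if "submodule N A M" "submodule N' A M" "N \<subseteq> N'" for N N'
    using r[of N N'] that by (cases "N = N'") (simp_all add: psubset_eq less_imp_le)
  with r show ?thesis by (rule that)
qed

lemma fin_length_sub:
  assumes "right_module A M" "submodule K A M" "fin_length A M"
  shows "fin_length A (M\<lparr>carrier := K\<rparr>)"
proof -
  obtain r :: "_ set \<Rightarrow> nat" where "\<And>L L'. submodule L A M \<Longrightarrow> submodule L' A M \<Longrightarrow> L \<subset> L' \<Longrightarrow> r L < r L'"
    by (rule fin_lengthE[OF assms(3)]) blast
  then show ?thesis by (intro fin_lengthI[of _ _ r]) (auto simp: submodule_sub_iff[OF assms(1,2)])
qed

lemma fin_length_inj:
  assumes "module_hom A M N f" "inj_on f (carrier M)" "fin_length A N"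
  shows "fin_length A M"
proof -
  interpret module_hom A M N f by fact
  obtain r :: "_ set \<Rightarrow> nat" where r: "\<And>L L'. submodule L A N \<Longrightarrow> submodule L' A N \<Longrightarrow> L \<subset> L' \<Longrightarrow> r L < r L'"
    by (rule fin_lengthE[OF assms(3)]) blast
  show ?thesis
  proof (rule fin_lengthI[of _ _ "\<lambda>L. r (f ` L)"])
    fix L L' assume L: "submodule L A M" "submodule L' A M" "L \<subset> L'"
    have "f ` L \<subset> f ` L'"
      using L(3) submoduleD(1)[OF L(2)] assms(2) by (metis image_strict_mono inj_on_subset)
    then show "r (f ` L) < r (f ` L')" using r submodule_image L by auto
  qed
qed

lemma fin_length_surj:
  assumes "module_hom A M N f" "f ` carrier M = carrier N" "fin_length A M"
  shows "fin_length A N"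
proof -
  interpret module_hom A M N f by fact
  obtain r :: "_ set \<Rightarrow> nat" where r: "\<And>L L'. submodule L A M \<Longrightarrow> submodule L' A M \<Longrightarrow> L \<subset> L' \<Longrightarrow> r L < r L'"
    by (rule fin_lengthE[OF assms(3)]) blast
  show ?thesis
  proof (rule fin_lengthI[of _ _ "\<lambda>L. r {x \<in> carrier M. f x \<in> L}"])
    fix L L' assume L: "submodule L A N" "submodule L' A N" "L \<subset> L'"
    then obtain y where y: "y \<in> L'" "y \<notin> L" by auto
    then obtain x where "x \<in> carrier M" "y = f x"
      using submoduleD(1)[OF L(2)] assms(2) by auto
    then have "{x \<in> carrier M. f x \<in> L} \<subset> {x \<in> carrier M. f x \<in> L'}" using L(3) y by auto
    then show "r {x \<in> carrier M. f x \<in> L} < r {x \<in> carrier M. f x \<in> L'}"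
      using r submodule_preimage L by auto
  qed
qed

text \<open>The rank of \<open>L\<close> is the rank of its intersection with the kernel plus the
  rank of its image; neither part can drop, and strictness is the modular law.\<close>

lemma fin_length_ext:
  assumes "module_hom A M N f" "fin_length A (M\<lparr>carrier := a_kernel M N f\<rparr>)" "fin_length A N"
  shows "fin_length A M"
proof -
  interpret module_hom A M N f by fact
  let ?K = "a_kernel M N f"
  note K = submodule_kernel
  obtain r :: "_ set \<Rightarrow> nat" where r: "\<And>L L'. submodule L A N \<Longrightarrow> submodule L' A N \<Longrightarrow> L \<subset> L' \<Longrightarrow> r L < r L'"
    "\<And>L L'. submodule L A N \<Longrightarrow> submodule L' A N \<Longrightarrow> L \<subseteq> L' \<Longrightarrow> r L \<le> r L'"
    by (rule fin_lengthE[OF assms(3)]) blast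
  obtain s :: "_ set \<Rightarrow> nat" where s0: "\<And>L L'. submodule L A (M\<lparr>carrier := ?K\<rparr>) \<Longrightarrow> submodule L' A (M\<lparr>carrier := ?K\<rparr>) \<Longrightarrow> L \<subset> L' \<Longrightarrow> s L < s L'"
    "\<And>L L'. submodule L A (M\<lparr>carrier := ?K\<rparr>) \<Longrightarrow> submodule L' A (M\<lparr>carrier := ?K\<rparr>) \<Longrightarrow> L \<subseteq> L' \<Longrightarrow> s L \<le> s L'"
    by (rule fin_lengthE[OF assms(2)]) blast
  note s = s0[unfolded submodule_sub_iff[OF M.right_module_axioms K]]
  show ?thesis
  proof (rule fin_lengthI[of _ _ "\<lambda>L. s (L \<inter> ?K) + r (f ` L)"])
    fix L L' assume L: "submodule L A M" "submodule L' A M" "L \<subset> L'"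
    have 1: "submodule (L \<inter> ?K) A M" "submodule (L' \<inter> ?K) A M" "submodule (f ` L) A N" "submodule (f ` L') A N"
      using L K submodule_Int submodule_image M.right_module_axioms by auto
    have le: "s (L \<inter> ?K) \<le> s (L' \<inter> ?K)" "r (f ` L) \<le> r (f ` L')"
      using 1 L by (auto intro!: s(2) r(2))
    \<comment> \<open>Modular law: if the images agree, an element of \<open>L'\<close> differs from
      one of \<open>L\<close> by an element of the kernel, and this difference lies in
      \<open>L'\<close>, hence in \<open>L\<close> if the intersections agree as well.\<close>
    have "L \<inter> ?K \<subset> L' \<inter> ?K \<or> f ` L \<subset> f ` L'"
    proof (rule ccontr)
      assume "\<not> ?thesis"
      then have eq: "L \<inter> ?K = L' \<inter> ?K" "f ` L = f ` L'" using L(3) by auto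
      have "L' \<subseteq> L"
      proof
        fix y assume y: "y \<in> L'"
        then obtain x where x: "x \<in> L" "f y = f x" using eq(2) by (metis imageE imageI)
        have c: "x \<in> carrier M" "y \<in> carrier M" using x y submoduleD(1)[OF L(2)] L(3) by auto
        have "y \<ominus>\<^bsub>M\<^esub> x \<in> L' \<inter> ?K" using y x L(3) c eq_iff submoduleD(6)[OF L(2)] by auto
        then have "y \<ominus>\<^bsub>M\<^esub> x \<in> L" using eq(1) by auto
        then have "(y \<ominus>\<^bsub>M\<^esub> x) \<oplus>\<^bsub>M\<^esub> x \<in> L" using submoduleD(3)[OF L(1)] x by auto
        moreover have "(y \<ominus>\<^bsub>M\<^esub> x) \<oplus>\<^bsub>M\<^esub> x = y" using c by algebra
        ultimately show "y \<in> L" by simp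
      qed
      then show False using L(3) by auto
    qed
    then show "s (L \<inter> ?K) + r (f ` L) < s (L' \<inter> ?K) + r (f ` L')"
    proof
      assume "L \<inter> ?K \<subset> L' \<inter> ?K"
      then have "s (L \<inter> ?K) < s (L' \<inter> ?K)" using 1 by (intro s(1)) auto
      then show ?thesis using le by auto
    next
      assume "f ` L \<subset> f ` L'"
      then have "r (f ` L) < r (f ` L')" using 1 by (intro r(1)) auto
      then show ?thesis using le by auto
    qed
  qed
qed

lemma fin_length_iso:
  assumes "right_module A M" "right_module A N" "rmod_iso A M N" "fin_length A N"
  shows "fin_length A M"
proof -
  obtain f where "f \<in> rmod_hom A M N" "inj_on f (carrier M)"
    using assms(3) by (auto simp: rmod_iso_def bij_betw_def)
  with fin_length_inj[OF module_homI[OF assms(1,2)] _ assms(4)] show ?thesis by blast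
qed

lemma fin_length_zero: "right_module A M \<Longrightarrow> zero_module M \<Longrightarrow> fin_length A M"
  unfolding zero_module_def
  by (rule fin_lengthI[of _ _ "\<lambda>_. 0"]) (use submoduleD(1) submoduleD(2) in \<open>metis subset_antisym psubset_eq singletonD subsetI subset_singletonD empty_iff\<close>)

text \<open>The kernel of \<open>snd\<close> embeds into \<open>M\<close> by \<open>fst\<close>, so
  the sum is an extension of \<open>N\<close> by a module of finite length.\<close>

lemma fin_length_direct_sum2:
  assumes "right_module A M" "right_module A N" "fin_length A M" "fin_length A N"
  shows "fin_length A (direct_sum2 M N)"
proof -
  let ?S = "direct_sum2 M N"
  have S: "right_module A ?S" by (rule right_module_direct_sum2) fact+
  interpret h: module_hom A ?S N snd by (rule module_homI) (use S assms rmod_hom_snd in auto)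
  let ?K = "a_kernel ?S N snd"
  have "inj_on fst ?K" by (auto simp: a_kernel_def' inj_on_def)
  then have "fin_length A (?S\<lparr>carrier := ?K\<rparr>)"
    by (intro fin_length_inj[OF module_homI[OF right_module_sub[OF S h.submodule_kernel] assms(1)] _ assms(3), of fst]
        rmod_hom_restrict[OF rmod_hom_fst]) (auto simp: a_kernel_def')
  then show ?thesis by (rule fin_length_ext[OF h.module_hom_axioms _ assms(4)])
qed

lemma fin_length_direct_sum:
  assumes "ring A" "\<And>i. i < k \<Longrightarrow> right_module A (N i)" "\<And>i. i < k \<Longrightarrow> fin_length A (N i)"
  shows "fin_length A (direct_sum k N)"
  using assms(2,3)
proof (induction k)
  case 0
  then show ?case using fin_length_zero zero_module_direct_sum_0 right_module_direct_sum[OF assms(1)] by blast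
next
  case (Suc k)
  have m: "right_module A (direct_sum k N)" "right_module A (direct_sum (Suc k) N)"
    using Suc.prems(1) by (auto intro!: right_module_direct_sum[OF assms(1)])
  show ?case
    by (rule fin_length_iso[OF m(2) _ direct_sum_Suc])
      (use m Suc in \<open>auto intro!: right_module_direct_sum2 fin_length_direct_sum2\<close>)
qed

section \<open>Finite generation\<close>

definition module_span :: "'a ring \<Rightarrow> ('a, 'm) module \<Rightarrow> 'm set \<Rightarrow> 'm set" where
  "module_span A M S = \<Inter>{N. submodule N A M \<and> S \<subseteq> N}"

lemma submodule_span:
  assumes "right_module A M" "S \<subseteq> carrier M"
  shows "submodule (module_span A M S) A M" "S \<subseteq> module_span A M S"
    and "\<And>N. submodule N A M \<Longrightarrow> S \<subseteq> N \<Longrightarrow> module_span A M S \<subseteq> N"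
proof -
  show "submodule (module_span A M S) A M"
    by (rule submoduleI'[OF assms(1)])
      (use assms(2) submodule_carrier[OF assms(1)] in
        \<open>auto simp: module_span_def intro: submoduleD(2) submoduleD(3) submoduleD(4)\<close>)
qed (auto simp: module_span_def)

text \<open>Linear combinations of \<open>S\<close> lie in every submodule that contains
  \<open>S\<close>, and they form such a submodule themselves. In terms of spans, generation passes
  through maps and sums by comparing submodules, without rearranging finite sums.\<close>

lemma fg_module_iff:
  "fg_module A M \<longleftrightarrow> right_module A M \<and> (\<exists>S. finite S \<and> S \<subseteq> carrier M \<and> module_span A M S = carrier M)"
proof (cases "right_module A M")
  case True
  then interpret right_module A M .
  have *: "{x. \<exists>c \<in> S \<rightarrow> carrier A. x = (\<Oplus>\<^bsub>M\<^esub>s\<in>S. c s \<odot>\<^bsub>M\<^esub> s)} = module_span A M S" (is "?L = ?R")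
    if S: "finite S" "S \<subseteq> carrier M" for S
  proof
    show "?L \<subseteq> ?R"
    proof (safe)
      fix c assume c: "c \<in> S \<rightarrow> carrier A"
      have "(\<Oplus>\<^bsub>M\<^esub>s\<in>T. c s \<odot>\<^bsub>M\<^esub> s) \<in> N" if "submodule N A M" "S \<subseteq> N" "T \<subseteq> S" for N T
        using finite_subset[OF \<open>T \<subseteq> S\<close> S(1)] that(3)
      proof (induction T)
        case (insert x F)
        then have "(\<Oplus>\<^bsub>M\<^esub>s\<in>insert x F. c s \<odot>\<^bsub>M\<^esub> s) = c x \<odot>\<^bsub>M\<^esub> x \<oplus>\<^bsub>M\<^esub> (\<Oplus>\<^bsub>M\<^esub>s\<in>F. c s \<odot>\<^bsub>M\<^esub> s)"
          using c S by (intro M.finsum_insert) (auto intro!: act_closed)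
        moreover have "c x \<in> carrier A" "x \<in> N" using insert.prems c that(2) by auto
        ultimately show ?case using insert submoduleD(3,4)[OF that(1)] by simp
      qed (use submoduleD(2)[OF that(1)] in simp)
      then show "(\<Oplus>\<^bsub>M\<^esub>s\<in>S. c s \<odot>\<^bsub>M\<^esub> s) \<in> module_span A M S"
        by (auto simp: module_span_def)
    qed
    have "submodule ?L A M"
    proof (rule submoduleI'[OF True])
      show "?L \<subseteq> carrier M" using S by (auto intro!: M.finsum_closed act_closed)
      show "\<zero>\<^bsub>M\<^esub> \<in> ?L"
      proof -
        have "(\<Oplus>\<^bsub>M\<^esub>s\<in>S. \<zero>\<^bsub>A\<^esub> \<odot>\<^bsub>M\<^esub> s) = (\<Oplus>\<^bsub>M\<^esub>s\<in>S. \<zero>\<^bsub>M\<^esub>)"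
          using S by (intro M.finsum_cong) (auto simp: simp_implies_def)
        then show ?thesis by (auto intro!: bexI[of _ "\<lambda>_. \<zero>\<^bsub>A\<^esub>"])
      qed
    next
      fix x y assume "x \<in> ?L" "y \<in> ?L"
      then obtain c d where cd: "c \<in> S \<rightarrow> carrier A" "d \<in> S \<rightarrow> carrier A"
        "x = (\<Oplus>\<^bsub>M\<^esub>s\<in>S. c s \<odot>\<^bsub>M\<^esub> s)" "y = (\<Oplus>\<^bsub>M\<^esub>s\<in>S. d s \<odot>\<^bsub>M\<^esub> s)" by auto
      have "x \<oplus>\<^bsub>M\<^esub> y = (\<Oplus>\<^bsub>M\<^esub>s\<in>S. c s \<odot>\<^bsub>M\<^esub> s \<oplus>\<^bsub>M\<^esub> d s \<odot>\<^bsub>M\<^esub> s)"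
        unfolding cd(3,4) using cd S by (intro M.finsum_addf[symmetric]) (auto intro!: act_closed)
      also have "\<dots> = (\<Oplus>\<^bsub>M\<^esub>s\<in>S. (c s \<oplus>\<^bsub>A\<^esub> d s) \<odot>\<^bsub>M\<^esub> s)"
        using cd S by (intro M.finsum_cong) (auto simp: simp_implies_def act_add_ring Pi_iff intro!: act_closed)
      finally show "x \<oplus>\<^bsub>M\<^esub> y \<in> ?L" using cd by (auto intro!: bexI[of _ "\<lambda>s. c s \<oplus>\<^bsub>A\<^esub> d s"])
    next
      fix a x assume a: "a \<in> carrier A" and "x \<in> ?L"
      then obtain c where c: "c \<in> S \<rightarrow> carrier A" "x = (\<Oplus>\<^bsub>M\<^esub>s\<in>S. c s \<odot>\<^bsub>M\<^esub> s)" by auto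
      have "a \<odot>\<^bsub>M\<^esub> (\<Oplus>\<^bsub>M\<^esub>s\<in>T. c s \<odot>\<^bsub>M\<^esub> s) = (\<Oplus>\<^bsub>M\<^esub>s\<in>T. (c s \<otimes>\<^bsub>A\<^esub> a) \<odot>\<^bsub>M\<^esub> s)" if "T \<subseteq> S" for T
        using finite_subset[OF \<open>T \<subseteq> S\<close> S(1)] that
      proof (induction T)
        case (insert s F)
        have 1: "(\<lambda>s. c s \<odot>\<^bsub>M\<^esub> s) \<in> F \<rightarrow> carrier M" "(\<lambda>s. (c s \<otimes>\<^bsub>A\<^esub> a) \<odot>\<^bsub>M\<^esub> s) \<in> F \<rightarrow> carrier M"
          and 2: "c s \<in> carrier A" "s \<in> carrier M"
          using insert.prems S c a by (auto intro!: act_closed)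
        then show ?case using insert a
          by (simp add: M.finsum_insert act_closed act_add_module act_mult M.finsum_closed)
      qed (use a in simp)
      then show "a \<odot>\<^bsub>M\<^esub> x \<in> ?L" using c a by (auto intro!: bexI[of _ "\<lambda>s. c s \<otimes>\<^bsub>A\<^esub> a"])
    qed
    moreover have "S \<subseteq> ?L"
    proof
      fix t assume t: "t \<in> S"
      have "(\<Oplus>\<^bsub>M\<^esub>s\<in>S. (if t = s then \<one>\<^bsub>A\<^esub> else \<zero>\<^bsub>A\<^esub>) \<odot>\<^bsub>M\<^esub> s) = (\<Oplus>\<^bsub>M\<^esub>s\<in>S. (if t = s then s else \<zero>\<^bsub>M\<^esub>))"
        using S by (intro M.finsum_cong) (auto simp: simp_implies_def act_one)
      also have "\<dots> = t" using S t by (intro M.finsum_singleton) auto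
      finally show "t \<in> ?L" by (auto intro!: bexI[of _ "\<lambda>s. if t = s then \<one>\<^bsub>A\<^esub> else \<zero>\<^bsub>A\<^esub>"])
    qed
    ultimately show "?R \<subseteq> ?L" using submodule_span(3)[OF True S(2)] by blast
  qed
  have sub: "?R S \<subseteq> carrier M" if "S \<subseteq> carrier M" for S
    using submodule_span(1)[OF True that] submoduleD(1) by blast
  have "(\<forall>x \<in> carrier M. \<exists>c \<in> S \<rightarrow> carrier A. x = (\<Oplus>\<^bsub>M\<^esub>s\<in>S. c s \<odot>\<^bsub>M\<^esub> s)) \<longleftrightarrow> module_span A M S = carrier M"
    if S: "finite S" "S \<subseteq> carrier M" for S
    unfolding *[OF S, symmetric] using sub[OF S(2)] unfolding *[OF S, symmetric] by blast
  then show ?thesis unfolding fg_module_def using True by meson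
qed (simp add: fg_module_def)

lemma fg_module_right: "fg_module A M \<Longrightarrow> right_module A M"
  by (simp add: fg_module_iff)

text \<open>The preimage of the span of the image of \<open>S\<close> is a submodule of
  \<open>M\<close> that contains the generators, hence is everything.\<close>

lemma fg_module_surj:
  assumes "module_hom A M N f" "f ` carrier M = carrier N" "fg_module A M"
  shows "fg_module A N"
proof -
  interpret module_hom A M N f by fact
  obtain S where S: "finite S" "S \<subseteq> carrier M" "module_span A M S = carrier M"
    using assms(3) by (auto simp: fg_module_iff)
  have fS: "f ` S \<subseteq> carrier N" using S assms(2) by auto
  have "carrier N \<subseteq> module_span A N (f ` S)"
  proof -
    have "submodule {x \<in> carrier M. f x \<in> module_span A N (f ` S)} A M"
      by (rule submodule_preimage) (rule submodule_span(1)[OF N.right_module_axioms fS])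
    from submodule_span(3)[OF M.right_module_axioms S(2) this]
    have "carrier M \<subseteq> {x \<in> carrier M. f x \<in> module_span A N (f ` S)}"
      using S submodule_span(2)[OF N.right_module_axioms fS] by auto
    then show ?thesis unfolding assms(2)[symmetric] by auto
  qed
  then have "module_span A N (f ` S) = carrier N"
    using submoduleD(1)[OF submodule_span(1)[OF N.right_module_axioms fS]] by auto
  then show ?thesis
    using S fS N.right_module_axioms by (auto simp: fg_module_iff intro!: exI[of _ "f ` S"])
qed

lemma fg_module_iso:
  assumes "rmod_iso A M N" "fg_module A M" "right_module A N"
  shows "fg_module A N"
proof -
  obtain f where "f \<in> rmod_hom A M N" "f ` carrier M = carrier N"
    using assms(1) by (auto simp: rmod_iso_def bij_betw_def)
  with fg_module_surj[OF module_homI[OF fg_module_right[OF assms(2)] assms(3)] _ assms(2)]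
  show ?thesis by blast
qed

text \<open>Among the spans of finite sets there is one of greatest rank, as ranks are bounded by
  that of the whole module. Adjoining any further element cannot enlarge it, so it contains all
  elements.\<close>

lemma fin_length_imp_fg:
  assumes M: "right_module A M" and "fin_length A M"
  shows "fg_module A M"
proof -
  obtain r :: "_ set \<Rightarrow> nat" where r: "\<And>L L'. submodule L A M \<Longrightarrow> submodule L' A M \<Longrightarrow> L \<subset> L' \<Longrightarrow> r L < r L'"
    "\<And>L L'. submodule L A M \<Longrightarrow> submodule L' A M \<Longrightarrow> L \<subseteq> L' \<Longrightarrow> r L \<le> r L'"
    by (rule fin_lengthE[OF assms(2)]) blast
  note sp = submodule_span[OF M]
  have bound: "r (module_span A M T) < Suc (r (carrier M))" if "T \<subseteq> carrier M" for T
    using r(2)[OF sp(1)[OF that] submodule_carrier[OF M]] submoduleD(1)[OF sp(1)[OF that]] by simp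
  have "\<exists>S. (finite S \<and> S \<subseteq> carrier M) \<and>
     (\<forall>T. finite T \<and> T \<subseteq> carrier M \<longrightarrow> r (module_span A M T) \<le> r (module_span A M S))"
    by (rule ex_has_greatest_nat[where k = "{}" and b = "Suc (r (carrier M))"
          and P = "\<lambda>S. finite S \<and> S \<subseteq> carrier M" and f = "\<lambda>T. r (module_span A M T)"])
      (simp, intro allI impI, rule bound, simp)
  then obtain S where S: "finite S" "S \<subseteq> carrier M"
    and mx: "\<And>T. finite T \<Longrightarrow> T \<subseteq> carrier M \<Longrightarrow> r (module_span A M T) \<le> r (module_span A M S)"
    by (elim exE conjE) (simp add: that)
  have "x \<in> module_span A M S" if x: "x \<in> carrier M" for x
  proof -
    have i: "insert x S \<subseteq> carrier M" using S x by auto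
    have "module_span A M S \<subseteq> module_span A M (insert x S)"
      by (rule sp(3)[OF S(2) sp(1)[OF i]]) (use sp(2)[OF i] in auto)
    then have "module_span A M S = module_span A M (insert x S)"
      using r(1)[OF sp(1)[OF S(2)] sp(1)[OF i]] mx[of "insert x S"] S i by (auto simp: psubset_eq)
    then show ?thesis using sp(2)[OF i] by auto
  qed
  then have "module_span A M S = carrier M" using submoduleD(1)[OF sp(1)[OF S(2)]] by auto
  then show ?thesis using S M by (auto simp: fg_module_iff)
qed

lemma fg_module_direct_sum2:
  assumes "fg_module A M" "fg_module A N"
  shows "fg_module A (direct_sum2 M N)"
proof -
  have M: "right_module A M" and N: "right_module A N" using assms by (auto simp: fg_module_iff)
  obtain S T where S: "finite S" "S \<subseteq> carrier M" "module_span A M S = carrier M"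
    and T: "finite T" "T \<subseteq> carrier N" "module_span A N T = carrier N"
    using assms by (auto simp: fg_module_iff)
  let ?D = "direct_sum2 M N"
  have D: "right_module A ?D" using M N by (rule right_module_direct_sum2)
  interpret D: right_module A ?D by (rule D)
  interpret l: module_hom A M ?D "\<lambda>x. (x, \<zero>\<^bsub>N\<^esub>)" by (intro module_homI rmod_hom_inl) fact+
  interpret r: module_hom A N ?D "\<lambda>x. (\<zero>\<^bsub>M\<^esub>, x)" by (intro module_homI rmod_hom_inr) fact+
  let ?G = "(\<lambda>x. (x, \<zero>\<^bsub>N\<^esub>)) ` S \<union> (\<lambda>x. (\<zero>\<^bsub>M\<^esub>, x)) ` T"
  have G: "?G \<subseteq> carrier ?D" using S T r.M.M.zero_closed l.M.M.zero_closed by auto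
  let ?L = "module_span A ?D ?G"
  note L = submodule_span(1)[OF D G] submodule_span(2)[OF D G]
  have 1: "carrier M \<subseteq> {x \<in> carrier M. (x, \<zero>\<^bsub>N\<^esub>) \<in> ?L}"
    unfolding S(3)[symmetric]
    by (rule submodule_span(3)[OF M S(2)], unfold S(3), rule l.submodule_preimage[OF L(1)])
      (use S(2) L(2) in blast)
  have 2: "carrier N \<subseteq> {x \<in> carrier N. (\<zero>\<^bsub>M\<^esub>, x) \<in> ?L}"
    unfolding T(3)[symmetric]
    by (rule submodule_span(3)[OF N T(2)], unfold T(3), rule r.submodule_preimage[OF L(1)])
      (use T(2) L(2) in blast)
  have "carrier ?D \<subseteq> ?L"
  proof
    fix z assume "z \<in> carrier ?D"
    then obtain x y where xy: "z = (x, y)" "x \<in> carrier M" "y \<in> carrier N" by auto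
    then have "(x, \<zero>\<^bsub>N\<^esub>) \<oplus>\<^bsub>?D\<^esub> (\<zero>\<^bsub>M\<^esub>, y) \<in> ?L"
      using 1 2 by (intro submoduleD(3)[OF L(1)]) auto
    then show "z \<in> ?L" using xy by auto
  qed
  then have "?L = carrier ?D" using submoduleD(1)[OF L(1)] by blast
  moreover have "finite ?G" using S T by auto
  ultimately show ?thesis using G D unfolding fg_module_iff by blast
qed

lemma fg_module_zero: "right_module A M \<Longrightarrow> zero_module M \<Longrightarrow> fg_module A M"
  using fin_length_imp_fg fin_length_zero by blast

lemma fg_module_direct_sum:
  assumes "ring A" "\<And>i. i < k \<Longrightarrow> fg_module A (N i)"
  shows "fg_module A (direct_sum k N)"
  using assms(2)
proof (induction k)
  case 0
  then show ?case using fg_module_zero zero_module_direct_sum_0 right_module_direct_sum[OF assms(1)] by blast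
next
  case (Suc k)
  have m: "right_module A (direct_sum (Suc k) N)"
    by (rule right_module_direct_sum[OF assms(1)]) (rule fg_module_right[OF Suc.prems])
  have f: "fg_module A (direct_sum2 (direct_sum k N) (N k))"
    by (rule fg_module_direct_sum2) (rule Suc.IH, auto intro: Suc.prems)
  show ?case
    by (rule fg_module_iso[OF rmod_iso_sym[OF m direct_sum_Suc] f m])
qed

section \<open>The regular module, free modules and copies on \<open>'a fgmod\<close>\<close>

lemma regular_simps [simp]:
  "carrier (regular A) = carrier A" "\<zero>\<^bsub>regular A\<^esub> = \<zero>\<^bsub>A\<^esub>"
  "x \<oplus>\<^bsub>regular A\<^esub> y = x \<oplus>\<^bsub>A\<^esub> y" "a \<odot>\<^bsub>regular A\<^esub> x = x \<otimes>\<^bsub>A\<^esub> a"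
  by (simp_all add: regular_def)

text \<open>The definitions take rings of the unextended record type, whereas the locale
  \<open>ring\<close> allows record extensions; this locale fixes the type.\<close>

locale base_ring = ring A for A :: "'a ring" (structure)
begin

lemma right_module_regular: "right_module A (regular A)"
  by (rule right_moduleI) (auto simp: ring_axioms a_ac l_distr r_distr m_assoc intro: l_neg a_inv_closed bexI)

lemma rmod_hom_regular:
  assumes "right_module A M" "x \<in> carrier M"
  shows "(\<lambda>a. a \<odot>\<^bsub>M\<^esub> x) \<in> rmod_hom A (regular A) M"
proof -
  interpret right_module A M by fact
  show ?thesis by (rule rmod_homI) (use assms in \<open>auto simp: act_closed act_add_ring act_mult\<close>)
qed

lemma fg_module_regular: "fg_module A (regular A)"
proof -
  have 1: "{\<one>} \<subseteq> carrier (regular A)" by auto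
  note sp = submodule_span[OF right_module_regular 1]
  have "x \<in> module_span A (regular A) {\<one>}" if "x \<in> carrier A" for x
    using submoduleD(4)[OF sp(1), of x \<one>] that sp(2) by auto
  then have "module_span A (regular A) {\<one>} = carrier (regular A)"
    using submoduleD(1)[OF sp(1)] by auto
  then show ?thesis using right_module_regular 1 unfolding fg_module_iff by blast
qed

text \<open>Each generator gets one free summand, on which \<open>a\<close> goes to the action of
  \<open>a\<close> on that generator. The induction only keeps track of the generators being hit;
  surjectivity follows at the end since the image is a submodule.\<close>

lemma free_surjection:
  assumes "fg_module A M"
  obtains k f where "f \<in> rmod_hom A (direct_sum k (\<lambda>_. regular A)) M"
    "f ` carrier (direct_sum k (\<lambda>_. regular A)) = carrier M"
proof -
  have M: "right_module A M" using assms by (simp add: fg_module_iff)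
  interpret M: right_module A M by fact
  let ?F = "\<lambda>k. direct_sum k (\<lambda>_. regular A)"
  have F: "right_module A (?F k)" for k
    by (rule right_module_direct_sum) (auto intro: ring_axioms right_module_regular)
  obtain S where S: "finite S" "S \<subseteq> carrier M" "module_span A M S = carrier M"
    using assms by (auto simp: fg_module_iff)
  have "\<exists>k. \<exists>f \<in> rmod_hom A (?F k) M. T \<subseteq> f ` carrier (?F k)" if "finite T" "T \<subseteq> carrier M" for T
    using that
  proof (induction T)
    case empty
    then show ?case using rmod_hom_zero[OF M] by blast
  next
    case (insert s T)
    then obtain k f where f: "f \<in> rmod_hom A (?F k) M" "T \<subseteq> f ` carrier (?F k)" by auto
    interpret f: module_hom A "?F k" M f by (rule module_homI) (use F M f in auto)
    obtain g h where g: "g \<in> rmod_hom A (?F (Suc k)) (direct_sum2 (?F k) (regular A))"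
      "h \<in> rmod_hom A (direct_sum2 (?F k) (regular A)) (?F (Suc k))"
      "\<And>y. y \<in> carrier (direct_sum2 (?F k) (regular A)) \<Longrightarrow> g (h y) = y"
      by (rule rmod_isoE[OF F direct_sum_Suc]) blast
    define f' where "f' x = f (fst (g x)) \<oplus>\<^bsub>M\<^esub> snd (g x) \<odot>\<^bsub>M\<^esub> s" for x
    have f': "f' \<in> rmod_hom A (?F (Suc k)) M"
      unfolding f'_def
      by (rule rmod_hom_comp[OF g(1) rmod_hom_copair[OF M f(1) rmod_hom_regular[OF M, of s]]])
        (use insert in auto)
    have s: "s \<in> carrier M" using insert by auto
    have im: "f (fst y) \<oplus>\<^bsub>M\<^esub> snd y \<odot>\<^bsub>M\<^esub> s \<in> f' ` carrier (?F (Suc k))"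
      if "y \<in> carrier (direct_sum2 (?F k) (regular A))" for y
      using g(3)[OF that] rmod_homD(1)[OF g(2) that] unfolding f'_def by (intro image_eqI[of _ _ "h y"]) auto
    have "insert s T \<subseteq> f' ` carrier (?F (Suc k))"
    proof safe
      show "s \<in> f' ` carrier (?F (Suc k))"
        using im[of "(\<zero>\<^bsub>?F k\<^esub>, \<one>)"] f.zero f.M.M.zero_closed s M.act_one by auto
      fix x assume "x \<in> T"
      then obtain y where y: "y \<in> carrier (?F k)" "x = f y" using f(2) by blast
      then show "x \<in> f' ` carrier (?F (Suc k))"
        using im[of "(y, \<zero>)"] f.closed s by auto
    qed
    then show ?case using f' by blast
  qed
  from this[OF S(1,2)] obtain k f where f: "f \<in> rmod_hom A (?F k) M" "S \<subseteq> f ` carrier (?F k)" by blast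
  interpret f: module_hom A "?F k" M f by (rule module_homI) (use F M f in auto)
  have "f ` carrier (?F k) = carrier M"
    using submodule_span(3)[OF M S(2) f.submodule_range f(2)] S(3) f.closed by auto
  with f(1) show ?thesis by (rule that)
qed

text \<open>An element is encoded by its fibre in a free module. Such a fibre is a set of functions
  from \<open>nat\<close> to \<open>'a\<close>, which is the element type of
  \<open>'a fgmod\<close>, and fibres over distinct elements differ because they are nonempty and
  disjoint.\<close>

lemma fgmod_copy:
  assumes "fg_module A M"
  obtains X :: "'a fgmod" where "fg_module A X" "rmod_iso A M X"
proof -
  have M: "right_module A M" using assms by (simp add: fg_module_iff)
  obtain k f where f: "f \<in> rmod_hom A (direct_sum k (\<lambda>_. regular A)) M"
    "f ` carrier (direct_sum k (\<lambda>_. regular A)) = carrier M"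
    by (rule free_surjection[OF assms])
  define c where "c y = {u \<in> carrier (direct_sum k (\<lambda>_. regular A)). f u = y}" for y
  have "inj_on c (carrier M)"
  proof (rule inj_onI)
    fix x y assume x: "x \<in> carrier M" and eq: "c x = c y"
    obtain u where u: "u \<in> carrier (direct_sum k (\<lambda>_. regular A))" "f u = x"
      using x unfolding f(2)[symmetric] by blast
    have "u \<in> c x" using u by (simp only: c_def mem_Collect_eq)
    then have "u \<in> c y" by (simp only: eq)
    then show "x = y" using u(2) by (simp only: c_def mem_Collect_eq)
  qed
  note t = transport[OF M this]
  show ?thesis by (rule that[OF fg_module_iso[OF t(2) assms t(1)] t(2)])
qed

end

text \<open>Isolates the finiteness on which the module theory runs. Both the algebra
  \<open>A\<close> and the commutative base ring \<open>R\<close> are instances.\<close>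

locale artin_ring = base_ring A for A :: "'a ring" (structure) +
  assumes regular_fin_length: "fin_length A (regular A)"
begin

lemma fg_imp_fin_length:
  assumes "fg_module A M" shows "fin_length A M"
proof -
  let ?F = "\<lambda>k. direct_sum k (\<lambda>_. regular A)"
  obtain k f where f: "f \<in> rmod_hom A (?F k) M" "f ` carrier (?F k) = carrier M"
    by (rule free_surjection[OF assms])
  have F: "right_module A (?F k)" "fin_length A (?F k)"
    by (auto intro!: right_module_direct_sum fin_length_direct_sum ring_axioms right_module_regular regular_fin_length)
  show ?thesis
    by (rule fin_length_surj[OF module_homI[OF F(1) _ f(1)] f(2) F(2)]) (rule fg_module_right[OF assms])
qed

lemma fg_sub:
  assumes "fg_module A M" "submodule K A M" shows "fg_module A (M\<lparr>carrier := K\<rparr>)"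
proof -
  have M: "right_module A M" using assms(1) by (rule fg_module_right)
  show ?thesis
    by (rule fin_length_imp_fg[OF right_module_sub[OF M assms(2)]
          fin_length_sub[OF M assms(2) fg_imp_fin_length[OF assms(1)]]])
qed

lemma fg_quotient:
  assumes "fg_module A M" "submodule K A M" shows "fg_module A (rep_quotient M K)"
  using rep_quotient[OF fg_module_right[OF assms(1)] assms(2)]
  by (intro fg_module_surj[OF module_homI[OF fg_module_right[OF assms(1)]] _ assms(1)])

end

section \<open>Direct summands and short exact sequences\<close>

text \<open>Retracts, so that no complement has to be named and the two modules may have different
  types; a complement can be recovered as the kernel of the retraction.\<close>

definition summand :: "'a ring \<Rightarrow> ('a, 'm) module \<Rightarrow> ('a, 'n) module \<Rightarrow> bool" where
  "summand A X M \<longleftrightarrow> (\<exists>i \<in> rmod_hom A X M. \<exists>p \<in> rmod_hom A M X. \<forall>x \<in> carrier X. p (i x) = x)"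

lemma summandI:
  "i \<in> rmod_hom A X M \<Longrightarrow> p \<in> rmod_hom A M X \<Longrightarrow> (\<And>x. x \<in> carrier X \<Longrightarrow> p (i x) = x) \<Longrightarrow> summand A X M"
  by (auto simp: summand_def)

lemma summandE:
  assumes "summand A X M"
  obtains i p where "i \<in> rmod_hom A X M" "p \<in> rmod_hom A M X" "\<And>x. x \<in> carrier X \<Longrightarrow> p (i x) = x"
  using assms by (auto simp: summand_def)

lemma summand_trans:
  assumes "summand A X Y" "summand A Y Z" shows "summand A X Z"
proof -
  obtain i p where i: "i \<in> rmod_hom A X Y" "p \<in> rmod_hom A Y X" "\<And>x. x \<in> carrier X \<Longrightarrow> p (i x) = x"
    by (rule summandE[OF assms(1)]) blast
  obtain j q where j: "j \<in> rmod_hom A Y Z" "q \<in> rmod_hom A Z Y" "\<And>x. x \<in> carrier Y \<Longrightarrow> q (j x) = x"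
    by (rule summandE[OF assms(2)]) blast
  show ?thesis
    by (rule summandI[OF rmod_hom_comp[OF i(1) j(1)] rmod_hom_comp[OF j(2) i(2)]])
      (simp add: i(3) j(3) rmod_homD(1)[OF i(1)])
qed

lemma rmod_iso_imp_summand: "right_module A X \<Longrightarrow> rmod_iso A X Y \<Longrightarrow> summand A X Y"
  by (erule (1) rmod_isoE) (rule summandI)

lemma summand_direct_sum2:
  assumes "right_module A X" "right_module A Y"
  shows "summand A X (direct_sum2 X Y)" "summand A Y (direct_sum2 X Y)"
  by (rule summandI[OF rmod_hom_inl[OF assms(2)] rmod_hom_fst]; simp)
    (rule summandI[OF rmod_hom_inr[OF assms(1)] rmod_hom_snd]; simp)

lemma summand_direct_sum2_mono:
  assumes "summand A X M" "summand A Y N"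
  shows "summand A (direct_sum2 X Y) (direct_sum2 M N)"
proof -
  obtain i p where i: "i \<in> rmod_hom A X M" "p \<in> rmod_hom A M X" "\<And>x. x \<in> carrier X \<Longrightarrow> p (i x) = x"
    by (rule summandE[OF assms(1)]) blast
  obtain j q where j: "j \<in> rmod_hom A Y N" "q \<in> rmod_hom A N Y" "\<And>x. x \<in> carrier Y \<Longrightarrow> q (j x) = x"
    by (rule summandE[OF assms(2)]) blast
  show ?thesis
    by (rule summandI[of "\<lambda>x. (i (fst x), j (snd x))" _ _ _ "\<lambda>x. (p (fst x), q (snd x))"])
      (auto simp: i(3) j(3) intro!: rmod_hom_pair rmod_hom_comp[OF rmod_hom_fst i(1)] rmod_hom_comp[OF rmod_hom_snd j(1)]
        rmod_hom_comp[OF rmod_hom_fst i(2)] rmod_hom_comp[OF rmod_hom_snd j(2)])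
qed

text \<open>The composite of \<open>p\<close> and \<open>i\<close> is an idempotent of
  \<open>M\<close>; an element splits into its value under this idempotent and the remainder, which
  \<open>p\<close> annihilates.\<close>

lemma split_direct_sum2:
  assumes M: "right_module A M" and X: "right_module A X"
    and i: "i \<in> rmod_hom A X M" and p: "p \<in> rmod_hom A M X" and pi: "\<And>x. x \<in> carrier X \<Longrightarrow> p (i x) = x"
  shows "rmod_iso A M (direct_sum2 X (M\<lparr>carrier := a_kernel M X p\<rparr>))"
proof -
  interpret i: module_hom A X M i by (rule module_homI) fact+
  interpret p: module_hom A M X p by (rule module_homI) fact+
  let ?K = "M\<lparr>carrier := a_kernel M X p\<rparr>"
  have k: "(\<lambda>m. m \<ominus>\<^bsub>M\<^esub> i (p m)) \<in> rmod_hom A M ?K"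
  proof (rule rmod_hom_into_sub[OF rmod_hom_minus[OF M rmod_hom_id rmod_hom_comp[OF p i]]])
    show "(\<lambda>m. m \<ominus>\<^bsub>M\<^esub> i (p m)) ` carrier M \<subseteq> a_kernel M X p"
      by (auto simp: a_kernel_def' p.minus p.closed i.closed pi i.M.M.diff_zero_iff)
  qed
  have inc: "(\<lambda>m. m) \<in> rmod_hom A ?K M"
    by (rule rmod_hom_inclusion) (auto simp: a_kernel_def')
  show ?thesis
  proof (rule rmod_isoI'[OF rmod_hom_pair[OF p k] rmod_hom_copair[OF M i inc]])
    fix m assume m: "m \<in> carrier M"
    then have "i (p m) \<in> carrier M" using p.closed i.closed by blast
    then show "i (fst (p m, m \<ominus>\<^bsub>M\<^esub> i (p m))) \<oplus>\<^bsub>M\<^esub> snd (p m, m \<ominus>\<^bsub>M\<^esub> i (p m)) = m"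
      using m unfolding fst_conv snd_conv by algebra
  next
    fix y assume "y \<in> carrier (direct_sum2 X ?K)"
    then obtain x k where y: "y = (x, k)" "x \<in> carrier X" "k \<in> carrier M" "p k = \<zero>\<^bsub>X\<^esub>"
      by (auto simp: a_kernel_def')
    have c: "i x \<in> carrier M" using y i.closed by blast
    have "p (i x \<oplus>\<^bsub>M\<^esub> k) = x" using y c p.add pi by simp
    moreover have "i x \<oplus>\<^bsub>M\<^esub> k \<ominus>\<^bsub>M\<^esub> i x = k" using c y(3) by algebra
    ultimately show "(p (i (fst y) \<oplus>\<^bsub>M\<^esub> snd y), i (fst y) \<oplus>\<^bsub>M\<^esub> snd y \<ominus>\<^bsub>M\<^esub> i (p (i (fst y) \<oplus>\<^bsub>M\<^esub> snd y))) = y"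
      using y(1) by simp
  qed
qed

section \<open>Short exact sequences\<close>

definition short_exact :: "'a ring \<Rightarrow> ('a, 'm) module \<Rightarrow> ('a, 'n) module \<Rightarrow> ('a, 'k) module \<Rightarrow> bool" where
  "short_exact A X M Y \<longleftrightarrow> (\<exists>f \<in> rmod_hom A X M. \<exists>g \<in> rmod_hom A M Y.
     inj_on f (carrier X) \<and> g ` carrier M = carrier Y \<and> f ` carrier X = a_kernel M Y g)"

lemma short_exactI:
  "f \<in> rmod_hom A X M \<Longrightarrow> g \<in> rmod_hom A M Y \<Longrightarrow> inj_on f (carrier X) \<Longrightarrow> g ` carrier M = carrier Y \<Longrightarrow>
    f ` carrier X = a_kernel M Y g \<Longrightarrow> short_exact A X M Y"
  by (auto simp: short_exact_def)

lemma short_exactE: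
  assumes "short_exact A X M Y"
  obtains f g where "f \<in> rmod_hom A X M" "g \<in> rmod_hom A M Y" "inj_on f (carrier X)"
    "g ` carrier M = carrier Y" "f ` carrier X = a_kernel M Y g"
  using assms by (auto simp: short_exact_def)

lemma short_exact_quotient:
  assumes "right_module A X" "right_module A M" "f \<in> rmod_hom A X M" "inj_on f (carrier X)"
  shows "short_exact A X M (rep_quotient M (f ` carrier X))"
proof -
  interpret module_hom A X M f by (rule module_homI) fact+
  note q = rep_quotient[OF assms(2) submodule_range]
  show ?thesis by (rule short_exactI[OF assms(3) q(2) assms(4) q(3) q(4)[symmetric]])
qed

lemma short_exact_kernel:
  assumes "g \<in> rmod_hom A M Y" "g ` carrier M = carrier Y"
  shows "short_exact A (M\<lparr>carrier := a_kernel M Y g\<rparr>) M Y"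
  by (rule short_exactI[OF rmod_hom_inclusion assms(1) _ assms(2)]) (auto simp: a_kernel_def')

lemma short_exact_iso:
  assumes mods: "right_module A X" "right_module A M" "right_module A Y" "right_module A Y'"
    and ex: "short_exact A X M Y" and iso: "rmod_iso A X X'" "rmod_iso A M M'" "rmod_iso A Y Y'"
  shows "short_exact A X' M' Y'"
proof -
  obtain f g where f: "f \<in> rmod_hom A X M" "g \<in> rmod_hom A M Y" "inj_on f (carrier X)"
    "g ` carrier M = carrier Y" "f ` carrier X = a_kernel M Y g"
    by (rule short_exactE[OF ex]) blast
  obtain x x' where x: "x \<in> rmod_hom A X X'" "x' \<in> rmod_hom A X' X"
    "\<And>u. u \<in> carrier X \<Longrightarrow> x' (x u) = u" "\<And>u. u \<in> carrier X' \<Longrightarrow> x (x' u) = u"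
    by (rule rmod_isoE[OF mods(1) iso(1)]) blast
  obtain m m' where m: "m \<in> rmod_hom A M M'" "m' \<in> rmod_hom A M' M"
    "\<And>u. u \<in> carrier M \<Longrightarrow> m' (m u) = u" "\<And>u. u \<in> carrier M' \<Longrightarrow> m (m' u) = u"
    by (rule rmod_isoE[OF mods(2) iso(2)]) blast
  obtain y y' where y: "y \<in> rmod_hom A Y Y'" "y' \<in> rmod_hom A Y' Y"
    "\<And>u. u \<in> carrier Y \<Longrightarrow> y' (y u) = u" "\<And>u. u \<in> carrier Y' \<Longrightarrow> y (y' u) = u"
    by (rule rmod_isoE[OF mods(3) iso(3)]) blast
  interpret y: module_hom A Y Y' y by (rule module_homI) (use mods y in auto)
  note cl = rmod_homD(1)[OF f(1)] rmod_homD(1)[OF f(2)] rmod_homD(1)[OF x(1)] rmod_homD(1)[OF x(2)]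
     rmod_homD(1)[OF m(1)] rmod_homD(1)[OF m(2)] rmod_homD(1)[OF y(1)] rmod_homD(1)[OF y(2)]
  show ?thesis
  proof (rule short_exactI)
    show "(\<lambda>u. m (f (x' u))) \<in> rmod_hom A X' M'"
      by (rule rmod_hom_comp[OF rmod_hom_comp[OF x(2) f(1)] m(1)])
    show "(\<lambda>u. y (g (m' u))) \<in> rmod_hom A M' Y'"
      by (rule rmod_hom_comp[OF rmod_hom_comp[OF m(2) f(2)] y(1)])
    show "inj_on (\<lambda>u. m (f (x' u))) (carrier X')"
    proof (rule inj_onI)
      fix u v assume u: "u \<in> carrier X'" "v \<in> carrier X'" and "m (f (x' u)) = m (f (x' v))"
      then have "f (x' u) = f (x' v)" using m(3) cl(1,4) by metis
      then have "x' u = x' v" using inj_onD[OF f(3)] cl(4) u by blast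
      then show "u = v" using x(4) u by metis
    qed
    show "(\<lambda>u. y (g (m' u))) ` carrier M' = carrier Y'"
    proof (intro subset_antisym subsetI)
      fix v assume v: "v \<in> carrier Y'"
      then have "y' v \<in> g ` carrier M" using f(4) cl(8) by simp
      then obtain w where w: "w \<in> carrier M" "y' v = g w" by auto
      have "y (g (m' (m w))) = v" by (simp only: m(3)[OF w(1)] w(2)[symmetric] y(4)[OF v])
      then show "v \<in> (\<lambda>u. y (g (m' u))) ` carrier M'" using cl(5)[OF w(1)] by force
    qed (use cl in auto)
    show "(\<lambda>u. m (f (x' u))) ` carrier X' = a_kernel M' Y' (\<lambda>u. y (g (m' u)))"
    proof (intro subset_antisym subsetI)
      fix v assume "v \<in> (\<lambda>u. m (f (x' u))) ` carrier X'"
      then obtain u where u: "u \<in> carrier X'" "v = m (f (x' u))" by auto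
      have "f (x' u) \<in> a_kernel M Y g" using f(5) u(1) cl(4) by blast
      then have "g (f (x' u)) = \<zero>\<^bsub>Y\<^esub>" by (simp add: a_kernel_def')
      then have "y (g (m' v)) = \<zero>\<^bsub>Y'\<^esub>" using u m(3) cl(1,4) y.zero by simp
      then show "v \<in> a_kernel M' Y' (\<lambda>u. y (g (m' u)))" using u cl by (simp add: a_kernel_def')
    next
      fix v assume "v \<in> a_kernel M' Y' (\<lambda>u. y (g (m' u)))"
      then have v: "v \<in> carrier M'" "y (g (m' v)) = \<zero>\<^bsub>Y'\<^esub>" by (auto simp: a_kernel_def')
      have "y' (y (g (m' v))) = y' (y \<zero>\<^bsub>Y\<^esub>)" using v(2) y.zero by simp
      then have "g (m' v) = \<zero>\<^bsub>Y\<^esub>" using y(3) cl v(1) by simp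
      then have "m' v \<in> f ` carrier X" unfolding f(5) using cl v(1) by (simp add: a_kernel_def')
      then obtain u where u: "u \<in> carrier X" "m' v = f u" by auto
      have "m (f (x' (x u))) = v" by (simp only: x(3)[OF u(1)] u(2)[symmetric] m(4)[OF v(1)])
      then show "v \<in> (\<lambda>u. m (f (x' u))) ` carrier X'" using cl(3)[OF u(1)] by force
    qed
  qed
qed

lemma short_exact_direct_sum2:
  assumes "short_exact A X M Y" "short_exact A X' M' Y'"
  shows "short_exact A (direct_sum2 X X') (direct_sum2 M M') (direct_sum2 Y Y')"
proof -
  obtain f g where f: "f \<in> rmod_hom A X M" "g \<in> rmod_hom A M Y" "inj_on f (carrier X)"
    "g ` carrier M = carrier Y" "f ` carrier X = a_kernel M Y g"
    by (rule short_exactE[OF assms(1)]) blast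
  obtain f' g' where f': "f' \<in> rmod_hom A X' M'" "g' \<in> rmod_hom A M' Y'" "inj_on f' (carrier X')"
    "g' ` carrier M' = carrier Y'" "f' ` carrier X' = a_kernel M' Y' g'"
    by (rule short_exactE[OF assms(2)]) blast
  have im: "(\<lambda>x. (h (fst x), h' (snd x))) ` (S \<times> S') = (h ` S) \<times> (h' ` S')" for h h' and S S'
    by force
  show ?thesis
  proof (rule short_exactI[of "\<lambda>x. (f (fst x), f' (snd x))" _ _ _ "\<lambda>x. (g (fst x), g' (snd x))"])
    show "inj_on (\<lambda>x. (f (fst x), f' (snd x))) (carrier (direct_sum2 X X'))"
      using f(3) f'(3) by (auto simp: inj_on_def)
    show "(\<lambda>x. (g (fst x), g' (snd x))) ` carrier (direct_sum2 M M') = carrier (direct_sum2 Y Y')"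
      using f(4) f'(4) by (simp add: im)
    show "(\<lambda>x. (f (fst x), f' (snd x))) ` carrier (direct_sum2 X X') =
      a_kernel (direct_sum2 M M') (direct_sum2 Y Y') (\<lambda>x. (g (fst x), g' (snd x)))"
      using f(5) f'(5) by (auto simp: im a_kernel_def')
  qed (intro rmod_hom_pair rmod_hom_comp[OF rmod_hom_fst] rmod_hom_comp[OF rmod_hom_snd] f f')+
qed

section \<open>Projective and injective modules\<close>

lemma projective_fg: "projective_module A P \<Longrightarrow> fg_module A P"
  by (simp add: projective_module_def)

lemma injective_fg: "injective_module A P \<Longrightarrow> fg_module A P"
  by (simp add: injective_module_def)

context base_ring
begin

text \<open>The definition promises lifts only for test modules on \<open>'a fgmod\<close>.
  Conjugating the surjection with copies of \<open>X\<close> and \<open>Y\<close> extends the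
  promise to all types.\<close>

lemma projective_lift:
  assumes P: "projective_module A P" and X: "fg_module A X" and Y: "fg_module A Y"
    and g: "g \<in> rmod_hom A X Y" "g ` carrier X = carrier Y" and f: "f \<in> rmod_hom A P Y"
  obtains h where "h \<in> rmod_hom A P X" "\<And>p. p \<in> carrier P \<Longrightarrow> g (h p) = f p"
proof -
  obtain X' :: "'a fgmod" where X': "fg_module A X'" "rmod_iso A X X'" by (rule fgmod_copy[OF X])
  obtain Y' :: "'a fgmod" where Y': "fg_module A Y'" "rmod_iso A Y Y'" by (rule fgmod_copy[OF Y])
  obtain x x' where x: "x \<in> rmod_hom A X X'" "x' \<in> rmod_hom A X' X"
    "\<And>u. u \<in> carrier X \<Longrightarrow> x' (x u) = u" "\<And>u. u \<in> carrier X' \<Longrightarrow> x (x' u) = u"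
    by (rule rmod_isoE[OF fg_module_right[OF X] X'(2)]) blast
  obtain y y' where y: "y \<in> rmod_hom A Y Y'" "y' \<in> rmod_hom A Y' Y"
    "\<And>u. u \<in> carrier Y \<Longrightarrow> y' (y u) = u" "\<And>u. u \<in> carrier Y' \<Longrightarrow> y (y' u) = u"
    by (rule rmod_isoE[OF fg_module_right[OF Y] Y'(2)]) blast
  have onto: "(\<lambda>u. y (g (x' u))) ` carrier X' = carrier Y'"
  proof (intro subset_antisym subsetI)
    fix v assume v: "v \<in> carrier Y'"
    then have "y' v \<in> g ` carrier X" using g(2) rmod_homD(1)[OF y(2)] by simp
    then obtain w where w: "w \<in> carrier X" "y' v = g w" by auto
    have "y (g (x' (x w))) = v" by (simp only: x(3)[OF w(1)] w(2)[symmetric] y(4)[OF v])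
    then show "v \<in> (\<lambda>u. y (g (x' u))) ` carrier X'" using rmod_homD(1)[OF x(1) w(1)] by force
  qed (use rmod_homD(1)[OF y(1)] rmod_homD(1)[OF g(1)] rmod_homD(1)[OF x(2)] in auto)
  have "\<exists>h \<in> rmod_hom A P X'. \<forall>p \<in> carrier P. y (g (x' (h p))) = y (f p)"
    using P[unfolded projective_module_def, THEN conjunct2, rule_format, OF conjI[OF X'(1) conjI[OF Y'(1)
      conjI[OF rmod_hom_comp[OF rmod_hom_comp[OF x(2) g(1)] y(1)] conjI[OF onto rmod_hom_comp[OF f y(1)]]]]]] .
  then obtain h where h: "h \<in> rmod_hom A P X'" "\<And>p. p \<in> carrier P \<Longrightarrow> y (g (x' (h p))) = y (f p)" by auto
  show ?thesis
  proof (rule that[OF rmod_hom_comp[OF h(1) x(2)]])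
    fix p assume p: "p \<in> carrier P"
    have "y' (y (g (x' (h p)))) = y' (y (f p))" using h(2)[OF p] by simp
    then show "g (x' (h p)) = f p"
      using y(3) rmod_homD(1)[OF f p] rmod_homD(1)[OF g(1) rmod_homD(1)[OF x(2) rmod_homD(1)[OF h(1) p]]] by simp
  qed
qed

text \<open>Injectivity is freed from the type \<open>'a fgmod\<close> by the same conjugation with
  copies.\<close>

lemma injective_extend:
  assumes J: "injective_module A J" and X: "fg_module A X" and Y: "fg_module A Y"
    and g: "g \<in> rmod_hom A X Y" "inj_on g (carrier X)" and f: "f \<in> rmod_hom A X J"
  obtains h where "h \<in> rmod_hom A Y J" "\<And>x. x \<in> carrier X \<Longrightarrow> h (g x) = f x"
proof -
  obtain X' :: "'a fgmod" where X': "fg_module A X'" "rmod_iso A X X'" by (rule fgmod_copy[OF X])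
  obtain Y' :: "'a fgmod" where Y': "fg_module A Y'" "rmod_iso A Y Y'" by (rule fgmod_copy[OF Y])
  obtain x x' where x: "x \<in> rmod_hom A X X'" "x' \<in> rmod_hom A X' X"
    "\<And>u. u \<in> carrier X \<Longrightarrow> x' (x u) = u" "\<And>u. u \<in> carrier X' \<Longrightarrow> x (x' u) = u"
    by (rule rmod_isoE[OF fg_module_right[OF X] X'(2)]) blast
  obtain y y' where y: "y \<in> rmod_hom A Y Y'" "y' \<in> rmod_hom A Y' Y"
    "\<And>u. u \<in> carrier Y \<Longrightarrow> y' (y u) = u" "\<And>u. u \<in> carrier Y' \<Longrightarrow> y (y' u) = u"
    by (rule rmod_isoE[OF fg_module_right[OF Y] Y'(2)]) blast
  note cl = rmod_homD(1)[OF x(2)] rmod_homD(1)[OF g(1)]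
  have "inj_on (\<lambda>u. y (g (x' u))) (carrier X')"
  proof (rule inj_onI)
    fix u v assume u: "u \<in> carrier X'" "v \<in> carrier X'" "y (g (x' u)) = y (g (x' v))"
    have "g (x' u) = g (x' v)"
      by (rule box_equals[OF arg_cong[OF u(3), of y'] y(3)[OF cl(2)[OF cl(1)[OF u(1)]]] y(3)[OF cl(2)[OF cl(1)[OF u(2)]]]])
    then have "x' u = x' v" by (rule inj_onD[OF g(2)]) (use cl u in auto)
    from arg_cong[OF this, of x] show "u = v" by (rule box_equals[OF _ x(4)[OF u(1)] x(4)[OF u(2)]])
  qed
  note inj = this
  have "\<exists>h \<in> rmod_hom A Y' J. \<forall>u \<in> carrier X'. h (y (g (x' u))) = f (x' u)"
    using J[unfolded injective_module_def, THEN conjunct2, rule_format, OF conjI[OF X'(1) conjI[OF Y'(1)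
      conjI[OF rmod_hom_comp[OF rmod_hom_comp[OF x(2) g(1)] y(1)] conjI[OF inj rmod_hom_comp[OF x(2) f]]]]]] .
  then obtain h where h: "h \<in> rmod_hom A Y' J" "\<And>u. u \<in> carrier X' \<Longrightarrow> h (y (g (x' u))) = f (x' u)" by auto
  show ?thesis
  proof (rule that[OF rmod_hom_comp[OF y(1) h(1)]])
    fix u assume "u \<in> carrier X"
    then show "h (y (g u)) = f u" using h(2)[of "x u"] x(3) rmod_homD(1)[OF x(1)] by simp
  qed
qed

lemma projective_summand:
  assumes "projective_module A P" "fg_module A X" "summand A X P"
  shows "projective_module A X"
  unfolding projective_module_def
proof (intro conjI allI impI)
  fix M N :: "'a fgmod" and g f
  assume *: "fg_module A M \<and> fg_module A N \<and> g \<in> rmod_hom A M N \<and> g ` carrier M = carrier N \<and> f \<in> rmod_hom A X N"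
  obtain i p where i: "i \<in> rmod_hom A X P" "p \<in> rmod_hom A P X" "\<And>x. x \<in> carrier X \<Longrightarrow> p (i x) = x"
    by (rule summandE[OF assms(3)]) blast
  obtain h where h: "h \<in> rmod_hom A P M" "\<And>x. x \<in> carrier P \<Longrightarrow> g (h x) = f (p x)"
    by (rule projective_lift[OF assms(1), of M N g "\<lambda>x. f (p x)"]) (use * rmod_hom_comp[OF i(2)] in auto)
  show "\<exists>h\<in>rmod_hom A X M. \<forall>x\<in>carrier X. g (h x) = f x"
    by (rule bexI[OF _ rmod_hom_comp[OF i(1) h(1)]]) (simp add: h(2) rmod_homD(1)[OF i(1)] i(3))
qed (rule assms)

lemma injective_summand:
  assumes "injective_module A P" "fg_module A X" "summand A X P"
  shows "injective_module A X"
  unfolding injective_module_def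
proof (intro conjI allI impI)
  fix M N :: "'a fgmod" and g f
  assume *: "fg_module A M \<and> fg_module A N \<and> g \<in> rmod_hom A M N \<and> inj_on g (carrier M) \<and> f \<in> rmod_hom A M X"
  obtain i p where i: "i \<in> rmod_hom A X P" "p \<in> rmod_hom A P X" "\<And>x. x \<in> carrier X \<Longrightarrow> p (i x) = x"
    by (rule summandE[OF assms(3)]) blast
  obtain h where h: "h \<in> rmod_hom A N P" "\<And>x. x \<in> carrier M \<Longrightarrow> h (g x) = i (f x)"
    by (rule injective_extend[OF assms(1), of M N g "\<lambda>x. i (f x)"]) (use * rmod_hom_comp[OF _ i(1)] in auto)
  show "\<exists>h\<in>rmod_hom A N X. \<forall>x\<in>carrier M. h (g x) = f x"
    by (rule bexI[OF _ rmod_hom_comp[OF h(1) i(2)]]) (use * in \<open>auto simp: h(2) i(3) rmod_hom_def Pi_iff\<close>)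
qed (rule assms)

lemma projective_iso:
  assumes "projective_module A P" "rmod_iso A P X" "right_module A X"
  shows "projective_module A X"
proof (rule projective_summand[OF assms(1) fg_module_iso[OF assms(2) projective_fg[OF assms(1)] assms(3)]])
  show "summand A X P"
    by (intro rmod_iso_imp_summand[OF assms(3)] rmod_iso_sym[OF _ assms(2)] fg_module_right projective_fg assms(1))
qed

lemma injective_iso:
  assumes "injective_module A P" "rmod_iso A P X" "right_module A X"
  shows "injective_module A X"
proof (rule injective_summand[OF assms(1) fg_module_iso[OF assms(2) injective_fg[OF assms(1)] assms(3)]])
  show "summand A X P"
    by (intro rmod_iso_imp_summand[OF assms(3)] rmod_iso_sym[OF _ assms(2)] fg_module_right injective_fg assms(1))
qed

lemma projective_direct_sum2:
  assumes "projective_module A P" "projective_module A Q"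
  shows "projective_module A (direct_sum2 P Q)"
  unfolding projective_module_def
proof (intro conjI allI impI)
  note fg = assms[THEN projective_fg]
  show "fg_module A (direct_sum2 P Q)" by (rule fg_module_direct_sum2[OF fg])
  fix M N :: "'a fgmod" and g f
  assume "fg_module A M \<and> fg_module A N \<and> g \<in> rmod_hom A M N \<and> g ` carrier M = carrier N \<and> f \<in> rmod_hom A (direct_sum2 P Q) N"
  then have M: "fg_module A M" "fg_module A N" "g \<in> rmod_hom A M N" "g ` carrier M = carrier N"
    and f: "f \<in> rmod_hom A (direct_sum2 P Q) N" by auto
  obtain h where h: "h \<in> rmod_hom A P M" "\<And>x. x \<in> carrier P \<Longrightarrow> g (h x) = f (x, \<zero>\<^bsub>Q\<^esub>)"
    by (rule projective_lift[OF assms(1) M rmod_hom_comp[OF rmod_hom_inl[OF fg_module_right[OF fg(2)]] f]]) blast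
  obtain k where k: "k \<in> rmod_hom A Q M" "\<And>x. x \<in> carrier Q \<Longrightarrow> g (k x) = f (\<zero>\<^bsub>P\<^esub>, x)"
    by (rule projective_lift[OF assms(2) M rmod_hom_comp[OF rmod_hom_inr[OF fg_module_right[OF fg(1)]] f]]) blast
  interpret P: right_module A P by (rule fg_module_right[OF fg(1)])
  interpret Q: right_module A Q by (rule fg_module_right[OF fg(2)])
  show "\<exists>h\<in>rmod_hom A (direct_sum2 P Q) M. \<forall>x\<in>carrier (direct_sum2 P Q). g (h x) = f x"
  proof (rule bexI[OF _ rmod_hom_copair[OF fg_module_right[OF M(1)] h(1) k(1)]], rule ballI)
    fix x assume "x \<in> carrier (direct_sum2 P Q)"
    then have x: "fst x \<in> carrier P" "snd x \<in> carrier Q" by auto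
    have "g (h (fst x) \<oplus>\<^bsub>M\<^esub> k (snd x)) = f (fst x, \<zero>\<^bsub>Q\<^esub>) \<oplus>\<^bsub>N\<^esub> f (\<zero>\<^bsub>P\<^esub>, snd x)"
      using rmod_homD(2)[OF M(3) rmod_homD(1)[OF h(1) x(1)] rmod_homD(1)[OF k(1) x(2)]] h(2) k(2) x by simp
    also have "\<dots> = f x"
      using rmod_homD(2)[OF f, of "(fst x, \<zero>\<^bsub>Q\<^esub>)" "(\<zero>\<^bsub>P\<^esub>, snd x)"] x by simp
    finally show "g (h (fst x) \<oplus>\<^bsub>M\<^esub> k (snd x)) = f x" .
  qed
qed

lemma injective_direct_sum2:
  assumes "injective_module A P" "injective_module A Q"
  shows "injective_module A (direct_sum2 P Q)"
  unfolding injective_module_def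
proof (intro conjI allI impI)
  note fg = assms[THEN injective_fg]
  show "fg_module A (direct_sum2 P Q)" by (rule fg_module_direct_sum2[OF fg])
  fix M N :: "'a fgmod" and g f
  assume "fg_module A M \<and> fg_module A N \<and> g \<in> rmod_hom A M N \<and> inj_on g (carrier M) \<and> f \<in> rmod_hom A M (direct_sum2 P Q)"
  then have M: "fg_module A M" "fg_module A N" "g \<in> rmod_hom A M N" "inj_on g (carrier M)"
    and f: "f \<in> rmod_hom A M (direct_sum2 P Q)" by auto
  obtain h where h: "h \<in> rmod_hom A N P" "\<And>x. x \<in> carrier M \<Longrightarrow> h (g x) = fst (f x)"
    by (rule injective_extend[OF assms(1) M rmod_hom_comp[OF f rmod_hom_fst]]) blast
  obtain k where k: "k \<in> rmod_hom A N Q" "\<And>x. x \<in> carrier M \<Longrightarrow> k (g x) = snd (f x)"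
    by (rule injective_extend[OF assms(2) M rmod_hom_comp[OF f rmod_hom_snd]]) blast
  show "\<exists>h\<in>rmod_hom A N (direct_sum2 P Q). \<forall>x\<in>carrier M. h (g x) = f x"
    by (rule bexI[OF _ rmod_hom_pair[OF h(1) k(1)]]) (simp add: h(2) k(2))
qed

lemma projective_zero:
  assumes "right_module A Z" "zero_module Z" shows "projective_module A Z"
  unfolding projective_module_def
proof (intro conjI allI impI)
  show "fg_module A Z" by (rule fg_module_zero[OF assms])
  fix M N :: "'a fgmod" and g f
  assume *: "fg_module A M \<and> fg_module A N \<and> g \<in> rmod_hom A M N \<and> g ` carrier M = carrier N \<and> f \<in> rmod_hom A Z N"
  then have m: "right_module A M" "right_module A N" by (auto intro: fg_module_right)
  interpret f: module_hom A Z N f by (rule module_homI) (use * m assms in auto)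
  interpret g: module_hom A M N g by (rule module_homI) (use * m in auto)
  show "\<exists>h\<in>rmod_hom A Z M. \<forall>p\<in>carrier Z. g (h p) = f p"
    by (rule bexI[OF _ rmod_hom_zero[OF m(1)]]) (use assms(2) f.zero g.zero in \<open>simp add: zero_module_def\<close>)
qed

text \<open>A homomorphism from the regular module is determined by the image of
  \<open>\<one>\<close>, which may be chosen freely; any preimage of \<open>f \<one>\<close> gives a
  lift.\<close>

lemma projective_regular: "projective_module A (regular A)"
  unfolding projective_module_def
proof (intro conjI allI impI)
  show "fg_module A (regular A)" by (rule fg_module_regular)
  fix M N :: "'a fgmod" and g f
  assume *: "fg_module A M \<and> fg_module A N \<and> g \<in> rmod_hom A M N \<and> g ` carrier M = carrier N \<and> f \<in> rmod_hom A (regular A) N"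
  then have f: "f \<in> rmod_hom A (regular A) N" and g: "g \<in> rmod_hom A M N" by auto
  have "f \<one> \<in> g ` carrier M" using rmod_homD(1)[OF f, of \<one>] * by auto
  then obtain x where x: "x \<in> carrier M" "f \<one> = g x" by auto
  show "\<exists>h\<in>rmod_hom A (regular A) M. \<forall>p\<in>carrier (regular A). g (h p) = f p"
  proof (rule bexI[OF _ rmod_hom_regular[OF _ x(1)]], rule ballI)
    fix a assume "a \<in> carrier (regular A)"
    then show "g (a \<odot>\<^bsub>M\<^esub> x) = f a"
      using rmod_homD(3)[OF g _ x(1), of a] rmod_homD(3)[OF f, of a \<one>] x(2) by simp
  qed (use * fg_module_right in auto)
qed

lemma projective_direct_sum:
  assumes "\<And>i. i < k \<Longrightarrow> projective_module A (N i)"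
  shows "projective_module A (direct_sum k N)"
  using assms
proof (induction k)
  case 0
  show ?case
    by (rule projective_zero[OF right_module_direct_sum[OF ring_axioms] zero_module_direct_sum_0]) simp
next
  case (Suc k)
  have m: "right_module A (direct_sum (Suc k) N)"
    by (rule right_module_direct_sum[OF ring_axioms]) (rule fg_module_right[OF projective_fg[OF Suc.prems]])
  have "projective_module A (direct_sum k N)" by (rule Suc.IH) (simp add: Suc.prems)
  then have "projective_module A (direct_sum2 (direct_sum k N) (N k))"
    by (rule projective_direct_sum2) (simp add: Suc.prems)
  then show ?case by (rule projective_iso[OF _ rmod_iso_sym[OF m direct_sum_Suc] m])
qed

text \<open>No minimality is meant: it is a free module, moved to \<open>'a fgmod\<close> so that it
  may occur as a term of the resolutions in the definitions.\<close>

lemma projective_cover: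
  assumes "fg_module A X"
  obtains F :: "'a fgmod" and f where "projective_module A F" "f \<in> rmod_hom A F X" "f ` carrier F = carrier X"
proof -
  obtain k g where g: "g \<in> rmod_hom A (direct_sum k (\<lambda>_. regular A)) X"
    "g ` carrier (direct_sum k (\<lambda>_. regular A)) = carrier X"
    by (rule free_surjection[OF assms])
  let ?D = "direct_sum k (\<lambda>_. regular A)"
  have D: "projective_module A ?D" by (rule projective_direct_sum) (rule projective_regular)
  note Dm = fg_module_right[OF projective_fg[OF D]]
  obtain F :: "'a fgmod" where F: "fg_module A F" "rmod_iso A ?D F" by (rule fgmod_copy[OF projective_fg[OF D]])
  obtain x x' where x: "x \<in> rmod_hom A ?D F" "x' \<in> rmod_hom A F ?D"
    "\<And>u. u \<in> carrier ?D \<Longrightarrow> x' (x u) = u" "\<And>u. u \<in> carrier F \<Longrightarrow> x (x' u) = u"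
    by (rule rmod_isoE[OF Dm F(2)]) blast
  have "(\<lambda>u. g (x' u)) ` carrier F = carrier X"
  proof (intro subset_antisym subsetI)
    fix v assume "v \<in> carrier X"
    then obtain u where u: "u \<in> carrier ?D" "v = g u" unfolding g(2)[symmetric] by (rule imageE)
    then show "v \<in> (\<lambda>u. g (x' u)) ` carrier F"
      by (intro image_eqI[of _ _ "x u"]) (simp_all only: x(3) rmod_homD(1)[OF x(1)])
  next
    fix v assume "v \<in> (\<lambda>u. g (x' u)) ` carrier F"
    then obtain u where u: "u \<in> carrier F" "v = g (x' u)" by (rule imageE)
    show "v \<in> carrier X" unfolding u(2) by (rule rmod_homD(1)[OF g(1) rmod_homD(1)[OF x(2) u(1)]])
  qed
  then show ?thesis
    using that[OF projective_iso[OF D F(2) fg_module_right[OF F(1)]] rmod_hom_comp[OF x(2) g(1)]] by blast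
qed

section \<open>Splitting, Schanuel's lemma and its dual\<close>

lemma short_exact_split:
  assumes X: "right_module A X" and M: "fg_module A M" and Y: "projective_module A Y" and ex: "short_exact A X M Y"
  shows "rmod_iso A M (direct_sum2 Y X)"
proof -
  obtain f g where f: "f \<in> rmod_hom A X M" "g \<in> rmod_hom A M Y" "inj_on f (carrier X)"
    "g ` carrier M = carrier Y" "f ` carrier X = a_kernel M Y g"
    by (rule short_exactE[OF ex]) blast
  note Ym = fg_module_right[OF projective_fg[OF Y]] and Mm = fg_module_right[OF M]
  obtain s where s: "s \<in> rmod_hom A Y M" "\<And>y. y \<in> carrier Y \<Longrightarrow> g (s y) = y"
    by (rule projective_lift[OF Y M projective_fg[OF Y] f(2,4) rmod_hom_id]) blast
  interpret g: module_hom A M Y g by (rule module_homI[OF Mm Ym f(2)])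
  note 1 = split_direct_sum2[OF Mm Ym s(1) f(2) s(2)]
  let ?K = "M\<lparr>carrier := a_kernel M Y g\<rparr>"
  note K = right_module_sub[OF Mm g.submodule_kernel]
  have "f \<in> rmod_hom A X ?K" by (rule rmod_hom_into_sub[OF f(1)]) (simp add: f(5))
  then have "rmod_iso A X ?K" by (rule rmod_isoI[OF _ f(3)]) (simp add: f(5))
  then have "rmod_iso A ?K X" by (rule rmod_iso_sym[OF X])
  then have "rmod_iso A (direct_sum2 Y ?K) (direct_sum2 Y X)" by (rule direct_sum2_cong[OF Ym K rmod_iso_refl])
  with 1 show ?thesis by (rule rmod_iso_trans)
qed

text \<open>The isomorphism is written down directly; eliminating the pullback of \<open>P\<close> and \<open>P'\<close> over
  \<open>Y\<close> from the usual proof leads to these formulas.\<close>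

lemma schanuel:
  assumes mods: "right_module A K" "right_module A K'" "fg_module A Y"
    and P: "projective_module A P" "projective_module A P'"
    and ex: "short_exact A K P Y" "short_exact A K' P' Y"
  shows "rmod_iso A (direct_sum2 K P') (direct_sum2 K' P)"
proof -
  obtain f g where f: "f \<in> rmod_hom A K P" "g \<in> rmod_hom A P Y" "inj_on f (carrier K)"
    "g ` carrier P = carrier Y" "f ` carrier K = a_kernel P Y g"
    by (rule short_exactE[OF ex(1)]) blast
  obtain f' g' where f': "f' \<in> rmod_hom A K' P'" "g' \<in> rmod_hom A P' Y" "inj_on f' (carrier K')"
    "g' ` carrier P' = carrier Y" "f' ` carrier K' = a_kernel P' Y g'"
    by (rule short_exactE[OF ex(2)]) blast
  note fg = P[THEN projective_fg]
  note Pm = fg[THEN fg_module_right] and Ym = fg_module_right[OF mods(3)]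
  obtain h where h: "h \<in> rmod_hom A P P'" "\<And>x. x \<in> carrier P \<Longrightarrow> g' (h x) = g x"
    by (rule projective_lift[OF P(1) fg(2) mods(3) f'(2,4) f(2)]) blast
  obtain h' where h': "h' \<in> rmod_hom A P' P" "\<And>x. x \<in> carrier P' \<Longrightarrow> g (h' x) = g' x"
    by (rule projective_lift[OF P(2) fg(1) mods(3) f(2,4) f'(2)]) blast
  interpret g: module_hom A P Y g by (rule module_homI) fact+
  interpret g': module_hom A P' Y g' by (rule module_homI) fact+
  interpret f: module_hom A K P f by (rule module_homI) fact+
  interpret f': module_hom A K' P' f' by (rule module_homI) fact+
  interpret h: module_hom A P P' h by (rule module_homI) fact+
  interpret h': module_hom A P' P h' by (rule module_homI) fact+
  have gf: "g (f k) = \<zero>\<^bsub>Y\<^esub>" if "k \<in> carrier K" for k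
    using f(5) that by (auto simp: a_kernel_def' set_eq_iff)
  have gf': "g' (f' k) = \<zero>\<^bsub>Y\<^esub>" if "k \<in> carrier K'" for k
    using f'(5) that by (auto simp: a_kernel_def' set_eq_iff)
  define \<alpha> where "\<alpha> x = f (fst x) \<oplus>\<^bsub>P\<^esub> h' (snd x)" for x
  define \<beta> where "\<beta> y = f' (fst y) \<oplus>\<^bsub>P'\<^esub> h (snd y)" for y
  have \<alpha>: "\<alpha> \<in> rmod_hom A (direct_sum2 K P') P"
    unfolding \<alpha>_def by (rule rmod_hom_copair[OF Pm(1) f(1) h'(1)])
  have \<beta>: "\<beta> \<in> rmod_hom A (direct_sum2 K' P) P'"
    unfolding \<beta>_def by (rule rmod_hom_copair[OF Pm(2) f'(1) h(1)])
  have g\<alpha>: "g (\<alpha> x) = g' (snd x)" if "x \<in> carrier (direct_sum2 K P')" for x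
    using that by (auto simp: \<alpha>_def g.add gf h' f.closed h'.closed g'.closed)
  have g\<beta>: "g' (\<beta> x) = g (snd x)" if "x \<in> carrier (direct_sum2 K' P)" for x
    using that by (auto simp: \<beta>_def g'.add gf' h f'.closed h.closed g.closed)
  \<comment> \<open>By \<open>g\<alpha>\<close>, both \<open>snd x\<close> and
    \<open>h (\<alpha> x)\<close> lie over the same element of \<open>Y\<close>, so their difference
    comes from \<open>K'\<close>; \<open>k2\<close> is the mirror image.\<close>
  have k1: "(\<lambda>x. snd x \<ominus>\<^bsub>P'\<^esub> h (\<alpha> x)) \<in> rmod_hom A (direct_sum2 K P') P'"
    by (rule rmod_hom_minus[OF Pm(2) rmod_hom_snd rmod_hom_comp[OF \<alpha> h(1)]])
  have i1: "(\<lambda>x. snd x \<ominus>\<^bsub>P'\<^esub> h (\<alpha> x)) ` carrier (direct_sum2 K P') \<subseteq> f' ` carrier K'"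
    unfolding f'(5) using rmod_homD(1)[OF \<alpha>]
    by (auto simp: a_kernel_def' g'.minus h.closed h(2) g\<alpha> g'.closed g.N.M.diff_zero_iff)
  obtain a where a: "a \<in> rmod_hom A (direct_sum2 K P') K'"
    "\<And>x. x \<in> carrier (direct_sum2 K P') \<Longrightarrow> f' (a x) = snd x \<ominus>\<^bsub>P'\<^esub> h (\<alpha> x)"
    by (rule factor_through_inj[OF mods(2) Pm(2) right_module_direct_sum2[OF mods(1) Pm(2)] f'(1,3) k1 i1]) blast
  have k2: "(\<lambda>x. snd x \<ominus>\<^bsub>P\<^esub> h' (\<beta> x)) \<in> rmod_hom A (direct_sum2 K' P) P"
    by (rule rmod_hom_minus[OF Pm(1) rmod_hom_snd rmod_hom_comp[OF \<beta> h'(1)]])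
  have i2: "(\<lambda>x. snd x \<ominus>\<^bsub>P\<^esub> h' (\<beta> x)) ` carrier (direct_sum2 K' P) \<subseteq> f ` carrier K"
    unfolding f(5) using rmod_homD(1)[OF \<beta>]
    by (auto simp: a_kernel_def' g.minus h'.closed h'(2) g\<beta> g.closed g.N.M.diff_zero_iff)
  obtain b where b: "b \<in> rmod_hom A (direct_sum2 K' P) K"
    "\<And>x. x \<in> carrier (direct_sum2 K' P) \<Longrightarrow> f (b x) = snd x \<ominus>\<^bsub>P\<^esub> h' (\<beta> x)"
    by (rule factor_through_inj[OF mods(1) Pm(1) right_module_direct_sum2[OF mods(2) Pm(1)] f(1,3) k2 i2]) blast
  show ?thesis
  proof (rule rmod_isoI'[OF rmod_hom_pair[OF a(1) \<alpha>] rmod_hom_pair[OF b(1) \<beta>]])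
    fix x assume x: "x \<in> carrier (direct_sum2 K P')"
    then have xs: "fst x \<in> carrier K" "snd x \<in> carrier P'" by auto
    note c = rmod_homD(1)[OF \<alpha> x] rmod_homD(1)[OF a(1) x]
    have d: "(a x, \<alpha> x) \<in> carrier (direct_sum2 K' P)" using c by simp
    have \<beta>x: "\<beta> (a x, \<alpha> x) = snd x"
      using xs h.closed[OF c(1)] unfolding \<beta>_def fst_conv snd_conv a(2)[OF x] by algebra
    have "f (b (a x, \<alpha> x)) = \<alpha> x \<ominus>\<^bsub>P\<^esub> h' (snd x)"
      unfolding b(2)[OF d] \<beta>x snd_conv ..
    also have "\<dots> = f (fst x)"
      using h'.closed[OF xs(2)] f.closed[OF xs(1)] unfolding \<alpha>_def by algebra
    finally have "f (b (a x, \<alpha> x)) = f (fst x)" .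
    then have "b (a x, \<alpha> x) = fst x"
      using inj_onD[OF f(3)] rmod_homD(1)[OF b(1) d] xs by blast
    then show "(b (a x, \<alpha> x), \<beta> (a x, \<alpha> x)) = x" using \<beta>x by simp
  next
    fix x assume x: "x \<in> carrier (direct_sum2 K' P)"
    then have xs: "fst x \<in> carrier K'" "snd x \<in> carrier P" by auto
    note c = rmod_homD(1)[OF \<beta> x] rmod_homD(1)[OF b(1) x]
    have d: "(b x, \<beta> x) \<in> carrier (direct_sum2 K P')" using c by simp
    have \<alpha>x: "\<alpha> (b x, \<beta> x) = snd x"
      using xs h'.closed[OF c(1)] unfolding \<alpha>_def fst_conv snd_conv b(2)[OF x] by algebra
    have "f' (a (b x, \<beta> x)) = \<beta> x \<ominus>\<^bsub>P'\<^esub> h (snd x)"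
      unfolding a(2)[OF d] \<alpha>x snd_conv ..
    also have "\<dots> = f' (fst x)"
      using h.closed[OF xs(2)] f'.closed[OF xs(1)] unfolding \<beta>_def by algebra
    finally have "f' (a (b x, \<beta> x)) = f' (fst x)" .
    then have "a (b x, \<beta> x) = fst x"
      using inj_onD[OF f'(3)] rmod_homD(1)[OF a(1) d] xs by blast
    then show "(a (b x, \<beta> x), \<alpha> (b x, \<beta> x)) = x" using \<alpha>x by simp
  qed
qed

text \<open>The half of the dual of Schanuel's lemma that is wanted. The comparison maps
  \<open>h\<close> and \<open>h'\<close> restrict to the identity of \<open>X\<close>, so
  \<open>u \<ominus> h' (h u)\<close> and \<open>g' (h u)\<close> both vanish on \<open>X\<close>
  and together define a map from \<open>C\<close>. The retraction is \<open>g\<close> on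
  \<open>J\<close> and the map induced by \<open>h'\<close> on \<open>C'\<close>, since
  \<open>u\<close> is the sum of \<open>u \<ominus> h' (h u)\<close> and
  \<open>h' (h u)\<close>.\<close>

lemma cosyzygy_summand:
  assumes X: "fg_module A X" and mods: "right_module A C" "right_module A C'"
    and J: "injective_module A J" "injective_module A J'"
    and ex: "short_exact A X J C" "short_exact A X J' C'"
  shows "summand A C (direct_sum2 J C')"
proof -
  obtain f g where f: "f \<in> rmod_hom A X J" "g \<in> rmod_hom A J C" "inj_on f (carrier X)"
    "g ` carrier J = carrier C" "f ` carrier X = a_kernel J C g"
    by (rule short_exactE[OF ex(1)]) blast
  obtain f' g' where f': "f' \<in> rmod_hom A X J'" "g' \<in> rmod_hom A J' C'" "inj_on f' (carrier X)"
    "g' ` carrier J' = carrier C'" "f' ` carrier X = a_kernel J' C' g'"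
    by (rule short_exactE[OF ex(2)]) blast
  note fg = J[THEN injective_fg]
  note Jm = fg[THEN fg_module_right] and Xm = fg_module_right[OF X]
  obtain h where h: "h \<in> rmod_hom A J J'" "\<And>x. x \<in> carrier X \<Longrightarrow> h (f x) = f' x"
    by (rule injective_extend[OF J(2) X fg(1) f(1,3) f'(1)]) blast
  obtain h' where h': "h' \<in> rmod_hom A J' J" "\<And>x. x \<in> carrier X \<Longrightarrow> h' (f' x) = f x"
    by (rule injective_extend[OF J(1) X fg(2) f'(1,3) f(1)]) blast
  interpret g: module_hom A J C g by (rule module_homI) fact+
  interpret g': module_hom A J' C' g' by (rule module_homI) fact+
  interpret f: module_hom A X J f by (rule module_homI) fact+
  interpret h: module_hom A J J' h by (rule module_homI) fact+
  interpret h': module_hom A J' J h' by (rule module_homI) fact+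
  have ker: "\<exists>x \<in> carrier X. u = f x" if "u \<in> carrier J" "g u = \<zero>\<^bsub>C\<^esub>" for u
    using f(5) that by (auto simp: a_kernel_def' set_eq_iff)
  have ker': "\<exists>x \<in> carrier X. u = f' x" if "u \<in> carrier J'" "g' u = \<zero>\<^bsub>C'\<^esub>" for u
    using f'(5) that by (auto simp: a_kernel_def' set_eq_iff)
  have gf: "g (f k) = \<zero>\<^bsub>C\<^esub>" if "k \<in> carrier X" for k
    using f(5) that by (auto simp: a_kernel_def' set_eq_iff)
  have gf': "g' (f' k) = \<zero>\<^bsub>C'\<^esub>" if "k \<in> carrier X" for k
    using f'(5) that by (auto simp: a_kernel_def' set_eq_iff)
  define s where "s u = (u \<ominus>\<^bsub>J\<^esub> h' (h u), g' (h u))" for u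
  have s: "s \<in> rmod_hom A J (direct_sum2 J C')"
    unfolding s_def
    by (rule rmod_hom_pair[OF rmod_hom_minus[OF Jm(1) rmod_hom_id rmod_hom_comp[OF h(1) h'(1)]] rmod_hom_comp[OF h(1) f'(2)]])
  have sk: "s u = \<zero>\<^bsub>direct_sum2 J C'\<^esub>" if u: "u \<in> carrier J" "g u = \<zero>\<^bsub>C\<^esub>" for u
  proof -
    obtain x where "x \<in> carrier X" "u = f x" using ker[OF u] by blast
    then show ?thesis using gf' by (simp add: s_def h h' f.closed g.M.M.diff_zero_iff)
  qed
  obtain \<sigma> where \<sigma>: "\<sigma> \<in> rmod_hom A C (direct_sum2 J C')" "\<And>u. u \<in> carrier J \<Longrightarrow> \<sigma> (g u) = s u"
    by (rule factor_through_surj[OF Jm(1) mods(1) right_module_direct_sum2[OF Jm(1) mods(2)] f(2,4) s sk]) blast+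
  have kk: "g (h' u) = \<zero>\<^bsub>C\<^esub>" if u: "u \<in> carrier J'" "g' u = \<zero>\<^bsub>C'\<^esub>" for u
  proof -
    obtain x where "x \<in> carrier X" "u = f' x" using ker'[OF u] by blast
    then show ?thesis using gf by (simp add: h')
  qed
  obtain t where t: "t \<in> rmod_hom A C' C" "\<And>u. u \<in> carrier J' \<Longrightarrow> t (g' u) = g (h' u)"
    by (rule factor_through_surj[OF Jm(2) mods(2) mods(1) f'(2,4) rmod_hom_comp[OF h'(1) f(2)] kk]) blast+
  show ?thesis
  proof (rule summandI[OF \<sigma>(1) rmod_hom_copair[OF mods(1) f(2) t(1)]])
    fix c assume "c \<in> carrier C"
    then obtain u where u: "u \<in> carrier J" "c = g u" unfolding f(4)[symmetric] by (rule imageE)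
    note hu = h.closed[OF u(1)] and hhu = h'.closed[OF h.closed[OF u(1)]]
    have "g (u \<ominus>\<^bsub>J\<^esub> h' (h u)) \<oplus>\<^bsub>C\<^esub> g (h' (h u)) = g ((u \<ominus>\<^bsub>J\<^esub> h' (h u)) \<oplus>\<^bsub>J\<^esub> h' (h u))"
      using u hhu by (simp add: g.add)
    also have "(u \<ominus>\<^bsub>J\<^esub> h' (h u)) \<oplus>\<^bsub>J\<^esub> h' (h u) = u" using u(1) hhu by algebra
    finally show "g (fst (\<sigma> c)) \<oplus>\<^bsub>C\<^esub> t (snd (\<sigma> c)) = c"
      using u \<sigma>(2)[OF u(1)] t(2)[OF hu] by (simp add: s_def)
  qed
qed

end

section \<open>Indecomposable modules and the Krull--Schmidt property\<close>

lemma rmod_hom_funpow: "f \<in> rmod_hom A M M \<Longrightarrow> f ^^ n \<in> rmod_hom A M M"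
proof (induction n)
  case 0
  then show ?case using rmod_hom_id[of A M] by (simp add: id_def)
next
  case (Suc n)
  then show ?case using rmod_hom_comp[OF Suc.IH[OF Suc.prems] Suc.prems] by (simp add: comp_def)
qed

context artin_ring
begin

lemma indecomposable_fg: "indecomposable_module A M \<Longrightarrow> fg_module A M"
  by (simp add: indecomposable_module_def)

lemma indecomposable_not_zero: "indecomposable_module A M \<Longrightarrow> \<not> zero_module M"
  by (simp add: indecomposable_module_def)

text \<open>The definition excludes decompositions on \<open>'a fgmod\<close> only; copying both
  summands there excludes them on all types.\<close>

lemma indecomposableD:
  assumes M: "indecomposable_module A M" and X: "fg_module A X" and Y: "fg_module A Y"
    and iso: "rmod_iso A M (direct_sum2 X Y)"
  shows "zero_module X \<or> zero_module Y"
proof -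
  obtain X' :: "'a fgmod" where X': "fg_module A X'" "rmod_iso A X X'" by (rule fgmod_copy[OF X])
  obtain Y' :: "'a fgmod" where Y': "fg_module A Y'" "rmod_iso A Y Y'" by (rule fgmod_copy[OF Y])
  note m = fg_module_right[OF X] fg_module_right[OF Y] fg_module_right[OF X'(1)] fg_module_right[OF Y'(1)]
  have "rmod_iso A M (direct_sum2 X' Y')"
    by (rule rmod_iso_trans[OF iso direct_sum2_cong[OF m(1,2) X'(2) Y'(2)]])
  then have "zero_module X' \<or> zero_module Y'"
    using M[unfolded indecomposable_module_def] X'(1) Y'(1) by blast
  then show ?thesis
    using zero_module_iso[OF rmod_iso_sym[OF m(1) X'(2)] m(3,1)] zero_module_iso[OF rmod_iso_sym[OF m(2) Y'(2)] m(4,2)]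
    by blast
qed

text \<open>The exponent is chosen so that both the image and the kernel of the iterates are stable from
  there on; then the module is the direct sum of that image and that kernel.\<close>

lemma fitting:
  assumes M: "indecomposable_module A M" and f: "f \<in> rmod_hom A M M"
  shows "bij_betw f (carrier M) (carrier M) \<or> (\<exists>n. \<forall>x \<in> carrier M. (f ^^ n) x = \<zero>\<^bsub>M\<^esub>)"
proof -
  note fg = indecomposable_fg[OF M] and Mm = fg_module_right[OF indecomposable_fg[OF M]]
  obtain r :: "_ set \<Rightarrow> nat" where r: "\<And>L L'. submodule L A M \<Longrightarrow> submodule L' A M \<Longrightarrow> L \<subset> L' \<Longrightarrow> r L < r L'"
    "\<And>L L'. submodule L A M \<Longrightarrow> submodule L' A M \<Longrightarrow> L \<subseteq> L' \<Longrightarrow> r L \<le> r L'"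
    by (rule fin_lengthE[OF fg_imp_fin_length[OF fg]]) blast
  have p: "module_hom A M M (f ^^ n)" for n by (rule module_homI[OF Mm Mm rmod_hom_funpow[OF f]])
  define im where "im n = (f ^^ n) ` carrier M" for n
  define ke where "ke n = a_kernel M M (f ^^ n)" for n
  have sub: "submodule (im n) A M" "submodule (ke n) A M" for n
    unfolding im_def ke_def by (rule module_hom.submodule_range[OF p], rule module_hom.submodule_kernel[OF p])
  have cl: "(f ^^ n) x \<in> carrier M" if "x \<in> carrier M" for n x
    by (rule module_hom.closed[OF p that])
  have pz: "(f ^^ n) \<zero>\<^bsub>M\<^esub> = \<zero>\<^bsub>M\<^esub>" for n by (rule module_hom.zero[OF p])
  have im_add: "im (n + m) \<subseteq> im n" for n m
    unfolding im_def using cl by (auto simp: funpow_add)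
  have ke_add: "ke n \<subseteq> ke (m + n)" for n m
    unfolding ke_def a_kernel_def' using pz by (auto simp: funpow_add)
  \<comment> \<open>Images shrink and kernels grow along the iterates, so \<open>s\<close> never
    increases; where it is least, both have become stationary.\<close>
  define s where "s n = r (im n) + (r (carrier M) - r (ke n))" for n
  obtain n where n: "\<And>m. s n \<le> s m" using ex_has_least_nat[of "\<lambda>_. True" _ s] by blast
  have ke_le: "r (ke m) \<le> r (carrier M)" for m
    by (rule r(2)[OF sub(2) submodule_carrier[OF Mm]]) (simp add: ke_def a_kernel_def')
  have stable: "im (n + m) = im n \<and> ke (n + m) = ke n" for m
  proof (rule ccontr)
    assume ne: "\<not> ?thesis"
    have k: "ke n \<subseteq> ke (n + m)" using ke_add[of n m] by (simp only: add.commute)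
    have 1: "r (im (n + m)) \<le> r (im n)" by (rule r(2)[OF sub(1) sub(1) im_add])
    have 2: "r (ke n) \<le> r (ke (n + m))" by (rule r(2)[OF sub(2) sub(2) k])
    from ne have "im (n + m) \<subset> im n \<or> ke n \<subset> ke (n + m)" using im_add[of n m] k by blast
    then have "r (im (n + m)) < r (im n) \<or> r (ke n) < r (ke (n + m))"
      using r(1)[OF sub(1) sub(1), of "n + m" n] r(1)[OF sub(2) sub(2), of n "n + m"] by blast
    then have "s (n + m) < s n" unfolding s_def using 1 2 ke_le[of n] ke_le[of "n + m"] by linarith
    then show False using n[of "n + m"] by simp
  qed
  \<comment> \<open>The exponent is \<open>Suc n\<close> rather than \<open>n\<close>, so that
    \<open>f\<close> occurs as first and as last factor of \<open>g\<close>: injectivity and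
    surjectivity are later passed from \<open>g\<close> to \<open>f\<close>, which fails for the
    zeroth power.\<close>
  define g where "g = f ^^ Suc n"
  define L where "L = im (Suc n)"
  interpret g: module_hom A M M g unfolding g_def by (rule p)
  have L: "L = g ` carrier M" by (simp add: L_def g_def im_def)
  have gg: "g (g x) = (f ^^ (Suc n + Suc n)) x" for x
    unfolding g_def funpow_add by (simp add: comp_def)
  have imL: "im (Suc n + Suc n) = L" using stable[of 1] stable[of "Suc (Suc n)"] by (simp add: L_def)
  have keL: "ke (Suc n + Suc n) = ke (Suc n)" using stable[of 1] stable[of "Suc (Suc n)"] by simp
  have gL: "g ` L = L"
  proof -
    have "g ` L = im (Suc n + Suc n)" unfolding L im_def image_image by (rule image_cong[OF refl gg])
    then show ?thesis using imL by simp
  qed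
  have Lsub: "submodule L A M" unfolding L_def by (rule sub)
  have LM: "L \<subseteq> carrier M" by (rule submoduleD(1)[OF Lsub])
  have inj: "u = \<zero>\<^bsub>M\<^esub>" if u: "u \<in> L" "g u = \<zero>\<^bsub>M\<^esub>" for u
  proof -
    obtain v where v: "v \<in> carrier M" "u = g v" using u(1) unfolding L by (rule imageE)
    have "v \<in> ke (Suc n + Suc n)"
      using u(2) v unfolding ke_def a_kernel_def' by (simp only: gg v(2) mem_Collect_eq simp_thms)
    then have "g v = \<zero>\<^bsub>M\<^esub>" unfolding keL by (simp only: ke_def a_kernel_def' g_def mem_Collect_eq)
    then show ?thesis using v by simp
  qed
  let ?L = "M\<lparr>carrier := L\<rparr>"
  have Lm: "right_module A ?L" by (rule right_module_sub[OF Mm Lsub])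
  have g': "g \<in> rmod_hom A ?L ?L"
    by (rule rmod_hom_into_sub[OF rmod_hom_restrict[OF g.hom LM]]) (simp add: gL)
  interpret gL: module_hom A ?L ?L g by (rule module_homI[OF Lm Lm g'])
  have "inj_on g (carrier ?L)" unfolding gL.inj_iff using inj by simp
  then have bij: "bij_betw g (carrier ?L) (carrier ?L)" using gL by (simp add: bij_betw_def)
  let ?k = "inv_into L g"
  have k: "?k \<in> rmod_hom A ?L ?L" using rmod_hom_inverse[OF Lm g' bij] by simp
  have kg: "?k (g u) = u" if "u \<in> L" for u using bij that by (simp add: bij_betw_def)
  have gk: "g (?k u) = u" if "u \<in> L" for u using that gL by (simp add: f_inv_into_f)
  \<comment> \<open>As \<open>g\<close> is bijective on its image \<open>L\<close>, applying
    \<open>g\<close> and then the inverse of \<open>g\<close> on \<open>L\<close> is a retraction of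
    \<open>M\<close> onto \<open>L\<close>, with the same kernel as \<open>g\<close>.\<close>
  have p: "(\<lambda>x. ?k (g x)) \<in> rmod_hom A M ?L"
    by (rule rmod_hom_comp[OF rmod_hom_into_sub[OF g.hom] k]) (simp add: L)
  have "rmod_iso A M (direct_sum2 ?L (M\<lparr>carrier := a_kernel M ?L (\<lambda>x. ?k (g x))\<rparr>))"
    by (rule split_direct_sum2[OF Mm Lm rmod_hom_inclusion[OF LM] p]) (simp add: kg)
  moreover have kp: "submodule (a_kernel M ?L (\<lambda>x. ?k (g x))) A M"
    by (rule module_hom.submodule_kernel[OF module_homI[OF Mm Lm p]])
  ultimately have "zero_module ?L \<or> zero_module (M\<lparr>carrier := a_kernel M ?L (\<lambda>x. ?k (g x))\<rparr>)"
    by (intro indecomposableD[OF M fg_sub[OF fg Lsub] fg_sub[OF fg kp]])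
  then show ?thesis
  proof
    assume "zero_module ?L"
    then have "\<forall>x \<in> carrier M. (f ^^ Suc n) x = \<zero>\<^bsub>M\<^esub>" unfolding zero_module_def L g_def by auto
    then show ?thesis by blast
  next
    assume z: "zero_module (M\<lparr>carrier := a_kernel M ?L (\<lambda>x. ?k (g x))\<rparr>)"
    interpret f: module_hom A M M f by (rule module_homI[OF Mm Mm f])
    have kz: "?k \<zero>\<^bsub>M\<^esub> = \<zero>\<^bsub>M\<^esub>" using module_hom.zero[OF module_homI[OF Lm Lm k]] by simp
    have ginj: "x = \<zero>\<^bsub>M\<^esub>" if "x \<in> carrier M" "g x = \<zero>\<^bsub>M\<^esub>" for x
    proof -
      have "x \<in> a_kernel M ?L (\<lambda>x. ?k (g x))" using that kz by (simp add: a_kernel_def')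
      then show ?thesis using z by (simp add: zero_module_def)
    qed
    have finj: "inj_on f (carrier M)" unfolding f.inj_iff
    proof (intro ballI impI)
      fix x assume x: "x \<in> carrier M" "f x = \<zero>\<^bsub>M\<^esub>"
      then have "g x = \<zero>\<^bsub>M\<^esub>" using pz[of n] by (simp add: g_def funpow_Suc_right del: funpow.simps)
      then show "x = \<zero>\<^bsub>M\<^esub>" using ginj x by blast
    qed
    have "carrier M \<subseteq> f ` carrier M"
    proof
      fix x assume x: "x \<in> carrier M"
      have gx: "g x \<in> L" using x L by blast
      let ?u = "?k (g x)"
      have u: "?u \<in> L" using rmod_homD(1)[OF k, of "g x"] gx by simp
      have uM: "?u \<in> carrier M" using u LM by blast
      have "g (x \<ominus>\<^bsub>M\<^esub> ?u) = \<zero>\<^bsub>M\<^esub>" using g.minus[OF x uM] gk[OF gx] g.closed[OF x] g.M.M.diff_zero_iff by simp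
      then have "x \<ominus>\<^bsub>M\<^esub> ?u = \<zero>\<^bsub>M\<^esub>" using ginj x uM by simp
      then have "x = ?u" using x uM g.M.M.diff_zero_iff by simp
      then have "x \<in> L" using u by simp
      then obtain y where "y \<in> carrier M" "x = g y" unfolding L by (rule imageE)
      then show "x \<in> f ` carrier M" using cl[of y n] by (simp add: g_def)
    qed
    then have "f ` carrier M = carrier M" using f.closed by blast
    then show ?thesis using finj by (simp add: bij_betw_def)
  qed
qed

text \<open>An endomorphism that is both injective and nilpotent forces the module to be zero, so
  only the other case of \<open>fitting\<close> remains.\<close>

lemma indecomposable_inj_endo_bij:
  assumes M: "indecomposable_module A M" and f: "f \<in> rmod_hom A M M" and inj: "inj_on f (carrier M)"
  shows "bij_betw f (carrier M) (carrier M)"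
proof -
  note Mm = fg_module_right[OF indecomposable_fg[OF M]]
  interpret f: module_hom A M M f by (rule module_homI[OF Mm Mm f])
  have False if n: "\<forall>x \<in> carrier M. (f ^^ n) x = \<zero>\<^bsub>M\<^esub>" for n
  proof -
    have "x = \<zero>\<^bsub>M\<^esub>" if "x \<in> carrier M" "(f ^^ n) x = \<zero>\<^bsub>M\<^esub>" for x
      using that
    proof (induction n arbitrary: x)
      case (Suc n)
      have "(f ^^ n) x \<in> carrier M" using rmod_homD(1)[OF rmod_hom_funpow[OF f] Suc.prems(1)] .
      then have "(f ^^ n) x = \<zero>\<^bsub>M\<^esub>" using inj Suc.prems(2) unfolding f.inj_iff by simp
      then show ?case using Suc by simp
    qed simp
    then have "zero_module M" using n f.M.M.zero_closed by (auto simp: zero_module_def)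
    then show False using indecomposable_not_zero[OF M] by blast
  qed
  then show ?thesis using fitting[OF M f] by blast
qed

text \<open>If \<open>f\<close> is nilpotent, an element annihilated by \<open>g\<close> is fixed by
  \<open>f\<close>, hence by all powers of \<open>f\<close>, and is zero. So \<open>g\<close> is
  injective, which is enough. This is the locality of the endomorphism ring in the form in which it
  is used.\<close>

lemma indecomposable_local:
  assumes M: "indecomposable_module A M" and f: "f \<in> rmod_hom A M M" and g: "g \<in> rmod_hom A M M"
    and fg: "\<And>x. x \<in> carrier M \<Longrightarrow> f x \<oplus>\<^bsub>M\<^esub> g x = x"
  shows "bij_betw f (carrier M) (carrier M) \<or> bij_betw g (carrier M) (carrier M)"
proof -
  note Mm = fg_module_right[OF indecomposable_fg[OF M]]
  interpret f: module_hom A M M f by (rule module_homI[OF Mm Mm f])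
  interpret g: module_hom A M M g by (rule module_homI[OF Mm Mm g])
  from fitting[OF M f] show ?thesis
  proof
    assume "\<exists>n. \<forall>x \<in> carrier M. (f ^^ n) x = \<zero>\<^bsub>M\<^esub>"
    then obtain n where n: "\<And>x. x \<in> carrier M \<Longrightarrow> (f ^^ n) x = \<zero>\<^bsub>M\<^esub>" by blast
    have "inj_on g (carrier M)" unfolding g.inj_iff
    proof (intro ballI impI)
      fix x assume x: "x \<in> carrier M" "g x = \<zero>\<^bsub>M\<^esub>"
      then have "f x = x" using fg[OF x(1)] f.closed[OF x(1)] by simp
      then have "(f ^^ n) x = x" by (induction n) simp_all
      then show "x = \<zero>\<^bsub>M\<^esub>" using n[OF x(1)] by simp
    qed
    then show ?thesis using indecomposable_inj_endo_bij[OF M g] by blast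
  qed simp
qed

text \<open>The identity of \<open>U\<close> is the sum of its passages through \<open>X\<close> and
  through \<open>Y\<close>. One of them is bijective by locality, and its inverse corrects the
  projection to a retraction.\<close>

lemma indecomposable_summand_direct_sum2:
  assumes U: "indecomposable_module A U" and mods: "right_module A X" "right_module A Y"
    and s: "summand A U (direct_sum2 X Y)"
  shows "summand A U X \<or> summand A U Y"
proof -
  note Um = fg_module_right[OF indecomposable_fg[OF U]]
  obtain i p where i: "i \<in> rmod_hom A U (direct_sum2 X Y)" "p \<in> rmod_hom A (direct_sum2 X Y) U"
    "\<And>x. x \<in> carrier U \<Longrightarrow> p (i x) = x"
    by (rule summandE[OF s]) blast
  note i1 = rmod_hom_comp[OF i(1) rmod_hom_fst] and i2 = rmod_hom_comp[OF i(1) rmod_hom_snd]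
  note p1 = rmod_hom_comp[OF rmod_hom_inl[OF mods(2)] i(2)] and p2 = rmod_hom_comp[OF rmod_hom_inr[OF mods(1)] i(2)]
  interpret X: right_module A X by fact
  interpret Y: right_module A Y by fact
  have sum: "p (fst (i x), \<zero>\<^bsub>Y\<^esub>) \<oplus>\<^bsub>U\<^esub> p (\<zero>\<^bsub>X\<^esub>, snd (i x)) = x" if x: "x \<in> carrier U" for x
    using rmod_homD(2)[OF i(2), of "(fst (i x), \<zero>\<^bsub>Y\<^esub>)" "(\<zero>\<^bsub>X\<^esub>, snd (i x))"] rmod_homD(1)[OF i(1) x] i(3)[OF x]
    by (auto simp: mem_Times_iff)
  have conc: "summand A U V" if j: "j \<in> rmod_hom A U V" and q: "q \<in> rmod_hom A V U"
    and b: "bij_betw (\<lambda>x. q (j x)) (carrier U) (carrier U)" for V :: "('a, 'z) module" and j q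
    by (rule summandI[OF j rmod_hom_comp[OF q rmod_hom_inverse[OF Um rmod_hom_comp[OF j q] b]]])
      (rule bij_betw_inv_into_left[OF b])
  from indecomposable_local[OF U rmod_hom_comp[OF i1 p1] rmod_hom_comp[OF i2 p2] sum]
  show ?thesis using conc[OF i1 p1] conc[OF i2 p2] by blast
qed

lemma summand_kernel:
  assumes M: "fg_module A M" and X: "right_module A X" and s: "summand A X M"
  obtains K where "submodule K A M" "rmod_iso A M (direct_sum2 X (M\<lparr>carrier := K\<rparr>))"
proof -
  obtain i p where i: "i \<in> rmod_hom A X M" "p \<in> rmod_hom A M X" "\<And>x. x \<in> carrier X \<Longrightarrow> p (i x) = x"
    by (rule summandE[OF s]) blast
  show ?thesis
    by (rule that[OF module_hom.submodule_kernel[OF module_homI[OF fg_module_right[OF M] X i(2)]]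
          split_direct_sum2[OF fg_module_right[OF M] X i]])
qed

lemma summand_indecomposable_iso:
  assumes V: "indecomposable_module A V" and U: "fg_module A U" "\<not> zero_module U" and s: "summand A U V"
  shows "rmod_iso A U V"
proof -
  note Um = fg_module_right[OF U(1)] and Vf = indecomposable_fg[OF V]
  obtain K where K: "submodule K A V" "rmod_iso A V (direct_sum2 U (V\<lparr>carrier := K\<rparr>))"
    by (rule summand_kernel[OF Vf Um s])
  note Kf = fg_sub[OF Vf K(1)]
  have "zero_module (V\<lparr>carrier := K\<rparr>)" using indecomposableD[OF V U(1) Kf K(2)] U(2) by blast
  then have "rmod_iso A V U"
    using rmod_iso_trans[OF K(2) direct_sum2_zero[OF Um fg_module_right[OF Kf]]] by blast
  then show ?thesis by (rule rmod_iso_sym[OF fg_module_right[OF Vf]])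
qed

text \<open>Gaussian elimination on a two by two matrix with invertible pivot in the corner:
  \<open>X\<close> is identified with the vectors that \<open>\<phi>\<close> sends into the summand
  \<open>Y\<close>, and the inverse map is read off from \<open>\<psi>\<close> on that
  summand.\<close>

lemma cancel_unit:
  assumes U: "indecomposable_module A U" and mods: "right_module A X" "right_module A Y"
    and \<phi>: "\<phi> \<in> rmod_hom A (direct_sum2 U X) (direct_sum2 U Y)" "\<psi> \<in> rmod_hom A (direct_sum2 U Y) (direct_sum2 U X)"
      "\<And>z. z \<in> carrier (direct_sum2 U X) \<Longrightarrow> \<psi> (\<phi> z) = z" "\<And>z. z \<in> carrier (direct_sum2 U Y) \<Longrightarrow> \<phi> (\<psi> z) = z"
    and bij: "bij_betw (\<lambda>u. fst (\<phi> (u, \<zero>\<^bsub>X\<^esub>))) (carrier U) (carrier U)"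
  shows "rmod_iso A X Y"
proof -
  note Um = fg_module_right[OF indecomposable_fg[OF U]]
  interpret U: right_module A U by (rule Um)
  interpret X: right_module A X by fact
  interpret Y: right_module A Y by fact
  let ?a = "\<lambda>u. fst (\<phi> (u, \<zero>\<^bsub>X\<^esub>))"
  have a: "?a \<in> rmod_hom A U U"
    by (rule rmod_hom_comp[OF rmod_hom_comp[OF rmod_hom_inl[OF mods(1)] \<phi>(1)] rmod_hom_fst])
  define b where "b x = fst (\<phi> (\<zero>\<^bsub>U\<^esub>, x))" for x
  have b: "b \<in> rmod_hom A X U" unfolding b_def
    by (rule rmod_hom_comp[OF rmod_hom_comp[OF rmod_hom_inr[OF Um] \<phi>(1)] rmod_hom_fst])
  define k where "k = inv_into (carrier U) ?a"
  have k: "k \<in> rmod_hom A U U" unfolding k_def by (rule rmod_hom_inverse[OF Um a bij])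
  have ak: "?a (k u) = u" if "u \<in> carrier U" for u unfolding k_def by (rule bij_betw_inv_into_right[OF bij that])
  have ka: "k (?a u) = u" if "u \<in> carrier U" for u unfolding k_def by (rule bij_betw_inv_into_left[OF bij that])
  have fst\<phi>: "fst (\<phi> (u, x)) = ?a u \<oplus>\<^bsub>U\<^esub> b x" if "u \<in> carrier U" "x \<in> carrier X" for u x
    using rmod_homD(2)[OF \<phi>(1), of "(u, \<zero>\<^bsub>X\<^esub>)" "(\<zero>\<^bsub>U\<^esub>, x)"] that by (simp add: b_def)
  \<comment> \<open>The first coordinate solves the equation that the \<open>U\<close>-component of
    \<open>\<phi>\<close> on this vector be zero; \<open>k\<close> is the inverse of the
    pivot.\<close>
  define e where "e x = (k (\<ominus>\<^bsub>U\<^esub> b x), x)" for x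
  have e: "e \<in> rmod_hom A X (direct_sum2 U X)" unfolding e_def
    by (rule rmod_hom_pair[OF rmod_hom_comp[OF rmod_hom_neg[OF Um b] k] rmod_hom_id])
  note ec = rmod_homD(1)[OF e] and bc = rmod_homD(1)[OF b]
  have e0: "fst (\<phi> (e x)) = \<zero>\<^bsub>U\<^esub>" if x: "x \<in> carrier X" for x
    using fst\<phi>[of "k (\<ominus>\<^bsub>U\<^esub> b x)" x] ak[of "\<ominus>\<^bsub>U\<^esub> b x"] rmod_homD(1)[OF k] bc[OF x] x
    by (simp add: e_def U.M.l_neg)
  have h: "(\<lambda>x. snd (\<phi> (e x))) \<in> rmod_hom A X Y"
    by (rule rmod_hom_comp[OF rmod_hom_comp[OF e \<phi>(1)] rmod_hom_snd])
  have h': "(\<lambda>y. snd (\<psi> (\<zero>\<^bsub>U\<^esub>, y))) \<in> rmod_hom A Y X"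
    by (rule rmod_hom_comp[OF rmod_hom_comp[OF rmod_hom_inr[OF Um] \<phi>(2)] rmod_hom_snd])
  show ?thesis
  proof (rule rmod_isoI'[OF h h'])
    fix x assume x: "x \<in> carrier X"
    have "(\<zero>\<^bsub>U\<^esub>, snd (\<phi> (e x))) = \<phi> (e x)" using e0[OF x] by (simp add: prod_eq_iff)
    then show "snd (\<psi> (\<zero>\<^bsub>U\<^esub>, snd (\<phi> (e x)))) = x"
      using \<phi>(3)[OF ec[OF x]] by (simp add: e_def)
  next
    fix y assume y: "y \<in> carrier Y"
    have y0: "(\<zero>\<^bsub>U\<^esub>, y) \<in> carrier (direct_sum2 U Y)" using y by simp
    obtain u x where ux: "\<psi> (\<zero>\<^bsub>U\<^esub>, y) = (u, x)" "u \<in> carrier U" "x \<in> carrier X"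
      using rmod_homD(1)[OF \<phi>(2) y0] by (cases "\<psi> (\<zero>\<^bsub>U\<^esub>, y)") auto
    have \<phi>ux: "\<phi> (u, x) = (\<zero>\<^bsub>U\<^esub>, y)" using \<phi>(4)[OF y0] ux by simp
    then have z: "?a u \<oplus>\<^bsub>U\<^esub> b x = \<zero>\<^bsub>U\<^esub>" using fst\<phi>[OF ux(2,3)] by simp
    have "\<ominus>\<^bsub>U\<^esub> b x = ?a u" by (rule U.M.minus_equality[OF z bc[OF ux(3)] rmod_homD(1)[OF a ux(2)]])
    then have "e x = (u, x)" using ka[OF ux(2)] by (simp add: e_def)
    then show "snd (\<phi> (e (snd (\<psi> (\<zero>\<^bsub>U\<^esub>, y))))) = y" using ux(1) \<phi>ux by simp
  qed
qed

text \<open>If the component \<open>U \<rightarrow> U\<close> of the given isomorphism is not invertible, it becomes the identity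
  after adding to it a multiple of the component \<open>U \<rightarrow> Y\<close>, because \<open>End U\<close> is local.\<close>

lemma cancel_indecomposable:
  assumes U: "indecomposable_module A U" and mods: "right_module A X" "right_module A Y"
    and iso: "rmod_iso A (direct_sum2 U X) (direct_sum2 U Y)"
  shows "rmod_iso A X Y"
proof -
  note Um = fg_module_right[OF indecomposable_fg[OF U]]
  interpret U: right_module A U by (rule Um)
  interpret X: right_module A X by fact
  interpret Y: right_module A Y by fact
  note UX = right_module_direct_sum2[OF Um mods(1)]
  obtain \<phi> \<psi> where \<phi>: "\<phi> \<in> rmod_hom A (direct_sum2 U X) (direct_sum2 U Y)" "\<psi> \<in> rmod_hom A (direct_sum2 U Y) (direct_sum2 U X)"
      "\<And>z. z \<in> carrier (direct_sum2 U X) \<Longrightarrow> \<psi> (\<phi> z) = z" "\<And>z. z \<in> carrier (direct_sum2 U Y) \<Longrightarrow> \<phi> (\<psi> z) = z"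
    by (rule rmod_isoE[OF UX iso]) blast
  define a where "a u = fst (\<phi> (u, \<zero>\<^bsub>X\<^esub>))" for u
  define c where "c u = snd (\<phi> (u, \<zero>\<^bsub>X\<^esub>))" for u
  define a' where "a' u = fst (\<psi> (u, \<zero>\<^bsub>Y\<^esub>))" for u
  define b' where "b' y = fst (\<psi> (\<zero>\<^bsub>U\<^esub>, y))" for y
  have a: "a \<in> rmod_hom A U U" unfolding a_def
    by (rule rmod_hom_comp[OF rmod_hom_comp[OF rmod_hom_inl[OF mods(1)] \<phi>(1)] rmod_hom_fst])
  have c: "c \<in> rmod_hom A U Y" unfolding c_def
    by (rule rmod_hom_comp[OF rmod_hom_comp[OF rmod_hom_inl[OF mods(1)] \<phi>(1)] rmod_hom_snd])
  have a': "a' \<in> rmod_hom A U U" unfolding a'_def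
    by (rule rmod_hom_comp[OF rmod_hom_comp[OF rmod_hom_inl[OF mods(2)] \<phi>(2)] rmod_hom_fst])
  have b': "b' \<in> rmod_hom A Y U" unfolding b'_def
    by (rule rmod_hom_comp[OF rmod_hom_comp[OF rmod_hom_inr[OF Um] \<phi>(2)] rmod_hom_fst])
  have sum: "a' (a u) \<oplus>\<^bsub>U\<^esub> b' (c u) = u" if u: "u \<in> carrier U" for u
  proof -
    have u0: "(u, \<zero>\<^bsub>X\<^esub>) \<in> carrier (direct_sum2 U X)" using u by simp
    have "\<psi> (\<phi> (u, \<zero>\<^bsub>X\<^esub>)) = \<psi> (a u, \<zero>\<^bsub>Y\<^esub>) \<oplus>\<^bsub>direct_sum2 U X\<^esub> \<psi> (\<zero>\<^bsub>U\<^esub>, c u)"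
      using rmod_homD(2)[OF \<phi>(2), of "(a u, \<zero>\<^bsub>Y\<^esub>)" "(\<zero>\<^bsub>U\<^esub>, c u)"] rmod_homD(1)[OF a u] rmod_homD(1)[OF c u]
      by (simp add: a_def c_def)
    then show ?thesis using \<phi>(3)[OF u0] by (simp add: a'_def b'_def prod_eq_iff)
  qed
  from indecomposable_local[OF U rmod_hom_comp[OF a a'] rmod_hom_comp[OF c b'] sum]
  show ?thesis
  proof
    assume "bij_betw (\<lambda>x. a' (a x)) (carrier U) (carrier U)"
    then have "inj_on a (carrier U)" by (auto simp: bij_betw_def inj_on_def)
    then have "bij_betw a (carrier U) (carrier U)" by (rule indecomposable_inj_endo_bij[OF U a])
    then show ?thesis using cancel_unit[OF U mods \<phi>] by (simp add: a_def[abs_def])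
  next
    assume bij: "bij_betw (\<lambda>x. b' (c x)) (carrier U) (carrier U)"
    define k where "k = inv_into (carrier U) (\<lambda>x. b' (c x))"
    have k: "k \<in> rmod_hom A U U" unfolding k_def by (rule rmod_hom_inverse[OF Um rmod_hom_comp[OF c b'] bij])
    have kbc: "k (b' (c u)) = u" if "u \<in> carrier U" for u
      unfolding k_def by (rule bij_betw_inv_into_left[OF bij that])
    \<comment> \<open>Chosen so that adding \<open>w (c u)\<close> to \<open>a u\<close> gives
      \<open>u\<close>: as \<open>k (b' (c u))\<close> is \<open>u\<close>, the value of
      \<open>w\<close> at \<open>c u\<close> is \<open>u \<ominus> a u\<close>. The shear
      \<open>\<theta>\<close> performs this row operation and is invertible.\<close>
    define w where "w y = k (b' y) \<ominus>\<^bsub>U\<^esub> a (k (b' y))" for y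
    have w: "w \<in> rmod_hom A Y U" unfolding w_def
      by (rule rmod_hom_minus[OF Um rmod_hom_comp[OF b' k] rmod_hom_comp[OF rmod_hom_comp[OF b' k] a]])
    define \<theta> where "\<theta> z = (fst z \<oplus>\<^bsub>U\<^esub> w (snd z), snd z)" for z
    define \<theta>' where "\<theta>' z = (fst z \<ominus>\<^bsub>U\<^esub> w (snd z), snd z)" for z
    have \<theta>: "\<theta> \<in> rmod_hom A (direct_sum2 U Y) (direct_sum2 U Y)" unfolding \<theta>_def
      by (rule rmod_hom_pair[OF rmod_hom_add[OF Um rmod_hom_fst rmod_hom_comp[OF rmod_hom_snd w]] rmod_hom_snd])
    have \<theta>': "\<theta>' \<in> rmod_hom A (direct_sum2 U Y) (direct_sum2 U Y)" unfolding \<theta>'_def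
      by (rule rmod_hom_pair[OF rmod_hom_minus[OF Um rmod_hom_fst rmod_hom_comp[OF rmod_hom_snd w]] rmod_hom_snd])
    have inv: "\<theta>' (\<theta> z) = z \<and> \<theta> (\<theta>' z) = z" if zc: "z \<in> carrier (direct_sum2 U Y)" for z
    proof -
      obtain u y where z: "z = (u, y)" "u \<in> carrier U" "y \<in> carrier Y" using zc by auto
      note wy = rmod_homD(1)[OF w z(3)]
      have "u \<oplus>\<^bsub>U\<^esub> w y \<ominus>\<^bsub>U\<^esub> w y = u" using z(2) wy by algebra
      moreover have "u \<ominus>\<^bsub>U\<^esub> w y \<oplus>\<^bsub>U\<^esub> w y = u" using z(2) wy by algebra
      ultimately show ?thesis by (simp add: \<theta>_def \<theta>'_def z(1))
    qed
    have id: "fst (\<theta> (\<phi> (u, \<zero>\<^bsub>X\<^esub>))) = u" if u: "u \<in> carrier U" for u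
    proof -
      have "fst (\<theta> (\<phi> (u, \<zero>\<^bsub>X\<^esub>))) = a u \<oplus>\<^bsub>U\<^esub> (u \<ominus>\<^bsub>U\<^esub> a u)"
        unfolding \<theta>_def fst_conv a_def[symmetric] c_def[symmetric] w_def kbc[OF u] ..
      also have "\<dots> = u" using u rmod_homD(1)[OF a u] by algebra
      finally show ?thesis .
    qed
    have "bij_betw (\<lambda>u. fst (\<theta> (\<phi> (u, \<zero>\<^bsub>X\<^esub>)))) (carrier U) (carrier U)"
      using bij_betw_cong[of "carrier U" "\<lambda>u. u", OF id[symmetric]] bij_betw_id[of "carrier U"] by (simp add: id_def)
    then show ?thesis
      by (rule cancel_unit[OF U mods rmod_hom_comp[OF \<phi>(1) \<theta>] rmod_hom_comp[OF \<theta>' \<phi>(2)], rotated -1])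
        (simp_all only: inv rmod_homD(1)[OF \<phi>(1)] rmod_homD(1)[OF \<phi>(2)] rmod_homD(1)[OF \<theta>'] \<phi>(3,4) simp_thms)
  qed
qed

end

section \<open>Sums of lists of modules\<close>

lemma direct_sum_cong:
  fixes N N' :: "nat \<Rightarrow> ('a, 'm) module"
  assumes "\<And>i. i < k \<Longrightarrow> N i = N' i" shows "direct_sum k N = direct_sum k N'"
proof -
  have "(\<lambda>i\<in>{..<k}. h (N i) i) = (\<lambda>i\<in>{..<k}. h (N' i) i)" for h :: "('a, 'm) module \<Rightarrow> nat \<Rightarrow> 'm"
    using assms by (auto intro!: restrict_ext)
  then show ?thesis
    unfolding direct_sum_def using assms by (auto intro!: PiE_cong ext)
qed

text \<open>The list is reversed because \<open>direct_sum_Suc\<close> splits off the last summand.\<close>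

definition list_sum :: "('a, 'm) module list \<Rightarrow> ('a, nat \<Rightarrow> 'm) module" where
  "list_sum l = direct_sum (length l) (nth (rev l))"

lemma direct_sum_eq_list_sum: "direct_sum k N = list_sum (rev (map N [0..<k]))"
  unfolding list_sum_def by (simp, rule direct_sum_cong, simp)

lemma direct_sum_const_eq_list_sum: "direct_sum k (\<lambda>_. Q) = list_sum (replicate k Q)"
  unfolding list_sum_def by (simp, rule direct_sum_cong, simp)

lemma zero_module_list_sum_Nil: "zero_module (list_sum [])"
  unfolding list_sum_def by (simp only: list.size zero_module_direct_sum_0)

context base_ring
begin

lemma right_module_list_sum: "(\<And>U. U \<in> set l \<Longrightarrow> right_module A U) \<Longrightarrow> right_module A (list_sum l)"
  unfolding list_sum_def
  by (rule right_module_direct_sum[OF ring_axioms]) (metis length_rev nth_mem set_rev)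

lemma fg_module_list_sum: "(\<And>U. U \<in> set l \<Longrightarrow> fg_module A U) \<Longrightarrow> fg_module A (list_sum l)"
  unfolding list_sum_def
  by (rule fg_module_direct_sum[OF ring_axioms]) (metis length_rev nth_mem set_rev)

lemma list_sum_Cons:
  assumes "\<And>V. V \<in> set (U # l) \<Longrightarrow> right_module A V"
  shows "rmod_iso A (list_sum (U # l)) (direct_sum2 U (list_sum l))"
proof -
  have "list_sum l = direct_sum (length l) (nth (rev (U # l)))"
    unfolding list_sum_def by (rule direct_sum_cong) (simp add: nth_append)
  moreover have "nth (rev (U # l)) (length l) = U" by (simp add: nth_append)
  moreover have "list_sum (U # l) = direct_sum (Suc (length l)) (nth (rev (U # l)))" by (simp add: list_sum_def)
  ultimately have "rmod_iso A (list_sum (U # l)) (direct_sum2 (list_sum l) U)"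
    using direct_sum_Suc[of A "length l" "nth (rev (U # l))"] by simp
  then show ?thesis by (rule rmod_iso_trans[OF _ direct_sum2_commute])
qed

lemma list_sum_append:
  assumes "\<And>V. V \<in> set (l @ l') \<Longrightarrow> right_module A V"
  shows "rmod_iso A (list_sum (l @ l')) (direct_sum2 (list_sum l) (list_sum l'))"
  using assms
proof (induction l)
  case Nil
  have m: "right_module A (list_sum l')" "right_module A (list_sum [])"
    using Nil by (auto intro: right_module_list_sum)
  have "rmod_iso A (list_sum l') (direct_sum2 (list_sum l') (list_sum []))"
    by (rule rmod_iso_sym[OF right_module_direct_sum2[OF m] direct_sum2_zero[OF m zero_module_list_sum_Nil]])
  then show ?case unfolding append_Nil by (rule rmod_iso_trans[OF _ direct_sum2_commute])
next
  case (Cons U l)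
  have m: "right_module A U" "right_module A (list_sum l)" "right_module A (list_sum l')" "right_module A (list_sum (l @ l'))"
    "right_module A (list_sum (U # l))"
    using Cons.prems by (auto intro!: right_module_list_sum)
  have 1: "rmod_iso A (list_sum (U # l @ l')) (direct_sum2 U (list_sum (l @ l')))"
    by (rule list_sum_Cons) (use Cons.prems in auto)
  have 2: "rmod_iso A (direct_sum2 U (list_sum (l @ l'))) (direct_sum2 U (direct_sum2 (list_sum l) (list_sum l')))"
    by (rule direct_sum2_cong[OF m(1,4) rmod_iso_refl Cons.IH]) (use Cons.prems in auto)
  have 3: "rmod_iso A (direct_sum2 U (direct_sum2 (list_sum l) (list_sum l'))) (direct_sum2 (direct_sum2 U (list_sum l)) (list_sum l'))"
    by (rule rmod_iso_sym[OF _ direct_sum2_assoc]) (intro right_module_direct_sum2 m)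
  have "rmod_iso A (list_sum (U # l)) (direct_sum2 U (list_sum l))"
    by (rule list_sum_Cons) (use Cons.prems in auto)
  then have "rmod_iso A (direct_sum2 U (list_sum l)) (list_sum (U # l))" by (rule rmod_iso_sym[OF m(5)])
  then have 4: "rmod_iso A (direct_sum2 (direct_sum2 U (list_sum l)) (list_sum l')) (direct_sum2 (list_sum (U # l)) (list_sum l'))"
    by (rule direct_sum2_cong[OF right_module_direct_sum2[OF m(1,2)] m(3) _ rmod_iso_refl])
  show ?case unfolding append_Cons
    by (rule rmod_iso_trans[OF 1 rmod_iso_trans[OF 2 rmod_iso_trans[OF 3 4]]])
qed

text \<open>Equality of \<open>count_list\<close> expresses that the lists are permutations of each
  other. The head of the first list is located in the second and moved to the front by commutativity
  and associativity of sums.\<close>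

lemma list_sum_permute:
  assumes "\<And>V. V \<in> set l \<Longrightarrow> right_module A V" "count_list l = count_list l'"
  shows "rmod_iso A (list_sum l) (list_sum l')"
  using assms
proof (induction l arbitrary: l')
  case Nil
  then have "set l' = {}" by (metis count_list.simps(1) count_list_0_iff equals0I)
  then show ?case by (simp add: rmod_iso_refl)
next
  case (Cons U l)
  have c: "count_list (U # l) V = count_list l' V" for V by (simp only: Cons.prems(2))
  have "U \<in> set l'" using c[of U] count_list_0_iff[of l' U] by auto
  then obtain xs ys where l': "l' = xs @ U # ys" by (meson split_list)
  have ms: "count_list l = count_list (xs @ ys)"
  proof
    fix V show "count_list l V = count_list (xs @ ys) V" using c[of V] by (simp add: l' split: if_splits)
  qed
  have s: "set l = set (xs @ ys)" using ms by (metis count_list_0_iff subsetI subset_antisym)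
  have all: "V \<in> set (U # xs @ ys) \<Longrightarrow> right_module A V" for V using Cons.prems(1) s by auto
  have m: "right_module A U" "right_module A (list_sum l)" "right_module A (list_sum xs)" "right_module A (list_sum ys)"
    "right_module A (list_sum (xs @ ys))" "right_module A (list_sum (U # ys))" "right_module A (list_sum (U # xs))"
    using all s by (auto intro!: right_module_list_sum)
  have 1: "rmod_iso A (list_sum (U # l)) (direct_sum2 U (list_sum l))"
    by (rule list_sum_Cons) (use Cons.prems in auto)
  have 2: "rmod_iso A (direct_sum2 U (list_sum l)) (direct_sum2 U (list_sum (xs @ ys)))"
    by (rule direct_sum2_cong[OF m(1,2) rmod_iso_refl Cons.IH[OF _ ms]]) (use Cons.prems in auto)
  have 3: "rmod_iso A (direct_sum2 U (list_sum (xs @ ys))) (direct_sum2 U (direct_sum2 (list_sum xs) (list_sum ys)))"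
    by (rule direct_sum2_cong[OF m(1,5) rmod_iso_refl list_sum_append]) (use all in auto)
  have 4: "rmod_iso A (direct_sum2 U (direct_sum2 (list_sum xs) (list_sum ys))) (direct_sum2 (direct_sum2 U (list_sum xs)) (list_sum ys))"
    by (rule rmod_iso_sym[OF _ direct_sum2_assoc]) (intro right_module_direct_sum2 m)
  have 5: "rmod_iso A (direct_sum2 (direct_sum2 U (list_sum xs)) (list_sum ys)) (direct_sum2 (direct_sum2 (list_sum xs) U) (list_sum ys))"
    by (rule direct_sum2_cong[OF right_module_direct_sum2[OF m(1,3)] m(4) direct_sum2_commute rmod_iso_refl])
  have "rmod_iso A (direct_sum2 U (list_sum ys)) (list_sum (U # ys))"
    by (rule rmod_iso_sym[OF m(6) list_sum_Cons]) (use all in auto)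
  then have 6: "rmod_iso A (direct_sum2 (list_sum xs) (direct_sum2 U (list_sum ys))) (direct_sum2 (list_sum xs) (list_sum (U # ys)))"
    by (rule direct_sum2_cong[OF m(3) right_module_direct_sum2[OF m(1,4)] rmod_iso_refl])
  have 7: "rmod_iso A (direct_sum2 (list_sum xs) (list_sum (U # ys))) (list_sum l')"
    unfolding l' by (rule rmod_iso_sym[OF right_module_list_sum list_sum_append]) (use all in auto)
  show ?case
    by (rule rmod_iso_trans[OF 1 rmod_iso_trans[OF 2 rmod_iso_trans[OF 3 rmod_iso_trans[OF 4
        rmod_iso_trans[OF 5 rmod_iso_trans[OF direct_sum2_assoc rmod_iso_trans[OF 6 7]]]]]]])
qed

lemma summand_list_sum:
  assumes "\<And>V. V \<in> set l \<Longrightarrow> right_module A V" "U \<in> set l"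
  shows "summand A U (list_sum l)"
proof -
  obtain xs ys where l: "l = xs @ U # ys" using assms(2) by (meson split_list)
  have all: "V \<in> set (U # xs @ ys) \<Longrightarrow> right_module A V" for V using assms(1) by (auto simp: l)
  have m: "right_module A U" "right_module A (list_sum (xs @ ys))" "right_module A (list_sum l)" "right_module A (list_sum (U # xs @ ys))"
    using all assms(1) by (auto intro!: right_module_list_sum)
  have "rmod_iso A (direct_sum2 U (list_sum (xs @ ys))) (list_sum (U # xs @ ys))"
    by (rule rmod_iso_sym[OF m(4) list_sum_Cons]) (rule all)
  moreover have "rmod_iso A (list_sum (U # xs @ ys)) (list_sum l)"
    by (rule list_sum_permute) (use all in \<open>auto simp: l fun_eq_iff\<close>)
  ultimately have "rmod_iso A (direct_sum2 U (list_sum (xs @ ys))) (list_sum l)" by (rule rmod_iso_trans)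
  then have "summand A (direct_sum2 U (list_sum (xs @ ys))) (list_sum l)"
    by (rule rmod_iso_imp_summand[OF right_module_direct_sum2[OF m(1,2)]])
  then show ?thesis by (rule summand_trans[OF summand_direct_sum2(1)[OF m(1,2)]])
qed

text \<open>Replaces summands by representatives of their isomorphism classes, so that a module is
  described by a list of indices in which repetition stands for multiplicity.\<close>

lemma list_sum_iso_map:
  assumes "\<And>V. V \<in> set l \<Longrightarrow> right_module A V" "\<And>j. j < t \<Longrightarrow> right_module A (N j)"
    and "\<And>V. V \<in> set l \<Longrightarrow> \<exists>j<t. rmod_iso A V (N j)"
  shows "\<exists>js. set js \<subseteq> {..<t} \<and> rmod_iso A (list_sum l) (list_sum (map N js))"
  using assms(1,3)
proof (induction l)
  case Nil
  show ?case by (intro exI[of _ "[]"] conjI zero_modules_iso right_module_list_sum) (simp_all add: zero_module_list_sum_Nil)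
next
  case (Cons V l)
  then obtain js where js: "set js \<subseteq> {..<t}" "rmod_iso A (list_sum l) (list_sum (map N js))" by auto
  obtain j where j: "j < t" "rmod_iso A V (N j)" using Cons.prems(2) by auto
  have m: "right_module A V" "right_module A (list_sum l)" "right_module A (list_sum (map N (j # js)))"
    using Cons.prems j assms(2) subsetD[OF js(1)] by (auto intro!: right_module_list_sum)
  have "rmod_iso A (list_sum (V # l)) (direct_sum2 V (list_sum l))"
    by (rule list_sum_Cons) (use Cons.prems in auto)
  moreover have "rmod_iso A (direct_sum2 V (list_sum l)) (direct_sum2 (N j) (list_sum (map N js)))"
    by (rule direct_sum2_cong[OF m(1,2) j(2) js(2)])
  moreover have "rmod_iso A (direct_sum2 (N j) (list_sum (map N js))) (list_sum (map N (j # js)))"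
    unfolding list.map by (rule rmod_iso_sym[OF m(3)[unfolded list.map] list_sum_Cons]) (use js j assms(2) in auto)
  ultimately have "rmod_iso A (list_sum (V # l)) (list_sum (map N (j # js)))" by (blast intro: rmod_iso_trans)
  then show ?case using js j by (intro exI[of _ "j # js"]) auto
qed

end

section \<open>Existence of decompositions, cancellation, and the category
  \<open>add Q\<close>\<close>

context artin_ring
begin

lemma cancel_list_sum:
  assumes "\<And>U. U \<in> set l \<Longrightarrow> indecomposable_module A U" and mods: "right_module A X" "right_module A Y"
    and "rmod_iso A (direct_sum2 (list_sum l) X) (direct_sum2 (list_sum l) Y)"
  shows "rmod_iso A X Y"
  using assms(1,4)
proof (induction l)
  case Nil
  have z: "right_module A (list_sum [])" by (rule right_module_list_sum) simp
  have x: "rmod_iso A (direct_sum2 (list_sum []) X) X"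
    by (rule rmod_iso_trans[OF direct_sum2_commute direct_sum2_zero[OF mods(1) z zero_module_list_sum_Nil]])
  have y: "rmod_iso A (direct_sum2 (list_sum []) Y) Y"
    by (rule rmod_iso_trans[OF direct_sum2_commute direct_sum2_zero[OF mods(2) z zero_module_list_sum_Nil]])
  have "rmod_iso A X (direct_sum2 (list_sum []) X)"
    by (rule rmod_iso_sym[OF right_module_direct_sum2[OF z mods(1)] x])
  then show ?case by (rule rmod_iso_trans[OF _ rmod_iso_trans[OF Nil(2) y]])
next
  case (Cons U l)
  have U: "right_module A V" if "V \<in> set (U # l)" for V
    by (rule fg_module_right[OF indecomposable_fg[OF Cons.prems(1)[OF that]]])
  have m: "right_module A U" "right_module A (list_sum l)" "right_module A (list_sum (U # l))"
    using U by (auto intro!: right_module_list_sum)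
  note D = list_sum_Cons[OF U]
  have D': "rmod_iso A (direct_sum2 U (list_sum l)) (list_sum (U # l))" by (rule rmod_iso_sym[OF m(3) D])
  note Um = right_module_direct_sum2[OF m(1,2)]
  have x: "rmod_iso A (direct_sum2 U (direct_sum2 (list_sum l) X)) (direct_sum2 (list_sum (U # l)) X)"
    by (rule rmod_iso_trans[OF rmod_iso_sym[OF right_module_direct_sum2[OF Um mods(1)] direct_sum2_assoc]
        direct_sum2_cong[OF Um mods(1) D' rmod_iso_refl]])
  have y: "rmod_iso A (direct_sum2 (list_sum (U # l)) Y) (direct_sum2 U (direct_sum2 (list_sum l) Y))"
    by (rule rmod_iso_trans[OF direct_sum2_cong[OF m(3) mods(2) D rmod_iso_refl] direct_sum2_assoc])
  have "rmod_iso A (direct_sum2 (list_sum l) X) (direct_sum2 (list_sum l) Y)"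
    by (rule cancel_indecomposable[OF Cons.prems(1) right_module_direct_sum2[OF m(2) mods(1)]
          right_module_direct_sum2[OF m(2) mods(2)] rmod_iso_trans[OF x rmod_iso_trans[OF Cons.prems(2) y]]]) simp
  then show ?case by (rule Cons.IH[rotated]) (simp add: Cons.prems(1))
qed

text \<open>Induction on the rank of the whole module. The rank function is a variable of the
  induction: each summand receives the rank pulled back along its embedding into \<open>X\<close>,
  for which its own value is smaller.\<close>

lemma decomposition_bounded:
  fixes X :: "'a fgmod"
  assumes "fg_module A X" and "\<And>N N'. submodule N A X \<Longrightarrow> submodule N' A X \<Longrightarrow> N \<subset> N' \<Longrightarrow> r N < (r N' :: nat)"
  shows "\<exists>l :: 'a fgmod list. (\<forall>U \<in> set l. indecomposable_module A U) \<and> rmod_iso A X (list_sum l)"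
  using assms
proof (induction "r (carrier X)" arbitrary: X r rule: less_induct)
  case less
  note X = fg_module_right[OF less.prems(1)]
  show ?case
  proof (cases "zero_module X \<or> indecomposable_module A X")
    case True
    then show ?thesis
    proof
      assume "zero_module X"
      then have "rmod_iso A X (list_sum [])"
        by (intro zero_modules_iso[OF X] right_module_list_sum zero_module_list_sum_Nil) simp_all
      then show ?thesis by (intro exI[of _ "[]"]) simp
    next
      assume "indecomposable_module A X"
      have z: "right_module A (list_sum [])" by (rule right_module_list_sum) simp
      have d: "right_module A (list_sum [X])" by (rule right_module_list_sum) (simp add: X)
      have "rmod_iso A (list_sum [X]) X"
        by (rule rmod_iso_trans[OF list_sum_Cons direct_sum2_zero[OF X z zero_module_list_sum_Nil]]) (simp add: X)
      then have "rmod_iso A X (list_sum [X])" by (rule rmod_iso_sym[OF d])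
      then show ?thesis using \<open>indecomposable_module A X\<close> by (intro exI[of _ "[X]"]) simp
    qed
  next
    case False
    then obtain Y Z :: "'a fgmod" where YZ: "fg_module A Y" "fg_module A Z" "rmod_iso A X (direct_sum2 Y Z)"
      "\<not> zero_module Y" "\<not> zero_module Z"
      using less.prems(1) unfolding indecomposable_module_def by blast
    note m = fg_module_right[OF YZ(1)] fg_module_right[OF YZ(2)]
    obtain \<phi> \<psi> where \<phi>: "\<phi> \<in> rmod_hom A X (direct_sum2 Y Z)" "\<psi> \<in> rmod_hom A (direct_sum2 Y Z) X"
      "\<And>x. x \<in> carrier X \<Longrightarrow> \<psi> (\<phi> x) = x" "\<And>x. x \<in> carrier (direct_sum2 Y Z) \<Longrightarrow> \<phi> (\<psi> x) = x"
      by (rule rmod_isoE[OF X YZ(3)]) blast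
    \<comment> \<open>The element \<open>w\<close> outside the image of \<open>j\<close> witnesses
      that \<open>V\<close> becomes a proper submodule of \<open>X\<close>; below it is a nonzero
      element of the other summand.\<close>
    have step: "\<exists>l :: 'a fgmod list. (\<forall>U \<in> set l. indecomposable_module A U) \<and> rmod_iso A V (list_sum l)"
      if V: "fg_module A V" and j: "j \<in> rmod_hom A V (direct_sum2 Y Z)" "inj_on j (carrier V)"
        and w: "w \<in> carrier (direct_sum2 Y Z)" "w \<notin> j ` carrier V" for V :: "'a fgmod" and j w
    proof (rule less.hyps[of "\<lambda>N. r ((\<lambda>v. \<psi> (j v)) ` N)" V])
      note Vm = fg_module_right[OF V]
      interpret j: module_hom A V X "\<lambda>v. \<psi> (j v)"
        by (rule module_homI[OF Vm X rmod_hom_comp[OF j(1) \<phi>(2)]])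
      have inj: "inj_on (\<lambda>v. \<psi> (j v)) (carrier V)"
      proof (rule inj_onI)
        fix u v assume u: "u \<in> carrier V" "v \<in> carrier V" "\<psi> (j u) = \<psi> (j v)"
        have "j u = j v"
          by (rule box_equals[OF arg_cong[OF u(3), of \<phi>] \<phi>(4)[OF rmod_homD(1)[OF j(1) u(1)]] \<phi>(4)[OF rmod_homD(1)[OF j(1) u(2)]]])
        then show "u = v" by (rule inj_onD[OF j(2) _ u(1,2)])
      qed
      have "\<psi> w \<notin> (\<lambda>v. \<psi> (j v)) ` carrier V"
      proof
        assume "\<psi> w \<in> (\<lambda>v. \<psi> (j v)) ` carrier V"
        then obtain v where v: "v \<in> carrier V" "\<psi> w = \<psi> (j v)" by auto
        have "w = j v"
          by (rule box_equals[OF arg_cong[OF v(2), of \<phi>] \<phi>(4)[OF w(1)] \<phi>(4)[OF rmod_homD(1)[OF j(1) v(1)]]])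
        then show False using w(2) v(1) by blast
      qed
      then have "(\<lambda>v. \<psi> (j v)) ` carrier V \<subset> carrier X"
        using j.closed rmod_homD(1)[OF \<phi>(2) w(1)] by auto
      then show "r ((\<lambda>v. \<psi> (j v)) ` carrier V) < r (carrier X)"
        by (rule less.prems(2)[OF j.submodule_range submodule_carrier[OF X]])
      show "fg_module A V" by (rule V)
      fix N N' assume N: "submodule N A V" "submodule N' A V" "N \<subset> N'"
      have "(\<lambda>v. \<psi> (j v)) ` N \<subset> (\<lambda>v. \<psi> (j v)) ` N'"
        by (rule image_strict_mono[OF inj_on_subset[OF inj submoduleD(1)[OF N(2)]] N(3)])
      then show "r ((\<lambda>v. \<psi> (j v)) ` N) < r ((\<lambda>v. \<psi> (j v)) ` N')"
        by (rule less.prems(2)[OF j.submodule_image[OF N(1)] j.submodule_image[OF N(2)]])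
    qed
    interpret Y: right_module A Y by (rule m)
    interpret Z: right_module A Z by (rule m)
    obtain z where z: "z \<in> carrier Z" "z \<noteq> \<zero>\<^bsub>Z\<^esub>"
      using YZ(5) Z.M.zero_closed unfolding zero_module_def by blast
    obtain y where y: "y \<in> carrier Y" "y \<noteq> \<zero>\<^bsub>Y\<^esub>"
      using YZ(4) Y.M.zero_closed unfolding zero_module_def by blast
    obtain l :: "'a fgmod list" where l: "\<forall>U \<in> set l. indecomposable_module A U" "rmod_iso A Y (list_sum l)"
      using step[OF YZ(1) rmod_hom_inl[OF m(2)], of "(\<zero>\<^bsub>Y\<^esub>, z)"] z by (auto simp: inj_on_def)
    obtain l' :: "'a fgmod list" where l': "\<forall>U \<in> set l'. indecomposable_module A U" "rmod_iso A Z (list_sum l')"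
      using step[OF YZ(2) rmod_hom_inr[OF m(1)], of "(y, \<zero>\<^bsub>Z\<^esub>)"] y by (auto simp: inj_on_def)
    have all: "right_module A V" if "V \<in> set (l @ l')" for V
      using that l(1) l'(1) by (auto intro: fg_module_right indecomposable_fg)
    have "rmod_iso A (direct_sum2 (list_sum l) (list_sum l')) (list_sum (l @ l'))"
      by (rule rmod_iso_sym[OF right_module_list_sum list_sum_append]) (rule all, assumption)+
    then have "rmod_iso A X (list_sum (l @ l'))"
      by (rule rmod_iso_trans[OF YZ(3) rmod_iso_trans[OF direct_sum2_cong[OF m l(2) l'(2)]]])
    then show ?thesis using l(1) l'(1) by (intro exI[of _ "l @ l'"]) auto
  qed
qed

lemma decomposition:
  assumes "fg_module A X"
  obtains l :: "'a fgmod list" where "\<And>U. U \<in> set l \<Longrightarrow> indecomposable_module A U" "rmod_iso A X (list_sum l)"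
proof -
  obtain X' :: "'a fgmod" where X': "fg_module A X'" "rmod_iso A X X'" by (rule fgmod_copy[OF assms])
  obtain r :: "(nat \<Rightarrow> 'a) set set \<Rightarrow> nat" where r: "\<And>L L'. submodule L A X' \<Longrightarrow> submodule L' A X' \<Longrightarrow> L \<subset> L' \<Longrightarrow> r L < r L'"
    by (rule fin_lengthE[OF fg_imp_fin_length[OF X'(1)]]) blast
  have "\<exists>l :: 'a fgmod list. (\<forall>U \<in> set l. indecomposable_module A U) \<and> rmod_iso A X' (list_sum l)"
    by (rule decomposition_bounded[where r = r, OF X'(1)]) (rule r; assumption)
  then obtain l :: "'a fgmod list"
    where l: "\<forall>U \<in> set l. indecomposable_module A U" "rmod_iso A X' (list_sum l)" by blast
  show ?thesis by (rule that[OF _ rmod_iso_trans[OF X'(2) l(2)]]) (use l(1) in blast)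
qed

text \<open>A decomposition of \<open>Z\<close> allows its indecomposable summands, whose
  endomorphism rings are local, to be cancelled one at a time.\<close>

lemma cancel_fg:
  assumes Z: "fg_module A Z" and mods: "right_module A X" "right_module A Y"
    and iso: "rmod_iso A (direct_sum2 X Z) (direct_sum2 Y Z)"
  shows "rmod_iso A X Y"
proof -
  obtain l :: "'a fgmod list" where l: "\<And>U. U \<in> set l \<Longrightarrow> indecomposable_module A U" "rmod_iso A Z (list_sum l)"
    by (rule decomposition[OF Z]) blast
  note Zm = fg_module_right[OF Z]
  have lm: "right_module A (list_sum l)"
    by (rule right_module_list_sum) (rule fg_module_right[OF indecomposable_fg[OF l(1)]])
  have l': "rmod_iso A (list_sum l) Z" by (rule rmod_iso_sym[OF Zm l(2)])
  have 1: "rmod_iso A (direct_sum2 (list_sum l) X) (direct_sum2 X Z)"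
    by (rule rmod_iso_trans[OF direct_sum2_cong[OF lm mods(1) l' rmod_iso_refl] direct_sum2_commute])
  have 2: "rmod_iso A (direct_sum2 Y Z) (direct_sum2 (list_sum l) Y)"
    by (rule rmod_iso_trans[OF direct_sum2_commute direct_sum2_cong[OF Zm mods(2) l(2) rmod_iso_refl]])
  show ?thesis
    by (rule cancel_list_sum[OF l(1) mods rmod_iso_trans[OF 1 rmod_iso_trans[OF iso 2]]])
qed

lemma indecomposable_summand_direct_sum:
  assumes U: "indecomposable_module A U" and N: "\<And>i. i < k \<Longrightarrow> right_module A (N i)"
    and s: "summand A U (direct_sum k N)"
  shows "\<exists>i<k. summand A U (N i)"
  using N s
proof (induction k)
  case 0
  obtain i p where i: "i \<in> rmod_hom A U (direct_sum 0 N)" "p \<in> rmod_hom A (direct_sum 0 N) U"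
    "\<And>x. x \<in> carrier U \<Longrightarrow> p (i x) = x"
    by (rule summandE[OF 0(2)]) blast
  note Um = fg_module_right[OF indecomposable_fg[OF U]]
  interpret p: module_hom A "direct_sum 0 N" U p
    by (rule module_homI[OF right_module_direct_sum[OF ring_axioms] Um i(2)]) simp
  have "x = \<zero>\<^bsub>U\<^esub>" if "x \<in> carrier U" for x
    using i(3)[OF that] rmod_homD(1)[OF i(1) that] zero_module_direct_sum_0[of N] p.zero
    by (metis singletonD zero_module_def)
  then have "zero_module U" using p.N.M.zero_closed unfolding zero_module_def by blast
  then show ?case using indecomposable_not_zero[OF U] by blast
next
  case (Suc k)
  have m: "right_module A (direct_sum k N)" "right_module A (N k)" "right_module A (direct_sum (Suc k) N)"
    using Suc.prems(1) by (auto intro!: right_module_direct_sum ring_axioms)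
  have "summand A U (direct_sum2 (direct_sum k N) (N k))"
    by (rule summand_trans[OF Suc.prems(2) rmod_iso_imp_summand[OF m(3) direct_sum_Suc]])
  from indecomposable_summand_direct_sum2[OF U m(1,2) this] show ?case
    using Suc.IH Suc.prems(1) by (metis less_Suc_eq)
qed

text \<open>The definition wants a complement on \<open>'a fgmod\<close>. A retraction produces one
  as a submodule of the sum of copies of \<open>Q\<close>, which is finitely generated by finite
  length and hence can be copied.\<close>

lemma in_add_iff:
  fixes Q :: "'a fgmod"
  assumes Q: "fg_module A Q"
  shows "in_add A Q X \<longleftrightarrow> fg_module A X \<and> (\<exists>k. summand A X (direct_sum k (\<lambda>_. Q)))"
proof
  assume "in_add A Q X"
  then obtain k and Y :: "'a fgmod" where X: "fg_module A X" "fg_module A Y"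
    and iso: "rmod_iso A (direct_sum2 X Y) (direct_sum k (\<lambda>_. Q))" unfolding in_add_def by blast
  note m = fg_module_right[OF X(1)] fg_module_right[OF X(2)]
  have "summand A X (direct_sum k (\<lambda>_. Q))"
    by (rule summand_trans[OF summand_direct_sum2(1)[OF m] rmod_iso_imp_summand[OF right_module_direct_sum2[OF m] iso]])
  then show "fg_module A X \<and> (\<exists>k. summand A X (direct_sum k (\<lambda>_. Q)))" using X(1) by blast
next
  assume "fg_module A X \<and> (\<exists>k. summand A X (direct_sum k (\<lambda>_. Q)))"
  then obtain k where X: "fg_module A X" and s: "summand A X (direct_sum k (\<lambda>_. Q))" by blast
  let ?D = "direct_sum k (\<lambda>_. Q)"
  have D: "fg_module A ?D" by (rule fg_module_direct_sum[OF ring_axioms Q])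
  obtain K where K: "submodule K A ?D" "rmod_iso A ?D (direct_sum2 X (?D\<lparr>carrier := K\<rparr>))"
    by (rule summand_kernel[OF D fg_module_right[OF X] s])
  note Kf = fg_sub[OF D K(1)]
  obtain Y :: "'a fgmod" where Y: "fg_module A Y" "rmod_iso A (?D\<lparr>carrier := K\<rparr>) Y" by (rule fgmod_copy[OF Kf])
  have "rmod_iso A ?D (direct_sum2 X Y)"
    by (rule rmod_iso_trans[OF K(2) direct_sum2_cong[OF fg_module_right[OF X] fg_module_right[OF Kf] rmod_iso_refl Y(2)]])
  then have "rmod_iso A (direct_sum2 X Y) ?D" by (rule rmod_iso_sym[OF fg_module_right[OF D]])
  then show "in_add A Q X" unfolding in_add_def using X Y(1) by blast
qed

lemma in_add_summand:
  fixes Q :: "'a fgmod"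
  assumes "fg_module A Q" "in_add A Q Y" "fg_module A X" "summand A X Y"
  shows "in_add A Q X"
  using assms summand_trans[OF assms(4)] unfolding in_add_iff[OF assms(1)] by blast

lemma in_add_self: "fg_module A Q \<Longrightarrow> in_add A (Q :: 'a fgmod) Q"
  unfolding in_add_iff
proof (intro conjI exI[of _ 1])
  assume Q: "fg_module A Q"
  note m = fg_module_right[OF Q]
  have "direct_sum 1 (\<lambda>_. Q) = list_sum [Q]" by (simp add: direct_sum_const_eq_list_sum)
  moreover have "summand A Q (list_sum [Q])" by (rule summand_list_sum) (simp_all add: m)
  ultimately show "summand A Q (direct_sum 1 (\<lambda>_. Q))" by simp
qed

lemma in_add_zero:
  fixes Q :: "'a fgmod"
  assumes "fg_module A Q" "right_module A Z" "zero_module Z" shows "in_add A Q Z"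
proof -
  have "rmod_iso A Z (direct_sum 0 (\<lambda>_. Q))"
    by (rule zero_modules_iso[OF assms(2) right_module_direct_sum[OF ring_axioms] assms(3) zero_module_direct_sum_0]) simp
  then show ?thesis
    unfolding in_add_iff[OF assms(1)]
    using rmod_iso_imp_summand[OF assms(2)] fg_module_zero[OF assms(2,3)] by blast
qed

lemma in_add_direct_sum2:
  fixes Q :: "'a fgmod"
  assumes Q: "fg_module A Q" and X: "in_add A Q X" and Y: "in_add A Q Y"
  shows "in_add A Q (direct_sum2 X Y)"
proof -
  obtain k l where s: "summand A X (direct_sum k (\<lambda>_. Q))" "summand A Y (direct_sum l (\<lambda>_. Q))"
    and fg: "fg_module A X" "fg_module A Y"
    using X Y unfolding in_add_iff[OF Q] by blast
  note m = fg_module_right[OF Q]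
  have d: "right_module A (list_sum (replicate i Q))" for i by (rule right_module_list_sum) (simp add: m)
  have "rmod_iso A (list_sum (replicate k Q @ replicate l Q)) (direct_sum2 (list_sum (replicate k Q)) (list_sum (replicate l Q)))"
    by (rule list_sum_append) (use m in auto)
  then have "rmod_iso A (direct_sum2 (list_sum (replicate k Q)) (list_sum (replicate l Q))) (list_sum (replicate (k + l) Q))"
    unfolding replicate_add[symmetric] by (rule rmod_iso_sym[OF d])
  then have "summand A (direct_sum2 (list_sum (replicate k Q)) (list_sum (replicate l Q))) (list_sum (replicate (k + l) Q))"
    by (rule rmod_iso_imp_summand[OF right_module_direct_sum2[OF d d]])
  then have "summand A (direct_sum2 X Y) (direct_sum (k + l) (\<lambda>_. Q))"
    unfolding direct_sum_const_eq_list_sum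
    by (rule summand_trans[OF summand_direct_sum2_mono[OF s[unfolded direct_sum_const_eq_list_sum]]])
  then show ?thesis unfolding in_add_iff[OF Q] using fg_module_direct_sum2[OF fg] by blast
qed

lemma in_add_trans:
  fixes Q T :: "'a fgmod"
  assumes Q: "fg_module A Q" and T: "in_add A Q T" and X: "in_add A T X"
  shows "in_add A Q X"
proof -
  have Tf: "fg_module A T" using T unfolding in_add_def by blast
  obtain k where X': "fg_module A X" "summand A X (direct_sum k (\<lambda>_. T))"
    using X unfolding in_add_iff[OF Tf] by blast
  have "in_add A Q (direct_sum k (\<lambda>_. T))"
  proof (induction k)
    case 0
    show ?case
      by (rule in_add_zero[OF Q right_module_direct_sum[OF ring_axioms] zero_module_direct_sum_0]) simp
  next
    case (Suc k)
    note m = fg_module_direct_sum[OF ring_axioms Tf]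
    show ?case
      by (rule in_add_summand[OF Q in_add_direct_sum2[OF Q Suc T] m rmod_iso_imp_summand[OF fg_module_right[OF m] direct_sum_Suc]])
  qed
  then show ?thesis by (rule in_add_summand[OF Q _ X'])
qed

text \<open>Locality pushes \<open>U\<close> from the sum of copies of \<open>Q\<close> into one
  copy and then into one \<open>N j\<close>; being nonzero, it exhausts this indecomposable
  module.\<close>

lemma indecomposable_in_add:
  fixes Q U :: "'a fgmod"
  assumes N: "\<And>j. j < t \<Longrightarrow> indecomposable_module A (N j :: 'a fgmod)" and Q: "fg_module A Q" "rmod_iso A Q (direct_sum t N)"
    and U: "indecomposable_module A U" "in_add A Q U"
  shows "\<exists>j<t. rmod_iso A U (N j)"
proof -
  obtain k where "summand A U (direct_sum k (\<lambda>_. Q))" using U(2) unfolding in_add_iff[OF Q(1)] by blast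
  then obtain i where "i < k" "summand A U Q"
    using indecomposable_summand_direct_sum[OF U(1), of k "\<lambda>_. Q"] fg_module_right[OF Q(1)] by blast
  then have "summand A U (direct_sum t N)"
    using summand_trans rmod_iso_imp_summand[OF fg_module_right[OF Q(1)] Q(2)] by blast
  then obtain j where "j < t" "summand A U (N j)"
    using indecomposable_summand_direct_sum[OF U(1), of t N] fg_module_right[OF indecomposable_fg[OF N]] by blast
  then show ?thesis
    using summand_indecomposable_iso[OF N indecomposable_fg[OF U(1)] indecomposable_not_zero[OF U(1)]] by blast
qed

lemma in_add_decomposition:
  fixes Q :: "'a fgmod"
  assumes N: "\<And>j. j < t \<Longrightarrow> indecomposable_module A (N j :: 'a fgmod)" and Q: "fg_module A Q" "rmod_iso A Q (direct_sum t N)"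
    and X: "in_add A Q X"
  shows "\<exists>js. set js \<subseteq> {..<t} \<and> rmod_iso A X (list_sum (map N js))"
proof -
  have Xf: "fg_module A X" using X unfolding in_add_def by blast
  obtain l :: "'a fgmod list" where l: "\<And>U. U \<in> set l \<Longrightarrow> indecomposable_module A U" "rmod_iso A X (list_sum l)"
    by (rule decomposition[OF Xf]) blast
  note lm = fg_module_right[OF indecomposable_fg[OF l(1)]]
  have "\<exists>j<t. rmod_iso A U (N j)" if U: "U \<in> set l" for U
  proof (rule indecomposable_in_add[OF N Q l(1)[OF U]])
    have "summand A U X"
      by (rule summand_trans[OF summand_list_sum[OF lm U]
            rmod_iso_imp_summand[OF right_module_list_sum[OF lm] rmod_iso_sym[OF fg_module_right[OF Xf] l(2)]]])
    then show "in_add A Q U" by (rule in_add_summand[OF Q(1) X indecomposable_fg[OF l(1)[OF U]]])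
  qed
  from list_sum_iso_map[OF lm fg_module_right[OF indecomposable_fg[OF N]] this]
  show ?thesis using rmod_iso_trans[OF l(2)] by blast
qed

end

section \<open>Resolutions and homological dimensions\<close>

text \<open>Infima of nonempty sets of extended naturals are attained, and the empty set has infimum
  \<open>\<infinity>\<close>, which no finite bound allows. So a bound on a dimension is the
  existence of one resolution.\<close>

lemma Inf_enat_le_iff: "Inf {enat r | r. \<Phi> r} \<le> enat k \<longleftrightarrow> (\<exists>r\<le>k. \<Phi> r)"
proof
  assume le: "Inf {enat r | r. \<Phi> r} \<le> enat k"
  then have "{enat r | r. \<Phi> r} \<noteq> {}" by (metis Inf_empty enat_ord_simps(5) top_enat_def enat.distinct(2))
  then have "Inf {enat r | r. \<Phi> r} \<in> {enat r | r. \<Phi> r}"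
    unfolding Inf_enat_def by (metis (no_types, lifting) LeastI ex_in_conv)
  then show "\<exists>r\<le>k. \<Phi> r" using le by auto
next
  assume "\<exists>r\<le>k. \<Phi> r"
  then obtain r where r: "r \<le> k" "\<Phi> r" by blast
  then have "Inf {enat r | r. \<Phi> r} \<le> enat r" by (intro Inf_lower) blast
  then show "Inf {enat r | r. \<Phi> r} \<le> enat k" using r(1) by (meson enat_ord_simps(1) order_trans)
qed

lemma finite_coresolution_0:
  "finite_coresolution A P 0 X \<longleftrightarrow> (\<exists>Q :: 'a fgmod. fg_module A Q \<and> P Q \<and> rmod_iso A X Q)"
proof
  assume "finite_coresolution A P 0 X"
  then obtain Q :: "nat \<Rightarrow> 'a fgmod" and e where "fg_module A (Q 0)" "P (Q 0)" "e \<in> rmod_hom A X (Q 0)"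
    "inj_on e (carrier X)" "e ` carrier X = carrier (Q 0)"
    unfolding finite_coresolution_def Let_def by auto
  then show "\<exists>Q :: 'a fgmod. fg_module A Q \<and> P Q \<and> rmod_iso A X Q" by (blast intro: rmod_isoI)
next
  assume "\<exists>Q :: 'a fgmod. fg_module A Q \<and> P Q \<and> rmod_iso A X Q"
  then obtain Q :: "'a fgmod" and e where "fg_module A Q" "P Q" "e \<in> rmod_hom A X Q" "bij_betw e (carrier X) (carrier Q)"
    unfolding rmod_iso_def by blast
  then show "finite_coresolution A P 0 X"
    unfolding finite_coresolution_def Let_def bij_betw_def
    by (intro exI[of _ "\<lambda>_. Q"] exI[of _ e]) simp
qed

lemma finite_coresolution_1:
  "finite_coresolution A P 1 X \<longleftrightarrow>
    (\<exists>(Q :: 'a fgmod) (Q' :: 'a fgmod). fg_module A Q \<and> P Q \<and> fg_module A Q' \<and> P Q' \<and> short_exact A X Q Q')"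
proof
  assume "finite_coresolution A P 1 X"
  then obtain Q :: "nat \<Rightarrow> 'a fgmod" and e d where "\<forall>i\<le>1. fg_module A (Q i) \<and> P (Q i)" "e \<in> rmod_hom A X (Q 0)"
    "d 0 \<in> rmod_hom A (Q 0) (Q 1)" "inj_on e (carrier X)" "e ` carrier X = a_kernel (Q 0) (Q 1) (d 0)"
    "d 0 ` carrier (Q 0) = carrier (Q 1)"
    unfolding finite_coresolution_def Let_def by auto
  then show "\<exists>(Q :: 'a fgmod) (Q' :: 'a fgmod). fg_module A Q \<and> P Q \<and> fg_module A Q' \<and> P Q' \<and> short_exact A X Q Q'"
    by (intro exI[of _ "Q 0"] exI[of _ "Q 1"]) (auto intro: short_exactI)
next
  assume "\<exists>(Q :: 'a fgmod) (Q' :: 'a fgmod). fg_module A Q \<and> P Q \<and> fg_module A Q' \<and> P Q' \<and> short_exact A X Q Q'"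
  then obtain Q Q' :: "'a fgmod" where Q: "fg_module A Q" "P Q" "fg_module A Q'" "P Q'" "short_exact A X Q Q'"
    by (elim exE conjE) (rule that)
  obtain f g where "f \<in> rmod_hom A X Q" "g \<in> rmod_hom A Q Q'" "inj_on f (carrier X)"
     "g ` carrier Q = carrier Q'" "f ` carrier X = a_kernel Q Q' g"
    by (rule short_exactE[OF Q(5)]) (rule that)
  with Q(1-4) show "finite_coresolution A P 1 X"
    unfolding finite_coresolution_def Let_def
    by (intro exI[of _ "\<lambda>i. if i = 0 then Q else Q'"] exI[of _ f] exI[of _ "\<lambda>_. g"]) simp
qed

text \<open>The length of the coresolution of a tilting module is unknown, but its first two terms
  suffice: the cokernel of \<open>e\<close> embeds into \<open>Q'\<close>. Length zero is a case of
  its own because no second term exists there.\<close>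

lemma finite_coresolution_start:
  assumes "finite_coresolution A P r X"
  obtains (iso) Q :: "'a fgmod" where "fg_module A Q" "P Q" "rmod_iso A X Q"
    | (long) Q Q' :: "'a fgmod" and e d where "fg_module A Q" "P Q" "fg_module A Q'" "P Q'"
      "e \<in> rmod_hom A X Q" "d \<in> rmod_hom A Q Q'" "inj_on e (carrier X)" "e ` carrier X = a_kernel Q Q' d"
proof (cases r)
  case 0
  then obtain Q :: "'a fgmod" where "fg_module A Q" "P Q" "rmod_iso A X Q"
    using assms unfolding 0 finite_coresolution_0 by (elim exE conjE) (rule that)
  then show ?thesis by (rule iso)
next
  case (Suc k)
  from assms obtain Q :: "nat \<Rightarrow> 'a fgmod" and e d where Q: "\<forall>i\<le>r. fg_module A (Q i) \<and> P (Q i)"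
    and e: "e \<in> rmod_hom A X (Q 0)" and d: "\<forall>i<r. d i \<in> rmod_hom A (Q i) (Q (Suc i))" and inj: "inj_on e (carrier X)"
    and ker: "e ` carrier X = (if 0 < r then a_kernel (Q 0) (Q (Suc 0)) (d 0) else carrier (Q 0))"
    unfolding finite_coresolution_def Let_def by (elim exE conjE) (rule that)
  show ?thesis
  proof (rule long[OF _ _ _ _ e _ inj])
    show "fg_module A (Q 0)" "P (Q 0)" "fg_module A (Q (Suc 0))" "P (Q (Suc 0))"
      using Q Suc by simp_all
    show "d 0 \<in> rmod_hom A (Q 0) (Q (Suc 0))" using d Suc by simp
    show "e ` carrier X = a_kernel (Q 0) (Q (Suc 0)) (d 0)" using ker Suc by simp
  qed
qed

lemma finite_resolution_0:
  assumes "\<And>Q :: 'a fgmod. P Q \<Longrightarrow> right_module A Q" "right_module A Y"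
  shows "finite_resolution A P 0 Y \<longleftrightarrow> (\<exists>Q :: 'a fgmod. fg_module A Q \<and> P Q \<and> rmod_iso A Q Y)"
proof
  assume "finite_resolution A P 0 Y"
  then obtain Q :: "nat \<Rightarrow> 'a fgmod" and e where Q: "fg_module A (Q 0)" "P (Q 0)" "e \<in> rmod_hom A (Q 0) Y"
    "e ` carrier (Q 0) = carrier Y" "a_kernel (Q 0) Y e = {\<zero>\<^bsub>Q 0\<^esub>}"
    unfolding finite_resolution_def Let_def by auto
  interpret module_hom A "Q 0" Y e by (rule module_homI[OF assms(1)[OF Q(2)] assms(2) Q(3)])
  have "inj_on e (carrier (Q 0))" unfolding inj_iff using Q(5) by (auto simp: a_kernel_def')
  then show "\<exists>Q :: 'a fgmod. fg_module A Q \<and> P Q \<and> rmod_iso A Q Y" using Q(1-4) by (blast intro: rmod_isoI)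
next
  assume "\<exists>Q :: 'a fgmod. fg_module A Q \<and> P Q \<and> rmod_iso A Q Y"
  then obtain Q :: "'a fgmod" and e where Q: "fg_module A Q" "P Q" "e \<in> rmod_hom A Q Y" "bij_betw e (carrier Q) (carrier Y)"
    unfolding rmod_iso_def by blast
  interpret module_hom A Q Y e by (rule module_homI[OF assms(1)[OF Q(2)] assms(2) Q(3)])
  have "inj_on e (carrier Q)" "e ` carrier Q = carrier Y" using Q(4) by (auto simp: bij_betw_def)
  moreover from this have "a_kernel Q Y e = {\<zero>\<^bsub>Q\<^esub>}" using zero unfolding inj_iff a_kernel_def' by auto
  ultimately show "finite_resolution A P 0 Y"
    unfolding finite_resolution_def Let_def using Q(1-3)
    by (intro exI[of _ "\<lambda>_. Q"] exI[of _ e]) simp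
qed

lemma finite_resolution_1:
  assumes "\<And>Q :: 'a fgmod. P Q \<Longrightarrow> right_module A Q"
  shows "finite_resolution A P 1 Y \<longleftrightarrow>
    (\<exists>(Q :: 'a fgmod) (Q' :: 'a fgmod). fg_module A Q \<and> P Q \<and> fg_module A Q' \<and> P Q' \<and> short_exact A Q' Q Y)"
proof
  assume "finite_resolution A P 1 Y"
  then obtain Q :: "nat \<Rightarrow> 'a fgmod" and e d where Q: "\<forall>i\<le>1. fg_module A (Q i) \<and> P (Q i)" "e \<in> rmod_hom A (Q 0) Y"
    "d 0 \<in> rmod_hom A (Q 1) (Q 0)" "e ` carrier (Q 0) = carrier Y" "a_kernel (Q 0) Y e = d 0 ` carrier (Q 1)"
    "a_kernel (Q 1) (Q 0) (d 0) = {\<zero>\<^bsub>Q 1\<^esub>}"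
    unfolding finite_resolution_def Let_def by auto
  interpret module_hom A "Q 1" "Q 0" "d 0" by (rule module_homI[OF assms assms Q(3)]) (use Q(1) in auto)
  have "inj_on (d 0) (carrier (Q 1))" unfolding inj_iff using Q(6) by (auto simp: a_kernel_def')
  then have "short_exact A (Q 1) (Q 0) Y" using Q by (intro short_exactI[of "d 0" _ _ _ e]) auto
  then show "\<exists>(Q :: 'a fgmod) (Q' :: 'a fgmod). fg_module A Q \<and> P Q \<and> fg_module A Q' \<and> P Q' \<and> short_exact A Q' Q Y"
    using Q(1) by (intro exI[of _ "Q 0"] exI[of _ "Q 1"]) auto
next
  assume "\<exists>(Q :: 'a fgmod) (Q' :: 'a fgmod). fg_module A Q \<and> P Q \<and> fg_module A Q' \<and> P Q' \<and> short_exact A Q' Q Y"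
  then obtain Q Q' :: "'a fgmod" where P: "fg_module A Q" "P Q" "fg_module A Q'" "P Q'" "short_exact A Q' Q Y"
    by (elim exE conjE) (rule that)
  obtain f g where "f \<in> rmod_hom A Q' Q" "g \<in> rmod_hom A Q Y" "inj_on f (carrier Q')"
     "g ` carrier Q = carrier Y" "f ` carrier Q' = a_kernel Q Y g"
    by (rule short_exactE[OF P(5)]) (rule that)
  note Q = P(1-4) this
  interpret module_hom A Q' Q f by (rule module_homI[OF assms assms Q(5)]) (use Q in auto)
  have "a_kernel Q' Q f = {\<zero>\<^bsub>Q'\<^esub>}" using Q(7) zero unfolding inj_iff a_kernel_def' by auto
  then show "finite_resolution A P 1 Y"
    unfolding finite_resolution_def Let_def using Q
    by (intro exI[of _ "\<lambda>i. if i = 0 then Q else Q'"] exI[of _ g] exI[of _ "\<lambda>_. f"]) simp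
qed

section \<open>Projective dimension at most one, injective dimension zero\<close>

definition pd_le_one :: "'a ring \<Rightarrow> ('a, 'm) module \<Rightarrow> bool" where
  "pd_le_one A X \<longleftrightarrow> (\<exists>(P :: 'a fgmod) (P' :: 'a fgmod). projective_module A P \<and> projective_module A P' \<and> short_exact A P' P X)"

context artin_ring
begin

text \<open>Lets resolutions of length zero count as length one, the second term being the zero
  submodule of a copy of \<open>X\<close>.\<close>

lemma projective_imp_pd_le_one:
  assumes "projective_module A X" shows "pd_le_one A X"
proof -
  note fg = projective_fg[OF assms]
  obtain F :: "'a fgmod" where F: "fg_module A F" "rmod_iso A X F" by (rule fgmod_copy[OF fg])
  note m = fg_module_right[OF F(1)] fg_module_right[OF fg]
  interpret F: right_module A F by (rule m)
  let ?Z = "F\<lparr>carrier := {\<zero>\<^bsub>F\<^esub>}\<rparr>"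
  have Z: "right_module A ?Z" "zero_module ?Z"
    by (rule right_module_sub[OF m(1) submodule_zero[OF m(1)]]) (simp add: zero_module_def)
  obtain e e' where e: "e \<in> rmod_hom A F X" "e' \<in> rmod_hom A X F"
    "\<And>x. x \<in> carrier F \<Longrightarrow> e' (e x) = x" "\<And>x. x \<in> carrier X \<Longrightarrow> e (e' x) = x"
    by (rule rmod_isoE[OF m(1) rmod_iso_sym[OF m(2) F(2)]]) blast
  interpret e: module_hom A F X e by (rule module_homI[OF m e(1)])
  have "short_exact A ?Z F X"
  proof (rule short_exactI[OF rmod_hom_inclusion e(1)])
    show "e ` carrier F = carrier X"
    proof (intro subset_antisym subsetI)
      fix x assume x: "x \<in> carrier X"
      show "x \<in> e ` carrier F"
        by (rule image_eqI[of _ _ "e' x"]) (simp_all only: e(4)[OF x] rmod_homD(1)[OF e(2) x])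
    qed (use e.closed in auto)
    have "x = \<zero>\<^bsub>F\<^esub>" if x: "x \<in> carrier F" "e x = \<zero>\<^bsub>X\<^esub>" for x
      by (rule box_equals[OF arg_cong[OF x(2)[folded e.zero], of e'] e(3)[OF x(1)] e(3)[OF F.M.zero_closed]])
    then show "(\<lambda>x. x) ` carrier ?Z = a_kernel F X e" using e.zero by (auto simp: a_kernel_def')
  qed auto
  then show ?thesis
    unfolding pd_le_one_def using projective_iso[OF assms F(2) m(1)] projective_zero[OF Z] by blast
qed

lemma projective_right_module: "projective_module A X \<Longrightarrow> right_module A X"
  by (rule fg_module_right[OF projective_fg])

lemma finite_projective_resolution_0:
  assumes "right_module A X"
  shows "finite_resolution A (projective_module A) 0 X \<longleftrightarrow> projective_module A X"
proof -
  have r: "finite_resolution A (projective_module A) 0 X \<longleftrightarrow>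
      (\<exists>Q :: 'a fgmod. fg_module A Q \<and> projective_module A Q \<and> rmod_iso A Q X)"
    by (rule finite_resolution_0[OF _ assms]) (rule projective_right_module)
  show ?thesis
    unfolding r
  proof
    assume "\<exists>Q :: 'a fgmod. fg_module A Q \<and> projective_module A Q \<and> rmod_iso A Q X"
    then show "projective_module A X" using projective_iso[OF _ _ assms] by blast
  next
    assume X: "projective_module A X"
    obtain F :: "'a fgmod" where F: "fg_module A F" "rmod_iso A X F" by (rule fgmod_copy[OF projective_fg[OF X]])
    then show "\<exists>Q :: 'a fgmod. fg_module A Q \<and> projective_module A Q \<and> rmod_iso A Q X"
      using projective_iso[OF X F(2) fg_module_right[OF F(1)]] rmod_iso_sym[OF assms F(2)] by blast
  qed
qed

lemma proj_dim_le_one_iff: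
  assumes "right_module A X"
  shows "proj_dim A X \<le> 1 \<longleftrightarrow> pd_le_one A X"
proof -
  have r: "finite_resolution A (projective_module A) 1 X \<longleftrightarrow>
      (\<exists>(Q :: 'a fgmod) (Q' :: 'a fgmod). fg_module A Q \<and> projective_module A Q \<and> fg_module A Q' \<and>
         projective_module A Q' \<and> short_exact A Q' Q X)"
    by (rule finite_resolution_1) (rule projective_right_module)
  have "proj_dim A X \<le> 1 \<longleftrightarrow> (\<exists>r\<le>1. finite_resolution A (projective_module A) r X)"
    unfolding proj_dim_def one_enat_def by (rule Inf_enat_le_iff)
  also have "\<dots> \<longleftrightarrow> finite_resolution A (projective_module A) 0 X \<or> finite_resolution A (projective_module A) 1 X"
    by (auto simp: le_Suc_eq)
  also have "\<dots> \<longleftrightarrow> pd_le_one A X"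
    unfolding r finite_projective_resolution_0[OF assms] using projective_imp_pd_le_one[of X] projective_fg
    unfolding pd_le_one_def by blast
  finally show ?thesis .
qed

lemma proj_dim_zero_imp_projective:
  assumes "right_module A X" "proj_dim A X = 0"
  shows "projective_module A X"
proof -
  have "\<exists>r\<le>0. finite_resolution A (projective_module A) r X"
    using assms(2) Inf_enat_le_iff[of "\<lambda>r. finite_resolution A (projective_module A) r X" 0]
    unfolding proj_dim_def zero_enat_def by simp
  then show ?thesis using finite_projective_resolution_0[OF assms(1)] by simp
qed

lemma inj_dim_le_iff: "inj_dim A X \<le> enat k \<longleftrightarrow> (\<exists>r\<le>k. finite_coresolution A (injective_module A) r X)"
  unfolding inj_dim_def by (rule Inf_enat_le_iff)

lemma inj_dim_zero_iff:
  assumes "right_module A X"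
  shows "inj_dim A X = 0 \<longleftrightarrow> injective_module A X"
proof -
  have "inj_dim A X = 0 \<longleftrightarrow> finite_coresolution A (injective_module A) 0 X"
    using inj_dim_le_iff[of X 0] by (simp add: zero_enat_def[symmetric])
  also have "\<dots> \<longleftrightarrow> injective_module A X"
  proof
    assume "finite_coresolution A (injective_module A) 0 X"
    then obtain Q :: "'a fgmod" where "injective_module A Q" "rmod_iso A X Q" unfolding finite_coresolution_0 by blast
    then show "injective_module A X" using injective_iso rmod_iso_sym[OF assms] assms by blast
  next
    assume X: "injective_module A X"
    obtain Q :: "'a fgmod" where Q: "fg_module A Q" "rmod_iso A X Q" by (rule fgmod_copy[OF injective_fg[OF X]])
    then show "finite_coresolution A (injective_module A) 0 X"
      unfolding finite_coresolution_0 using injective_iso[OF X Q(2) fg_module_right[OF Q(1)]] by blast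
  qed
  finally show ?thesis .
qed

text \<open>The preimage of \<open>X\<close> in a projective \<open>P\<close> mapping onto \<open>M\<close> is the kernel of \<open>P \<rightarrow> Y\<close>.\<close>

lemma short_exact_pullback:
  assumes X: "projective_module A X" and mods: "right_module A P'" "fg_module A P" "right_module A M" "right_module A Y"
    and ex: "short_exact A P' P M" "short_exact A X M Y"
  obtains K where "submodule K A P" "short_exact A (P\<lparr>carrier := K\<rparr>) P Y"
    "rmod_iso A (P\<lparr>carrier := K\<rparr>) (direct_sum2 X P')"
proof -
  note Xm = projective_right_module[OF X] and Pm = fg_module_right[OF mods(2)]
  obtain f g where f: "f \<in> rmod_hom A P' P" "g \<in> rmod_hom A P M" "inj_on f (carrier P')"
    "g ` carrier P = carrier M" "f ` carrier P' = a_kernel P M g"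
    by (rule short_exactE[OF ex(1)]) blast
  obtain j q where j: "j \<in> rmod_hom A X M" "q \<in> rmod_hom A M Y" "inj_on j (carrier X)"
    "q ` carrier M = carrier Y" "j ` carrier X = a_kernel M Y q"
    by (rule short_exactE[OF ex(2)]) blast
  note qg = rmod_hom_comp[OF f(2) j(2)]
  interpret g: module_hom A P M g by (rule module_homI[OF Pm mods(3) f(2)])
  interpret q: module_hom A M Y q by (rule module_homI[OF mods(3,4) j(2)])
  interpret qg: module_hom A P Y "\<lambda>x. q (g x)" by (rule module_homI[OF Pm mods(4) qg])
  interpret j: module_hom A X M j by (rule module_homI[OF Xm mods(3) j(1)])
  let ?K = "a_kernel P Y (\<lambda>x. q (g x))"
  let ?KM = "P\<lparr>carrier := ?K\<rparr>"
  have K: "submodule ?K A P" by (rule qg.submodule_kernel)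
  have KP: "?K \<subseteq> carrier P" by (rule submoduleD(1)[OF K])
  have KMm: "right_module A ?KM" by (rule right_module_sub[OF Pm K])
  have onto: "(\<lambda>x. q (g x)) ` carrier P = carrier Y" by (simp only: image_image[symmetric] f(4) j(4))
  have gK: "g ` carrier ?KM \<subseteq> j ` carrier X" unfolding j(5) by (auto simp: a_kernel_def' g.closed)
  obtain h where h: "h \<in> rmod_hom A ?KM X" "\<And>z. z \<in> carrier ?KM \<Longrightarrow> j (h z) = g z"
    by (rule factor_through_inj[OF Xm mods(3) KMm j(1,3) rmod_hom_restrict[OF f(2) KP] gK]) blast
  have hc: "h z \<in> carrier X" if "z \<in> ?K" for z using rmod_homD(1)[OF h(1)] that by simp
  \<comment> \<open>The preimage of \<open>X\<close> in \<open>P\<close> is an extension of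
    \<open>X\<close> by the kernel \<open>P'\<close> of \<open>P \<rightarrow> M\<close>; it splits
    because \<open>X\<close> is projective.\<close>
  have "short_exact A P' ?KM X"
  proof (rule short_exactI[OF _ h(1) f(3)])
    have "f ` carrier P' \<subseteq> ?K" unfolding f(5) by (auto simp: a_kernel_def' q.zero)
    then show "f \<in> rmod_hom A P' ?KM" by (rule rmod_hom_into_sub[OF f(1)])
    show "h ` carrier ?KM = carrier X"
    proof (intro subset_antisym subsetI)
      fix x assume x: "x \<in> carrier X"
      have jx: "j x \<in> a_kernel M Y q" unfolding j(5)[symmetric] using x by blast
      then have "j x \<in> g ` carrier P" unfolding f(4) by (simp add: a_kernel_def')
      then obtain z where z: "z \<in> carrier P" "j x = g z" by (rule imageE)
      have zK: "z \<in> carrier ?KM" using z jx by (simp add: a_kernel_def')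
      have "j (h z) = j x" using h(2)[OF zK] z(2) by simp
      then have "h z = x" by (rule inj_onD[OF j(3) _ rmod_homD(1)[OF h(1) zK] x])
      then show "x \<in> h ` carrier ?KM" using zK by blast
    qed (use rmod_homD(1)[OF h(1)] in blast)
    have "h z = \<zero>\<^bsub>X\<^esub> \<longleftrightarrow> g z = \<zero>\<^bsub>M\<^esub>" if z: "z \<in> ?K" for z
    proof -
      have "h z = \<zero>\<^bsub>X\<^esub> \<longleftrightarrow> j (h z) = j \<zero>\<^bsub>X\<^esub>"
        using inj_on_eq_iff[OF j(3) hc[OF z] j.M.M.zero_closed] by simp
      then show ?thesis using h(2)[of z] z j.zero by simp
    qed
    then show "f ` carrier P' = a_kernel ?KM X h" unfolding f(5) by (auto simp: a_kernel_def' q.zero)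
  qed
  then have iso: "rmod_iso A ?KM (direct_sum2 X P')"
    by (rule short_exact_split[OF mods(1) fg_sub[OF mods(2) K] X])
  show ?thesis by (rule that[OF K short_exact_kernel[OF qg onto] iso])
qed

text \<open>The kernel of \<open>P \<rightarrow> M \<rightarrow> Y\<close> is the sum of
  \<open>X\<close> and \<open>P'\<close>, hence projective. With the regular module as
  \<open>X\<close>, the dimension bound passes to cokernels of embeddings of
  \<open>A\<close>.\<close>

lemma pd_le_one_cokernel:
  assumes X: "projective_module A X" and mods: "right_module A M" "right_module A Y"
    and M: "pd_le_one A M" and ex: "short_exact A X M Y"
  shows "pd_le_one A Y"
proof -
  obtain P P' :: "'a fgmod" where P: "projective_module A P" "projective_module A P'" "short_exact A P' P M"
    using M unfolding pd_le_one_def by blast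
  obtain K where K: "submodule K A P" "short_exact A (P\<lparr>carrier := K\<rparr>) P Y"
    "rmod_iso A (P\<lparr>carrier := K\<rparr>) (direct_sum2 X P')"
    by (rule short_exact_pullback[OF X projective_right_module[OF P(2)] projective_fg[OF P(1)] mods P(3) ex])
  note Km = right_module_sub[OF projective_right_module[OF P(1)] K(1)]
  have "projective_module A (P\<lparr>carrier := K\<rparr>)"
    by (rule projective_iso[OF projective_direct_sum2[OF X P(2)] rmod_iso_sym[OF Km K(3)] Km])
  then show ?thesis unfolding pd_le_one_def using P(1) K(2) by blast
qed

section \<open>Projective resolutions and Ext into an injective module\<close>

lemma proj_resolution_exists:
  assumes X: "fg_module A X"
  shows "\<exists>P e d. proj_resolution A X P e d"
proof -
  obtain F :: "'a fgmod" and e where F: "projective_module A F" "e \<in> rmod_hom A F X" "e ` carrier F = carrier X"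
    by (rule projective_cover[OF X]) blast
  define K0 where "K0 = a_kernel F X e"
  have K0: "submodule K0 A F" unfolding K0_def
    by (rule module_hom.submodule_kernel[OF module_homI[OF projective_right_module[OF F(1)] fg_module_right[OF X] F(2)]])
  \<comment> \<open>A state is a projective module together with the submodule that the next term
    has to cover. The state at index zero is pinned to \<open>F\<close> and the kernel of
    \<open>e\<close>, so that the sequence built fits the augmentation chosen before.\<close>
  let ?ok = "\<lambda>(n::nat) (s :: 'a fgmod \<times> (nat \<Rightarrow> 'a) set set). projective_module A (fst s) \<and> submodule (snd s) A (fst s) \<and> (n = 0 \<longrightarrow> s = (F, K0))"
  let ?next = "\<lambda>(n::nat) (s :: 'a fgmod \<times> (nat \<Rightarrow> 'a) set set) (s' :: 'a fgmod \<times> (nat \<Rightarrow> 'a) set set).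
    \<exists>d. d \<in> rmod_hom A (fst s') (fst s) \<and> d ` carrier (fst s') = snd s \<and> snd s' = a_kernel (fst s') (fst s) d"
  have "\<exists>s. \<forall>n. ?ok n (s n) \<and> ?next n (s n) (s (Suc n))"
  proof (rule dependent_nat_choice)
    show "\<exists>s. ?ok 0 s" using F(1) K0 by (intro exI[of _ "(F, K0)"]) simp
    fix s n assume ok: "?ok n s"
    have m: "right_module A (fst s)" using ok projective_right_module by blast
    have "fg_module A ((fst s)\<lparr>carrier := snd s\<rparr>)" using ok projective_fg fg_sub by blast
    then obtain G :: "'a fgmod" and d where G: "projective_module A G" "d \<in> rmod_hom A G ((fst s)\<lparr>carrier := snd s\<rparr>)"
      "d ` carrier G = carrier ((fst s)\<lparr>carrier := snd s\<rparr>)"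
      by (rule projective_cover) blast
    have d: "d \<in> rmod_hom A G (fst s)"
      using rmod_hom_comp[OF G(2) rmod_hom_inclusion] submoduleD(1) ok by blast
    have "submodule (a_kernel G (fst s) d) A G"
      by (rule module_hom.submodule_kernel[OF module_homI[OF projective_right_module[OF G(1)] m d]])
    then show "\<exists>s'. ?ok (Suc n) s' \<and> ?next n s s'"
      using G d by (intro exI[of _ "(G, a_kernel G (fst s) d)"] conjI) (auto intro!: exI[of _ d])
  qed
  then obtain s where "\<forall>n. ?ok n (s n) \<and> ?next n (s n) (s (Suc n))" by (rule exE)
  note s = this[rule_format, THEN conjunct1] this[rule_format, THEN conjunct2]
  have "\<forall>n. \<exists>d. d \<in> rmod_hom A (fst (s (Suc n))) (fst (s n)) \<and> d ` carrier (fst (s (Suc n))) = snd (s n) \<and>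
     snd (s (Suc n)) = a_kernel (fst (s (Suc n))) (fst (s n)) d" by (rule allI, rule s(2))
  from choice[OF this] obtain d where d': "\<forall>n. d n \<in> rmod_hom A (fst (s (Suc n))) (fst (s n)) \<and>
    d n ` carrier (fst (s (Suc n))) = snd (s n) \<and> snd (s (Suc n)) = a_kernel (fst (s (Suc n))) (fst (s n)) (d n)"
    by (rule exE)
  note d = d'[rule_format, THEN conjunct1] d'[rule_format, THEN conjunct2, THEN conjunct1]
    d'[rule_format, THEN conjunct2, THEN conjunct2]
  have s0: "fst (s 0) = F" "snd (s 0) = K0" using s(1)[of 0] by simp_all
  have "proj_resolution A X (\<lambda>n. fst (s n)) e d"
    unfolding proj_resolution_def
  proof (intro conjI allI)
    show "projective_module A (fst (s i))" for i using s(1)[of i] by blast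
    show "d i \<in> rmod_hom A (fst (s (Suc i))) (fst (s i))" for i by (rule d(1))
    show "a_kernel (fst (s 0)) X e = d 0 ` carrier (fst (s 1))" using d(2)[of 0] s0 by (simp add: K0_def)
    show "a_kernel (fst (s (Suc i))) (fst (s i)) (d i) = d (Suc i) ` carrier (fst (s (Suc (Suc i))))" for i
      using d(2)[of "Suc i"] d(3)[of i] by simp
  qed (use F s0 in simp_all)
  then show ?thesis by blast
qed

text \<open>Triviality of Ext includes that it is a group, so the cocycles have to be known as a
  group before the quotient is formed. Commutativity makes every subgroup normal.\<close>

lemma comm_group_cocycles:
  assumes Y: "right_module A Y" and P: "right_module A (P i)" and d: "d i \<in> rmod_hom A (P (Suc i)) (P i)"
  shows "comm_group (Hom_group A (P i) Y\<lparr>carrier := cocycles A P d i Y\<rparr>)"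
proof -
  interpret Y: right_module A Y by fact
  interpret P: right_module A "P i" by fact
  note dc = rmod_homD(1)[OF d]
  have r: "restrict f (carrier (P i)) \<in> rmod_hom A (P i) Y" if "f \<in> rmod_hom A (P i) Y" for f
    by (rule rmod_hom_cong[OF that P]) simp
  have in_iff: "f \<in> cocycles A P d i Y \<longleftrightarrow> f \<in> rmod_hom A (P i) Y \<and> f \<in> extensional (carrier (P i)) \<and>
    (\<forall>x \<in> carrier (P (Suc i)). f (d i x) = \<zero>\<^bsub>Y\<^esub>)" for f
    by (simp add: cocycles_def Hom_group_def)
  have eq: "restrict g (carrier (P i)) = f" if "f \<in> cocycles A P d i Y" "\<And>x. x \<in> carrier (P i) \<Longrightarrow> g x = f x" for f g
    using that unfolding in_iff by (intro ext) (simp add: extensional_def)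
  have cl: "f x \<in> carrier Y" if "f \<in> cocycles A P d i Y" "x \<in> carrier (P i)" for f x
    by (rule rmod_homD(1)[where A = A, OF _ that(2)]) (use that(1) in \<open>simp add: in_iff\<close>)
  show ?thesis
  proof (rule comm_groupI; simp add: Hom_group_def)
    fix f g h assume f: "f \<in> cocycles A P d i Y" and g: "g \<in> cocycles A P d i Y"
    show "(\<lambda>x\<in>carrier (P i). f x \<oplus>\<^bsub>Y\<^esub> g x) \<in> cocycles A P d i Y"
      unfolding in_iff
      using f g dc by (auto simp: in_iff intro!: r rmod_hom_add[OF Y])
    show "(\<lambda>x\<in>carrier (P i). f x \<oplus>\<^bsub>Y\<^esub> g x) = (\<lambda>x\<in>carrier (P i). g x \<oplus>\<^bsub>Y\<^esub> f x)"
      using f g by (intro restrict_ext Y.M.a_comm cl)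
    assume h: "h \<in> cocycles A P d i Y"
    show "(\<lambda>x\<in>carrier (P i). (if x \<in> carrier (P i) then f x \<oplus>\<^bsub>Y\<^esub> g x else undefined) \<oplus>\<^bsub>Y\<^esub> h x) =
       (\<lambda>x\<in>carrier (P i). f x \<oplus>\<^bsub>Y\<^esub> (if x \<in> carrier (P i) then g x \<oplus>\<^bsub>Y\<^esub> h x else undefined))"
      using f g h by (intro restrict_ext) (simp add: Y.M.a_assoc cl)
  next
    show "(\<lambda>x\<in>carrier (P i). \<zero>\<^bsub>Y\<^esub>) \<in> cocycles A P d i Y"
      unfolding in_iff using dc by (auto intro!: r rmod_hom_zero[OF Y])
    fix f assume f: "f \<in> cocycles A P d i Y"
    show "(\<lambda>x\<in>carrier (P i). (if x \<in> carrier (P i) then \<zero>\<^bsub>Y\<^esub> else undefined) \<oplus>\<^bsub>Y\<^esub> f x) = f"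
      by (rule eq[OF f]) (simp add: cl[OF f])
    show "\<exists>g\<in>cocycles A P d i Y. (\<lambda>x\<in>carrier (P i). g x \<oplus>\<^bsub>Y\<^esub> f x) = (\<lambda>x\<in>carrier (P i). \<zero>\<^bsub>Y\<^esub>)"
    proof (rule bexI[of _ "\<lambda>x\<in>carrier (P i). \<ominus>\<^bsub>Y\<^esub> f x"])
      show "(\<lambda>x\<in>carrier (P i). \<ominus>\<^bsub>Y\<^esub> f x) \<in> cocycles A P d i Y"
        unfolding in_iff using f dc by (auto simp: in_iff intro!: r rmod_hom_neg[OF Y])
    qed (use f in \<open>auto intro!: restrict_ext simp: cl Y.M.l_neg\<close>)
  qed
qed

text \<open>A cocycle vanishes on the kernel of \<open>d j\<close>, which is the image of the next
  differential. It therefore factors through the image of \<open>d j\<close>, and the factor extends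
  to \<open>P j\<close> since \<open>T\<close> is injective.\<close>

lemma cocycles_injective:
  assumes T: "injective_module A T" and res: "proj_resolution A X P e d"
  shows "cocycles A P d (Suc j) T = coboundaries A P d (Suc j) T"
proof -
  have P: "projective_module A (P i)" "d i \<in> rmod_hom A (P (Suc i)) (P i)"
    "a_kernel (P (Suc i)) (P i) (d i) = d (Suc i) ` carrier (P (Suc (Suc i)))" for i
    using res unfolding proj_resolution_def by simp_all
  note fg = projective_fg[OF P(1)] and m = projective_right_module[OF P(1)]
  note Tm = fg_module_right[OF injective_fg[OF T]]
  interpret T: right_module A T by (rule Tm)
  interpret d: module_hom A "P (Suc j)" "P j" "d j" by (rule module_homI[OF m m P(2)])
  have r: "restrict f (carrier (P i)) \<in> rmod_hom A (P i) T" if "f \<in> rmod_hom A (P i) T" for f i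
    by (rule rmod_hom_cong[OF that m]) simp
  show ?thesis
  proof (intro subset_antisym subsetI)
    fix f assume "f \<in> cocycles A P d (Suc j) T"
    then have f: "f \<in> rmod_hom A (P (Suc j)) T" "f \<in> extensional (carrier (P (Suc j)))"
      "\<And>x. x \<in> carrier (P (Suc (Suc j))) \<Longrightarrow> f (d (Suc j) x) = \<zero>\<^bsub>T\<^esub>"
      by (simp_all add: cocycles_def Hom_group_def)
    let ?K = "(P j)\<lparr>carrier := d j ` carrier (P (Suc j))\<rparr>"
    have K: "submodule (d j ` carrier (P (Suc j))) A (P j)" by (rule d.submodule_range)
    have dK: "d j \<in> rmod_hom A (P (Suc j)) ?K" by (rule rmod_hom_into_sub[OF P(2)]) simp
    have z: "f x = \<zero>\<^bsub>T\<^esub>" if "x \<in> carrier (P (Suc j))" "d j x = \<zero>\<^bsub>?K\<^esub>" for x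
    proof -
      have "x \<in> d (Suc j) ` carrier (P (Suc (Suc j)))"
        using that unfolding P(3)[symmetric] by (simp add: a_kernel_def')
      then show ?thesis using f(3) by blast
    qed
    obtain h where h: "h \<in> rmod_hom A ?K T" "\<And>x. x \<in> carrier (P (Suc j)) \<Longrightarrow> h (d j x) = f x"
      by (rule factor_through_surj[OF m right_module_sub[OF m K] Tm dK _ f(1) z]) (simp, blast+)
    obtain g where g: "g \<in> rmod_hom A (P j) T" "\<And>x. x \<in> carrier ?K \<Longrightarrow> g x = h x"
      by (rule injective_extend[OF T fg_sub[OF fg K] fg rmod_hom_inclusion[OF submoduleD(1)[OF K]] _ h(1)]) (simp, blast)
    have "f = (\<lambda>x\<in>carrier (P (Suc j)). restrict g (carrier (P j)) (d j x))"
    proof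
      fix x show "f x = (\<lambda>x\<in>carrier (P (Suc j)). restrict g (carrier (P j)) (d j x)) x"
        using f(2) g(2)[of "d j x"] h(2)[of x] d.closed[of x] by (cases "x \<in> carrier (P (Suc j))") (simp_all add: extensional_def)
    qed
    then show "f \<in> coboundaries A P d (Suc j) T"
      using r[OF g(1)] by (auto simp: coboundaries_def Hom_group_def intro!: exI[of _ "restrict g (carrier (P j))"])
  next
    fix f assume "f \<in> coboundaries A P d (Suc j) T"
    then obtain g where g: "f = (\<lambda>x\<in>carrier (P (Suc j)). g (d j x))" "g \<in> rmod_hom A (P j) T"
      by (auto simp: coboundaries_def Hom_group_def)
    interpret g: module_hom A "P j" T g by (rule module_homI[OF m Tm g(2)])
    have "d j (d (Suc j) x) = \<zero>\<^bsub>P j\<^esub>" if "x \<in> carrier (P (Suc (Suc j)))" for x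
    proof -
      have "d (Suc j) x \<in> a_kernel (P (Suc j)) (P j) (d j)" unfolding P(3) using that by blast
      then show ?thesis by (simp add: a_kernel_def')
    qed
    then show "f \<in> cocycles A P d (Suc j) T"
      unfolding cocycles_def Hom_group_def g(1)
      using r[OF rmod_hom_comp[OF P(2) g(2)]] rmod_homD(1)[OF P(2)[of "Suc j"]] g.zero by auto
  qed
qed

text \<open>In positive degree all cocycles are coboundaries for every resolution, hence for the one
  that \<open>SOME\<close> selects; existence of a resolution is what makes this selection
  meaningful. The quotient then has a single coset.\<close>

lemma Ext_injective_trivial:
  assumes X: "fg_module A X" and T: "injective_module A T" and i: "1 \<le> i"
  shows "trivial_group (Ext A i X T)"
proof -
  obtain P e d where s: "(SOME (P, e, d). proj_resolution A X P e d) = (P, e, d)" by (metis prod_cases3)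
  have "case (SOME (P, e, d). proj_resolution A X P e d) of (P, e, d) \<Rightarrow> proj_resolution A X P e d"
    by (rule someI_ex) (use proj_resolution_exists[OF X] in simp)
  then have res: "proj_resolution A X P e d" unfolding s by simp
  obtain j where j: "i = Suc j" using i by (cases i) auto
  let ?G = "Hom_group A (P i) T\<lparr>carrier := cocycles A P d i T\<rparr>"
  have "projective_module A (P i)" "d i \<in> rmod_hom A (P (Suc i)) (P i)"
    using res unfolding proj_resolution_def by simp_all
  then interpret G: comm_group ?G
    by (intro comm_group_cocycles fg_module_right[OF injective_fg[OF T]] projective_right_module)
  have Ext: "Ext A i X T = ?G Mod carrier ?G"
    unfolding Ext_def s using cocycles_injective[OF T res, of j] by (simp add: j)
  have "carrier ?G \<lhd> ?G" by (rule G.subgroup_imp_normal[OF G.subgroup_self])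
  then have grp: "group (?G Mod carrier ?G)" by (rule normal.factorgroup_is_group)
  have "carrier (?G Mod carrier ?G) = {carrier ?G}"
    using G.coset_join2[OF _ G.subgroup_self] G.one_closed by (auto simp: FactGroup_def RCOSETS_def)
  then show ?thesis unfolding Ext trivial_group_def using grp by (simp add: FactGroup_def)
qed

end

section \<open>Commutative artinian rings have finite length\<close>

lemma (in base_ring) submodule_regular_iff_ideal:
  assumes "cring A"
  shows "submodule J A (regular A) \<longleftrightarrow> ideal J A"
proof
  interpret cring A by fact
  assume J: "submodule J A (regular A)"
  note D = submoduleD[OF J, unfolded regular_simps]
  show "ideal J A"
  proof (rule idealI[OF ring_axioms])
    have "\<ominus> x \<in> J" if "x \<in> J" for x
      using D(4)[of "\<ominus> \<one>" x] that D(1) r_minus[of x \<one>] by auto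
    then show "subgroup J (add_monoid A)"
      unfolding subgroup_def using D(1-3) by (simp add: a_inv_def)
    fix a x assume a: "a \<in> J" "x \<in> carrier A"
    then have "a \<in> carrier A" using D(1) by auto
    show "a \<otimes> x \<in> J" by (rule D(4)[OF a(2,1)])
    then show "x \<otimes> a \<in> J" using m_comm[OF \<open>a \<in> carrier A\<close> a(2)] by simp
  qed
next
  interpret cring A by fact
  assume J: "ideal J A"
  interpret J: ideal J A by (rule J)
  show "submodule J A (regular A)"
    by (rule submoduleI'[OF right_module_regular])
      (auto intro: J.a_closed J.I_r_closed J.zero_closed J.a_subset[THEN subsetD])
qed

text \<open>The ring is used through its action on one module all of whose proper submodules have finite
  length. If the module itself does not, every scalar acts as zero or is invertible modulo the annihilator,
  so that the module is a vector space; a complement of a line then gives a contradiction.\<close>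

lemma (in base_ring) fin_length_minimal:
  assumes comm: "cring A" and art: "artinian_ring A" and M: "right_module A M"
    and proper: "\<And>K. submodule K A M \<Longrightarrow> K \<noteq> carrier M \<Longrightarrow> fin_length A (M\<lparr>carrier := K\<rparr>)"
  shows "fin_length A M"
proof (rule ccontr)
  assume not: "\<not> fin_length A M"
  interpret cring A by fact
  interpret M: right_module A M by fact
  have comm_act: "a \<odot>\<^bsub>M\<^esub> (b \<odot>\<^bsub>M\<^esub> x) = b \<odot>\<^bsub>M\<^esub> (a \<odot>\<^bsub>M\<^esub> x)"
    if "a \<in> carrier A" "b \<in> carrier A" "x \<in> carrier M" for a b x
    using M.act_mult[of a b x] M.act_mult[of b a x] m_comm[of a b] that by simp
  have mult: "(\<lambda>x. a \<odot>\<^bsub>M\<^esub> x) \<in> rmod_hom A M M" if "a \<in> carrier A" for a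
    by (rule rmod_homI) (use that in \<open>auto simp: M.act_closed M.act_add_module comm_act\<close>)
  \<comment> \<open>If \<open>a\<close> neither kills \<open>M\<close> nor acts onto, its kernel and
    its image are both proper, hence of finite length, and so is \<open>M\<close> as an
    extension.\<close>
  have kill_or_onto: "(\<forall>x \<in> carrier M. a \<odot>\<^bsub>M\<^esub> x = \<zero>\<^bsub>M\<^esub>) \<or> (\<lambda>x. a \<odot>\<^bsub>M\<^esub> x) ` carrier M = carrier M"
    if a: "a \<in> carrier A" for a
  proof (rule ccontr)
    assume neg: "\<not> ?thesis"
    interpret h: module_hom A M M "\<lambda>x. a \<odot>\<^bsub>M\<^esub> x" by (rule module_homI[OF M M mult[OF a]])
    let ?I = "(\<lambda>x. a \<odot>\<^bsub>M\<^esub> x) ` carrier M"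
    have I: "submodule ?I A M" "fin_length A (M\<lparr>carrier := ?I\<rparr>)"
      using neg proper[OF h.submodule_range] h.submodule_range by auto
    have h': "module_hom A M (M\<lparr>carrier := ?I\<rparr>) (\<lambda>x. a \<odot>\<^bsub>M\<^esub> x)"
      by (rule module_homI[OF M right_module_sub[OF M I(1)] rmod_hom_into_sub[OF mult[OF a]]]) simp
    have "a_kernel M M (\<lambda>x. a \<odot>\<^bsub>M\<^esub> x) \<noteq> carrier M" using neg by (auto simp: a_kernel_def')
    then have "fin_length A (M\<lparr>carrier := a_kernel M M (\<lambda>x. a \<odot>\<^bsub>M\<^esub> x)\<rparr>)"
      by (rule proper[OF h.submodule_kernel])
    then have "fin_length A (M\<lparr>carrier := a_kernel M (M\<lparr>carrier := ?I\<rparr>) (\<lambda>x. a \<odot>\<^bsub>M\<^esub> x)\<rparr>)"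
      by (simp add: a_kernel_def')
    then have "fin_length A M" by (rule fin_length_ext[OF h' _ I(2)])
    then show False using not by blast
  qed
  have unit: "(\<forall>x \<in> carrier M. a \<odot>\<^bsub>M\<^esub> x = \<zero>\<^bsub>M\<^esub>) \<or> (\<exists>s \<in> carrier A. \<forall>x \<in> carrier M. s \<odot>\<^bsub>M\<^esub> (a \<odot>\<^bsub>M\<^esub> x) = x)"
    if a: "a \<in> carrier A" for a
  proof (cases "\<forall>x \<in> carrier M. a \<odot>\<^bsub>M\<^esub> x = \<zero>\<^bsub>M\<^esub>")
    case False
    then have onto: "(\<lambda>x. a \<odot>\<^bsub>M\<^esub> x) ` carrier M = carrier M" using kill_or_onto[OF a] by blast
    \<comment> \<open>The sum of the ideal generated by the power of \<open>a\<close> and the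
      annihilator of \<open>M\<close>, described by actions. These ideals decrease, so the
      descending chain condition applies.\<close>
    define I where "I m = {b \<in> carrier A. \<exists>s \<in> carrier A. \<forall>x \<in> carrier M. b \<odot>\<^bsub>M\<^esub> x = (a [^] m \<otimes> s) \<odot>\<^bsub>M\<^esub> x}" for m :: nat
    have "ideal (I m) A" for m
      unfolding submodule_regular_iff_ideal[OF comm, symmetric]
    proof (rule submoduleI'[OF right_module_regular])
      show "I m \<subseteq> carrier (regular A)" by (auto simp: I_def)
      show "\<zero>\<^bsub>regular A\<^esub> \<in> I m" using a by (auto simp: I_def intro!: bexI[of _ \<zero>])
      fix b c assume "b \<in> I m" "c \<in> I m"
      then obtain s t where s: "b \<in> carrier A" "s \<in> carrier A" "\<forall>x \<in> carrier M. b \<odot>\<^bsub>M\<^esub> x = (a [^] m \<otimes> s) \<odot>\<^bsub>M\<^esub> x"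
        and t: "c \<in> carrier A" "t \<in> carrier A" "\<forall>x \<in> carrier M. c \<odot>\<^bsub>M\<^esub> x = (a [^] m \<otimes> t) \<odot>\<^bsub>M\<^esub> x"
        by (auto simp: I_def)
      show "b \<oplus>\<^bsub>regular A\<^esub> c \<in> I m"
        using s t a by (auto simp: I_def r_distr M.act_add_ring intro!: bexI[of _ "s \<oplus> t"])
    next
      fix r b assume "r \<in> carrier A" "b \<in> I m"
      then obtain s where s: "r \<in> carrier A" "b \<in> carrier A" "s \<in> carrier A" "\<forall>x \<in> carrier M. b \<odot>\<^bsub>M\<^esub> x = (a [^] m \<otimes> s) \<odot>\<^bsub>M\<^esub> x"
        by (auto simp: I_def)
      then show "r \<odot>\<^bsub>regular A\<^esub> b \<in> I m"
        using a by (auto simp: I_def M.act_mult M.act_closed m_assoc[symmetric] intro!: bexI[of _ "s \<otimes> r"])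
    qed
    moreover have "I (Suc m) \<subseteq> I m" for m
    proof
      fix b assume "b \<in> I (Suc m)"
      then obtain s where "b \<in> carrier A" "s \<in> carrier A" "\<forall>x \<in> carrier M. b \<odot>\<^bsub>M\<^esub> x = (a [^] Suc m \<otimes> s) \<odot>\<^bsub>M\<^esub> x"
        by (auto simp: I_def)
      then show "b \<in> I m" using a by (auto simp: I_def m_assoc intro!: bexI[of _ "a \<otimes> s"])
    qed
    ultimately obtain m where m: "\<forall>i\<ge>m. I i = I m" using art unfolding artinian_ring_def by meson
    have "a [^] m \<in> I m" using a by (auto simp: I_def intro!: bexI[of _ \<one>])
    then have "a [^] m \<in> I (Suc m)" using m by (metis le_SucI order_refl)
    then obtain s where s: "s \<in> carrier A" "\<forall>x \<in> carrier M. a [^] m \<odot>\<^bsub>M\<^esub> x = (a [^] Suc m \<otimes> s) \<odot>\<^bsub>M\<^esub> x"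
      by (auto simp: I_def)
    have pow_onto: "(\<lambda>x. a [^] k \<odot>\<^bsub>M\<^esub> x) ` carrier M = carrier M" for k :: nat
    proof (induction k)
      case 0
      show ?case using M.act_one by force
    next
      case (Suc k)
      have "(\<lambda>x. a [^] Suc k \<odot>\<^bsub>M\<^esub> x) ` carrier M = (\<lambda>x. a \<odot>\<^bsub>M\<^esub> x) ` (\<lambda>x. a [^] k \<odot>\<^bsub>M\<^esub> x) ` carrier M"
        unfolding image_image by (rule image_cong[OF refl]) (use a in \<open>simp add: M.act_mult\<close>)
      then show ?case using Suc onto by simp
    qed
    \<comment> \<open>Once the chain is stationary, the \<open>m\<close>-th power of
      \<open>a\<close> acts as the next power followed by \<open>s\<close>; since the
      \<open>m\<close>-th power acts onto, \<open>s\<close> undoes \<open>a\<close> on all of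
      \<open>M\<close>.\<close>
    have "s \<odot>\<^bsub>M\<^esub> (a \<odot>\<^bsub>M\<^esub> y) = y" if "y \<in> carrier M" for y
    proof -
      obtain x where x: "x \<in> carrier M" "y = a [^] m \<odot>\<^bsub>M\<^esub> x"
        using \<open>y \<in> carrier M\<close> pow_onto[of m] by (metis imageE)
      have "s \<odot>\<^bsub>M\<^esub> (a \<odot>\<^bsub>M\<^esub> y) = (a [^] Suc m \<otimes> s) \<odot>\<^bsub>M\<^esub> x"
        using a s(1) x by (simp add: M.act_mult)
      then show ?thesis using s(2) x by simp
    qed
    then show ?thesis using s(1) by blast
  qed simp
  have "\<not> zero_module M" using not fin_length_zero[OF M] by blast
  then obtain x where x: "x \<in> carrier M" "x \<noteq> \<zero>\<^bsub>M\<^esub>"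
    using M.M.zero_closed unfolding zero_module_def by blast
  \<comment> \<open>A maximal submodule avoiding \<open>x\<close> plays the complement of the line
    through \<open>x\<close>.\<close>
  let ?S = "{H. submodule H A M \<and> x \<notin> H}"
  have "\<exists>H \<in> ?S. \<forall>K \<in> ?S. H \<subseteq> K \<longrightarrow> K = H"
  proof (rule subset_Zorn_nonempty)
    show "?S \<noteq> {}" using submodule_zero[OF M] x by blast
    fix C assume C: "C \<noteq> {}" "subset.chain ?S C"
    then have CS: "H \<in> C \<Longrightarrow> submodule H A M" "H \<in> C \<Longrightarrow> x \<notin> H" for H
      by (auto simp: subset_chain_def)
    have tot: "H \<subseteq> K \<or> K \<subseteq> H" if "H \<in> C" "K \<in> C" for H K
      using C(2) that by (auto simp: subset_chain_def)
    have "submodule (\<Union>C) A M"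
    proof (rule submoduleI'[OF M])
      show "\<Union>C \<subseteq> carrier M" using CS(1) submoduleD(1) by blast
      show "\<zero>\<^bsub>M\<^esub> \<in> \<Union>C" using C(1) CS(1) submoduleD(2) by blast
      fix u v assume "u \<in> \<Union>C" "v \<in> \<Union>C"
      then obtain H K where "H \<in> C" "K \<in> C" "u \<in> H" "v \<in> K" by blast
      then obtain L where "L \<in> C" "u \<in> L" "v \<in> L" using tot[of H K] by blast
      then show "u \<oplus>\<^bsub>M\<^esub> v \<in> \<Union>C" using submoduleD(3)[OF CS(1)] by blast
    next
      fix a u assume "a \<in> carrier A" "u \<in> \<Union>C"
      then show "a \<odot>\<^bsub>M\<^esub> u \<in> \<Union>C" using submoduleD(4)[OF CS(1)] by blast
    qed
    then show "\<Union>C \<in> ?S" using CS(2) by blast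
  qed
  then obtain H where H: "submodule H A M" "x \<notin> H"
    and max: "\<And>K. submodule K A M \<Longrightarrow> x \<notin> K \<Longrightarrow> H \<subseteq> K \<Longrightarrow> K = H" by auto
  have HM: "H \<subseteq> carrier M" by (rule submoduleD(1)[OF H(1)])
  \<comment> \<open>By maximality \<open>K\<close> contains \<open>x\<close>. For \<open>y\<close>
    outside \<open>H\<close>, maximality also puts \<open>x\<close> into the sum of \<open>H\<close>
    and the multiples of \<open>y\<close>; the scalar involved does not kill \<open>M\<close>, so it
    can be inverted, and \<open>y\<close> is recovered from \<open>x\<close> and \<open>H\<close>
    inside \<open>K\<close>.\<close>
  have full: "K = carrier M" if K: "submodule K A M" "H \<subseteq> K" "K \<noteq> H" for K
  proof (intro subset_antisym subsetI)
    have xK: "x \<in> K" using max K by blast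
    fix y assume y: "y \<in> carrier M"
    show "y \<in> K"
    proof (cases "y \<in> H")
      case False
      interpret l: module_hom A "regular A" M "\<lambda>a. a \<odot>\<^bsub>M\<^esub> y"
        by (rule module_homI[OF right_module_regular M rmod_hom_regular[OF M y]])
      let ?L = "submodule_sum M H ((\<lambda>a. a \<odot>\<^bsub>M\<^esub> y) ` carrier (regular A))"
      note L = submodule_sum[OF M H(1) l.submodule_range]
      have "y \<in> (\<lambda>a. a \<odot>\<^bsub>M\<^esub> y) ` carrier (regular A)"
        using M.act_one[OF y] by (intro image_eqI[of _ _ \<one>]) simp_all
      then have "y \<in> ?L" using L(3) by blast
      then have "x \<in> ?L" using max[OF L(1) _ L(2)] False by blast
      then obtain h a where h: "h \<in> H" "a \<in> carrier A" "x = h \<oplus>\<^bsub>M\<^esub> a \<odot>\<^bsub>M\<^esub> y"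
        unfolding submodule_sum_def by auto
      have hM: "h \<in> carrier M" using h HM by blast
      have ay: "a \<odot>\<^bsub>M\<^esub> y \<in> carrier M" by (rule M.act_closed[OF h(2) y])
      have "\<not> (\<forall>x \<in> carrier M. a \<odot>\<^bsub>M\<^esub> x = \<zero>\<^bsub>M\<^esub>)"
      proof
        assume "\<forall>x \<in> carrier M. a \<odot>\<^bsub>M\<^esub> x = \<zero>\<^bsub>M\<^esub>"
        then have "x = h" using h(3) hM y by simp
        then show False using h(1) H(2) by simp
      qed
      then obtain s where s: "s \<in> carrier A" "\<forall>x \<in> carrier M. s \<odot>\<^bsub>M\<^esub> (a \<odot>\<^bsub>M\<^esub> x) = x"
        using unit[OF h(2)] by blast
      have "a \<odot>\<^bsub>M\<^esub> y = x \<ominus>\<^bsub>M\<^esub> h" unfolding h(3) using hM ay by algebra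
      then have "a \<odot>\<^bsub>M\<^esub> y \<in> K" using submoduleD(6)[OF K(1) xK] h(1) K(2) by auto
      then have "s \<odot>\<^bsub>M\<^esub> (a \<odot>\<^bsub>M\<^esub> y) \<in> K" by (rule submoduleD(4)[OF K(1) s(1)])
      then show ?thesis using s(2) y by simp
    qed (use K in blast)
  qed (use submoduleD(1)[OF K(1)] in blast)
  note q = rep_quotient[OF M H(1)]
  interpret q: module_hom A M "rep_quotient M H" "coset_rep M H" by (rule module_homI[OF M q(1,2)])
  have "H \<noteq> carrier M" using H(2) x(1) by blast
  then have flH: "fin_length A (M\<lparr>carrier := a_kernel M (rep_quotient M H) (coset_rep M H)\<rparr>)"
    unfolding q(4) by (rule proper[OF H(1)])
  \<comment> \<open>Nothing lies strictly between \<open>H\<close> and \<open>M\<close>, so a rank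
    with two values is strictly monotone on submodules of the quotient. Finite length of
    \<open>M\<close>, as an extension, is then the contradiction.\<close>
  have "fin_length A (rep_quotient M H)"
  proof (rule fin_lengthI[of _ _ "\<lambda>N. if N = carrier (rep_quotient M H) then 1 else 0"])
    fix N N' assume N: "submodule N A (rep_quotient M H)" "submodule N' A (rep_quotient M H)" "N \<subset> N'"
    have pre: "submodule {m \<in> carrier M. coset_rep M H m \<in> N'} A M" by (rule q.submodule_preimage[OF N(2)])
    have sub: "H \<subseteq> {m \<in> carrier M. coset_rep M H m \<in> N'}"
    proof
      fix m assume m: "m \<in> H"
      then have "coset_rep M H m = \<zero>\<^bsub>rep_quotient M H\<^esub>"
        using q(4) unfolding a_kernel_def' by blast
      then show "m \<in> {m \<in> carrier M. coset_rep M H m \<in> N'}" using submoduleD(2)[OF N(2)] m HM by auto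
    qed
    obtain y where y: "y \<in> N'" "y \<notin> N" using N(3) by blast
    then have "y \<in> coset_rep M H ` carrier M" unfolding q(3) using submoduleD(1)[OF N(2)] by blast
    then obtain m where m: "m \<in> carrier M" "y = coset_rep M H m" by (rule imageE)
    have "m \<notin> H"
    proof
      assume "m \<in> H"
      then have "y = \<zero>\<^bsub>rep_quotient M H\<^esub>" using q(4) m(2) unfolding a_kernel_def' by blast
      then show False using submoduleD(2)[OF N(1)] y(2) by blast
    qed
    then have "{m \<in> carrier M. coset_rep M H m \<in> N'} \<noteq> H" using m y by blast
    then have all: "{m \<in> carrier M. coset_rep M H m \<in> N'} = carrier M" by (rule full[OF pre sub])
    have "carrier (rep_quotient M H) \<subseteq> N'"
    proof
      fix z assume "z \<in> carrier (rep_quotient M H)"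
      then obtain u where "u \<in> carrier M" "z = coset_rep M H u" unfolding q(3)[symmetric] by (rule imageE)
      then show "z \<in> N'" using all by blast
    qed
    then have "N' = carrier (rep_quotient M H)" using submoduleD(1)[OF N(2)] by blast
    then show "(if N = carrier (rep_quotient M H) then 1 else 0) < (if N' = carrier (rep_quotient M H) then 1 else (0::nat))"
      using N(3) by auto
  qed
  then have "fin_length A M" by (rule fin_length_ext[OF q.module_hom_axioms flH])
  then show False using not by blast
qed

text \<open>An ideal of infinite length all of whose proper subideals have finite length would
  contradict \<open>fin_length_minimal\<close>. So each ideal of infinite length properly contains
  another one, and dependent choice yields a strictly descending chain of ideals.\<close>

lemma artinian_ring_fin_length:
  fixes R :: "'r ring"
  assumes art: "artinian_ring R"
  shows "fin_length R (regular R)"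
proof (rule ccontr)
  assume not: "\<not> fin_length R (regular R)"
  have comm: "cring R" using art unfolding artinian_ring_def by simp
  interpret cring R by (rule comm)
  interpret base_ring R by (rule base_ring.intro) (rule ring_axioms)
  let ?bad = "\<lambda>J. submodule J R (regular R) \<and> \<not> fin_length R ((regular R)\<lparr>carrier := J\<rparr>)"
  have smaller: "\<exists>K. ?bad K \<and> K \<subset> J" if J: "?bad J" for J
  proof (rule ccontr)
    assume none: "\<not> ?thesis"
    note Jm = right_module_sub[OF right_module_regular conjunct1[OF J]]
    have "fin_length R ((regular R)\<lparr>carrier := J\<rparr>)"
    proof (rule fin_length_minimal[OF comm art Jm])
      fix K assume K: "submodule K R ((regular R)\<lparr>carrier := J\<rparr>)" "K \<noteq> carrier ((regular R)\<lparr>carrier := J\<rparr>)"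
      then have "submodule K R (regular R)" "K \<subset> J"
        using submodule_sub_iff[OF right_module_regular conjunct1[OF J]] by auto
      then show "fin_length R ((regular R)\<lparr>carrier := J\<rparr>\<lparr>carrier := K\<rparr>)" using none by auto
    qed
    then show False using J by blast
  qed
  have "?bad (carrier R)"
    using not submodule_carrier[OF right_module_regular] by (simp add: regular_def)
  then have "\<exists>J. ?bad J" by (rule exI)
  then have "\<exists>J. \<forall>n. ?bad (J n) \<and> J (Suc n) \<subset> J n"
    by (rule dependent_nat_choice) (rule smaller)
  then obtain J :: "nat \<Rightarrow> 'r set" where J': "\<forall>n. ?bad (J n) \<and> J (Suc n) \<subset> J n" by (rule exE)
  note J = J'[rule_format, THEN conjunct1] J'[rule_format, THEN conjunct2]
  have "\<forall>i. ideal (J i) R \<and> J (Suc i) \<subseteq> J i"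
    using conjunct1[OF J(1)] psubset_imp_subset[OF J(2)] unfolding submodule_regular_iff_ideal[OF comm] by simp
  then have "\<exists>m. \<forall>i\<ge>m. J i = J m" using art unfolding artinian_ring_def by (simp only: simp_thms)
  then obtain m where m: "\<forall>i\<ge>m. J i = J m" by (rule exE)
  have "J (Suc m) = J m" by (rule m[rule_format]) simp
  then show False using J(2)[of m] by blast
qed

section \<open>Artin algebras and the module \<open>D A\<close>\<close>

definition restrict_scalars :: "('r \<Rightarrow> 'a) \<Rightarrow> ('a, 'm) module \<Rightarrow> ('r, 'm) module" where
  "restrict_scalars \<phi> M = \<lparr>carrier = carrier M, mult = mult M, one = \<one>\<^bsub>M\<^esub>,
     zero = \<zero>\<^bsub>M\<^esub>, add = add M, smult = (\<lambda>r x. \<phi> r \<odot>\<^bsub>M\<^esub> x)\<rparr>"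

lemma restrict_scalars_simps [simp]:
  "carrier (restrict_scalars \<phi> M) = carrier M" "\<zero>\<^bsub>restrict_scalars \<phi> M\<^esub> = \<zero>\<^bsub>M\<^esub>"
  "x \<oplus>\<^bsub>restrict_scalars \<phi> M\<^esub> y = x \<oplus>\<^bsub>M\<^esub> y" "r \<odot>\<^bsub>restrict_scalars \<phi> M\<^esub> x = \<phi> r \<odot>\<^bsub>M\<^esub> x"
  by (simp_all add: restrict_scalars_def)

lemma scalar_module_simps [simp]:
  "carrier (scalar_module A \<phi>) = carrier A" "\<zero>\<^bsub>scalar_module A \<phi>\<^esub> = \<zero>\<^bsub>A\<^esub>"
  "x \<oplus>\<^bsub>scalar_module A \<phi>\<^esub> y = x \<oplus>\<^bsub>A\<^esub> y" "r \<odot>\<^bsub>scalar_module A \<phi>\<^esub> x = \<phi> r \<otimes>\<^bsub>A\<^esub> x"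
  by (simp_all add: scalar_module_def)

lemma dual_regular_simps [simp]:
  "carrier (dual_regular R \<phi> E A) = rmod_hom R (scalar_module A \<phi>) E \<inter> extensional (carrier A)"
  "\<zero>\<^bsub>dual_regular R \<phi> E A\<^esub> = (\<lambda>x\<in>carrier A. \<zero>\<^bsub>E\<^esub>)"
  "f \<oplus>\<^bsub>dual_regular R \<phi> E A\<^esub> g = (\<lambda>x\<in>carrier A. f x \<oplus>\<^bsub>E\<^esub> g x)"
  "a \<odot>\<^bsub>dual_regular R \<phi> E A\<^esub> f = (\<lambda>x\<in>carrier A. f (a \<otimes>\<^bsub>A\<^esub> x))"
  by (simp_all add: dual_regular_def)

locale artin_algebra_over = A: base_ring A + R: artin_ring R
  for R :: "'r ring" and A :: "'a ring" +
  fixes \<phi> :: "'r \<Rightarrow> 'a"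
  assumes cring: "cring R" and phi_hom: "\<phi> \<in> ring_hom R A"
    and central: "\<And>r x. r \<in> carrier R \<Longrightarrow> x \<in> carrier A \<Longrightarrow> \<phi> r \<otimes>\<^bsub>A\<^esub> x = x \<otimes>\<^bsub>A\<^esub> \<phi> r"
    and fg_scalar: "fg_module R (scalar_module A \<phi>)"
begin

lemma phi: "r \<in> carrier R \<Longrightarrow> \<phi> r \<in> carrier A"
  by (rule ring_hom_closed[OF phi_hom])

lemma right_module_restrict_scalars:
  assumes "right_module A M" shows "right_module R (restrict_scalars \<phi> M)"
proof -
  interpret M: right_module A M by fact
  show ?thesis
    by (rule right_moduleI)
      (auto simp: R.ring_axioms M.M.a_ac M.act_closed phi ring_hom_add[OF phi_hom] ring_hom_mult[OF phi_hom]
        ring_hom_one[OF phi_hom] M.act_add_ring M.act_add_module M.act_mult M.act_one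
        intro!: bexI[OF _ M.M.a_inv_closed] M.M.l_neg)
qed

lemma rmod_hom_restrict_scalars:
  "f \<in> rmod_hom A M N \<Longrightarrow> f \<in> rmod_hom R (restrict_scalars \<phi> M) (restrict_scalars \<phi> N)"
  by (rule rmod_homI) (auto simp: phi rmod_homD)

lemma submodule_restrict_scalars:
  assumes "right_module A M" "submodule N A M" shows "submodule N R (restrict_scalars \<phi> M)"
  by (rule submoduleI'[OF right_module_restrict_scalars[OF assms(1)]])
    (use submoduleD(1)[OF assms(2)] in \<open>auto simp: phi intro: submoduleD(2,3,4)[OF assms(2)]\<close>)

text \<open>Every \<open>A\<close>-submodule is an \<open>R\<close>-submodule, so a rank function
  over \<open>R\<close> serves over \<open>A\<close>.\<close>

lemma fin_length_restrict_scalars: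
  assumes "right_module A M" "fin_length R (restrict_scalars \<phi> M)" shows "fin_length A M"
proof -
  obtain r :: "_ set \<Rightarrow> nat" where "\<And>L L'. submodule L R (restrict_scalars \<phi> M) \<Longrightarrow> submodule L' R (restrict_scalars \<phi> M) \<Longrightarrow>
     L \<subset> L' \<Longrightarrow> r L < r L'"
    by (rule fin_lengthE[OF assms(2)]) blast
  then show ?thesis by (intro fin_lengthI[of _ _ r]) (auto intro: submodule_restrict_scalars[OF assms(1)])
qed

text \<open>Restriction of the right action multiplies by \<open>\<phi> r\<close> on the right,
  \<open>scalar_module\<close> on the left; centrality identifies the two.\<close>

lemma fin_length_restrict_regular: "fin_length R (restrict_scalars \<phi> (regular A))"
proof -
  note m = right_module_restrict_scalars[OF A.right_module_regular] and s = fg_module_right[OF fg_scalar]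
  have "(\<lambda>x. x) \<in> rmod_hom R (restrict_scalars \<phi> (regular A)) (scalar_module A \<phi>)"
    by (rule rmod_homI) (auto simp: central)
  then have "rmod_iso R (restrict_scalars \<phi> (regular A)) (scalar_module A \<phi>)" by (rule rmod_isoI) simp_all
  then show ?thesis by (rule fin_length_iso[OF m s _ R.fg_imp_fin_length[OF fg_scalar]])
qed

lemma fin_length_regular: "fin_length A (regular A)"
  by (rule fin_length_restrict_scalars[OF A.right_module_regular fin_length_restrict_regular])

lemma fg_restrict_scalars:
  assumes M: "fg_module A M" shows "fg_module R (restrict_scalars \<phi> M)"
proof -
  obtain k f where f: "f \<in> rmod_hom A (direct_sum k (\<lambda>_. regular A)) M"
    "f ` carrier (direct_sum k (\<lambda>_. regular A)) = carrier M"
    by (rule A.free_surjection[OF M])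
  let ?D = "direct_sum k (\<lambda>_. regular A)"
  let ?D' = "direct_sum k (\<lambda>_. restrict_scalars \<phi> (regular A))"
  have "f \<in> rmod_hom R ?D' (restrict_scalars \<phi> M)"
    using rmod_hom_restrict_scalars[OF f(1)] by (simp add: rmod_hom_def)
  moreover have "right_module R ?D'"
    by (rule right_module_direct_sum[OF R.ring_axioms right_module_restrict_scalars[OF A.right_module_regular]])
  ultimately have h: "module_hom R ?D' (restrict_scalars \<phi> M) f"
    by (intro module_homI right_module_restrict_scalars[OF fg_module_right[OF M]])
  have "fin_length R ?D'"
    by (rule fin_length_direct_sum[OF R.ring_axioms right_module_restrict_scalars[OF A.right_module_regular] fin_length_restrict_regular])
  then have "fin_length R (restrict_scalars \<phi> M)"
    by (intro fin_length_surj[OF h]) (use f(2) in simp)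
  then show ?thesis by (rule fin_length_imp_fg[OF right_module_restrict_scalars[OF fg_module_right[OF M]]])
qed

lemma right_module_dual_regular:
  assumes E: "right_module R E" shows "right_module A (dual_regular R \<phi> E A)"
proof -
  interpret E: right_module R E by fact
  let ?D = "rmod_hom R (scalar_module A \<phi>) E \<inter> extensional (carrier A)"
  note sm = fg_module_right[OF fg_scalar]
  have r: "restrict f (carrier A) \<in> ?D" if "f \<in> rmod_hom R (scalar_module A \<phi>) E" for f
    using rmod_hom_cong[OF that sm, of "restrict f (carrier A)"] by simp
  have cl: "f x \<in> carrier E" if "f \<in> ?D" "x \<in> carrier A" for f x
    using rmod_homD(1)[of f R "scalar_module A \<phi>" E x] that by simp
  have eq: "restrict g (carrier A) = f" if "f \<in> ?D" "\<And>x. x \<in> carrier A \<Longrightarrow> g x = f x" for f g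
  proof
    fix x show "restrict g (carrier A) x = f x"
      using that by (cases "x \<in> carrier A") (simp_all add: extensional_def)
  qed
  have act: "(\<lambda>x. f (a \<otimes>\<^bsub>A\<^esub> x)) \<in> rmod_hom R (scalar_module A \<phi>) E" if f: "f \<in> ?D" and a: "a \<in> carrier A" for f a
  proof (rule rmod_homI)
    have fh: "f \<in> rmod_hom R (scalar_module A \<phi>) E" using f by simp
    fix x assume x: "x \<in> carrier (scalar_module A \<phi>)"
    then show "f (a \<otimes>\<^bsub>A\<^esub> x) \<in> carrier E" using cl[OF f] a by simp
    show "f (a \<otimes>\<^bsub>A\<^esub> (r \<odot>\<^bsub>scalar_module A \<phi>\<^esub> x)) = r \<odot>\<^bsub>E\<^esub> f (a \<otimes>\<^bsub>A\<^esub> x)" if "r \<in> carrier R" for r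
    proof -
      have "a \<otimes>\<^bsub>A\<^esub> (\<phi> r \<otimes>\<^bsub>A\<^esub> x) = (a \<otimes>\<^bsub>A\<^esub> \<phi> r) \<otimes>\<^bsub>A\<^esub> x"
        using a x phi[OF that] by (simp add: A.m_assoc)
      also have "\<dots> = \<phi> r \<otimes>\<^bsub>A\<^esub> (a \<otimes>\<^bsub>A\<^esub> x)"
        using a x phi[OF that] by (simp add: central[OF that a, symmetric] A.m_assoc)
      finally show ?thesis using rmod_homD(3)[OF fh that, of "a \<otimes>\<^bsub>A\<^esub> x"] a x by simp
    qed
    fix y assume y: "y \<in> carrier (scalar_module A \<phi>)"
    show "f (a \<otimes>\<^bsub>A\<^esub> (x \<oplus>\<^bsub>scalar_module A \<phi>\<^esub> y)) = f (a \<otimes>\<^bsub>A\<^esub> x) \<oplus>\<^bsub>E\<^esub> f (a \<otimes>\<^bsub>A\<^esub> y)"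
      using rmod_homD(2)[OF fh, of "a \<otimes>\<^bsub>A\<^esub> x" "a \<otimes>\<^bsub>A\<^esub> y"] a x y by (simp add: A.r_distr)
  qed
  show ?thesis
  proof (rule right_moduleI; (unfold dual_regular_simps)?)
    show "ring A" by (rule A.ring_axioms)
    show "(\<lambda>x\<in>carrier A. \<zero>\<^bsub>E\<^esub>) \<in> ?D" by (rule r[OF rmod_hom_zero[OF E]])
    fix f assume f: "f \<in> ?D"
    then have fh: "f \<in> rmod_hom R (scalar_module A \<phi>) E" by simp
    show "(\<lambda>x\<in>carrier A. (\<lambda>x\<in>carrier A. \<zero>\<^bsub>E\<^esub>) x \<oplus>\<^bsub>E\<^esub> f x) = f"
      by (rule eq[OF f]) (simp add: cl[OF f])
    show "\<exists>g\<in>?D. (\<lambda>x\<in>carrier A. g x \<oplus>\<^bsub>E\<^esub> f x) = (\<lambda>x\<in>carrier A. \<zero>\<^bsub>E\<^esub>)"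
      by (rule bexI[OF _ r[OF rmod_hom_neg[OF E fh]]]) (rule restrict_ext, simp add: cl[OF f] E.M.l_neg)
    show "(\<lambda>x\<in>carrier A. f (\<one>\<^bsub>A\<^esub> \<otimes>\<^bsub>A\<^esub> x)) = f"
      by (rule eq[OF f]) simp
    fix a assume a: "a \<in> carrier A"
    show "(\<lambda>x\<in>carrier A. f (a \<otimes>\<^bsub>A\<^esub> x)) \<in> ?D" by (rule r[OF act[OF f a]])
    fix b assume b: "b \<in> carrier A"
    show "(\<lambda>x\<in>carrier A. f ((a \<oplus>\<^bsub>A\<^esub> b) \<otimes>\<^bsub>A\<^esub> x)) =
      (\<lambda>x\<in>carrier A. (\<lambda>x\<in>carrier A. f (a \<otimes>\<^bsub>A\<^esub> x)) x \<oplus>\<^bsub>E\<^esub> (\<lambda>x\<in>carrier A. f (b \<otimes>\<^bsub>A\<^esub> x)) x)"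
    proof (rule restrict_ext)
      fix x assume "x \<in> carrier A"
      then show "f ((a \<oplus>\<^bsub>A\<^esub> b) \<otimes>\<^bsub>A\<^esub> x) =
         (\<lambda>x\<in>carrier A. f (a \<otimes>\<^bsub>A\<^esub> x)) x \<oplus>\<^bsub>E\<^esub> (\<lambda>x\<in>carrier A. f (b \<otimes>\<^bsub>A\<^esub> x)) x"
        using rmod_homD(2)[OF fh, of "a \<otimes>\<^bsub>A\<^esub> x" "b \<otimes>\<^bsub>A\<^esub> x"] a b by (simp add: A.l_distr)
    qed
    show "(\<lambda>x\<in>carrier A. f (a \<otimes>\<^bsub>A\<^esub> b \<otimes>\<^bsub>A\<^esub> x)) =
       (\<lambda>x\<in>carrier A. (\<lambda>x\<in>carrier A. f (a \<otimes>\<^bsub>A\<^esub> x)) (b \<otimes>\<^bsub>A\<^esub> x))"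
      by (rule restrict_ext) (use a b in \<open>simp add: A.m_assoc\<close>)
  next
    fix f g assume f: "f \<in> ?D" and g: "g \<in> ?D"
    then have h: "f \<in> rmod_hom R (scalar_module A \<phi>) E" "g \<in> rmod_hom R (scalar_module A \<phi>) E" by simp_all
    show "(\<lambda>x\<in>carrier A. f x \<oplus>\<^bsub>E\<^esub> g x) \<in> ?D" by (rule r[OF rmod_hom_add[OF E h]])
    show "(\<lambda>x\<in>carrier A. f x \<oplus>\<^bsub>E\<^esub> g x) = (\<lambda>x\<in>carrier A. g x \<oplus>\<^bsub>E\<^esub> f x)"
      by (rule restrict_ext, rule E.M.a_comm) (rule cl[OF f] cl[OF g], assumption)+
    show "(\<lambda>x\<in>carrier A. (\<lambda>x\<in>carrier A. f x \<oplus>\<^bsub>E\<^esub> g x) (a \<otimes>\<^bsub>A\<^esub> x)) =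
       (\<lambda>x\<in>carrier A. (\<lambda>x\<in>carrier A. f (a \<otimes>\<^bsub>A\<^esub> x)) x \<oplus>\<^bsub>E\<^esub> (\<lambda>x\<in>carrier A. g (a \<otimes>\<^bsub>A\<^esub> x)) x)"
      if "a \<in> carrier A" for a
      by (rule restrict_ext) (use that in simp)
    fix h assume h: "h \<in> ?D"
    show "(\<lambda>x\<in>carrier A. (\<lambda>x\<in>carrier A. f x \<oplus>\<^bsub>E\<^esub> g x) x \<oplus>\<^bsub>E\<^esub> h x) =
       (\<lambda>x\<in>carrier A. f x \<oplus>\<^bsub>E\<^esub> (\<lambda>x\<in>carrier A. g x \<oplus>\<^bsub>E\<^esub> h x) x)"
      by (rule restrict_ext) (simp add: E.M.a_assoc cl[OF f] cl[OF g] cl[OF h])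
  qed
qed

text \<open>A functional is determined by its values on generators of \<open>A\<close>; cutting down by one evaluation
  at a time embeds \<open>D A\<close> into a power of \<open>E\<close>.\<close>

lemma fg_dual_regular:
  assumes E: "fg_module R E" shows "fg_module A (dual_regular R \<phi> E A)"
proof -
  let ?D = "dual_regular R \<phi> E A"
  note Em = fg_module_right[OF E]
  note Dm = right_module_dual_regular[OF Em] and sm = fg_module_right[OF fg_scalar]
  note rm = right_module_restrict_scalars[OF Dm]
  interpret E: right_module R E by (rule Em)
  obtain S where S: "finite S" "S \<subseteq> carrier A" "module_span R (scalar_module A \<phi>) S = carrier A"
    using fg_scalar by (auto simp: fg_module_iff)
  define K where "K T = {f \<in> carrier ?D. \<forall>s\<in>T. f s = \<zero>\<^bsub>E\<^esub>}" for T
  have ev: "(\<lambda>f. f s) \<in> rmod_hom R (restrict_scalars \<phi> ?D) E" if s: "s \<in> carrier A" for s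
  proof (rule rmod_homI)
    fix f assume f: "f \<in> carrier (restrict_scalars \<phi> ?D)"
    then have fh: "f \<in> rmod_hom R (scalar_module A \<phi>) E" by simp
    show "f s \<in> carrier E" using rmod_homD(1)[OF fh] s by simp
    show "(r \<odot>\<^bsub>restrict_scalars \<phi> ?D\<^esub> f) s = r \<odot>\<^bsub>E\<^esub> f s" if "r \<in> carrier R" for r
      using rmod_homD(3)[OF fh that, of s] s by simp
  qed (use s in simp)
  have K: "submodule (K T) R (restrict_scalars \<phi> ?D)" if T: "T \<subseteq> carrier A" for T
  proof (rule submoduleI'[OF rm])
    show "K T \<subseteq> carrier (restrict_scalars \<phi> ?D)" by (auto simp: K_def)
    interpret D: right_module R "restrict_scalars \<phi> ?D" by (rule rm)
    have z: "\<zero>\<^bsub>restrict_scalars \<phi> ?D\<^esub> s = \<zero>\<^bsub>E\<^esub>" if "s \<in> T" for s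
      using that T by auto
    show "\<zero>\<^bsub>restrict_scalars \<phi> ?D\<^esub> \<in> K T"
      using D.M.zero_closed z unfolding K_def restrict_scalars_simps(1) by blast
    fix f g assume fg: "f \<in> K T" "g \<in> K T"
    then have c: "f \<in> carrier (restrict_scalars \<phi> ?D)" "g \<in> carrier (restrict_scalars \<phi> ?D)" by (auto simp: K_def)
    have "(f \<oplus>\<^bsub>restrict_scalars \<phi> ?D\<^esub> g) s = \<zero>\<^bsub>E\<^esub>" if "s \<in> T" for s
      using rmod_homD(2)[OF ev c, of s] that T fg by (auto simp: K_def)
    then show "f \<oplus>\<^bsub>restrict_scalars \<phi> ?D\<^esub> g \<in> K T"
      using D.M.a_closed[OF c] unfolding K_def restrict_scalars_simps(1) by blast
  next
    interpret D: right_module R "restrict_scalars \<phi> ?D" by (rule rm)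
    fix r f assume r: "r \<in> carrier R" and f: "f \<in> K T"
    then have c: "f \<in> carrier (restrict_scalars \<phi> ?D)" by (auto simp: K_def)
    have "(r \<odot>\<^bsub>restrict_scalars \<phi> ?D\<^esub> f) s = \<zero>\<^bsub>E\<^esub>" if s: "s \<in> T" for s
    proof -
      have sA: "s \<in> carrier A" using s T by blast
      have "f s = \<zero>\<^bsub>E\<^esub>" using f s by (simp add: K_def)
      then show ?thesis using rmod_homD(3)[OF ev[OF sA] r c] r by simp
    qed
    then show "r \<odot>\<^bsub>restrict_scalars \<phi> ?D\<^esub> f \<in> K T"
      using D.act_closed[OF r c] unfolding K_def restrict_scalars_simps(1) by blast
  qed
  let ?K = "\<lambda>T. (restrict_scalars \<phi> ?D)\<lparr>carrier := K T\<rparr>"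
  have Ksub: "K T \<subseteq> carrier (restrict_scalars \<phi> ?D)" for T by (auto simp: K_def)
  \<comment> \<open>Evaluation at \<open>s\<close> maps \<open>K T\<close> to \<open>E\<close> with
    kernel \<open>K (insert s T)\<close>. So finite length climbs from \<open>K S\<close>, which is
    zero because \<open>S\<close> generates, up to \<open>K {}\<close>, the whole dual.\<close>
  have "fin_length R (?K {})" if "fin_length R (?K T)" "finite T" "T \<subseteq> carrier A" for T
    using that(2,1,3)
  proof (induction T)
    case (insert s T)
    have T: "T \<subseteq> carrier A" "s \<in> carrier A" using insert.prems by auto
    have h: "module_hom R (?K T) E (\<lambda>f. f s)"
      by (rule module_homI[OF right_module_sub[OF rm K[OF T(1)]] Em rmod_hom_restrict[OF ev[OF T(2)] Ksub]])
    have "a_kernel (?K T) E (\<lambda>f. f s) = K (insert s T)" by (auto simp: a_kernel_def' K_def)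
    then have "fin_length R ((?K T)\<lparr>carrier := a_kernel (?K T) E (\<lambda>f. f s)\<rparr>)" using insert.prems(1) by simp
    then have "fin_length R (?K T)" by (rule fin_length_ext[OF h _ R.fg_imp_fin_length[OF E]])
    then show ?case using insert.IH T by blast
  qed
  moreover have "fin_length R (?K S)"
  proof (rule fin_length_zero[OF right_module_sub[OF rm K[OF S(2)]]])
    have z: "f = \<zero>\<^bsub>?D\<^esub>" if f: "f \<in> K S" for f
    proof -
      have fh: "f \<in> rmod_hom R (scalar_module A \<phi>) E" "f \<in> extensional (carrier A)" using f by (simp_all add: K_def)
      interpret f: module_hom R "scalar_module A \<phi>" E f by (rule module_homI[OF sm Em fh(1)])
      have "module_span R (scalar_module A \<phi>) S \<subseteq> a_kernel (scalar_module A \<phi>) E f"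
        by (rule submodule_span(3)[OF sm _ f.submodule_kernel]) (use f S(2) in \<open>auto simp: K_def a_kernel_def'\<close>)
      then have "f x = \<zero>\<^bsub>E\<^esub>" if "x \<in> carrier A" for x using that unfolding S(3) by (auto simp: a_kernel_def')
      moreover have "f x = undefined" if "x \<notin> carrier A" for x
        using fh(2) that unfolding extensional_def by blast
      ultimately show ?thesis unfolding dual_regular_simps by (intro ext) (simp add: restrict_def)
    qed
    have "\<zero>\<^bsub>?D\<^esub> \<in> K S" using submoduleD(2)[OF K[OF S(2)]] by (simp only: restrict_scalars_simps)
    with z have "K S = {\<zero>\<^bsub>?D\<^esub>}" by blast
    then show "zero_module (?K S)" by (simp add: zero_module_def del: dual_regular_simps)
  qed
  ultimately have "fin_length R (?K {})" using S(1,2) by blast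
  moreover have "K {} = carrier ?D" by (auto simp: K_def)
  then have "?K {} = restrict_scalars \<phi> ?D" by (simp only: restrict_scalars_def) simp
  ultimately have "fin_length R (restrict_scalars \<phi> ?D)" by simp
  then show ?thesis by (intro fin_length_imp_fg[OF Dm] fin_length_restrict_scalars[OF Dm])
qed

text \<open>Homomorphisms over \<open>A\<close> into the dual of \<open>A\<close> correspond to
  homomorphisms over \<open>R\<close> into \<open>E\<close> by evaluation at \<open>\<one>\<close>.
  The extension problem is moved to \<open>R\<close>, solved there by injectivity of
  \<open>E\<close>, and moved back.\<close>

lemma injective_dual_regular:
  assumes E: "injective_module R E" shows "injective_module A (dual_regular R \<phi> E A)"
  unfolding injective_module_def
proof (intro conjI allI impI)
  let ?D = "dual_regular R \<phi> E A"
  note Ef = injective_fg[OF E]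
  show "fg_module A ?D" by (rule fg_dual_regular[OF Ef])
  fix X Y :: "'a fgmod" and g f
  assume "fg_module A X \<and> fg_module A Y \<and> g \<in> rmod_hom A X Y \<and> inj_on g (carrier X) \<and> f \<in> rmod_hom A X ?D"
  then have X: "fg_module A X" and Y: "fg_module A Y" and g: "g \<in> rmod_hom A X Y" "inj_on g (carrier X)"
    and f: "f \<in> rmod_hom A X ?D" by auto
  interpret X: right_module A X by (rule fg_module_right[OF X])
  interpret Y: right_module A Y by (rule fg_module_right[OF Y])
  have fx: "f x \<in> rmod_hom R (scalar_module A \<phi>) E" "f x \<in> extensional (carrier A)" if "x \<in> carrier X" for x
    using rmod_homD(1)[OF f that] by simp_all
  have f1: "(\<lambda>x. f x \<one>\<^bsub>A\<^esub>) \<in> rmod_hom R (restrict_scalars \<phi> X) E"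
  proof (rule rmod_homI)
    fix x assume x: "x \<in> carrier (restrict_scalars \<phi> X)"
    then show "f x \<one>\<^bsub>A\<^esub> \<in> carrier E" using rmod_homD(1)[OF fx(1)] by simp
    show "f (r \<odot>\<^bsub>restrict_scalars \<phi> X\<^esub> x) \<one>\<^bsub>A\<^esub> = r \<odot>\<^bsub>E\<^esub> f x \<one>\<^bsub>A\<^esub>" if "r \<in> carrier R" for r
      using rmod_homD(3)[OF f phi[OF that], of x] rmod_homD(3)[OF fx(1) that, of x "\<one>\<^bsub>A\<^esub>"] x phi[OF that] by simp
    fix y assume y: "y \<in> carrier (restrict_scalars \<phi> X)"
    show "f (x \<oplus>\<^bsub>restrict_scalars \<phi> X\<^esub> y) \<one>\<^bsub>A\<^esub> = f x \<one>\<^bsub>A\<^esub> \<oplus>\<^bsub>E\<^esub> f y \<one>\<^bsub>A\<^esub>"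
      using rmod_homD(2)[OF f, of x y] x y by simp
  qed
  obtain h where h: "h \<in> rmod_hom R (restrict_scalars \<phi> Y) E"
    "\<And>x. x \<in> carrier (restrict_scalars \<phi> X) \<Longrightarrow> h (g x) = f x \<one>\<^bsub>A\<^esub>"
    by (rule R.injective_extend[OF E fg_restrict_scalars[OF X] fg_restrict_scalars[OF Y] rmod_hom_restrict_scalars[OF g(1)] _ f1])
      (use g(2) in simp, blast)
  note hD = rmod_homD[OF h(1), unfolded restrict_scalars_simps]
  \<comment> \<open>The inverse of the correspondence: \<open>h\<close> is turned into the map
    sending \<open>y\<close> to the functional that takes \<open>a\<close> to \<open>h\<close> of
    \<open>y\<close> acted on by \<open>a\<close>.\<close>
  define k where "k y = (\<lambda>a\<in>carrier A. h (a \<odot>\<^bsub>Y\<^esub> y))" for y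
  have k: "k \<in> rmod_hom A Y ?D"
  proof (rule rmod_homI)
    fix y assume y: "y \<in> carrier Y"
    have "k y \<in> rmod_hom R (scalar_module A \<phi>) E"
    proof (rule rmod_homI)
      fix a assume a: "a \<in> carrier (scalar_module A \<phi>)"
      then show "k y a \<in> carrier E" using y hD(1) Y.act_closed by (simp add: k_def)
      show "k y (r \<odot>\<^bsub>scalar_module A \<phi>\<^esub> a) = r \<odot>\<^bsub>E\<^esub> k y a" if "r \<in> carrier R" for r
        using that y a phi[OF that] hD(3)[OF that Y.act_closed[of a y]]
        by (simp add: k_def central Y.act_mult)
      fix b assume b: "b \<in> carrier (scalar_module A \<phi>)"
      show "k y (a \<oplus>\<^bsub>scalar_module A \<phi>\<^esub> b) = k y a \<oplus>\<^bsub>E\<^esub> k y b"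
        using y a b hD(2)[OF Y.act_closed[of a y] Y.act_closed[of b y]] by (simp add: k_def Y.act_add_ring)
    qed
    then show "k y \<in> carrier ?D" by (simp add: k_def)
    show "k (a \<odot>\<^bsub>Y\<^esub> y) = a \<odot>\<^bsub>?D\<^esub> k y" if "a \<in> carrier A" for a
      unfolding dual_regular_simps k_def by (rule restrict_ext) (use y that in \<open>simp add: Y.act_mult\<close>)
    fix z assume z: "z \<in> carrier Y"
    show "k (y \<oplus>\<^bsub>Y\<^esub> z) = k y \<oplus>\<^bsub>?D\<^esub> k z"
      unfolding dual_regular_simps k_def
      by (rule restrict_ext) (use y z hD(2)[OF Y.act_closed[of _ y] Y.act_closed[of _ z]] in \<open>simp add: Y.act_add_module\<close>)
  qed
  have "k (g x) = f x" if x: "x \<in> carrier X" for x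
  proof
    fix a show "k (g x) a = f x a"
    proof (cases "a \<in> carrier A")
      case True
      have "k (g x) a = h (g (a \<odot>\<^bsub>X\<^esub> x))" using True x rmod_homD(3)[OF g(1) True x] by (simp add: k_def)
      also have "\<dots> = f (a \<odot>\<^bsub>X\<^esub> x) \<one>\<^bsub>A\<^esub>" using h(2) X.act_closed[OF True x] by simp
      also have "\<dots> = f x a" using rmod_homD(3)[OF f True x] True by simp
      finally show ?thesis .
    next
      case False
      then show ?thesis using fx(2)[OF x] by (simp add: k_def extensional_def)
    qed
  qed
  then show "\<exists>h\<in>rmod_hom A Y ?D. \<forall>x\<in>carrier X. h (g x) = f x" using k by blast
qed

end

lemma artin_algebra_over:
  assumes "artin_algebra R \<phi> A" shows "artin_algebra_over R A \<phi>"
proof -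
  have R: "artinian_ring R" "ring A" "\<phi> \<in> ring_hom R A"
    "\<And>r x. r \<in> carrier R \<Longrightarrow> x \<in> carrier A \<Longrightarrow> \<phi> r \<otimes>\<^bsub>A\<^esub> x = x \<otimes>\<^bsub>A\<^esub> \<phi> r" "fg_module R (scalar_module A \<phi>)"
    using assms unfolding artin_algebra_def by blast+
  have c: "cring R" using R(1) unfolding artinian_ring_def by simp
  show ?thesis
    by (intro artin_algebra_over.intro artin_algebra_over_axioms.intro base_ring.intro artin_ring.intro
        artin_ring_axioms.intro artinian_ring_fin_length R c cring.axioms(1))
qed

section \<open>Counting indecomposable summands\<close>

text \<open>A homogeneous system with fewer equations than unknowns. Elimination is done without
  division, so that the solution stays integral; its entries are read as multiplicities
  later.\<close>

lemma int_linear_dependency: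
  fixes c :: "'i \<Rightarrow> nat \<Rightarrow> int"
  assumes "finite S" "t < card S"
  shows "\<exists>x. (\<exists>i\<in>S. x i \<noteq> 0) \<and> (\<forall>j<t. (\<Sum>i\<in>S. x i * c i j) = 0)"
  using assms
proof (induction t arbitrary: S c)
  case 0
  then obtain i where "i \<in> S" by fastforce
  then show ?case by (intro exI[of _ "\<lambda>_. 1"]) auto
next
  case (Suc t)
  show ?case
  proof (cases "\<forall>i\<in>S. c i t = 0")
    case True
    obtain x where "\<exists>i\<in>S. x i \<noteq> 0" "\<forall>j<t. (\<Sum>i\<in>S. x i * c i j) = 0"
      using Suc.IH[OF Suc.prems(1), of c] Suc.prems(2) by auto
    moreover have "(\<Sum>i\<in>S. x i * c i t) = 0" using True by (intro sum.neutral) simp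
    ultimately show ?thesis by (intro exI[of _ x]) (auto simp: less_Suc_eq)
  next
    case False
    then obtain p where p: "p \<in> S" "c p t \<noteq> 0" by blast
    let ?S = "S - {p}"
    have "finite ?S" "t < card ?S" using Suc.prems p(1) by auto
    \<comment> \<open>Cross-multiplying with the pivot \<open>c p t\<close> clears column
      \<open>t\<close> from all rows other than \<open>p\<close>.\<close>
    from Suc.IH[OF this, of "\<lambda>i j. c p t * c i j - c i t * c p j"] obtain x where
      x: "\<exists>i\<in>?S. x i \<noteq> 0" "\<And>j. j < t \<Longrightarrow> (\<Sum>i\<in>?S. x i * (c p t * c i j - c i t * c p j)) = 0" by blast
    \<comment> \<open>Scaling \<open>x\<close> by the pivot undoes the cross-multiplication, and the
      entry at \<open>p\<close> makes column \<open>t\<close> sum to zero. The solution stays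
      nonzero since the pivot is nonzero.\<close>
    define y where "y i = (if i = p then - (\<Sum>i\<in>?S. x i * c i t) else c p t * x i)" for i
    have sum: "(\<Sum>i\<in>S. y i * c i j) = (\<Sum>i\<in>?S. x i * (c p t * c i j - c i t * c p j))" for j
    proof -
      have "(\<Sum>i\<in>S. y i * c i j) = y p * c p j + (\<Sum>i\<in>?S. y i * c i j)"
        using Suc.prems(1) p(1) by (rule sum.remove)
      also have "(\<Sum>i\<in>?S. y i * c i j) = (\<Sum>i\<in>?S. c p t * x i * c i j)"
        by (rule sum.cong) (auto simp: y_def)
      also have "y p * c p j = - ((\<Sum>i\<in>?S. x i * c i t) * c p j)" by (simp add: y_def)
      also have "- ((\<Sum>i\<in>?S. x i * c i t) * c p j) + (\<Sum>i\<in>?S. c p t * x i * c i j) =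
          (\<Sum>i\<in>?S. x i * (c p t * c i j - c i t * c p j))"
        by (simp add: sum_distrib_right sum_distrib_left sum_subtractf algebra_simps)
      finally show ?thesis .
    qed
    have "(\<Sum>i\<in>S. y i * c i j) = 0" if "j < Suc t" for j
    proof (cases "j = t")
      case True
      then show ?thesis unfolding sum by (simp add: mult.commute)
    next
      case False
      then show ?thesis unfolding sum using x(2) that by simp
    qed
    moreover have "\<exists>i\<in>S. y i \<noteq> 0" using x(1) p by (auto simp: y_def)
    ultimately show ?thesis by blast
  qed
qed

lemma count_list_map_cong:
  "count_list l = count_list l' \<Longrightarrow> count_list (map f l) = count_list (map f l')"
proof (induction l arbitrary: l')
  case Nil
  then have "set l' = {}" by (metis count_list.simps(1) count_list_0_iff equals0I)
  then show ?case by simp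
next
  case (Cons u l)
  have c: "count_list (u # l) v = count_list l' v" for v by (simp only: Cons.prems)
  have "u \<in> set l'" using c[of u] count_list_0_iff[of l' u] by auto
  then obtain xs ys where l': "l' = xs @ u # ys" by (meson split_list)
  have "count_list l = count_list (xs @ ys)"
  proof
    fix v show "count_list l v = count_list (xs @ ys) v" using c[of v] by (simp add: l' split: if_splits)
  qed
  from Cons.IH[OF this] have "count_list (map f l) v = count_list (map f (xs @ ys)) v" for v by simp
  then show ?case by (intro ext) (simp add: l')
qed

lemma count_list_concat_map:
  "count_list (concat (map \<alpha> l)) j = sum_list (map (\<lambda>i. count_list (\<alpha> i) j) l)"
  by (induction l) simp_all

lemma sum_list_replicates:
  "sum_list (map f (concat (map (\<lambda>i. replicate (m i) i) [0..<n]))) = (\<Sum>i<n. m i * (f i :: nat))"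
  by (induction n) (simp_all add: sum_list_replicate)

section \<open>Exact sequences with multiplicities, and the count of projectives\<close>

context artin_ring
begin

lemma projective_list_sum: "(\<And>U. U \<in> set l \<Longrightarrow> projective_module A U) \<Longrightarrow> projective_module A (list_sum l)"
  unfolding list_sum_def by (rule projective_direct_sum) (metis length_rev nth_mem set_rev)

lemma list_sum_map_permute:
  assumes "\<And>j. j \<in> set l \<Longrightarrow> right_module A (N j)" "count_list l = count_list l'"
  shows "rmod_iso A (list_sum (map N l)) (list_sum (map N l'))"
  by (rule list_sum_permute[OF _ count_list_map_cong[OF assms(2)]]) (use assms(1) in auto)

lemma short_exact_refl:
  assumes "right_module A Z" "zero_module Z" "right_module A C"
  shows "short_exact A Z C C"
proof -
  interpret z: module_hom A Z C "\<lambda>x. \<zero>\<^bsub>C\<^esub>" by (rule module_homI[OF assms(1,3) rmod_hom_zero[OF assms(3)]])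
  show ?thesis
    by (rule short_exactI[OF z.hom rmod_hom_id]) (use assms(2) in \<open>auto simp: zero_module_def a_kernel_def'\<close>)
qed

text \<open>The sum of the sequences for all indices in \<open>l\<close>, each as often as it
  occurs. Both outer terms stay sums of modules \<open>N j\<close> with concatenated index lists, so
  multiplicities can be counted.\<close>

lemma short_exact_list_sum:
  assumes mods: "\<And>i. i < n \<Longrightarrow> right_module A (P i)" "\<And>j. j < t \<Longrightarrow> right_module A (N j)"
    and sub: "\<And>i. i < n \<Longrightarrow> set (\<alpha> i) \<subseteq> {..<t}" "\<And>i. i < n \<Longrightarrow> set (\<beta> i) \<subseteq> {..<t}"
    and ex: "\<And>i. i < n \<Longrightarrow> short_exact A (P i) (list_sum (map N (\<alpha> i))) (list_sum (map N (\<beta> i)))"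
    and l: "set l \<subseteq> {..<n}"
  shows "short_exact A (list_sum (map P l)) (list_sum (map N (concat (map \<alpha> l)))) (list_sum (map N (concat (map \<beta> l))))"
  using l
proof (induction l)
  case Nil
  show ?case
    unfolding list.map concat.simps
    by (intro short_exact_refl right_module_list_sum zero_module_list_sum_Nil) simp_all
next
  case (Cons i l)
  have i: "i < n" and l: "set l \<subseteq> {..<n}" using Cons.prems by auto
  have cN: "right_module A V" if "V \<in> set (map N (\<alpha> i @ concat (map \<alpha> l)))" for V
    using that sub(1) mods(2) i l by fastforce
  have cN': "right_module A V" if "V \<in> set (map N (\<beta> i @ concat (map \<beta> l)))" for V
    using that sub(2) mods(2) i l by fastforce
  have cP: "right_module A V" if "V \<in> set (map P (i # l))" for V
    using that mods(1) i l by auto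
  have P: "rmod_iso A (direct_sum2 (P i) (list_sum (map P l))) (list_sum (map P (i # l)))"
    unfolding list.map
    by (rule rmod_iso_sym[OF right_module_list_sum list_sum_Cons]) (use cP in auto)
  have N: "rmod_iso A (direct_sum2 (list_sum (map N (\<alpha> i))) (list_sum (map N (concat (map \<alpha> l))))) (list_sum (map N (concat (map \<alpha> (i # l)))))"
    unfolding list.map concat.simps map_append
    by (rule rmod_iso_sym[OF right_module_list_sum list_sum_append]) (use cN in \<open>simp_all add: map_append\<close>)
  have N': "rmod_iso A (direct_sum2 (list_sum (map N (\<beta> i))) (list_sum (map N (concat (map \<beta> l))))) (list_sum (map N (concat (map \<beta> (i # l)))))"
    unfolding list.map concat.simps map_append
    by (rule rmod_iso_sym[OF right_module_list_sum list_sum_append]) (use cN' in \<open>simp_all add: map_append\<close>)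
  have m: "right_module A (direct_sum2 (P i) (list_sum (map P l)))"
    "right_module A (direct_sum2 (list_sum (map N (\<alpha> i))) (list_sum (map N (concat (map \<alpha> l)))))"
    "right_module A (direct_sum2 (list_sum (map N (\<beta> i))) (list_sum (map N (concat (map \<beta> l)))))"
    "right_module A (list_sum (map N (concat (map \<beta> (i # l)))))"
    using cP cN cN' by (auto intro!: right_module_direct_sum2 right_module_list_sum)
  show ?case
    by (rule short_exact_iso[OF m short_exact_direct_sum2[OF ex[OF i] Cons.IH[OF l]] P N N'])
qed

lemma indecomposable_summand_list_sum:
  assumes U: "indecomposable_module A U" and l: "\<And>V. V \<in> set l \<Longrightarrow> right_module A V"
    and s: "summand A U (list_sum l)"
  shows "\<exists>V \<in> set l. summand A U V"
proof -
  have "\<exists>i<length l. summand A U (rev l ! i)"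
    by (rule indecomposable_summand_direct_sum[OF U _ s[unfolded list_sum_def]]) (metis l length_rev nth_mem set_rev)
  then show ?thesis by (metis length_rev nth_mem set_rev)
qed

text \<open>In the Grothendieck group of projectives the classes of the \<open>P i\<close> are independent, and those of
  the \<open>N j\<close>, computed by resolutions of length one, generate them. The proof turns an integral dependency
  into two short exact sequences with the same last two terms and different first terms.\<close>

lemma indecomposables_le:
  fixes P N :: "nat \<Rightarrow> 'a fgmod"
  assumes P: "\<And>i. i < n \<Longrightarrow> indecomposable_module A (P i)" "\<And>i. i < n \<Longrightarrow> projective_module A (P i)"
      "\<And>i j. i < n \<Longrightarrow> j < n \<Longrightarrow> i \<noteq> j \<Longrightarrow> \<not> rmod_iso A (P i) (P j)"
    and N: "\<And>j. j < t \<Longrightarrow> fg_module A (N j)"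
    and sub: "\<And>i. i < n \<Longrightarrow> set (\<alpha> i) \<subseteq> {..<t}" "\<And>i. i < n \<Longrightarrow> set (\<beta> i) \<subseteq> {..<t}"
    and ex: "\<And>i. i < n \<Longrightarrow> short_exact A (P i) (list_sum (map N (\<alpha> i))) (list_sum (map N (\<beta> i)))"
    and pd: "\<And>l. set l \<subseteq> {..<t} \<Longrightarrow> pd_le_one A (list_sum (map N l))"
  shows "n \<le> t"
proof (rule ccontr)
  assume "\<not> n \<le> t"
  then have "t < card {..<n}" by simp
  \<comment> \<open>The coefficients express the class of \<open>P i\<close> in those of the
    \<open>N j\<close>: middle term minus cokernel of its short exact sequence. More rows than
    columns force a relation.\<close>
  from int_linear_dependency[OF finite_lessThan this, of "\<lambda>i j. int (count_list (\<alpha> i) j) - int (count_list (\<beta> i) j)"]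
  obtain x where x: "\<exists>i<n. x i \<noteq> 0"
    and dep: "\<And>j. j < t \<Longrightarrow> (\<Sum>i<n. x i * (int (count_list (\<alpha> i) j) - int (count_list (\<beta> i) j))) = 0"
    by auto
  \<comment> \<open>The positive and the negative part of the relation, as index lists with
    multiplicities; they have no index in common and at least one is nonempty.\<close>
  define p where "p = concat (map (\<lambda>i. replicate (nat (x i)) i) [0..<n])"
  define q where "q = concat (map (\<lambda>i. replicate (nat (- x i)) i) [0..<n])"
  have pset: "i \<in> set p \<longleftrightarrow> i < n \<and> 0 < x i" and qset: "i \<in> set q \<longleftrightarrow> i < n \<and> x i < 0" for i
    by (auto simp: p_def q_def)
  have pn: "set p \<subseteq> {..<n}" and qn: "set q \<subseteq> {..<n}" using pset qset by auto
  define a where "a l = concat (map \<alpha> l)" for l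
  define b where "b l = concat (map \<beta> l)" for l
  have "set (concat (map \<gamma> l)) \<subseteq> {..<t}"
    if "set l \<subseteq> {..<n}" "\<And>i. i < n \<Longrightarrow> set (\<gamma> i) \<subseteq> {..<t}" for l and \<gamma> :: "nat \<Rightarrow> nat list"
  proof
    fix j assume "j \<in> set (concat (map \<gamma> l))"
    then obtain i where "i \<in> set l" "j \<in> set (\<gamma> i)" by auto
    then show "j \<in> {..<t}" using that(2)[of i] that(1) by blast
  qed
  then have at: "set (a l) \<subseteq> {..<t}" "set (b l) \<subseteq> {..<t}" if "set l \<subseteq> {..<n}" for l
    unfolding a_def b_def using that sub by blast+
  \<comment> \<open>The relation with the cokernel terms moved across, which removes all minus
    signs: both sides are honest direct sums.\<close>
  have cnt: "count_list (a p @ b q) = count_list (a q @ b p)"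
  proof
    fix j show "count_list (a p @ b q) j = count_list (a q @ b p) j"
    proof (cases "j < t")
      case True
      have "int (count_list (a p) j) + int (count_list (b q) j) - int (count_list (a q) j) - int (count_list (b p) j) =
        (\<Sum>i<n. int (nat (x i)) * int (count_list (\<alpha> i) j)) + (\<Sum>i<n. int (nat (- x i)) * int (count_list (\<beta> i) j))
        - (\<Sum>i<n. int (nat (- x i)) * int (count_list (\<alpha> i) j)) - (\<Sum>i<n. int (nat (x i)) * int (count_list (\<beta> i) j))"
        by (simp add: a_def b_def p_def q_def count_list_concat_map sum_list_replicates)
      also have "\<dots> = (\<Sum>i<n. (int (nat (x i)) - int (nat (- x i))) * (int (count_list (\<alpha> i) j) - int (count_list (\<beta> i) j)))"
        by (simp add: sum.distrib sum_subtractf algebra_simps)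
      also have "\<dots> = (\<Sum>i<n. x i * (int (count_list (\<alpha> i) j) - int (count_list (\<beta> i) j)))"
        by (rule sum.cong) auto
      also have "\<dots> = 0" by (rule dep[OF True])
      finally show ?thesis by simp
    next
      case False
      then have "j \<notin> set (a p @ b q)" "j \<notin> set (a q @ b p)" using at[OF pn] at[OF qn] by auto
      then show ?thesis by (metis count_notin)
    qed
  qed
  let ?N = "\<lambda>l. list_sum (map N l)"
  let ?P = "\<lambda>l. list_sum (map P l)"
  have Nm: "right_module A (?N l)" "fg_module A (?N l)" if "set l \<subseteq> {..<t}" for l
    using subsetD[OF that] N by (auto intro!: right_module_list_sum fg_module_list_sum fg_module_right)
  have Pm: "right_module A (?P l)" if "set l \<subseteq> {..<n}" for l
    by (rule right_module_list_sum) (use subsetD[OF that] P(1) in \<open>auto intro!: fg_module_right indecomposable_fg\<close>)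
  have Pp: "projective_module A (?P l)" if l: "set l \<subseteq> {..<n}" for l
    by (rule projective_list_sum) (use subsetD[OF l] P(2) in auto)
  let ?M = "?N (a p @ b q)"
  let ?Y = "direct_sum2 (?N (b p)) (?N (b q))"
  have Mset: "set (a p @ b q) \<subseteq> {..<t}" using at[OF pn] at[OF qn] by simp
  note Mm = Nm(1)[OF Mset] and Mpd = pd[OF Mset]
  note Bm = Nm[OF at(2)[OF pn]] Nm[OF at(2)[OF qn]]
  have Ym: "fg_module A ?Y" by (rule fg_module_direct_sum2[OF Bm(2,4)])
  have Z: "right_module A (list_sum ([] :: 'a fgmod list))" by (rule right_module_list_sum) simp
  \<comment> \<open>The sequence for \<open>l\<close> is enlarged by the identity of
    \<open>?N (b l')\<close>. For \<open>p\<close> and \<open>q\<close> exchanged, the middle term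
    changes only by a permutation, thanks to \<open>cnt\<close>, and the cokernel only by
    commutativity.\<close>
  have seq: "short_exact A (?P l) ?M ?Y"
    if l: "set l \<subseteq> {..<n}" and l': "set l' \<subseteq> {..<n}" and c: "count_list (a l @ b l') = count_list (a p @ b q)"
      and Y: "rmod_iso A (direct_sum2 (?N (b l)) (?N (b l'))) ?Y" for l l'
  proof -
    have e1: "short_exact A (?P l) (?N (a l)) (?N (b l))"
      unfolding a_def b_def
      by (rule short_exact_list_sum[where n = n and t = t])
        (rule fg_module_right indecomposable_fg P(1) N sub ex l | assumption)+
    note B = Nm(1)[OF at(2)[OF l]] Nm(1)[OF at(2)[OF l']] and A = Nm(1)[OF at(1)[OF l]]
    have e2: "short_exact A (list_sum ([] :: 'a fgmod list)) (?N (b l')) (?N (b l'))"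
      by (rule short_exact_refl[OF Z zero_module_list_sum_Nil B(2)])
    have M: "rmod_iso A (direct_sum2 (?N (a l)) (?N (b l'))) ?M"
    proof -
      have all: "right_module A V" if "V \<in> set (map N (a l) @ map N (b l'))" for V
        using that subsetD[OF at(1)[OF l]] subsetD[OF at(2)[OF l']] N by (auto intro!: fg_module_right)
      have "rmod_iso A (?N (a l @ b l')) ?M"
        by (rule list_sum_map_permute[OF _ c]) (use subsetD[OF at(1)[OF l]] subsetD[OF at(2)[OF l']] N in \<open>auto intro!: fg_module_right\<close>)
      moreover have "rmod_iso A (direct_sum2 (?N (a l)) (?N (b l'))) (?N (a l @ b l'))"
        unfolding map_append by (rule rmod_iso_sym[OF right_module_list_sum list_sum_append]) (rule all, assumption)+
      ultimately show ?thesis by (blast intro: rmod_iso_trans)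
    qed
    show ?thesis
      by (rule short_exact_iso[OF right_module_direct_sum2[OF Pm[OF l] Z] right_module_direct_sum2[OF A B(2)]
            right_module_direct_sum2[OF B] fg_module_right[OF Ym] short_exact_direct_sum2[OF e1 e2]
            direct_sum2_zero[OF Pm[OF l] Z zero_module_list_sum_Nil] M Y])
  qed
  have sp: "short_exact A (?P p) ?M ?Y" by (rule seq[OF pn qn refl rmod_iso_refl])
  have sq: "short_exact A (?P q) ?M ?Y" by (rule seq[OF qn pn cnt[symmetric] direct_sum2_commute])
  obtain Q Q' :: "'a fgmod" where Q: "projective_module A Q" "projective_module A Q'" "short_exact A Q' Q ?M"
    using Mpd unfolding pd_le_one_def by blast
  note Qf = projective_fg[OF Q(1)] projective_fg[OF Q(2)]
  note Qm = projective_right_module[OF Q(1)] projective_right_module[OF Q(2)]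
  obtain K where K: "submodule K A Q" "short_exact A (Q\<lparr>carrier := K\<rparr>) Q ?Y"
    "rmod_iso A (Q\<lparr>carrier := K\<rparr>) (direct_sum2 (?P p) Q')"
    by (rule short_exact_pullback[OF Pp[OF pn] Qm(2) Qf(1) Mm fg_module_right[OF Ym] Q(3) sp])
  obtain L where L: "submodule L A Q" "short_exact A (Q\<lparr>carrier := L\<rparr>) Q ?Y"
    "rmod_iso A (Q\<lparr>carrier := L\<rparr>) (direct_sum2 (?P q) Q')"
    by (rule short_exact_pullback[OF Pp[OF qn] Qm(2) Qf(1) Mm fg_module_right[OF Ym] Q(3) sq])
  note KL = right_module_sub[OF Qm(1) K(1)] right_module_sub[OF Qm(1) L(1)]
  \<comment> \<open>Both kernels belong to surjections from the same \<open>Q\<close> onto the same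
    \<open>?Y\<close>, so Schanuel's lemma compares them up to \<open>Q\<close>; cancelling
    \<open>Q\<close> and then \<open>Q'\<close> leaves \<open>?P p\<close> and
    \<open>?P q\<close>.\<close>
  have "rmod_iso A (Q\<lparr>carrier := K\<rparr>) (Q\<lparr>carrier := L\<rparr>)"
    by (rule cancel_fg[OF Qf(1) KL schanuel[OF KL Ym Q(1) Q(1) K(2) L(2)]])
  then have "rmod_iso A (direct_sum2 (?P p) Q') (direct_sum2 (?P q) Q')"
    using rmod_iso_trans[OF rmod_iso_sym[OF KL(1) K(3)] rmod_iso_trans[OF _ L(3)]] by blast
  then have pq: "rmod_iso A (?P p) (?P q)" by (rule cancel_fg[OF Qf(2) Pm[OF pn] Pm[OF qn]])
  \<comment> \<open>Unique decomposition: a summand of one side is isomorphic to a summand of the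
    other. Since \<open>p\<close> and \<open>q\<close> are disjoint and the \<open>P i\<close>
    pairwise non-isomorphic, this is absurd.\<close>
  have transfer: "\<exists>j\<in>set l'. rmod_iso A (P i) (P j)"
    if i: "i \<in> set l" and l: "set l \<subseteq> {..<n}" "set l' \<subseteq> {..<n}" and iso: "rmod_iso A (?P l) (?P l')" for i l l'
  proof -
    have m: "right_module A V" if "V \<in> set (map P l) \<union> set (map P l')" for V
      using that subsetD[OF l(1)] subsetD[OF l(2)] P(1) by (auto intro!: fg_module_right indecomposable_fg)
    have iP: "indecomposable_module A (P i)" using i subsetD[OF l(1)] P(1) by auto
    have "summand A (P i) (?P l)" by (rule summand_list_sum) (use m i in auto)
    then have "summand A (P i) (?P l')"
      by (rule summand_trans[OF _ rmod_iso_imp_summand[OF Pm[OF l(1)] iso]])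
    then have "\<exists>V \<in> set (map P l'). summand A (P i) V"
      by (intro indecomposable_summand_list_sum[OF iP]) (use m in auto)
    then obtain j where j: "j \<in> set l'" "summand A (P i) (P j)" by auto
    have "indecomposable_module A (P j)" using subsetD[OF l(2) j(1)] P(1) by auto
    then have "rmod_iso A (P i) (P j)"
      by (rule summand_indecomposable_iso[OF _ indecomposable_fg[OF iP] indecomposable_not_zero[OF iP] j(2)])
    then show ?thesis using j(1) by blast
  qed
  obtain i where i: "i < n" "x i \<noteq> 0" using x by blast
  show False
  proof (cases "0 < x i")
    case True
    then have "i \<in> set p" using i(1) unfolding pset by simp
    then obtain j where j: "j \<in> set q" "rmod_iso A (P i) (P j)" by (rule bexE[OF transfer[OF _ pn qn pq]]) (rule that)
    have "j < n \<and> x j < 0" using j(1) unfolding qset .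
    then have "j < n" "i \<noteq> j" using True by auto
    then show False using P(3)[OF i(1)] j(2) by blast
  next
    case False
    then have "i \<in> set q" using i unfolding qset by simp
    then obtain j where j: "j \<in> set p" "rmod_iso A (P i) (P j)"
      by (rule bexE[OF transfer[OF _ qn pn rmod_iso_sym[OF Pm[OF pn] pq]]]) (rule that)
    have "j < n \<and> 0 < x j" using j(1) unfolding pset .
    then have "j < n" "i \<noteq> j" using False by auto
    then show False using P(3)[OF i(1)] j(2) by blast
  qed
qed

section \<open>Indecomposable injectives and their simple submodules\<close>

lemma minimal_submodule:
  assumes E: "fg_module A E" "\<not> zero_module E"
  obtains S where "submodule S A E" "S \<noteq> {\<zero>\<^bsub>E\<^esub>}"
    "\<And>N. submodule N A E \<Longrightarrow> N \<subseteq> S \<Longrightarrow> N \<noteq> {\<zero>\<^bsub>E\<^esub>} \<Longrightarrow> N = S"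
proof -
  note Em = fg_module_right[OF E(1)]
  obtain r :: "_ set \<Rightarrow> nat" where r: "\<And>L L'. submodule L A E \<Longrightarrow> submodule L' A E \<Longrightarrow> L \<subset> L' \<Longrightarrow> r L < r L'"
    by (rule fin_lengthE[OF fg_imp_fin_length[OF E(1)]]) blast
  have "submodule (carrier E) A E \<and> carrier E \<noteq> {\<zero>\<^bsub>E\<^esub>}"
    using submodule_carrier[OF Em] E(2) by (simp add: zero_module_def)
  from ex_has_least_nat[of "\<lambda>S. submodule S A E \<and> S \<noteq> {\<zero>\<^bsub>E\<^esub>}", OF this, of r]
  obtain S where S: "submodule S A E" "S \<noteq> {\<zero>\<^bsub>E\<^esub>}"
    and least: "\<And>N. submodule N A E \<Longrightarrow> N \<noteq> {\<zero>\<^bsub>E\<^esub>} \<Longrightarrow> r S \<le> r N"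
    by (elim exE conjE) (simp add: that)
  show ?thesis
  proof (rule that[OF S])
    fix N assume N: "submodule N A E" "N \<subseteq> S" "N \<noteq> {\<zero>\<^bsub>E\<^esub>}"
    show "N = S"
    proof (rule ccontr)
      assume "N \<noteq> S"
      then have "r N < r S" using N(2) by (intro r[OF N(1) S(1)]) blast
      then show False using least[OF N(1,3)] by simp
    qed
  qed
qed

text \<open>A map that vanishes on all components vanishes. The bound on the image of the component
  is kept because that image will be compared with a minimal submodule containing the image of
  \<open>f\<close>.\<close>

lemma hom_direct_sum_component:
  assumes P: "\<forall>i<n. right_module A (P i)" and E: "right_module A E"
    and f: "f \<in> rmod_hom A (direct_sum n P) E" "u \<in> carrier (direct_sum n P)" "f u \<noteq> \<zero>\<^bsub>E\<^esub>"
  shows "\<exists>i<n. \<exists>g \<in> rmod_hom A (P i) E. g ` carrier (P i) \<subseteq> f ` carrier (direct_sum n P) \<and>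
    (\<exists>v \<in> carrier (P i). g v \<noteq> \<zero>\<^bsub>E\<^esub>)"
  using P f
proof (induction n arbitrary: f u)
  case 0
  have m: "right_module A (direct_sum 0 P)" by (rule right_module_direct_sum[OF ring_axioms]) simp
  interpret f: module_hom A "direct_sum 0 P" E f by (rule module_homI[OF m E 0(2)])
  have "u = \<zero>\<^bsub>direct_sum 0 P\<^esub>" using 0(3) zero_module_direct_sum_0[of P] unfolding zero_module_def by blast
  then have "f u = \<zero>\<^bsub>E\<^esub>" by (simp only: f.zero)
  then show ?case using 0(4) by blast
next
  case (Suc n)
  let ?D = "direct_sum n P" and ?D' = "direct_sum (Suc n) P"
  have m: "right_module A ?D" "right_module A ?D'" "right_module A (P n)"
    using Suc.prems(1) by (auto intro!: right_module_direct_sum ring_axioms)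
  obtain x y where x: "x \<in> rmod_hom A ?D' (direct_sum2 ?D (P n))" "y \<in> rmod_hom A (direct_sum2 ?D (P n)) ?D'"
    "\<And>z. z \<in> carrier ?D' \<Longrightarrow> y (x z) = z"
    by (rule rmod_isoE[OF m(2) direct_sum_Suc]) blast
  note i1 = rmod_hom_comp[OF rmod_hom_inl[OF m(3)] x(2)] and i2 = rmod_hom_comp[OF rmod_hom_inr[OF m(1)] x(2)]
  interpret D: right_module A ?D by (rule m)
  interpret Pn: right_module A "P n" by (rule m)
  interpret E: right_module A E by (rule E)
  have c: "fst (x u) \<in> carrier ?D" "snd (x u) \<in> carrier (P n)"
    using rmod_homD(1)[OF x(1) Suc.prems(3)] unfolding direct_sum2_simps mem_Times_iff by blast+
  have split: "f u = f (y (fst (x u), \<zero>\<^bsub>P n\<^esub>)) \<oplus>\<^bsub>E\<^esub> f (y (\<zero>\<^bsub>?D\<^esub>, snd (x u)))"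
  proof -
    have "(fst (x u), \<zero>\<^bsub>P n\<^esub>) \<oplus>\<^bsub>direct_sum2 ?D (P n)\<^esub> (\<zero>\<^bsub>?D\<^esub>, snd (x u)) = x u"
      using c unfolding direct_sum2_simps fst_conv snd_conv by (simp only: D.M.r_zero Pn.M.l_zero prod.collapse)
    then have "f u = f (y ((fst (x u), \<zero>\<^bsub>P n\<^esub>) \<oplus>\<^bsub>direct_sum2 ?D (P n)\<^esub> (\<zero>\<^bsub>?D\<^esub>, snd (x u))))"
      by (simp only: x(3)[OF Suc.prems(3)])
    also have "\<dots> = f (y (fst (x u), \<zero>\<^bsub>P n\<^esub>)) \<oplus>\<^bsub>E\<^esub> f (y (\<zero>\<^bsub>?D\<^esub>, snd (x u)))"
      by (rule rmod_homD(2)[OF rmod_hom_comp[OF x(2) Suc.prems(2)]])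
        (simp_all only: direct_sum2_simps mem_Times_iff fst_conv snd_conv c D.M.zero_closed Pn.M.zero_closed)
    finally show ?thesis .
  qed
  have sub: "(\<lambda>z. f (h z)) ` carrier X \<subseteq> f ` carrier ?D'" if "h \<in> rmod_hom A X ?D'" for h and X :: "('a, 'x) module"
    using rmod_homD(1)[OF that] by blast
  show ?case
  proof (cases "f (y (\<zero>\<^bsub>?D\<^esub>, snd (x u))) = \<zero>\<^bsub>E\<^esub>")
    case False
    then show ?thesis
      using rmod_hom_comp[OF i2 Suc.prems(2)] sub[OF i2] c(2) by (intro exI[of _ n] conjI bexI[of _ "\<lambda>v. f (y (\<zero>\<^bsub>?D\<^esub>, v))"]) auto
  next
    case True
    then have "f (y (fst (x u), \<zero>\<^bsub>P n\<^esub>)) \<noteq> \<zero>\<^bsub>E\<^esub>" using Suc.prems(4) split E.M.zero_closed by auto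
    note nz = this
    have "\<forall>i<n. right_module A (P i)" using Suc.prems(1) by simp
    from Suc.IH[OF this rmod_hom_comp[OF i1 Suc.prems(2)] c(1) nz]
    obtain i g where g: "i < n" "g \<in> rmod_hom A (P i) E"
      "g ` carrier (P i) \<subseteq> (\<lambda>z. f (y (z, \<zero>\<^bsub>P n\<^esub>))) ` carrier ?D" "\<exists>v \<in> carrier (P i). g v \<noteq> \<zero>\<^bsub>E\<^esub>"
      by (elim exE conjE bexE) (rule that; (rule bexI)?; assumption)
    then show ?thesis using sub[OF i1] by (intro exI[of _ i] conjI bexI[of _ g]) auto
  qed
qed

text \<open>Two homomorphisms from an indecomposable projective module onto simple modules have the same kernel:
  otherwise the module would be the sum of the two kernels, and its endomorphism ring is local.\<close>

lemma projective_indecomposable_kernels: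
  assumes P: "indecomposable_module A P" "projective_module A P" and mods: "right_module A E" "right_module A E'"
    and f: "f \<in> rmod_hom A P E" "f ` carrier P \<noteq> {\<zero>\<^bsub>E\<^esub>}"
      "\<And>N. submodule N A E \<Longrightarrow> N \<subseteq> f ` carrier P \<Longrightarrow> N \<noteq> {\<zero>\<^bsub>E\<^esub>} \<Longrightarrow> N = f ` carrier P"
    and g: "g \<in> rmod_hom A P E'" "g ` carrier P \<noteq> {\<zero>\<^bsub>E'\<^esub>}"
      "\<And>N. submodule N A E' \<Longrightarrow> N \<subseteq> g ` carrier P \<Longrightarrow> N \<noteq> {\<zero>\<^bsub>E'\<^esub>} \<Longrightarrow> N = g ` carrier P"
  shows "a_kernel P E f = a_kernel P E' g"
proof (rule ccontr)
  assume ne: "a_kernel P E f \<noteq> a_kernel P E' g"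
  note Pm = projective_right_module[OF P(2)] and Pf = projective_fg[OF P(2)]
  interpret f: module_hom A P E f by (rule module_homI[OF Pm mods(1) f(1)])
  interpret g: module_hom A P E' g by (rule module_homI[OF Pm mods(2) g(1)])
  let ?K = "a_kernel P E f" and ?L = "a_kernel P E' g"
  note K = f.submodule_kernel and L = g.submodule_kernel
  have KP: "?K \<subseteq> carrier P" and LP: "?L \<subseteq> carrier P" by (rule submoduleD(1)[OF K], rule submoduleD(1)[OF L])
  \<comment> \<open>If \<open>?L\<close> is not inside \<open>?K\<close>, then \<open>f\<close>
    sends it to a nonzero submodule of a simple image, hence onto it, and every \<open>p\<close> is
    congruent to an element of \<open>?L\<close> modulo \<open>?K\<close>. Otherwise
    \<open>?K\<close> is not inside \<open>?L\<close> and the roles are exchanged.\<close>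
  have sum: "\<exists>k\<in>?K. \<exists>l\<in>?L. p = k \<oplus>\<^bsub>P\<^esub> l" if p: "p \<in> carrier P" for p
  proof (cases "?L \<subseteq> ?K")
    case False
    have "f ` ?L = f ` carrier P"
    proof (rule f(3)[OF f.submodule_image[OF L] image_mono[OF LP]])
      show "f ` ?L \<noteq> {\<zero>\<^bsub>E\<^esub>}"
      proof
        assume "f ` ?L = {\<zero>\<^bsub>E\<^esub>}"
        then have "?L \<subseteq> ?K" using LP by (auto simp: a_kernel_def')
        then show False using False by blast
      qed
    qed
    then obtain l where l: "l \<in> ?L" "f p = f l" using p by (metis imageE imageI)
    have lP: "l \<in> carrier P" using l(1) LP by blast
    have "p \<ominus>\<^bsub>P\<^esub> l \<in> ?K" using f.eq_iff[OF p lP] l(2) by simp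
    moreover have "p = (p \<ominus>\<^bsub>P\<^esub> l) \<oplus>\<^bsub>P\<^esub> l" using p lP by algebra
    ultimately show ?thesis using l(1) by blast
  next
    case True
    have "g ` ?K = g ` carrier P"
    proof (rule g(3)[OF g.submodule_image[OF K] image_mono[OF KP]])
      show "g ` ?K \<noteq> {\<zero>\<^bsub>E'\<^esub>}"
      proof
        assume "g ` ?K = {\<zero>\<^bsub>E'\<^esub>}"
        then have "?K \<subseteq> ?L" using KP by (auto simp: a_kernel_def')
        then show False using True ne by blast
      qed
    qed
    then obtain k where k: "k \<in> ?K" "g p = g k" using p by (metis imageE imageI)
    have kP: "k \<in> carrier P" using k(1) KP by blast
    have "p \<ominus>\<^bsub>P\<^esub> k \<in> ?L" using g.eq_iff[OF p kP] k(2) by simp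
    moreover have "p = k \<oplus>\<^bsub>P\<^esub> (p \<ominus>\<^bsub>P\<^esub> k)" using p kP by algebra
    ultimately show ?thesis using k(1) by blast
  qed
  let ?PK = "P\<lparr>carrier := ?K\<rparr>" and ?PL = "P\<lparr>carrier := ?L\<rparr>"
  note inc = rmod_hom_inclusion[OF KP, of A] rmod_hom_inclusion[OF LP, of A]
  \<comment> \<open>Projectivity lifts the identity of \<open>P\<close> along this surjection and so
    writes it as a sum of endomorphisms with images in \<open>?K\<close> and in \<open>?L\<close>.
    One of them is bijective, so one kernel is all of \<open>P\<close>, although \<open>f\<close>
    and \<open>g\<close> are nonzero.\<close>
  have "(\<lambda>z. fst z \<oplus>\<^bsub>P\<^esub> snd z) ` carrier (direct_sum2 ?PK ?PL) = carrier P"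
  proof (intro subset_antisym subsetI)
    fix p assume "p \<in> carrier P"
    then obtain k l where "k \<in> ?K" "l \<in> ?L" "p = k \<oplus>\<^bsub>P\<^esub> l" using sum by blast
    then show "p \<in> (\<lambda>z. fst z \<oplus>\<^bsub>P\<^esub> snd z) ` carrier (direct_sum2 ?PK ?PL)" by (intro image_eqI[of _ _ "(k, l)"]) auto
  next
    fix p assume "p \<in> (\<lambda>z. fst z \<oplus>\<^bsub>P\<^esub> snd z) ` carrier (direct_sum2 ?PK ?PL)"
    then show "p \<in> carrier P" using f.M.M.a_closed[OF subsetD[OF KP] subsetD[OF LP]] by auto
  qed
  then obtain s where s: "s \<in> rmod_hom A P (direct_sum2 ?PK ?PL)" "\<And>p. p \<in> carrier P \<Longrightarrow> fst (s p) \<oplus>\<^bsub>P\<^esub> snd (s p) = p"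
    by (rule projective_lift[OF P(2) fg_module_direct_sum2[OF fg_sub[OF Pf K] fg_sub[OF Pf L]] Pf
          rmod_hom_copair[OF Pm inc] _ rmod_hom_id]) blast
  note s1 = rmod_hom_comp[OF rmod_hom_comp[OF s(1) rmod_hom_fst] inc(1)] and s2 = rmod_hom_comp[OF rmod_hom_comp[OF s(1) rmod_hom_snd] inc(2)]
  have c: "fst (s p) \<in> ?K" "snd (s p) \<in> ?L" if "p \<in> carrier P" for p
    using rmod_homD(1)[OF s(1) that] unfolding direct_sum2_simps mem_Times_iff by simp_all
  from indecomposable_local[OF P(1) s1 s2 s(2)] show False
  proof
    assume "bij_betw (\<lambda>p. fst (s p)) (carrier P) (carrier P)"
    then have im: "(\<lambda>p. fst (s p)) ` carrier P = carrier P" by (rule bij_betw_imp_surj_on)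
    have "(\<lambda>p. fst (s p)) ` carrier P \<subseteq> ?K" by (rule image_subsetI) (rule c(1))
    then have "carrier P \<subseteq> ?K" unfolding im .
    then have "f ` carrier P \<subseteq> {\<zero>\<^bsub>E\<^esub>}" by (auto simp: a_kernel_def')
    then show False using f(2) f.M.M.zero_closed by (metis image_is_empty empty_iff subset_singletonD)
  next
    assume "bij_betw (\<lambda>p. snd (s p)) (carrier P) (carrier P)"
    then have im: "(\<lambda>p. snd (s p)) ` carrier P = carrier P" by (rule bij_betw_imp_surj_on)
    have "(\<lambda>p. snd (s p)) ` carrier P \<subseteq> ?L" by (rule image_subsetI) (rule c(2))
    then have "carrier P \<subseteq> ?L" unfolding im .
    then have "g ` carrier P \<subseteq> {\<zero>\<^bsub>E'\<^esub>}" by (auto simp: a_kernel_def')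
    then show False using g(2) f.M.M.zero_closed by (metis image_is_empty empty_iff subset_singletonD)
  qed
qed

text \<open>A nonzero homomorphic image shared by two indecomposable injective modules extends to maps in both
  directions whose composition fixes it, so that it is not nilpotent.\<close>

lemma injective_indecomposables_iso:
  assumes E: "indecomposable_module A E" "injective_module A E" and E': "indecomposable_module A E'" "injective_module A E'"
    and P: "fg_module A P"
    and f: "f \<in> rmod_hom A P E" "f ` carrier P \<noteq> {\<zero>\<^bsub>E\<^esub>}"
    and g: "g \<in> rmod_hom A P E'" and ker: "a_kernel P E f = a_kernel P E' g"
  shows "rmod_iso A E E'"
proof -
  note Pm = fg_module_right[OF P] and Ef = injective_fg[OF E(2)] injective_fg[OF E'(2)]
  note Em = Ef[THEN fg_module_right]
  interpret f: module_hom A P E f by (rule module_homI[OF Pm Em(1) f(1)])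
  interpret g: module_hom A P E' g by (rule module_homI[OF Pm Em(2) g])
  \<comment> \<open>Equal kernels let \<open>v\<close> factor through the image of \<open>u\<close>,
    and injectivity of \<open>Y\<close> extends the factor to all of \<open>X\<close>.\<close>
  have extend: "\<exists>H \<in> rmod_hom A X Y. \<forall>p \<in> carrier P. H (u p) = v p"
    if u: "u \<in> rmod_hom A P X" and v: "v \<in> rmod_hom A P Y" and X: "fg_module A X" and Y: "injective_module A Y"
      and k: "a_kernel P X u = a_kernel P Y v" for X :: "('a, 'x) module" and Y :: "('a, 'y) module" and u v
  proof -
    note Xm = fg_module_right[OF X] and Ym = fg_module_right[OF injective_fg[OF Y]]
    interpret u: module_hom A P X u by (rule module_homI[OF Pm Xm u])
    let ?I = "X\<lparr>carrier := u ` carrier P\<rparr>"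
    have uI: "u \<in> rmod_hom A P ?I" by (rule rmod_hom_into_sub[OF u]) simp
    have z: "v p = \<zero>\<^bsub>Y\<^esub>" if "p \<in> carrier P" "u p = \<zero>\<^bsub>?I\<^esub>" for p
    proof -
      have "p \<in> a_kernel P Y v" unfolding k[symmetric] using that by (simp add: a_kernel_def')
      then show ?thesis by (simp add: a_kernel_def')
    qed
    obtain h where h: "h \<in> rmod_hom A ?I Y" "\<And>p. p \<in> carrier P \<Longrightarrow> h (u p) = v p"
      by (rule factor_through_surj[OF Pm right_module_sub[OF Xm u.submodule_range] Ym uI _ v z]) (simp, blast+)
    obtain H where H: "H \<in> rmod_hom A X Y" "\<And>x. x \<in> carrier ?I \<Longrightarrow> H x = h x"
      by (rule injective_extend[OF Y fg_sub[OF X u.submodule_range] X rmod_hom_inclusion[OF submoduleD(1)[OF u.submodule_range]] _ h(1)]) (simp, blast)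
    show ?thesis by (rule bexI[OF _ H(1)]) (use H(2) h(2) in simp)
  qed
  obtain H where H: "H \<in> rmod_hom A E E'" "\<And>p. p \<in> carrier P \<Longrightarrow> H (f p) = g p"
    using extend[OF f(1) g Ef(1) E'(2) ker] by blast
  obtain H' where H': "H' \<in> rmod_hom A E' E" "\<And>p. p \<in> carrier P \<Longrightarrow> H' (g p) = f p"
    using extend[OF g f(1) Ef(2) E(2) ker[symmetric]] by blast
  note HH = rmod_hom_comp[OF H(1) H'(1)]
  obtain p where p: "p \<in> carrier P" "f p \<noteq> \<zero>\<^bsub>E\<^esub>"
  proof -
    have "f \<zero>\<^bsub>P\<^esub> = \<zero>\<^bsub>E\<^esub>" by (rule f.zero)
    then have "\<zero>\<^bsub>E\<^esub> \<in> f ` carrier P" using f.M.M.zero_closed by (metis imageI)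
    then show thesis using f(2) that by blast
  qed
  \<comment> \<open>A fixed nonzero element rules out nilpotency, so the composite is bijective by
    \<open>fitting\<close> and \<open>E\<close> is a retract of \<open>E'\<close>.\<close>
  have "((\<lambda>x. H' (H x)) ^^ n) (f p) = f p" for n
    by (induction n) (simp_all add: H(2)[OF p(1)] H'(2)[OF p(1)])
  note fixed = this
  have "\<not> (\<exists>n. \<forall>x \<in> carrier E. ((\<lambda>x. H' (H x)) ^^ n) x = \<zero>\<^bsub>E\<^esub>)"
  proof
    assume "\<exists>n. \<forall>x \<in> carrier E. ((\<lambda>x. H' (H x)) ^^ n) x = \<zero>\<^bsub>E\<^esub>"
    then obtain n where "\<forall>x \<in> carrier E. ((\<lambda>x. H' (H x)) ^^ n) x = \<zero>\<^bsub>E\<^esub>" by (rule exE)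
    from bspec[OF this f.closed[OF p(1)]] show False unfolding fixed using p(2) by blast
  qed
  then have b: "bij_betw (\<lambda>x. H' (H x)) (carrier E) (carrier E)"
    using fitting[OF E(1) HH] by (simp only: simp_thms)
  have "summand A E E'"
    by (rule summandI[OF H(1) rmod_hom_comp[OF H'(1) rmod_hom_inverse[OF Em(1) HH b]]])
      (rule bij_betw_inv_into_left[OF b])
  then show ?thesis
    by (rule summand_indecomposable_iso[OF E'(1) Ef(1) indecomposable_not_zero[OF E(1)]])
qed

text \<open>Each \<open>E k\<close> has a simple submodule, onto which some \<open>P i\<close> maps.
  If one \<open>P i\<close> serves two injectives, the kernels agree by
  \<open>projective_indecomposable_kernels\<close> and the injectives are isomorphic, so the choice
  of \<open>i\<close> is injective in \<open>k\<close>.\<close>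

lemma injectives_le_projectives:
  fixes P E :: "nat \<Rightarrow> 'a fgmod"
  assumes A: "rmod_iso A (regular A) (direct_sum n P)"
    and P: "\<And>i. i < n \<Longrightarrow> indecomposable_module A (P i)" "\<And>i. i < n \<Longrightarrow> projective_module A (P i)"
    and E: "\<And>k. k < m \<Longrightarrow> indecomposable_module A (E k)" "\<And>k. k < m \<Longrightarrow> injective_module A (E k)"
      "\<And>k l. k < m \<Longrightarrow> l < m \<Longrightarrow> k \<noteq> l \<Longrightarrow> \<not> rmod_iso A (E k) (E l)"
  shows "m \<le> n"
proof -
  note Pm = projective_right_module[OF P(2)]
  \<comment> \<open>Records that the image of \<open>f\<close> is nonzero and minimal, that is,
    simple, without naming the simple module.\<close>
  define good where "good k i f \<longleftrightarrow> i < n \<and> f \<in> rmod_hom A (P i) (E k) \<and> f ` carrier (P i) \<noteq> {\<zero>\<^bsub>E k\<^esub>} \<and>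
    (\<forall>N. submodule N A (E k) \<and> N \<subseteq> f ` carrier (P i) \<and> N \<noteq> {\<zero>\<^bsub>E k\<^esub>} \<longrightarrow> N = f ` carrier (P i))" for k i f
  have "\<exists>i f. good k i f" if k: "k < m" for k
  proof -
    note Ef = indecomposable_fg[OF E(1)[OF k]]
    note Em = fg_module_right[OF Ef]
    obtain S where S: "submodule S A (E k)" "S \<noteq> {\<zero>\<^bsub>E k\<^esub>}"
      "\<And>N. submodule N A (E k) \<Longrightarrow> N \<subseteq> S \<Longrightarrow> N \<noteq> {\<zero>\<^bsub>E k\<^esub>} \<Longrightarrow> N = S"
      by (rule minimal_submodule[OF Ef indecomposable_not_zero[OF E(1)[OF k]]]) blast
    obtain x where x: "x \<in> S" "x \<noteq> \<zero>\<^bsub>E k\<^esub>" using S(2) submoduleD(2)[OF S(1)] by blast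
    have xE: "x \<in> carrier (E k)" using x(1) submoduleD(1)[OF S(1)] by blast
    interpret Ek: right_module A "E k" by (rule Em)
    obtain \<phi> \<psi> where \<phi>: "\<phi> \<in> rmod_hom A (regular A) (direct_sum n P)" "\<psi> \<in> rmod_hom A (direct_sum n P) (regular A)"
      "\<And>z. z \<in> carrier (regular A) \<Longrightarrow> \<psi> (\<phi> z) = z"
      by (rule rmod_isoE[OF right_module_regular A]) blast
    \<comment> \<open>The map from \<open>A\<close> sending \<open>\<one>\<close> to a nonzero
      \<open>x\<close> of the simple submodule, read on the decomposition of \<open>A\<close>. Its
      image lies in \<open>S\<close>, and some component must be nonzero.\<close>
    let ?f = "\<lambda>u. \<psi> u \<odot>\<^bsub>E k\<^esub> x"
    have f: "?f \<in> rmod_hom A (direct_sum n P) (E k)" by (rule rmod_hom_comp[OF \<phi>(2) rmod_hom_regular[OF Em xE]])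
    have one: "\<one> \<in> carrier (regular A)" by simp
    have "?f (\<phi> \<one>) \<noteq> \<zero>\<^bsub>E k\<^esub>" unfolding \<phi>(3)[OF one] Ek.act_one[OF xE] by (rule x(2))
    note nz = this
    have "\<forall>i<n. right_module A (P i)" using Pm by simp
    from hom_direct_sum_component[OF this Em f rmod_homD(1)[OF \<phi>(1) one] nz]
    obtain i g where g: "i < n" "g \<in> rmod_hom A (P i) (E k)" "g ` carrier (P i) \<subseteq> ?f ` carrier (direct_sum n P)"
      "\<exists>v \<in> carrier (P i). g v \<noteq> \<zero>\<^bsub>E k\<^esub>" by (elim exE conjE bexE) (rule that; (rule bexI)?; assumption)
    interpret g: module_hom A "P i" "E k" g by (rule module_homI[OF Pm[OF g(1)] Em g(2)])
    have "?f ` carrier (direct_sum n P) \<subseteq> S"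
    proof
      fix y assume "y \<in> ?f ` carrier (direct_sum n P)"
      then obtain u where u: "u \<in> carrier (direct_sum n P)" "y = ?f u" by (rule imageE)
      have "\<psi> u \<in> carrier A" using rmod_homD(1)[OF \<phi>(2) u(1)] unfolding regular_simps .
      then show "y \<in> S" unfolding u(2) by (rule submoduleD(4)[OF S(1) _ x(1)])
    qed
    then have gS: "g ` carrier (P i) \<subseteq> S" using g(3) by (rule subset_trans[rotated])
    have ne: "g ` carrier (P i) \<noteq> {\<zero>\<^bsub>E k\<^esub>}" using g(4) by blast
    have "g ` carrier (P i) = S" by (rule S(3)[OF g.submodule_range gS ne])
    then have "good k i g" unfolding good_def using g(1,2) ne S(3) by blast
    then show ?thesis by blast
  qed
  then have "\<forall>k. \<exists>i f. k < m \<longrightarrow> good k i f" by blast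
  then obtain \<sigma> where "\<forall>k. \<exists>f. k < m \<longrightarrow> good k (\<sigma> k) f" by metis
  then obtain F where F: "\<And>k. k < m \<Longrightarrow> good k (\<sigma> k) (F k)" by metis
  have "inj_on \<sigma> {..<m}"
  proof (rule inj_onI, rule ccontr)
    fix k l assume kl: "k \<in> {..<m}" "l \<in> {..<m}" "\<sigma> k = \<sigma> l" "k \<noteq> l"
    then have k: "k < m" and l: "l < m" by auto
    have fk: "\<sigma> k < n" "F k \<in> rmod_hom A (P (\<sigma> k)) (E k)" "F k ` carrier (P (\<sigma> k)) \<noteq> {\<zero>\<^bsub>E k\<^esub>}"
      "\<And>N. submodule N A (E k) \<Longrightarrow> N \<subseteq> F k ` carrier (P (\<sigma> k)) \<Longrightarrow> N \<noteq> {\<zero>\<^bsub>E k\<^esub>} \<Longrightarrow> N = F k ` carrier (P (\<sigma> k))"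
      using F[OF k] unfolding good_def by blast+
    have fl: "F l \<in> rmod_hom A (P (\<sigma> k)) (E l)" "F l ` carrier (P (\<sigma> k)) \<noteq> {\<zero>\<^bsub>E l\<^esub>}"
      "\<And>N. submodule N A (E l) \<Longrightarrow> N \<subseteq> F l ` carrier (P (\<sigma> k)) \<Longrightarrow> N \<noteq> {\<zero>\<^bsub>E l\<^esub>} \<Longrightarrow> N = F l ` carrier (P (\<sigma> k))"
      using F[OF l] unfolding good_def kl(3) by blast+
    have "a_kernel (P (\<sigma> k)) (E k) (F k) = a_kernel (P (\<sigma> k)) (E l) (F l)"
      by (rule projective_indecomposable_kernels[OF P(1)[OF fk(1)] P(2)[OF fk(1)] fg_module_right[OF indecomposable_fg[OF E(1)[OF k]]]
            fg_module_right[OF indecomposable_fg[OF E(1)[OF l]]] fk(2-4) fl])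
    then have "rmod_iso A (E k) (E l)"
      by (rule injective_indecomposables_iso[OF E(1)[OF k] E(2)[OF k] E(1)[OF l] E(2)[OF l] indecomposable_fg[OF P(1)[OF fk(1)]] fk(2,3) fl(1)])
    then show False using E(3)[OF k l kl(4)] by blast
  qed
  moreover have "\<sigma> ` {..<m} \<subseteq> {..<n}" using F unfolding good_def by auto
  ultimately have "card {..<m} \<le> card {..<n}" by (intro card_inj_on_le) auto
  then show ?thesis by simp
qed

end

section \<open>Injective modules generated by a coresolution of the algebra\<close>

lemma count_list_distinct: "distinct l \<Longrightarrow> count_list l x = (if x \<in> set l then 1 else 0)"
  by (induction l) auto

context artin_ring
begin

lemma pd_le_one_iso:
  assumes "right_module A X" "right_module A Y" "rmod_iso A X Y" "pd_le_one A X"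
  shows "pd_le_one A Y"
proof -
  obtain P P' :: "'a fgmod" where P: "projective_module A P" "projective_module A P'" "short_exact A P' P X"
    using assms(4) unfolding pd_le_one_def by blast
  have "short_exact A P' P Y"
    by (rule short_exact_iso[OF projective_right_module[OF P(2)] projective_right_module[OF P(1)] assms(1,2) P(3)
          rmod_iso_refl rmod_iso_refl assms(3)])
  then show ?thesis unfolding pd_le_one_def using P(1,2) by blast
qed

lemma in_add_fg: "in_add A Q X \<Longrightarrow> fg_module A X"
  by (simp add: in_add_def)

lemma in_add_list_sum:
  fixes Q :: "'a fgmod"
  assumes Q: "fg_module A Q" and l: "\<And>U. U \<in> set l \<Longrightarrow> in_add A Q U"
  shows "in_add A Q (list_sum l)"
  using l
proof (induction l)
  case Nil
  show ?case by (rule in_add_zero[OF Q right_module_list_sum zero_module_list_sum_Nil]) simp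
next
  case (Cons U l)
  have fg: "fg_module A V" if "V \<in> set (U # l)" for V by (rule in_add_fg[OF Cons.prems[OF that]])
  have "in_add A Q (direct_sum2 U (list_sum l))"
    by (rule in_add_direct_sum2[OF Q Cons.prems Cons.IH]) (simp_all add: Cons.prems)
  moreover have "fg_module A (list_sum (U # l))" by (rule fg_module_list_sum) (rule fg)
  moreover from this have "summand A (list_sum (U # l)) (direct_sum2 U (list_sum l))"
    by (rule rmod_iso_imp_summand[OF fg_module_right list_sum_Cons]) (rule fg_module_right[OF fg])
  ultimately show ?case by (rule in_add_summand[OF Q])
qed

lemma summand_direct_sum:
  assumes "\<And>i. i < k \<Longrightarrow> right_module A (N i)" "i < k"
  shows "summand A (N i) (direct_sum k N)"
  unfolding direct_sum_eq_list_sum by (rule summand_list_sum) (use assms in auto)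

lemma list_sum_map_iso:
  assumes "\<And>j. j \<in> set l \<Longrightarrow> right_module A (N j)" "\<And>j. j \<in> set l \<Longrightarrow> right_module A (M j)"
    and "\<And>j. j \<in> set l \<Longrightarrow> rmod_iso A (N j) (M j)"
  shows "rmod_iso A (list_sum (map N l)) (list_sum (map M l))"
  using assms
proof (induction l)
  case Nil
  show ?case unfolding list.map
    by (rule zero_modules_iso[OF right_module_list_sum right_module_list_sum zero_module_list_sum_Nil zero_module_list_sum_Nil]) simp_all
next
  case (Cons j l)
  have m: "right_module A (N j)" "right_module A (list_sum (map N l))" "right_module A (list_sum (map M (j # l)))"
    using Cons.prems by (auto intro!: right_module_list_sum)
  have IH: "rmod_iso A (list_sum (map N l)) (list_sum (map M l))"
    by (rule Cons.IH) (use Cons.prems in auto)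
  have 1: "rmod_iso A (direct_sum2 (N j) (list_sum (map N l))) (direct_sum2 (M j) (list_sum (map M l)))"
    by (rule direct_sum2_cong[OF m(1,2) _ IH]) (use Cons.prems in simp)
  have 2: "rmod_iso A (list_sum (map N (j # l))) (direct_sum2 (N j) (list_sum (map N l)))"
    unfolding list.map by (rule list_sum_Cons) (use Cons.prems in auto)
  have 3: "rmod_iso A (direct_sum2 (M j) (list_sum (map M l))) (list_sum (map M (j # l)))"
    by (rule rmod_iso_sym[OF m(3)]) (unfold list.map, rule list_sum_Cons, use Cons.prems in auto)
  show ?case by (rule rmod_iso_trans[OF 2 rmod_iso_trans[OF 1 3]])
qed

text \<open>A quotient \<open>C\<^sub>i\<close> of \<open>T\<^sup>0\<close> by the image of \<open>P i\<close> lies in \<open>add T\<close>, because \<open>A\<close> has the two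
  injective copresentations \<open>T\<^sup>0\<close> and \<open>T\<^sup>0 \<oplus> T\<^sup>0\<close>, the latter summand by summand. So every \<open>P i\<close> has a
  coresolution of length one in \<open>add T\<close>, and counting forces \<open>T\<close> to have at least as many indecomposable
  summands as there are indecomposable injective modules.\<close>

lemma injectives_in_add:
  fixes P N :: "nat \<Rightarrow> 'a fgmod" and T T0 C J :: "'a fgmod"
  assumes A: "rmod_iso A (regular A) (direct_sum n P)" "\<And>i. i < n \<Longrightarrow> indecomposable_module A (P i)"
      "\<And>i j. i < n \<Longrightarrow> j < n \<Longrightarrow> i \<noteq> j \<Longrightarrow> \<not> rmod_iso A (P i) (P j)"
    and T: "fg_module A T" "rmod_iso A T (direct_sum t N)" "\<And>j. j < t \<Longrightarrow> indecomposable_module A (N j)"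
      "\<And>i j. i < t \<Longrightarrow> j < t \<Longrightarrow> i \<noteq> j \<Longrightarrow> \<not> rmod_iso A (N i) (N j)"
    and add: "\<And>X :: 'a fgmod. in_add A T X \<Longrightarrow> injective_module A X \<and> pd_le_one A X"
    and seq: "in_add A T T0" "in_add A T C" "short_exact A (regular A) T0 C"
    and J: "injective_module A J"
  shows "in_add A T J"
proof -
  note Tm = fg_module_right[OF T(1)]
  note regm = right_module_regular
  have Pf: "fg_module A (P i)" if "i < n" for i by (rule indecomposable_fg[OF A(2)[OF that]])
  have Pm: "right_module A (P i)" if "i < n" for i by (rule fg_module_right[OF Pf[OF that]])
  have Nf: "fg_module A (N j)" if "j < t" for j by (rule indecomposable_fg[OF T(3)[OF that]])
  have Nm: "right_module A (N j)" if "j < t" for j by (rule fg_module_right[OF Nf[OF that]])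
  have Dm: "right_module A (direct_sum n P)" by (rule right_module_direct_sum[OF ring_axioms Pm])
  have Ps: "summand A (P i) (regular A)" if i: "i < n" for i
    by (rule summand_trans[OF summand_direct_sum[OF Pm i] rmod_iso_imp_summand[OF Dm rmod_iso_sym[OF regm A(1)]]])
  have Pp: "projective_module A (P i)" if i: "i < n" for i
    by (rule projective_summand[OF projective_regular Pf[OF i] Ps[OF i]])
  have Nadd: "in_add A T (N j)" if j: "j < t" for j
  proof (rule in_add_summand[OF T(1) in_add_self[OF T(1)] Nf[OF j]])
    have Dt: "right_module A (direct_sum t N)" by (rule right_module_direct_sum[OF ring_axioms Nm])
    show "summand A (N j) T"
      by (rule summand_trans[OF summand_direct_sum[OF Nm j] rmod_iso_imp_summand[OF Dt rmod_iso_sym[OF Tm T(2)]]])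
  qed
  note T0 = conjunct1[OF add[OF seq(1)]] and C = conjunct1[OF add[OF seq(2)]]
  note T0f = injective_fg[OF T0] and Cf = injective_fg[OF C]
  note T0m = fg_module_right[OF T0f] and Cm = fg_module_right[OF Cf]
  obtain e where e: "e \<in> rmod_hom A (regular A) T0" "inj_on e (carrier (regular A))"
    by (rule short_exactE[OF seq(3)]) blast
  have quotient: "\<exists>Q :: 'a fgmod. in_add A T Q \<and> short_exact A (P i) T0 Q" if i: "i < n" for i
  proof -
    obtain s p where s: "s \<in> rmod_hom A (P i) (regular A)" "p \<in> rmod_hom A (regular A) (P i)" "\<And>x. x \<in> carrier (P i) \<Longrightarrow> p (s x) = x"
      by (rule summandE[OF Ps[OF i]]) blast
    have K: "submodule (a_kernel (regular A) (P i) p) A (regular A)"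
      by (rule module_hom.submodule_kernel[OF module_homI[OF regm Pm[OF i] s(2)]])
    let ?P' = "(regular A)\<lparr>carrier := a_kernel (regular A) (P i) p\<rparr>"
    have P'm: "right_module A ?P'" by (rule right_module_sub[OF regm K])
    have iso: "rmod_iso A (regular A) (direct_sum2 (P i) ?P')" by (rule split_direct_sum2[OF regm Pm[OF i] s])
    have Xf: "fg_module A (direct_sum2 (P i) ?P')"
      by (rule fg_module_direct_sum2[OF Pf[OF i] fg_sub[OF fg_module_regular K]])
    have es: "(\<lambda>x. e (s x)) \<in> rmod_hom A (P i) T0" by (rule rmod_hom_comp[OF s(1) e(1)])
    have "inj_on (\<lambda>x. e (s x)) (carrier (P i))"
    proof (rule inj_onI)
      fix x y assume xy: "x \<in> carrier (P i)" "y \<in> carrier (P i)" "e (s x) = e (s y)"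
      have "s x = s y" by (rule inj_onD[OF e(2) xy(3) rmod_homD(1)[OF s(1) xy(1)] rmod_homD(1)[OF s(1) xy(2)]])
      from arg_cong[OF this, of p] show "x = y" by (rule box_equals[OF _ s(3)[OF xy(1)] s(3)[OF xy(2)]])
    qed
    note ex = short_exact_quotient[OF Pm[OF i] T0m es this]
    have e': "e \<in> rmod_hom A ?P' T0" by (rule rmod_hom_restrict[OF e(1) submoduleD(1)[OF K]])
    have "inj_on e (carrier ?P')" by (rule inj_on_subset[OF e(2)]) (use submoduleD(1)[OF K] in simp)
    note ex' = short_exact_quotient[OF P'm T0m e' this]
    let ?Q = "rep_quotient T0 ((\<lambda>x. e (s x)) ` carrier (P i))"
    let ?Q' = "rep_quotient T0 (e ` carrier ?P')"
    have Qf: "fg_module A ?Q" "fg_module A ?Q'"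
      by (rule fg_quotient[OF T0f module_hom.submodule_range[OF module_homI[OF Pm[OF i] T0m es]]],
          rule fg_quotient[OF T0f module_hom.submodule_range[OF module_homI[OF P'm T0m e']]])
    note Qm = Qf[THEN fg_module_right]
    have 1: "short_exact A (direct_sum2 (P i) ?P') (direct_sum2 T0 T0) (direct_sum2 ?Q ?Q')"
      by (rule short_exact_direct_sum2[OF ex ex'])
    have 2: "short_exact A (direct_sum2 (P i) ?P') T0 C"
      by (rule short_exact_iso[OF regm T0m Cm Cm seq(3) iso rmod_iso_refl rmod_iso_refl])
    \<comment> \<open>Blockwise and unsplit injective copresentations of the same module are
      compared by the dual of Schanuel's lemma. The terms \<open>T0\<close> and \<open>C\<close> on
      the right lie in \<open>add T\<close>, which is closed under retracts.\<close>
    have "summand A (direct_sum2 ?Q ?Q') (direct_sum2 (direct_sum2 T0 T0) C)"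
      by (rule cosyzygy_summand[OF Xf right_module_direct_sum2[OF Qm] Cm injective_direct_sum2[OF T0 T0] T0 1 2])
    then have "summand A ?Q (direct_sum2 (direct_sum2 T0 T0) C)"
      by (rule summand_trans[OF summand_direct_sum2(1)[OF Qm]])
    then have "in_add A T ?Q"
      by (rule in_add_summand[OF T(1) in_add_direct_sum2[OF T(1) in_add_direct_sum2[OF T(1) seq(1,1)] seq(2)] Qf(1)])
    then show ?thesis using ex by blast
  qed
  have "\<exists>a b. set a \<subseteq> {..<t} \<and> set b \<subseteq> {..<t} \<and> short_exact A (P i) (list_sum (map N a)) (list_sum (map N b))"
    if i: "i < n" for i
  proof -
    obtain Q :: "'a fgmod" where Q: "in_add A T Q" "short_exact A (P i) T0 Q" using quotient[OF i] by blast
    obtain a where a: "set a \<subseteq> {..<t}" "rmod_iso A T0 (list_sum (map N a))"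
      using in_add_decomposition[OF T(3) T(1,2) seq(1)] by blast
    obtain b where b: "set b \<subseteq> {..<t}" "rmod_iso A Q (list_sum (map N b))"
      using in_add_decomposition[OF T(3) T(1,2) Q(1)] by blast
    have bm: "right_module A (list_sum (map N b))"
      by (rule right_module_list_sum) (use subsetD[OF b(1)] Nm in auto)
    show ?thesis
      using short_exact_iso[OF Pm[OF i] T0m fg_module_right[OF in_add_fg[OF Q(1)]] bm Q(2) rmod_iso_refl a(2) b(2)] a(1) b(1) by blast
  qed
  then have "\<forall>i. \<exists>a b. i < n \<longrightarrow> set a \<subseteq> {..<t} \<and> set b \<subseteq> {..<t} \<and> short_exact A (P i) (list_sum (map N a)) (list_sum (map N b))"
    by blast
  from choice[OF this] obtain \<alpha> where "\<forall>i. \<exists>b. i < n \<longrightarrow> set (\<alpha> i) \<subseteq> {..<t} \<and> set b \<subseteq> {..<t} \<and>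
      short_exact A (P i) (list_sum (map N (\<alpha> i))) (list_sum (map N b))" by (rule exE)
  from choice[OF this] obtain \<beta> where \<alpha>\<beta>: "\<forall>i. i < n \<longrightarrow> set (\<alpha> i) \<subseteq> {..<t} \<and> set (\<beta> i) \<subseteq> {..<t} \<and>
      short_exact A (P i) (list_sum (map N (\<alpha> i))) (list_sum (map N (\<beta> i)))" by (rule exE)
  have pd: "pd_le_one A (list_sum (map N l))" if l: "set l \<subseteq> {..<t}" for l
  proof -
    have a: "in_add A T (list_sum (map N l))" by (rule in_add_list_sum[OF T(1)]) (use subsetD[OF l] Nadd in auto)
    note lf = in_add_fg[OF a]
    note lm = fg_module_right[OF lf]
    obtain X :: "'a fgmod" where X: "fg_module A X" "rmod_iso A (list_sum (map N l)) X" by (rule fgmod_copy[OF lf])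
    note Xm = fg_module_right[OF X(1)] and iso = rmod_iso_sym[OF lm X(2)]
    have "in_add A T X" by (rule in_add_summand[OF T(1) a X(1) rmod_iso_imp_summand[OF Xm iso]])
    then show ?thesis using pd_le_one_iso[OF Xm lm iso] add by blast
  qed
  \<comment> \<open>The sequences with index lists \<open>\<alpha> i\<close> and
    \<open>\<beta> i\<close> are what the count of projectives needs; here the bound on projective
    dimension over \<open>add T\<close> enters.\<close>
  have nt: "n \<le> t"
    by (rule indecomposables_le[where P = P and N = N and \<alpha> = \<alpha> and \<beta> = \<beta>])
      (use A(2,3) Pp Nf \<alpha>\<beta> pd in blast)+
  obtain l :: "'a fgmod list" where l: "\<And>U. U \<in> set l \<Longrightarrow> indecomposable_module A U" "rmod_iso A J (list_sum l)"
    by (rule decomposition[OF injective_fg[OF J]]) blast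
  have lm: "right_module A U" if "U \<in> set l" for U by (rule fg_module_right[OF indecomposable_fg[OF l(1)[OF that]]])
  have Jm: "right_module A J" by (rule fg_module_right[OF injective_fg[OF J]])
  have "\<exists>j<t. rmod_iso A U (N j)" if U: "U \<in> set l" for U
  proof (rule ccontr)
    assume none: "\<not> ?thesis"
    note Ui = l(1)[OF U]
    note Uf = indecomposable_fg[OF Ui]
    have Ls: "right_module A (list_sum l)" by (rule right_module_list_sum[OF lm])
    have "summand A U J"
      by (rule summand_trans[OF summand_list_sum[OF lm U] rmod_iso_imp_summand[OF Ls rmod_iso_sym[OF Jm l(2)]]])
    then have Uinj: "injective_module A U" by (rule injective_summand[OF J Uf])
    \<comment> \<open>An injective \<open>U\<close> missing from the list is appended at index
      \<open>t\<close>. That gives \<open>Suc t\<close> pairwise non-isomorphic indecomposable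
      injectives against \<open>n\<close> projectives, contrary to \<open>nt\<close>.\<close>
    define E where "E k = (if k < t then N k else U)" for k
    have "Suc t \<le> n"
    proof (rule injectives_le_projectives[OF A(1,2) Pp])
      show "indecomposable_module A (E k)" for k using T(3) Ui by (simp add: E_def)
      show "injective_module A (E k)" for k using add[OF Nadd] Uinj by (simp add: E_def)
      fix k m assume km: "k < Suc t" "m < Suc t" "k \<noteq> m"
      have nU: "\<not> rmod_iso A (N j) U" if "j < t" for j
        using none rmod_iso_sym[OF Nm[OF that]] that by blast
      show "\<not> rmod_iso A (E k) (E m)"
        using km T(4)[of k m] none nU[of k] by (auto simp: E_def)
    qed
    then show False using nt by simp
  qed
  from list_sum_iso_map[OF lm Nm this] obtain js where js: "set js \<subseteq> {..<t}" "rmod_iso A (list_sum l) (list_sum (map N js))"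
    by blast
  have "in_add A T (list_sum (map N js))" by (rule in_add_list_sum[OF T(1)]) (use subsetD[OF js(1)] Nadd in auto)
  then show ?thesis
    by (rule in_add_summand[OF T(1) _ injective_fg[OF J] rmod_iso_imp_summand[OF Jm rmod_iso_trans[OF l(2) js(2)]]])
qed

section \<open>Comparison of basic modules, and padding by zero modules\<close>

lemma basic_summands_embed:
  fixes N N' :: "nat \<Rightarrow> 'a fgmod" and T T' :: "'a fgmod"
  assumes T: "fg_module A T" "rmod_iso A T (direct_sum t N)" "\<And>j. j < t \<Longrightarrow> indecomposable_module A (N j)"
      "\<And>i j. i < t \<Longrightarrow> j < t \<Longrightarrow> i \<noteq> j \<Longrightarrow> \<not> rmod_iso A (N i) (N j)"
    and T': "fg_module A T'" "rmod_iso A T' (direct_sum t' N')" "\<And>j. j < t' \<Longrightarrow> indecomposable_module A (N' j)"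
    and add: "in_add A T' T"
  obtains \<pi> where "inj_on \<pi> {..<t}" "\<pi> ` {..<t} \<subseteq> {..<t'}" "\<And>j. j < t \<Longrightarrow> rmod_iso A (N j) (N' (\<pi> j))"
proof -
  have Nm: "right_module A (N j)" if "j < t" for j by (rule fg_module_right[OF indecomposable_fg[OF T(3)[OF that]]])
  have Dm: "right_module A (direct_sum t N)" by (rule right_module_direct_sum[OF ring_axioms Nm])
  have ex: "\<exists>k<t'. rmod_iso A (N j) (N' k)" if j: "j < t" for j
  proof (rule indecomposable_in_add[OF T'(3) T'(1,2) T(3)[OF j]])
    have "summand A (N j) T"
      by (rule summand_trans[OF summand_direct_sum[OF Nm j] rmod_iso_imp_summand[OF Dm rmod_iso_sym[OF fg_module_right[OF T(1)] T(2)]]])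
    then show "in_add A T' (N j)" by (rule in_add_summand[OF T'(1) add indecomposable_fg[OF T(3)[OF j]]])
  qed
  define \<pi> where "\<pi> j = (SOME k. k < t' \<and> rmod_iso A (N j) (N' k))" for j
  have \<pi>: "\<pi> j < t' \<and> rmod_iso A (N j) (N' (\<pi> j))" if "j < t" for j
    unfolding \<pi>_def by (rule someI_ex[OF ex[OF that]])
  show ?thesis
  proof (rule that)
    show "inj_on \<pi> {..<t}"
    proof (rule inj_onI, rule ccontr)
      fix i j assume ij: "i \<in> {..<t}" "j \<in> {..<t}" "\<pi> i = \<pi> j" "i \<noteq> j"
      then have "rmod_iso A (N i) (N j)"
        using rmod_iso_trans[of A "N i" "N' (\<pi> i)" "N j"] \<pi>[of i] \<pi>[of j] rmod_iso_sym[OF Nm[of j], of "N' (\<pi> j)"] by simp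
      then show False using T(4)[of i j] ij by simp
    qed
    show "\<pi> ` {..<t} \<subseteq> {..<t'}" using \<pi> by auto
  qed (use \<pi> in blast)
qed

text \<open>Injections of summands in both directions make the numbers of summands equal, so the
  injection \<open>\<pi>\<close> is a permutation, and the two sums differ only by order and by
  isomorphisms of the summands.\<close>

lemma krull_schmidt_basic:
  fixes N N' :: "nat \<Rightarrow> 'a fgmod" and T T' :: "'a fgmod"
  assumes T: "fg_module A T" "rmod_iso A T (direct_sum t N)" "\<And>j. j < t \<Longrightarrow> indecomposable_module A (N j)"
      "\<And>i j. i < t \<Longrightarrow> j < t \<Longrightarrow> i \<noteq> j \<Longrightarrow> \<not> rmod_iso A (N i) (N j)"
    and T': "fg_module A T'" "rmod_iso A T' (direct_sum t' N')" "\<And>j. j < t' \<Longrightarrow> indecomposable_module A (N' j)"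
      "\<And>i j. i < t' \<Longrightarrow> j < t' \<Longrightarrow> i \<noteq> j \<Longrightarrow> \<not> rmod_iso A (N' i) (N' j)"
    and add: "in_add A T' T" "in_add A T T'"
  shows "rmod_iso A T T'"
proof -
  obtain \<pi> where \<pi>: "inj_on \<pi> {..<t}" "\<pi> ` {..<t} \<subseteq> {..<t'}" "\<And>j. j < t \<Longrightarrow> rmod_iso A (N j) (N' (\<pi> j))"
    by (rule basic_summands_embed[OF T T'(1-3) add(1)]) blast+
  obtain \<rho> where \<rho>: "inj_on \<rho> {..<t'}" "\<rho> ` {..<t'} \<subseteq> {..<t}"
    by (rule basic_summands_embed[OF T' T(1-3) add(2)]) blast+
  have tt: "t' = t"
    using card_inj_on_le[OF \<pi>(1,2)] card_inj_on_le[OF \<rho>] by simp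
  have im: "\<pi> ` {..<t} = {..<t}" using endo_inj_surj[OF _ _ \<pi>(1)] \<pi>(2) tt by simp
  \<comment> \<open>The reversal matches the order in which \<open>list_sum\<close> spells out a
    \<open>direct_sum\<close>.\<close>
  let ?l = "rev [0..<t]"
  have Nm: "right_module A (N j)" if "j < t" for j by (rule fg_module_right[OF indecomposable_fg[OF T(3)[OF that]]])
  have N'm: "right_module A (N' j)" if "j < t" for j
    by (rule fg_module_right[OF indecomposable_fg[OF T'(3)]]) (simp add: tt that)
  have \<pi>t: "\<pi> j < t" if "j < t" for j using im that by blast
  have d: "direct_sum t M = list_sum (map M ?l)" for M :: "nat \<Rightarrow> 'a fgmod"
    by (simp add: direct_sum_eq_list_sum rev_map)
  have 1: "rmod_iso A (list_sum (map N ?l)) (list_sum (map (\<lambda>j. N' (\<pi> j)) ?l))"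
    by (rule list_sum_map_iso) (use Nm N'm \<pi>t \<pi>(3) in auto)
  have "count_list (map \<pi> ?l) = count_list ?l"
  proof
    fix j
    have "distinct (map \<pi> ?l)" using \<pi>(1) by (simp add: distinct_map atLeast0LessThan)
    then show "count_list (map \<pi> ?l) j = count_list ?l j"
      by (simp add: count_list_distinct atLeast0LessThan im del: count_list_map_conv)
  qed
  then have "rmod_iso A (list_sum (map N' (map \<pi> ?l))) (list_sum (map N' ?l))"
    by (rule list_sum_map_permute[rotated]) (use N'm \<pi>t in auto)
  then have 2: "rmod_iso A (list_sum (map (\<lambda>j. N' (\<pi> j)) ?l)) (list_sum (map N' ?l))"
    by (simp add: comp_def)
  have T'iso: "rmod_iso A (list_sum (map N' ?l)) T'"
    using rmod_iso_sym[OF fg_module_right[OF T'(1)] T'(2)] unfolding tt d .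
  show ?thesis
    by (rule rmod_iso_trans[OF T(2)[unfolded d] rmod_iso_trans[OF 1 rmod_iso_trans[OF 2 T'iso]]])
qed

text \<open>The sequence ends with a surjection onto \<open>C\<close>, so zero modules after
  \<open>C\<close> keep it exact at every place, for every length. This frees the equivalence from
  \<open>n\<close>.\<close>

lemma Sub_of_short_exact:
  fixes Q C I :: "'a fgmod"
  assumes I: "fg_module A I" and X: "fg_module A X" and add: "in_add A I Q" "in_add A I C" and ex: "short_exact A X Q C"
  shows "Sub A m I X"
proof -
  obtain f g where f: "f \<in> rmod_hom A X Q" "g \<in> rmod_hom A Q C" "inj_on f (carrier X)"
    "g ` carrier Q = carrier C" "f ` carrier X = a_kernel Q C g"
    by (rule short_exactE[OF ex]) blast
  note Cm = fg_module_right[OF in_add_fg[OF add(2)]]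
  interpret C: right_module A C by (rule Cm)
  let ?Z = "C\<lparr>carrier := {\<zero>\<^bsub>C\<^esub>}\<rparr>"
  have Z: "right_module A ?Z" by (rule right_module_sub[OF Cm submodule_zero[OF Cm]])
  have Zz: "zero_module ?Z" by (simp add: zero_module_def)
  have zero: "(\<lambda>x. \<zero>\<^bsub>C\<^esub>) \<in> rmod_hom A M ?Z" for M :: "'a fgmod" using rmod_hom_zero[OF Z] by simp
  define J where "J i = (if i = 0 then Q else if i = 1 then C else ?Z)" for i :: nat
  define d where "d i = (if i = 0 then g else (\<lambda>x. \<zero>\<^bsub>C\<^esub>))" for i :: nat
  have J: "J 0 = Q" "J (Suc 0) = C" "\<And>i. J (Suc (Suc i)) = ?Z" by (simp_all add: J_def)
  have d: "d 0 = g" "\<And>i. d (Suc i) = (\<lambda>x. \<zero>\<^bsub>C\<^esub>)" by (simp_all add: d_def)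
  have cC: "\<zero>\<^bsub>C\<^esub> \<in> carrier C" by simp
  show ?thesis
    unfolding Sub_def
  proof (intro conjI disjI2 exI[of _ J] exI[of _ f] exI[of _ d] allI impI)
    show "in_add A I (J i)" for i
      unfolding J_def using add in_add_zero[OF I Z Zz] by simp
    show "d i \<in> rmod_hom A (J i) (J (Suc i))" for i
      by (cases i) (simp_all only: J d f One_nat_def zero)
    show "d i ` carrier (J i) = a_kernel (J (Suc i)) (J (Suc (Suc i))) (d (Suc i))" for i
    proof (cases i)
      case 0
      then show ?thesis by (simp add: J d f(4) a_kernel_def')
    next
      case (Suc j)
      show ?thesis
        by (cases j) (use cC in \<open>auto simp: Suc J d a_kernel_def'\<close>)
    qed
  qed (use X f in \<open>simp_all add: J d\<close>)
qed

end

theorem proposition4p8: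
  fixes R :: "'r ring" and \<phi> :: "'r \<Rightarrow> 'a" and A :: "'a ring"
    and E :: "('r, 'e) module" and I :: "'a fgmod" and n :: nat
  assumes "artin_algebra R \<phi> A"
    and "matlis_module R E"
    and "basic_module A (regular A)"
    and "\<not> semisimple_module A (regular A)"
    and "inj_dim A (regular A) = 1"
    and "basic_module A I" and "injective_module A I"
    and "\<forall>X :: 'a fgmod. fg_module A X \<longrightarrow>
           (in_add A I X \<longleftrightarrow> injective_module A X \<and> proj_dim A X \<le> 1)"
  shows "almost_Auslander_Gorenstein A I n \<longleftrightarrow>
    (\<exists>T :: 'a fgmod.
       (basic_module A T \<and> d_tilting A 1 T \<and> Fac A 1 I T \<and> Sub A n I T \<and>
        d_cotilting R \<phi> E A 0 T) \<and>
       (\<forall>T' :: 'a fgmod.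
          basic_module A T' \<and> d_tilting A 1 T' \<and> Fac A 1 I T' \<and> Sub A n I T' \<and>
          d_cotilting R \<phi> E A 0 T' \<longrightarrow> rmod_iso A T' T))"
proof -
  have over: "artin_algebra_over R A \<phi>" by (rule artin_algebra_over) fact
  interpret artin_ring A
    by (rule artin_ring.intro[OF artin_algebra_over.axioms(1)[OF over]
          artin_ring_axioms.intro[OF artin_algebra_over.fin_length_regular[OF over]]])
  interpret O: artin_algebra_over R A \<phi> by (rule over)
  note I = \<open>injective_module A I\<close>
  note If = injective_fg[OF I]
  note regm = right_module_regular and regf = fg_module_regular
  let ?inj = "injective_module A"
  \<comment> \<open>The hypothesis on \<open>I\<close> in working form: the dimension bound becomes
    the existence of one short exact sequence.\<close>
  have addI: "in_add A I X \<longleftrightarrow> fg_module A X \<and> ?inj X \<and> pd_le_one A X" for X :: "'a fgmod"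
    using assms(8) proj_dim_le_one_iff[of X] fg_module_right[of A X] in_add_fg[of I X] by blast
  have E: "?inj (dual_regular R \<phi> E A)"
    by (rule O.injective_dual_regular) (use assms(2) in \<open>simp add: matlis_module_def injective_envelope_def\<close>)
  have not_inj: "\<not> ?inj (regular A)"
    using inj_dim_zero_iff[OF regm] assms(5) by simp
  have not_0: "\<not> finite_coresolution A ?inj 0 (regular A)"
    using inj_dim_le_iff[of "regular A" 0] assms(5) by (simp add: zero_enat_def[symmetric])
  obtain r where "r \<le> 1" "finite_coresolution A ?inj r (regular A)"
    using inj_dim_le_iff[of "regular A" 1] assms(5) by (auto simp: one_enat_def)
  then have "finite_coresolution A ?inj 1 (regular A)"
    using not_0 by (cases r) auto
  then obtain Q0 Q1 :: "'a fgmod" where Q0: "?inj Q0" and Q1: "?inj Q1" and Q01: "short_exact A (regular A) Q0 Q1"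
    unfolding finite_coresolution_1 by blast
  \<comment> \<open>Comparison with the fixed copresentation \<open>Q0\<close>, \<open>Q1\<close>
    makes \<open>C\<close> a retract of \<open>Q \<oplus> Q1\<close>, hence injective. The bound on
    its projective dimension comes from \<open>pd_le_one_cokernel\<close>, as \<open>A\<close> is
    projective.\<close>
  have cokernel: "?inj C" "in_add A I C"
    if Q: "in_add A I Q" and C: "fg_module A C" and ex: "short_exact A (regular A) Q C" for Q C :: "'a fgmod"
  proof -
    have Qi: "?inj Q" and Qp: "pd_le_one A Q" using Q unfolding addI by blast+
    note Cm = fg_module_right[OF C]
    have "summand A C (direct_sum2 Q Q1)"
      by (rule cosyzygy_summand[OF regf Cm fg_module_right[OF injective_fg[OF Q1]] Qi Q0 ex Q01])
    then show Ci: "?inj C" by (rule injective_summand[OF injective_direct_sum2[OF Qi Q1] C])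
    have "pd_le_one A C"
      by (rule pd_le_one_cokernel[OF projective_regular fg_module_right[OF in_add_fg[OF Q]] Cm Qp ex])
    with Ci C show "in_add A I C" unfolding addI by blast
  qed
  obtain n0 and P :: "nat \<Rightarrow> 'a fgmod" where P: "\<forall>i<n0. indecomposable_module A (P i)"
    "\<forall>i<n0. \<forall>j<n0. i \<noteq> j \<longrightarrow> \<not> rmod_iso A (P i) (P j)" "rmod_iso A (regular A) (direct_sum n0 P)"
    using assms(3) unfolding basic_module_def by blast
  \<comment> \<open>Membership of \<open>T\<close> in \<open>add I\<close> passes injectivity and
    the dimension bound to all of \<open>add T\<close>, as the count demands.\<close>
  have generate: "in_add A T J"
    if T: "basic_module A T" "in_add A I T" and seq: "in_add A T T0" "in_add A T C" "short_exact A (regular A) T0 C"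
      and J: "?inj J" for T T0 C J :: "'a fgmod"
  proof -
    obtain t and N :: "nat \<Rightarrow> 'a fgmod" where N: "\<forall>i<t. indecomposable_module A (N i)"
      "\<forall>i<t. \<forall>j<t. i \<noteq> j \<longrightarrow> \<not> rmod_iso A (N i) (N j)" "rmod_iso A T (direct_sum t N)"
      using T(1) unfolding basic_module_def by blast
    have add: "?inj X \<and> pd_le_one A X" if "in_add A T X" for X :: "'a fgmod"
      using in_add_trans[OF If T(2) that] unfolding addI by blast
    show ?thesis
      by (rule injectives_in_add[OF P(3) P(1)[rule_format] P(2)[rule_format] in_add_fg[OF T(2)] N(3) N(1)[rule_format]
            N(2)[rule_format] add seq J])
  qed
  text \<open>A tilting module in \<open>add I\<close> provides a copresentation of \<open>A\<close>; its cokernel splits off the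
    next term of the coresolution.\<close>
  have start: "\<exists>(T0 :: 'a fgmod) (C :: 'a fgmod). in_add A T T0 \<and> in_add A T C \<and> short_exact A (regular A) T0 C"
    if T: "in_add A I T" and res: "finite_coresolution A (in_add A T) r (regular A)" for T r
    using res
  proof (cases rule: finite_coresolution_start)
    case (iso Q)
    then have "?inj Q" using in_add_trans[OF If T] addI by blast
    then have "?inj (regular A)" by (rule injective_iso[OF _ rmod_iso_sym[OF regm iso(3)] regm])
    then show ?thesis using not_inj by blast
  next
    case (long Q Q' e d)
    note Tf = in_add_fg[OF T]
    note m = fg_module_right[OF long(1)] fg_module_right[OF long(3)]
    interpret e: module_hom A "regular A" Q e by (rule module_homI[OF regm m(1) long(5)])
    let ?K = "e ` carrier (regular A)"
    let ?C = "rep_quotient Q ?K"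
    note C = rep_quotient[OF m(1) e.submodule_range]
    have ex: "short_exact A (regular A) Q ?C" by (rule short_exact_quotient[OF regm m(1) long(5,7)])
    have Cf: "fg_module A ?C" by (rule fg_quotient[OF long(1) e.submodule_range])
    have "in_add A I Q" by (rule in_add_trans[OF If T long(2)])
    note Ci = cokernel(1)[OF this Cf ex]
    have d0: "d x = \<zero>\<^bsub>Q'\<^esub> \<longleftrightarrow> x \<in> ?K" if "x \<in> carrier Q" for x
      unfolding long(8) using that by (simp add: a_kernel_def')
    have q0: "coset_rep Q ?K x = \<zero>\<^bsub>?C\<^esub> \<longleftrightarrow> x \<in> ?K" if "x \<in> carrier Q" for x
    proof -
      have "x \<in> a_kernel Q ?C (coset_rep Q ?K) \<longleftrightarrow> coset_rep Q ?K x = \<zero>\<^bsub>?C\<^esub>"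
        using that unfolding a_kernel_def' by blast
      then show ?thesis unfolding C(4) by blast
    qed
    \<comment> \<open>\<open>d\<close> vanishes exactly on the image of \<open>A\<close>, so the
      induced map from the cokernel to \<open>Q'\<close> is injective; it splits because the
      cokernel is an injective module.\<close>
    have "d x = \<zero>\<^bsub>Q'\<^esub>" if "x \<in> carrier Q" "coset_rep Q ?K x = \<zero>\<^bsub>?C\<^esub>" for x
      using that(2) unfolding d0[OF that(1)] q0[OF that(1)] .
    then obtain h where h: "h \<in> rmod_hom A ?C Q'" "\<And>x. x \<in> carrier Q \<Longrightarrow> h (coset_rep Q ?K x) = d x"
      by (rule factor_through_surj[OF m(1) C(1) m(2) C(2,3) long(6)]) blast+
    interpret h: module_hom A ?C Q' h by (rule module_homI[OF C(1) m(2) h(1)])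
    have "inj_on h (carrier ?C)" unfolding h.inj_iff
    proof (intro ballI impI)
      fix c assume c: "c \<in> carrier ?C" "h c = \<zero>\<^bsub>Q'\<^esub>"
      then obtain x where x: "x \<in> carrier Q" "c = coset_rep Q ?K x" unfolding C(3)[symmetric] by blast
      then show "c = \<zero>\<^bsub>?C\<^esub>" using c(2) unfolding x(2) h(2)[OF x(1)] d0[OF x(1)] q0[OF x(1)] by blast
    qed
    then obtain k where "k \<in> rmod_hom A Q' ?C" "\<And>c. c \<in> carrier ?C \<Longrightarrow> k (h c) = c"
      by (rule injective_extend[OF Ci Cf long(3) h(1) _ rmod_hom_id]) blast
    then have "summand A ?C Q'" by (rule summandI[OF h(1)])
    then have "in_add A T ?C" by (rule in_add_summand[OF Tf long(4) Cf])
    then show ?thesis using long(2) ex by blast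
  qed
  have candidate: "in_add A I T"
    if T: "d_tilting A 1 T" "d_cotilting R \<phi> E A 0 T" for T
  proof -
    have Tf: "fg_module A T" using T(1) unfolding d_tilting_def tilting_def by blast
    note Tm = fg_module_right[OF Tf]
    have "proj_dim A T = 1" using T(1) by (simp add: d_tilting_def one_enat_def)
    then have "pd_le_one A T" using proj_dim_le_one_iff[OF Tm] by simp
    moreover have "?inj T" using T(2) inj_dim_zero_iff[OF Tm] by (simp add: d_cotilting_def zero_enat_def)
    ultimately show ?thesis using Tf unfolding addI by blast
  qed
  show ?thesis
  proof
    assume "almost_Auslander_Gorenstein A I n"
    then have "Sub A (n + 1) I (regular A)" unfolding almost_Auslander_Gorenstein_def by blast
    then obtain J :: "nat \<Rightarrow> 'a fgmod" and e where J: "in_add A I (J 0)" "e \<in> rmod_hom A (regular A) (J 0)"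
      "inj_on e (carrier (regular A))"
      unfolding Sub_def by auto
    note Jm = fg_module_right[OF in_add_fg[OF J(1)]]
    let ?C = "rep_quotient (J 0) (e ` carrier (regular A))"
    have ex: "short_exact A (regular A) (J 0) ?C" by (rule short_exact_quotient[OF regm Jm J(2,3)])
    have Cf: "fg_module A ?C"
      by (rule fg_quotient[OF in_add_fg[OF J(1)] module_hom.submodule_range[OF module_homI[OF regm Jm J(2)]]])
    note CI = cokernel(2)[OF J(1) Cf ex]
    have self: "in_add A I I" by (rule in_add_self[OF If])
    have all: "in_add A I X" if "?inj X" for X :: "'a fgmod"
      by (rule generate[OF assms(6) self J(1) CI ex that])
    have proj: "\<not> projective_module A I"
    proof
      assume p: "projective_module A I"
      obtain k where k: "summand A ?C (direct_sum k (\<lambda>_. I))" using CI unfolding in_add_iff[OF If] by blast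
      have "projective_module A ?C"
        by (rule projective_summand[OF projective_direct_sum[OF p] Cf k])
      from short_exact_split[OF regm in_add_fg[OF J(1)] this ex]
      have iso: "rmod_iso A (J 0) (direct_sum2 ?C (regular A))" .
      note Cm = fg_module_right[OF Cf]
      have "summand A (regular A) (J 0)"
        by (rule summand_trans[OF summand_direct_sum2(2)[OF Cm regm]
              rmod_iso_imp_summand[OF right_module_direct_sum2[OF Cm regm] rmod_iso_sym[OF Jm iso]]])
      then have "?inj (regular A)" using injective_summand[OF _ regf] J(1) addI by blast
      then show False using not_inj by blast
    qed
    have pd: "proj_dim A I = 1"
    proof (rule antisym)
      show "proj_dim A I \<le> 1" using self addI proj_dim_le_one_iff[OF fg_module_right[OF If]] by blast
      have "proj_dim A I \<noteq> 0" using proj_dim_zero_imp_projective[OF fg_module_right[OF If]] proj by blast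
      then show "1 \<le> proj_dim A I" by (simp add: one_eSuc ileI1 zero_less_iff_neq_zero)
    qed
    have Ext: "\<forall>i\<ge>1. trivial_group (Ext A i I I)" using Ext_injective_trivial[OF If I] by blast
    have "finite_coresolution A (in_add A I) 1 (regular A)"
      unfolding finite_coresolution_1 using J(1) CI ex in_add_fg[OF J(1)] Cf by blast
    then have tilt: "d_tilting A 1 I"
      unfolding d_tilting_def tilting_def using If pd Ext by (auto simp: one_enat_def)
    note Dm = fg_module_right[OF injective_fg[OF E]]
    obtain D :: "'a fgmod" where D: "fg_module A D" "rmod_iso A (dual_regular R \<phi> E A) D"
      by (rule fgmod_copy[OF injective_fg[OF E]])
    have ID: "in_add A I D" by (rule all[OF injective_iso[OF E D(2) fg_module_right[OF D(1)]]])
    have "finite_resolution A (in_add A I) 0 (dual_regular R \<phi> E A) \<longleftrightarrow>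
        (\<exists>Q :: 'a fgmod. fg_module A Q \<and> in_add A I Q \<and> rmod_iso A Q (dual_regular R \<phi> E A))"
      by (rule finite_resolution_0[OF _ Dm]) (rule fg_module_right[OF in_add_fg])
    then have "finite_resolution A (in_add A I) 0 (dual_regular R \<phi> E A)"
      using ID D(1) rmod_iso_sym[OF Dm D(2)] by blast
    then have cotilt: "d_cotilting R \<phi> E A 0 I"
      unfolding d_cotilting_def cotilting_def using If Ext inj_dim_zero_iff[OF fg_module_right[OF If]] I
      by (auto simp: zero_enat_def[symmetric])
    have fac: "Fac A 1 I I"
      unfolding Fac_def using If self rmod_hom_id[of A I]
      by (intro conjI exI[of _ "\<lambda>_. I"] exI[of _ "\<lambda>x. x"]) simp_all
    have Im: "right_module A I" by (rule fg_module_right[OF If])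
    interpret Im: right_module A I by (rule Im)
    let ?Z = "I\<lparr>carrier := {\<zero>\<^bsub>I\<^esub>}\<rparr>"
    have Z: "right_module A ?Z" "zero_module ?Z"
      by (rule right_module_sub[OF Im submodule_zero[OF Im]]) (simp add: zero_module_def)
    \<comment> \<open>The identity of \<open>I\<close> followed by zero is the copresentation that
      places \<open>I\<close> itself in \<open>Sub A n I\<close>.\<close>
    have "short_exact A I I ?Z"
      by (rule short_exactI[OF rmod_hom_id, of "\<lambda>_. \<zero>\<^bsub>I\<^esub>"])
        (use rmod_hom_zero[OF Z(1), of I] Im.M.zero_closed in \<open>auto simp: a_kernel_def'\<close>)
    then have sub: "Sub A n I I"
      by (rule Sub_of_short_exact[OF If If self in_add_zero[OF If Z]])
    \<comment> \<open>\<open>T\<close> lies in \<open>add I\<close> by \<open>candidate\<close> and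
      \<open>I\<close> in \<open>add T\<close> by \<open>generate\<close>; basic modules that
      generate each other in this sense are isomorphic.\<close>
    have unique: "rmod_iso A T I"
      if T: "basic_module A T" "d_tilting A 1 T" "d_cotilting R \<phi> E A 0 T" for T
    proof -
      note TI = candidate[OF T(2,3)]
      obtain r where "finite_coresolution A (in_add A T) r (regular A)"
        using T(2) unfolding d_tilting_def tilting_def by blast
      from start[OF TI this] obtain T0 C :: "'a fgmod" where seq: "in_add A T T0" "in_add A T C" "short_exact A (regular A) T0 C"
        by blast
      have IT: "in_add A T I" by (rule generate[OF T(1) TI seq I])
      obtain t and N :: "nat \<Rightarrow> 'a fgmod" where N: "\<forall>i<t. indecomposable_module A (N i)"
        "\<forall>i<t. \<forall>j<t. i \<noteq> j \<longrightarrow> \<not> rmod_iso A (N i) (N j)" "rmod_iso A T (direct_sum t N)"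
        using T(1) unfolding basic_module_def by blast
      obtain s and M :: "nat \<Rightarrow> 'a fgmod" where M: "\<forall>i<s. indecomposable_module A (M i)"
        "\<forall>i<s. \<forall>j<s. i \<noteq> j \<longrightarrow> \<not> rmod_iso A (M i) (M j)" "rmod_iso A I (direct_sum s M)"
        using assms(6) unfolding basic_module_def by blast
      show ?thesis
        by (rule krull_schmidt_basic[OF in_add_fg[OF TI] N(3) N(1)[rule_format] N(2)[rule_format]
              If M(3) M(1)[rule_format] M(2)[rule_format] TI IT])
    qed
    show "\<exists>T :: 'a fgmod.
       (basic_module A T \<and> d_tilting A 1 T \<and> Fac A 1 I T \<and> Sub A n I T \<and> d_cotilting R \<phi> E A 0 T) \<and>
       (\<forall>T' :: 'a fgmod.
          basic_module A T' \<and> d_tilting A 1 T' \<and> Fac A 1 I T' \<and> Sub A n I T' \<and>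
          d_cotilting R \<phi> E A 0 T' \<longrightarrow> rmod_iso A T' T)"
      using assms(6) tilt fac sub cotilt unique by (intro exI[of _ I]) blast
  next
    assume "\<exists>T :: 'a fgmod.
       (basic_module A T \<and> d_tilting A 1 T \<and> Fac A 1 I T \<and> Sub A n I T \<and> d_cotilting R \<phi> E A 0 T) \<and>
       (\<forall>T' :: 'a fgmod.
          basic_module A T' \<and> d_tilting A 1 T' \<and> Fac A 1 I T' \<and> Sub A n I T' \<and>
          d_cotilting R \<phi> E A 0 T' \<longrightarrow> rmod_iso A T' T)"
    then obtain T :: "'a fgmod" where T: "d_tilting A 1 T" "d_cotilting R \<phi> E A 0 T" by blast
    note TI = candidate[OF T]
    obtain r where "finite_coresolution A (in_add A T) r (regular A)"
      using T(1) unfolding d_tilting_def tilting_def by blast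
    from start[OF TI this] obtain T0 C :: "'a fgmod" where seq: "in_add A T T0" "in_add A T C" "short_exact A (regular A) T0 C"
      by blast
    \<comment> \<open>A single embedding of \<open>A\<close> with cokernel in \<open>add I\<close>,
      padded by zeros, reaches the required length.\<close>
    have "Sub A (n + 1) I (regular A)"
      by (rule Sub_of_short_exact[OF If regf in_add_trans[OF If TI seq(1)] in_add_trans[OF If TI seq(2)] seq(3)])
    moreover have "inj_dim A (regular A) \<le> enat (n + 1)"
      unfolding assms(5) by (simp add: one_enat_def)
    ultimately show "almost_Auslander_Gorenstein A I n" unfolding almost_Auslander_Gorenstein_def by blast
  qed
qed

end
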